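(* Let $\lambda$ be an infinite regular cardinal and let $\rho\colon\mathbb{S}\to\mathbb{T}$ be a theory morphism between $\lambda$-ary partial Horn theories. Assume that $\mathbf{PMod}\,\mathbb{S}$ satisfies the ascending chain condition. Then, for every replete full subcategory $\mathscr{E}\subseteq\mathbf{PMod}\,\mathbb{T}$, the following are equivalent: (i) $\mathscr{E}$ is definable by $\rho$-relative $\lambda$-ary judgments, i.e., there exists a set $\mathbb{T}'$ of $\rho$-relative $\lambda$-ary judgments satisfying $\mathscr{E}=\mathbf{PMod}(\mathbb{T}\cup\mathbb{T}')$. (ii) $\mathscr{E}\subseteq\mathbf{PMod}\,\mathbb{T}$ is closed under products, $\mathbb{T}$-closed subobjects, and $(U^\rho,\lambda)$-pure quotients. (iii) $\mathscr{E}\subseteq\mathbf{PMod}\,\mathbb{T}$ is closed under products, $\mathbb{T}$-closed subobjects, $U^\rho$-retracts, and $\lambda$-filtered colimits.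
   Context: Partial Horn logic. For a set $S$ (of sorts), an $S$-sorted $\lambda$-ary signature $\Sigma$ consists of a set of function symbols, each with an arity $f\colon\sqcap_{i<\alpha}s_i\to s$ ($\alpha<\lambda$; $s_i,s\in S$), and a set of relation symbols, each with an arity $R\colon\sqcap_{i<\alpha}s_i$ ($\alpha<\lambda$). For each sort there is a fixed set of $\lambda$ many variables (disjoint for distinct sorts). Raw terms are built from variables by function symbols respecting sorts; raw ($\lambda$-ary) Horn formulas are built from $R(\tau_i)_{i<\alpha}$, $\tau=\tau'$ (raw terms of the same sort) and $\top$ by conjunctions $\bigwedge_{i<\alpha}\phi_i$ with $\alpha<\lambda$. A context is a tuple $\vec x=(x_i:s_i)_{i<\alpha}$, $\alpha<\lambda$, of distinct variables. A term $\vec x.\tau$ (Horn formula $\vec x.\phi$) is a raw term (raw Horn formula) with a context containing all its variables. A Horn sequent $\phi\vdash_{\vec x}\psi$ is a pair of Horn formulas in the same context. A $\lambda$-ary partial Horn theory over $\Sigma$ is a set of Horn sequents over $\Sigma$. A partial $\Sigma$-structure $M$ consists of sets $M_s$ ($s\in S$), a partial map $[\![f]\!]_M\colon\prod_{i<\alpha}M_{s_i}\rightharpoonup M_s$ for each $f$, and a subset $[\![R]\!]_M\subseteq\prod_{i<\alpha}M_{s_i}$ for each $R$. Terms are interpreted as partial maps $[\![\vec x.\tau]\!]_M$ (a composite $f(\tau_j)_j$ is defined at $\vec m$ iff all $\tau_j$ are and $[\![f]\!]_M$ is defined at their values). Horn formulas are interpreted as subsets $[\![\vec x.\phi]\!]_M\subseteq\prod_i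 M_{s_i}$: $R(\tau_j)_j$ holds iff all $\tau_j$ are defined and the tuple of values lies in $[\![R]\!]_M$; $\tau=\tau'$ holds iff both are defined and equal; $\top$ always holds; conjunction is intersection. A sequent $\phi\vdash_{\vec x}\psi$ is valid in $M$ if $[\![\vec x.\phi]\!]_M\subseteq[\![\vec x.\psi]\!]_M$; $M$ is a partial $\mathbb{T}$-model if all sequents of $\mathbb{T}$ are valid in it. A $\Sigma$-homomorphism $h\colon M\to N$ is a family of total maps $h_s\colon M_s\to N_s$ such that whenever $[\![f]\!]_M(\vec a)$ is defined, $[\![f]\!]_N(h(\vec a))$ is defined and equals $h([\![f]\!]_M(\vec a))$, and $\vec a\in[\![R]\!]_M$ implies $h(\vec a)\in[\![R]\!]_N$. $\mathbf{PMod}\,\mathbb{T}$ is the category of partial $\mathbb{T}$-models and $\Sigma$-homomorphisms. Theory morphisms. Let $\mathbb{S}$ be over the $S$-sorted signature $\Sigma$ and $\mathbb{T}$ over the $S'$-sorted signature $\Sigma'$. A theory morphism $\rho\colon\mathbb{S}\to\mathbb{T}$ consists of a map $S\ni s\mapsto s^\rho\in S'$; for each function symbol $f\colon\sqcap_{i<\alpha}s_i\to s$ of $\Sigma$, a term $\vec x^\rho.f^\rho$ of sort $s^\rho$ over $\Sigma'$ in the context $\vec x^\rho=(x_i^\rho:s_i^\rho)_{i<\alpha}$; for each relation symbol $R\colon\sqcap_{i<\alpha}s_i$ of $\Sigma$, a Horn formula $\vec x^\rho.R^\rho$ over $\Sigma'$; such that for every sequent $\phi\vdash_{\vec x}\psi$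 in $\mathbb{S}$ its $\rho$-translation $\phi^\rho\vdash_{\vec x^\rho}\psi^\rho$ is derivable from $\mathbb{T}$ in $\lambda$-ary partial Horn logic (equivalently, by completeness of that logic, valid in every partial $\mathbb{T}$-model). The $\rho$-translations $\phi^\rho$ and $\psi^\rho$ are constructed by replacing all symbols that $\phi$ and $\psi$ include by their images under $\rho$. The translation functor $U^\rho\colon\mathbf{PMod}\,\mathbb{T}\to\mathbf{PMod}\,\mathbb{S}$ is given by $(U^\rho M)_s=M_{s^\rho}$, $[\![f]\!]_{U^\rho M}=[\![\vec x^\rho.f^\rho]\!]_M$, $[\![R]\!]_{U^\rho M}=[\![\vec x^\rho.R^\rho]\!]_M$. A $\rho$-relative $\lambda$-ary judgment is a $\lambda$-ary Horn sequent $\phi^\rho\vdash_{\vec x^\rho}\psi$, where $\vec x.\phi$ is a Horn formula over $\Sigma$ and $\vec x^\rho.\psi$ is a Horn formula over $\Sigma'$. A monomorphism $h\colon A\to B$ in $\mathbf{PMod}\,\mathbb{T}$ is $\mathbb{T}$-closed if for all function symbols $f$ and relation symbols $R$ of $\Sigma'$ and tuples $\vec a$ from $A$: if $[\![f]\!]_B(h(\vec a))$ is defined then $[\![f]\!]_A(\vec a)$ is defined; if $h(\vec a)\in[\![R]\!]_B$ then $\vec a\in[\![R]\!]_A$. For a functor $U$, a morphism $f\colon X\to Y$ is a $U$-retraction if $Uf$ has a right inverse (section); then $Y$ is a $U$-retract of $X$. A morphism $p\colon X\to Y$ in a category is a $\lambda$-pure epimorphism if every morphism $\Gamma\to Y$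 from a $\lambda$-presentable object $\Gamma$ factors through $p$. A morphism $p\colon X\to Y$ is a $(U,\lambda)$-pure epimorphism if $Up$ is a $\lambda$-pure epimorphism; then $Y$ is a $(U,\lambda)$-pure quotient of $X$. A full subcategory is replete if it is closed under isomorphic objects. Two objects $X,Y$ of a category are strongly connected if there exist morphisms $X\to Y$ and $Y\to X$. A category satisfies the ascending chain condition (ACC) if for every chain $X_0\to X_1\to X_2\to\cdots$ indexed by $\mathbb{N}$ there exists $N\in\mathbb{N}$ such that the objects $X_n$, $n\ge N$, are strongly connected to each other.
   Formalization: In the ρ-translation, each translated atomic formula also asserts that the translated subterms are defined; bare replacement forgets this when f^ρ or R^ρ omits a context variable, and then U^ρ may not land in PMod S and (i) need not imply (iii). *)

theory Defs
  imports "HOL-Library.FuncSet"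
begin

unbundle cardinal_syntax

section \<open>Cardinals and size\<close>

text \<open>
  A cardinal is a relation satisfying \<^term>\<open>Card_order\<close>.  For an infinite cardinal \<open>lam\<close>, every ordinal
  below \<open>lam\<close> is the order type of \<open>underS lam a\<close> for exactly one \<open>a \<in> Field lam\<close>.  We therefore use
  elements of \<open>Field lam\<close> as the ordinals \<open>\<alpha> < \<lambda>\<close>, and \<open>\<alpha>\<close>-indexed families are functions that are
  extensional on \<open>underS lam \<alpha>\<close>.

  A single HOL type cannot hold sets of all sizes, so ``set'' in the sense of category theory means
  \<open>\<kappa>\<close>-small set for a fixed inaccessible cardinal \<open>\<kappa>\<close>, as with Grothendieck universes; collections
  of structures are arbitrary.  Since \<open>\<kappa>\<close> is a cardinal on the type \<open>'u\<close>, every \<open>\<kappa>\<close>-small set is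
  in bijection with a subset of \<open>'u\<close>.
\<close>

definition inaccessible :: "'u rel \<Rightarrow> bool" where
  "inaccessible \<kappa> \<longleftrightarrow> Card_order \<kappa> \<and> natLeq <o \<kappa> \<and> regularCard \<kappa> \<and>
     (\<forall>A :: 'u set. |A| <o \<kappa> \<longrightarrow> |Pow A| <o \<kappa>)"


section \<open>Categories\<close>

record ('o, 'a) category =
  Obj :: "'o set"
  Arr :: "'a set"
  Dom :: "'a \<Rightarrow> 'o"
  Cod :: "'a \<Rightarrow> 'o"
  Id :: "'o \<Rightarrow> 'a"
  Comp :: "'a \<Rightarrow> 'a \<Rightarrow> 'a"

definition hom :: "('o, 'a, 'z) category_scheme \<Rightarrow> 'o \<Rightarrow> 'o \<Rightarrow> 'a set" where
  "hom C x y = {f \<in> Arr C. Dom C f = x \<and> Cod C f = y}"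

definition is_category :: "('o, 'a, 'z) category_scheme \<Rightarrow> bool" where
  "is_category C \<longleftrightarrow>
     (\<forall>f \<in> Arr C. Dom C f \<in> Obj C \<and> Cod C f \<in> Obj C) \<and>
     (\<forall>x \<in> Obj C. Id C x \<in> hom C x x) \<and>
     (\<forall>f \<in> Arr C. \<forall>g \<in> Arr C. Dom C g = Cod C f \<longrightarrow> Comp C g f \<in> hom C (Dom C f) (Cod C g)) \<and>
     (\<forall>f \<in> Arr C. Comp C f (Id C (Dom C f)) = f \<and> Comp C (Id C (Cod C f)) f = f) \<and>
     (\<forall>f \<in> Arr C. \<forall>g \<in> Arr C. \<forall>h \<in> Arr C. Dom C g = Cod C f \<longrightarrow> Dom C h = Cod C g \<longrightarrow>
        Comp C h (Comp C g f) = Comp C (Comp C h g) f)"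

record ('o, 'a, 'p, 'b) func =
  fobj :: "'o \<Rightarrow> 'p"
  farr :: "'a \<Rightarrow> 'b"

definition is_functor ::
  "('o, 'a, 'z) category_scheme \<Rightarrow> ('p, 'b, 'y) category_scheme \<Rightarrow> ('o, 'a, 'p, 'b) func \<Rightarrow> bool" where
  "is_functor C D F \<longleftrightarrow>
     (\<forall>x \<in> Obj C. fobj F x \<in> Obj D) \<and>
     (\<forall>f \<in> Arr C. farr F f \<in> hom D (fobj F (Dom C f)) (fobj F (Cod C f))) \<and>
     (\<forall>x \<in> Obj C. farr F (Id C x) = Id D (fobj F x)) \<and>
     (\<forall>f \<in> Arr C. \<forall>g \<in> Arr C. Dom C g = Cod C f \<longrightarrow>
        farr F (Comp C g f) = Comp D (farr F g) (farr F f))"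

definition mono_arr :: "('o, 'a, 'z) category_scheme \<Rightarrow> 'a \<Rightarrow> bool" where
  "mono_arr C h \<longleftrightarrow> h \<in> Arr C \<and>
     (\<forall>f \<in> Arr C. \<forall>g \<in> Arr C. Dom C f = Dom C g \<longrightarrow> Cod C f = Dom C h \<longrightarrow> Cod C g = Dom C h \<longrightarrow>
        Comp C h f = Comp C h g \<longrightarrow> f = g)"

definition has_section :: "('o, 'a, 'z) category_scheme \<Rightarrow> 'a \<Rightarrow> bool" where
  "has_section C f \<longleftrightarrow> f \<in> Arr C \<and>
     (\<exists>g \<in> hom C (Cod C f) (Dom C f). Comp C f g = Id C (Cod C f))"

definition isomorphic :: "('o, 'a, 'z) category_scheme \<Rightarrow> 'o \<Rightarrow> 'o \<Rightarrow> bool" where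
  "isomorphic C x y \<longleftrightarrow>
     (\<exists>f \<in> hom C x y. \<exists>g \<in> hom C y x. Comp C g f = Id C x \<and> Comp C f g = Id C y)"

text \<open>A full subcategory is given by its set of objects.\<close>

definition replete_full_subcategory :: "('o, 'a, 'z) category_scheme \<Rightarrow> 'o set \<Rightarrow> bool" where
  "replete_full_subcategory C E \<longleftrightarrow> E \<subseteq> Obj C \<and>
     (\<forall>x \<in> E. \<forall>y \<in> Obj C. isomorphic C x y \<longrightarrow> y \<in> E)"

definition strongly_connected :: "('o, 'a, 'z) category_scheme \<Rightarrow> 'o \<Rightarrow> 'o \<Rightarrow> bool" where
  "strongly_connected C x y \<longleftrightarrow> hom C x y \<noteq> {} \<and> hom C y x \<noteq> {}"

definition ascending_chain_condition :: "('o, 'a, 'z) category_scheme \<Rightarrow> bool" where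
  "ascending_chain_condition C \<longleftrightarrow>
     (\<forall>(X :: nat \<Rightarrow> 'o) f. (\<forall>n. X n \<in> Obj C \<and> f n \<in> hom C (X n) (X (Suc n))) \<longrightarrow>
        (\<exists>N. \<forall>m \<ge> N. \<forall>n \<ge> N. strongly_connected C (X m) (X n)))"

definition is_product ::
  "('o, 'a, 'z) category_scheme \<Rightarrow> 'i set \<Rightarrow> ('i \<Rightarrow> 'o) \<Rightarrow> 'o \<Rightarrow> ('i \<Rightarrow> 'a) \<Rightarrow> bool" where
  "is_product C I A P \<pi> \<longleftrightarrow> P \<in> Obj C \<and> (\<forall>i \<in> I. \<pi> i \<in> hom C P (A i)) \<and>
     (\<forall>Y \<in> Obj C. \<forall>g. (\<forall>i \<in> I. g i \<in> hom C Y (A i)) \<longrightarrow>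
        (\<exists>!u. u \<in> hom C Y P \<and> (\<forall>i \<in> I. Comp C (\<pi> i) u = g i)))"

definition is_cocone ::
  "('j, 'b, 'y) category_scheme \<Rightarrow> ('o, 'a, 'z) category_scheme \<Rightarrow> ('j, 'b, 'o, 'a) func \<Rightarrow>
    'o \<Rightarrow> ('j \<Rightarrow> 'a) \<Rightarrow> bool" where
  "is_cocone J C D X k \<longleftrightarrow> X \<in> Obj C \<and> (\<forall>j \<in> Obj J. k j \<in> hom C (fobj D j) X) \<and>
     (\<forall>a \<in> Arr J. Comp C (k (Cod J a)) (farr D a) = k (Dom J a))"

definition is_colimit ::
  "('j, 'b, 'y) category_scheme \<Rightarrow> ('o, 'a, 'z) category_scheme \<Rightarrow> ('j, 'b, 'o, 'a) func \<Rightarrow>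
    'o \<Rightarrow> ('j \<Rightarrow> 'a) \<Rightarrow> bool" where
  "is_colimit J C D X k \<longleftrightarrow> is_cocone J C D X k \<and>
     (\<forall>Y l. is_cocone J C D Y l \<longrightarrow>
        (\<exists>!u. u \<in> hom C X Y \<and> (\<forall>j \<in> Obj J. Comp C u (k j) = l j)))"

text \<open>
  Every family of fewer than \<open>\<lambda>\<close> objects has an upper bound (in particular there is an object), and
  every family of fewer than \<open>\<lambda>\<close> parallel arrows is coequalized by some arrow.
\<close>

definition filtered_category :: "'l rel \<Rightarrow> ('j, 'b, 'y) category_scheme \<Rightarrow> bool" where
  "filtered_category lam J \<longleftrightarrow> is_category J \<and>
     (\<forall>X \<subseteq> Obj J. |X| <o lam \<longrightarrow> (\<exists>c \<in> Obj J. \<forall>x \<in> X. hom J x c \<noteq> {})) \<and>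
     (\<forall>x \<in> Obj J. \<forall>y \<in> Obj J. \<forall>F \<subseteq> hom J x y. |F| <o lam \<longrightarrow>
        (\<exists>z \<in> Obj J. \<exists>h \<in> hom J y z. \<forall>f \<in> F. \<forall>g \<in> F. Comp J h f = Comp J h g))"

definition small_category :: "'u rel \<Rightarrow> ('j, 'b, 'y) category_scheme \<Rightarrow> bool" where
  "small_category \<kappa> J \<longleftrightarrow> |Obj J| <o \<kappa> \<and> |Arr J| <o \<kappa>"

text \<open>
  \<open>(X, k)\<close> is a colimit in \<open>C\<close> of a small \<open>\<lambda>\<close>-filtered diagram \<open>D\<close> of shape \<open>J\<close>.  Index categories
  have objects and arrows in \<open>'u\<close>; up to isomorphism these are all \<open>\<kappa>\<close>-small categories.
\<close>

definition filtered_colimit ::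
  "'u rel \<Rightarrow> 'l rel \<Rightarrow> ('o, 'a, 'z) category_scheme \<Rightarrow> ('u, 'u) category \<Rightarrow>
    ('u, 'u, 'o, 'a) func \<Rightarrow> 'o \<Rightarrow> ('u \<Rightarrow> 'a) \<Rightarrow> bool" where
  "filtered_colimit \<kappa> lam C J D X k \<longleftrightarrow>
     filtered_category lam J \<and> small_category \<kappa> J \<and> is_functor J C D \<and> is_colimit J C D X k"

text \<open>
  \<open>\<lambda>\<close>-presentability of \<open>G\<close>: the functor \<open>hom(G, -)\<close> preserves \<open>\<lambda>\<close>-filtered colimits, i.e. every
  \<open>G \<rightarrow> colim D\<close> factors through some \<open>D j\<close>, and any two factorizations through the same \<open>D j\<close> are
  identified by some \<open>D a\<close>.
\<close>

definition presentable ::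
  "'u rel \<Rightarrow> 'l rel \<Rightarrow> ('o, 'a, 'z) category_scheme \<Rightarrow> 'o \<Rightarrow> bool" where
  "presentable \<kappa> lam C G \<longleftrightarrow> G \<in> Obj C \<and>
     (\<forall>(J :: ('u, 'u) category) D X k. filtered_colimit \<kappa> lam C J D X k \<longrightarrow>
        (\<forall>f \<in> hom C G X. \<exists>j \<in> Obj J. \<exists>g \<in> hom C G (fobj D j). Comp C (k j) g = f) \<and>
        (\<forall>j \<in> Obj J. \<forall>g \<in> hom C G (fobj D j). \<forall>g' \<in> hom C G (fobj D j).
           Comp C (k j) g = Comp C (k j) g' \<longrightarrow>
           (\<exists>a \<in> Arr J. Dom J a = j \<and> Comp C (farr D a) g = Comp C (farr D a) g')))"

definition pure_epi ::
  "'u rel \<Rightarrow> 'l rel \<Rightarrow> ('o, 'a, 'z) category_scheme \<Rightarrow> 'a \<Rightarrow> bool" where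
  "pure_epi \<kappa> lam C p \<longleftrightarrow> p \<in> Arr C \<and>
     (\<forall>G. presentable \<kappa> lam C G \<longrightarrow>
        (\<forall>f \<in> hom C G (Cod C p). \<exists>g \<in> hom C G (Dom C p). Comp C p g = f))"

definition closed_under_products ::
  "'u rel \<Rightarrow> ('o, 'a, 'z) category_scheme \<Rightarrow> 'o set \<Rightarrow> bool" where
  "closed_under_products \<kappa> C E \<longleftrightarrow>
     (\<forall>(I :: 'u set) A P \<pi>. |I| <o \<kappa> \<longrightarrow> (\<forall>i \<in> I. A i \<in> E) \<longrightarrow> is_product C I A P \<pi> \<longrightarrow> P \<in> E)"

definition closed_under_filtered_colimits ::
  "'u rel \<Rightarrow> 'l rel \<Rightarrow> ('o, 'a, 'z) category_scheme \<Rightarrow> 'o set \<Rightarrow> bool" where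
  "closed_under_filtered_colimits \<kappa> lam C E \<longleftrightarrow>
     (\<forall>J D X k. filtered_colimit \<kappa> lam C J D X k \<longrightarrow> (\<forall>j \<in> Obj J. fobj D j \<in> E) \<longrightarrow> X \<in> E)"

definition closed_under_retracts ::
  "('o, 'a, 'z) category_scheme \<Rightarrow> ('p, 'b, 'y) category_scheme \<Rightarrow> ('o, 'a, 'p, 'b) func \<Rightarrow>
    'o set \<Rightarrow> bool" where
  "closed_under_retracts C D U E \<longleftrightarrow>
     (\<forall>f \<in> Arr C. Dom C f \<in> E \<longrightarrow> has_section D (farr U f) \<longrightarrow> Cod C f \<in> E)"

definition closed_under_pure_quotients ::
  "'u rel \<Rightarrow> 'l rel \<Rightarrow> ('o, 'a, 'z) category_scheme \<Rightarrow> ('p, 'b, 'y) category_scheme \<Rightarrow>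
    ('o, 'a, 'p, 'b) func \<Rightarrow> 'o set \<Rightarrow> bool" where
  "closed_under_pure_quotients \<kappa> lam C D U E \<longleftrightarrow>
     (\<forall>p \<in> Arr C. Dom C p \<in> E \<longrightarrow> pure_epi \<kappa> lam D (farr U p) \<longrightarrow> Cod C p \<in> E)"


section \<open>Partial Horn logic: syntax\<close>

record ('s, 'f, 'r, 'l) signature =
  sorts :: "'s set"
  funs :: "'f set"
  rels :: "'r set"
  fun_arity :: "'f \<Rightarrow> 'l"
  fun_dom :: "'f \<Rightarrow> 'l \<Rightarrow> 's"
  fun_cod :: "'f \<Rightarrow> 's"
  rel_arity :: "'r \<Rightarrow> 'l"
  rel_dom :: "'r \<Rightarrow> 'l \<Rightarrow> 's"

definition is_signature :: "'u rel \<Rightarrow> 'l rel \<Rightarrow> ('s, 'f, 'r, 'l) signature \<Rightarrow> bool" where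
  "is_signature \<kappa> lam \<Sigma> \<longleftrightarrow>
     |sorts \<Sigma>| <o \<kappa> \<and> |funs \<Sigma>| <o \<kappa> \<and> |rels \<Sigma>| <o \<kappa> \<and>
     (\<forall>f \<in> funs \<Sigma>. fun_arity \<Sigma> f \<in> Field lam \<and> fun_cod \<Sigma> f \<in> sorts \<Sigma> \<and>
        (\<forall>i \<in> underS lam (fun_arity \<Sigma> f). fun_dom \<Sigma> f i \<in> sorts \<Sigma>)) \<and>
     (\<forall>R \<in> rels \<Sigma>. rel_arity \<Sigma> R \<in> Field lam \<and>
        (\<forall>i \<in> underS lam (rel_arity \<Sigma> R). rel_dom \<Sigma> R i \<in> sorts \<Sigma>))"

definition fun_idx :: "'l rel \<Rightarrow> ('s, 'f, 'r, 'l) signature \<Rightarrow> 'f \<Rightarrow> 'l set" where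
  "fun_idx lam \<Sigma> f = underS lam (fun_arity \<Sigma> f)"

definition rel_idx :: "'l rel \<Rightarrow> ('s, 'f, 'r, 'l) signature \<Rightarrow> 'r \<Rightarrow> 'l set" where
  "rel_idx lam \<Sigma> R = underS lam (rel_arity \<Sigma> R)"

text \<open>The variables of sort \<open>s\<close> are the pairs \<open>(s, i)\<close> with \<open>i \<in> Field lam\<close>.\<close>

type_synonym ('s, 'l) var = "'s \<times> 'l"

definition vars :: "'l rel \<Rightarrow> ('s, 'f, 'r, 'l) signature \<Rightarrow> ('s, 'l) var set" where
  "vars lam \<Sigma> = sorts \<Sigma> \<times> Field lam"

datatype ('s, 'f, 'l) trm =
    Var "('s, 'l) var"
  | App 'f "'l \<Rightarrow> ('s, 'f, 'l) trm"

datatype ('s, 'f, 'r, 'l) fm =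
    Rel 'r "'l \<Rightarrow> ('s, 'f, 'l) trm"
  | Eq "('s, 'f, 'l) trm" "('s, 'f, 'l) trm"
  | Top
  | Conj 'l "'l \<Rightarrow> ('s, 'f, 'r, 'l) fm"

inductive raw_term ::
  "'l rel \<Rightarrow> ('s, 'f, 'r, 'l) signature \<Rightarrow> ('s, 'f, 'l) trm \<Rightarrow> 's \<Rightarrow> bool"
  for lam :: "'l rel" and \<Sigma> :: "('s, 'f, 'r, 'l) signature" where
  "v \<in> vars lam \<Sigma> \<Longrightarrow> raw_term lam \<Sigma> (Var v) (fst v)"
| "f \<in> funs \<Sigma> \<Longrightarrow> ts \<in> extensional (fun_idx lam \<Sigma> f) \<Longrightarrow>
   (\<forall>i \<in> fun_idx lam \<Sigma> f. raw_term lam \<Sigma> (ts i) (fun_dom \<Sigma> f i)) \<Longrightarrow>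
   raw_term lam \<Sigma> (App f ts) (fun_cod \<Sigma> f)"

inductive raw_formula :: "'l rel \<Rightarrow> ('s, 'f, 'r, 'l) signature \<Rightarrow> ('s, 'f, 'r, 'l) fm \<Rightarrow> bool"
  for lam :: "'l rel" and \<Sigma> :: "('s, 'f, 'r, 'l) signature" where
  "R \<in> rels \<Sigma> \<Longrightarrow> ts \<in> extensional (rel_idx lam \<Sigma> R) \<Longrightarrow>
   (\<forall>i \<in> rel_idx lam \<Sigma> R. raw_term lam \<Sigma> (ts i) (rel_dom \<Sigma> R i)) \<Longrightarrow>
   raw_formula lam \<Sigma> (Rel R ts)"
| "raw_term lam \<Sigma> t s \<Longrightarrow> raw_term lam \<Sigma> u s \<Longrightarrow> raw_formula lam \<Sigma> (Eq t u)"
| "raw_formula lam \<Sigma> Top"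
| "\<alpha> \<in> Field lam \<Longrightarrow> \<phi> \<in> extensional (underS lam \<alpha>) \<Longrightarrow>
   (\<forall>i \<in> underS lam \<alpha>. raw_formula lam \<Sigma> (\<phi> i)) \<Longrightarrow>
   raw_formula lam \<Sigma> (Conj \<alpha> \<phi>)"

primrec term_vars ::
  "'l rel \<Rightarrow> ('s, 'f, 'r, 'l) signature \<Rightarrow> ('s, 'f, 'l) trm \<Rightarrow> ('s, 'l) var set" where
  "term_vars lam \<Sigma> (Var v) = {v}"
| "term_vars lam \<Sigma> (App f ts) = (\<Union>i \<in> fun_idx lam \<Sigma> f. term_vars lam \<Sigma> (ts i))"

primrec fm_vars ::
  "'l rel \<Rightarrow> ('s, 'f, 'r, 'l) signature \<Rightarrow> ('s, 'f, 'r, 'l) fm \<Rightarrow> ('s, 'l) var set" where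
  "fm_vars lam \<Sigma> (Rel R ts) = (\<Union>i \<in> rel_idx lam \<Sigma> R. term_vars lam \<Sigma> (ts i))"
| "fm_vars lam \<Sigma> (Eq t u) = term_vars lam \<Sigma> t \<union> term_vars lam \<Sigma> u"
| "fm_vars lam \<Sigma> Top = {}"
| "fm_vars lam \<Sigma> (Conj \<alpha> \<phi>) = (\<Union>i \<in> underS lam \<alpha>. fm_vars lam \<Sigma> (\<phi> i))"

record ('s, 'l) ctx =
  ctx_len :: 'l
  ctx_var :: "'l \<Rightarrow> ('s, 'l) var"

definition ctx_idx :: "'l rel \<Rightarrow> ('s, 'l) ctx \<Rightarrow> 'l set" where
  "ctx_idx lam x = underS lam (ctx_len x)"

definition is_context :: "'l rel \<Rightarrow> ('s, 'f, 'r, 'l) signature \<Rightarrow> ('s, 'l) ctx \<Rightarrow> bool" where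
  "is_context lam \<Sigma> x \<longleftrightarrow> ctx_len x \<in> Field lam \<and>
     ctx_var x \<in> ctx_idx lam x \<rightarrow>\<^sub>E vars lam \<Sigma> \<and> inj_on (ctx_var x) (ctx_idx lam x)"

definition term_in_ctx ::
  "'l rel \<Rightarrow> ('s, 'f, 'r, 'l) signature \<Rightarrow> ('s, 'l) ctx \<Rightarrow> ('s, 'f, 'l) trm \<Rightarrow> 's \<Rightarrow> bool" where
  "term_in_ctx lam \<Sigma> x t s \<longleftrightarrow> is_context lam \<Sigma> x \<and> raw_term lam \<Sigma> t s \<and>
     term_vars lam \<Sigma> t \<subseteq> ctx_var x ` ctx_idx lam x"

definition fm_in_ctx ::
  "'l rel \<Rightarrow> ('s, 'f, 'r, 'l) signature \<Rightarrow> ('s, 'l) ctx \<Rightarrow> ('s, 'f, 'r, 'l) fm \<Rightarrow> bool" where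
  "fm_in_ctx lam \<Sigma> x \<phi> \<longleftrightarrow> is_context lam \<Sigma> x \<and> raw_formula lam \<Sigma> \<phi> \<and>
     fm_vars lam \<Sigma> \<phi> \<subseteq> ctx_var x ` ctx_idx lam x"

text \<open>\<open>Sequent x \<phi> \<psi>\<close> is \<open>\<phi> \<turnstile>\<^sub>x \<psi>\<close>.\<close>

datatype ('s, 'f, 'r, 'l) sequent =
  Sequent "('s, 'l) ctx" "('s, 'f, 'r, 'l) fm" "('s, 'f, 'r, 'l) fm"

primrec is_sequent ::
  "'l rel \<Rightarrow> ('s, 'f, 'r, 'l) signature \<Rightarrow> ('s, 'f, 'r, 'l) sequent \<Rightarrow> bool" where
  "is_sequent lam \<Sigma> (Sequent x \<phi> \<psi>) \<longleftrightarrow> fm_in_ctx lam \<Sigma> x \<phi> \<and> fm_in_ctx lam \<Sigma> x \<psi>"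

definition is_horn_theory ::
  "'l rel \<Rightarrow> ('s, 'f, 'r, 'l) signature \<Rightarrow> ('s, 'f, 'r, 'l) sequent set \<Rightarrow> bool" where
  "is_horn_theory lam \<Sigma> T \<longleftrightarrow> (\<forall>\<sigma> \<in> T. is_sequent lam \<Sigma> \<sigma>)"


section \<open>Partial structures and models\<close>

record ('s, 'f, 'r, 'l, 'u) pstruct =
  carr :: "'s \<Rightarrow> 'u set"
  fint :: "'f \<Rightarrow> ('l \<Rightarrow> 'u) \<Rightarrow> 'u option"
  rint :: "'r \<Rightarrow> ('l \<Rightarrow> 'u) set"

definition fun_args ::
  "'l rel \<Rightarrow> ('s, 'f, 'r, 'l) signature \<Rightarrow> ('s, 'f, 'r, 'l, 'u) pstruct \<Rightarrow> 'f \<Rightarrow> ('l \<Rightarrow> 'u) set" where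
  "fun_args lam \<Sigma> M f = (\<Pi>\<^sub>E i \<in> fun_idx lam \<Sigma> f. carr M (fun_dom \<Sigma> f i))"

definition rel_args ::
  "'l rel \<Rightarrow> ('s, 'f, 'r, 'l) signature \<Rightarrow> ('s, 'f, 'r, 'l, 'u) pstruct \<Rightarrow> 'r \<Rightarrow> ('l \<Rightarrow> 'u) set" where
  "rel_args lam \<Sigma> M R = (\<Pi>\<^sub>E i \<in> rel_idx lam \<Sigma> R. carr M (rel_dom \<Sigma> R i))"

text \<open>Components at symbols outside the signature carry no information and are normalized.\<close>

definition is_pstruct ::
  "'u rel \<Rightarrow> 'l rel \<Rightarrow> ('s, 'f, 'r, 'l) signature \<Rightarrow> ('s, 'f, 'r, 'l, 'u) pstruct \<Rightarrow> bool" where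
  "is_pstruct \<kappa> lam \<Sigma> M \<longleftrightarrow>
     (\<forall>s \<in> sorts \<Sigma>. |carr M s| <o \<kappa>) \<and>
     (\<forall>f \<in> funs \<Sigma>. \<forall>a y. fint M f a = Some y \<longrightarrow>
        a \<in> fun_args lam \<Sigma> M f \<and> y \<in> carr M (fun_cod \<Sigma> f)) \<and>
     (\<forall>R \<in> rels \<Sigma>. rint M R \<subseteq> rel_args lam \<Sigma> M R) \<and>
     (\<forall>s. s \<notin> sorts \<Sigma> \<longrightarrow> carr M s = {}) \<and>
     (\<forall>f. f \<notin> funs \<Sigma> \<longrightarrow> fint M f = (\<lambda>_. None)) \<and>
     (\<forall>R. R \<notin> rels \<Sigma> \<longrightarrow> rint M R = {})"

primrec term_val ::
  "'l rel \<Rightarrow> ('s, 'f, 'r, 'l) signature \<Rightarrow> ('s, 'f, 'r, 'l, 'u) pstruct \<Rightarrow>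
    (('s, 'l) var \<Rightarrow> 'u) \<Rightarrow> ('s, 'f, 'l) trm \<Rightarrow> 'u option" where
  "term_val lam \<Sigma> M e (Var v) = Some (e v)"
| "term_val lam \<Sigma> M e (App f ts) =
     (if \<forall>i \<in> fun_idx lam \<Sigma> f. term_val lam \<Sigma> M e (ts i) \<noteq> None
      then fint M f (\<lambda>i \<in> fun_idx lam \<Sigma> f. the (term_val lam \<Sigma> M e (ts i)))
      else None)"

primrec fm_holds ::
  "'l rel \<Rightarrow> ('s, 'f, 'r, 'l) signature \<Rightarrow> ('s, 'f, 'r, 'l, 'u) pstruct \<Rightarrow>
    (('s, 'l) var \<Rightarrow> 'u) \<Rightarrow> ('s, 'f, 'r, 'l) fm \<Rightarrow> bool" where
  "fm_holds lam \<Sigma> M e (Rel R ts) \<longleftrightarrow>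
     (\<forall>i \<in> rel_idx lam \<Sigma> R. term_val lam \<Sigma> M e (ts i) \<noteq> None) \<and>
     (\<lambda>i \<in> rel_idx lam \<Sigma> R. the (term_val lam \<Sigma> M e (ts i))) \<in> rint M R"
| "fm_holds lam \<Sigma> M e (Eq t u) \<longleftrightarrow>
     term_val lam \<Sigma> M e t \<noteq> None \<and> term_val lam \<Sigma> M e t = term_val lam \<Sigma> M e u"
| "fm_holds lam \<Sigma> M e Top \<longleftrightarrow> True"
| "fm_holds lam \<Sigma> M e (Conj \<alpha> \<phi>) \<longleftrightarrow> (\<forall>i \<in> underS lam \<alpha>. fm_holds lam \<Sigma> M e (\<phi> i))"

definition ctx_prod ::
  "'l rel \<Rightarrow> ('s, 'f, 'r, 'l, 'u) pstruct \<Rightarrow> ('s, 'l) ctx \<Rightarrow> ('l \<Rightarrow> 'u) set" where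
  "ctx_prod lam M x = (\<Pi>\<^sub>E i \<in> ctx_idx lam x. carr M (fst (ctx_var x i)))"

text \<open>The assignment sending the \<open>i\<close>-th variable of the context to the \<open>i\<close>-th entry of the tuple.\<close>

definition ctx_env :: "'l rel \<Rightarrow> ('s, 'l) ctx \<Rightarrow> ('l \<Rightarrow> 'u) \<Rightarrow> ('s, 'l) var \<Rightarrow> 'u" where
  "ctx_env lam x m = (\<lambda>v. m (inv_into (ctx_idx lam x) (ctx_var x) v))"

definition term_interp ::
  "'l rel \<Rightarrow> ('s, 'f, 'r, 'l) signature \<Rightarrow> ('s, 'f, 'r, 'l, 'u) pstruct \<Rightarrow>
    ('s, 'l) ctx \<Rightarrow> ('s, 'f, 'l) trm \<Rightarrow> ('l \<Rightarrow> 'u) \<Rightarrow> 'u option" where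
  "term_interp lam \<Sigma> M x t = (\<lambda>m. if m \<in> ctx_prod lam M x
     then term_val lam \<Sigma> M (ctx_env lam x m) t else None)"

definition fm_interp ::
  "'l rel \<Rightarrow> ('s, 'f, 'r, 'l) signature \<Rightarrow> ('s, 'f, 'r, 'l, 'u) pstruct \<Rightarrow>
    ('s, 'l) ctx \<Rightarrow> ('s, 'f, 'r, 'l) fm \<Rightarrow> ('l \<Rightarrow> 'u) set" where
  "fm_interp lam \<Sigma> M x \<phi> = {m \<in> ctx_prod lam M x. fm_holds lam \<Sigma> M (ctx_env lam x m) \<phi>}"

primrec valid_in ::
  "'l rel \<Rightarrow> ('s, 'f, 'r, 'l) signature \<Rightarrow> ('s, 'f, 'r, 'l, 'u) pstruct \<Rightarrow>
    ('s, 'f, 'r, 'l) sequent \<Rightarrow> bool" where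
  "valid_in lam \<Sigma> M (Sequent x \<phi> \<psi>) \<longleftrightarrow> fm_interp lam \<Sigma> M x \<phi> \<subseteq> fm_interp lam \<Sigma> M x \<psi>"

definition is_model ::
  "'u rel \<Rightarrow> 'l rel \<Rightarrow> ('s, 'f, 'r, 'l) signature \<Rightarrow> ('s, 'f, 'r, 'l) sequent set \<Rightarrow>
    ('s, 'f, 'r, 'l, 'u) pstruct \<Rightarrow> bool" where
  "is_model \<kappa> lam \<Sigma> T M \<longleftrightarrow> is_pstruct \<kappa> lam \<Sigma> M \<and> (\<forall>\<sigma> \<in> T. valid_in lam \<Sigma> M \<sigma>)"

definition fun_tuple ::
  "'l rel \<Rightarrow> ('s, 'f, 'r, 'l) signature \<Rightarrow> 'f \<Rightarrow> ('s \<Rightarrow> 'u \<Rightarrow> 'u) \<Rightarrow> ('l \<Rightarrow> 'u) \<Rightarrow> ('l \<Rightarrow> 'u)" where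
  "fun_tuple lam \<Sigma> f h a = (\<lambda>i \<in> fun_idx lam \<Sigma> f. h (fun_dom \<Sigma> f i) (a i))"

definition rel_tuple ::
  "'l rel \<Rightarrow> ('s, 'f, 'r, 'l) signature \<Rightarrow> 'r \<Rightarrow> ('s \<Rightarrow> 'u \<Rightarrow> 'u) \<Rightarrow> ('l \<Rightarrow> 'u) \<Rightarrow> ('l \<Rightarrow> 'u)" where
  "rel_tuple lam \<Sigma> R h a = (\<lambda>i \<in> rel_idx lam \<Sigma> R. h (rel_dom \<Sigma> R i) (a i))"

text \<open>
  The first condition ranges over all of \<open>'s\<close>; for \<open>s\<close> outside \<open>sorts \<Sigma>\<close> both carriers are empty, so
  \<open>h s\<close> is then the everywhere undefined function.
\<close>

definition is_homomorphism ::
  "'l rel \<Rightarrow> ('s, 'f, 'r, 'l) signature \<Rightarrow> ('s, 'f, 'r, 'l, 'u) pstruct \<Rightarrow> ('s, 'f, 'r, 'l, 'u) pstruct \<Rightarrow>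
    ('s \<Rightarrow> 'u \<Rightarrow> 'u) \<Rightarrow> bool" where
  "is_homomorphism lam \<Sigma> M N h \<longleftrightarrow>
     (\<forall>s. h s \<in> carr M s \<rightarrow>\<^sub>E carr N s) \<and>
     (\<forall>f \<in> funs \<Sigma>. \<forall>a \<in> fun_args lam \<Sigma> M f. \<forall>y. fint M f a = Some y \<longrightarrow>
        fint N f (fun_tuple lam \<Sigma> f h a) = Some (h (fun_cod \<Sigma> f) y)) \<and>
     (\<forall>R \<in> rels \<Sigma>. \<forall>a \<in> rel_args lam \<Sigma> M R. a \<in> rint M R \<longrightarrow> rel_tuple lam \<Sigma> R h a \<in> rint N R)"

datatype ('s, 'f, 'r, 'l, 'u) arrow =
  Arrow (source: "('s, 'f, 'r, 'l, 'u) pstruct") (maps: "'s \<Rightarrow> 'u \<Rightarrow> 'u")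
    (target: "('s, 'f, 'r, 'l, 'u) pstruct")

definition PMod ::
  "'u rel \<Rightarrow> 'l rel \<Rightarrow> ('s, 'f, 'r, 'l) signature \<Rightarrow> ('s, 'f, 'r, 'l) sequent set \<Rightarrow>
    (('s, 'f, 'r, 'l, 'u) pstruct, ('s, 'f, 'r, 'l, 'u) arrow) category" where
  "PMod \<kappa> lam \<Sigma> T =
    \<lparr> Obj = {M. is_model \<kappa> lam \<Sigma> T M},
      Arr = {f. is_model \<kappa> lam \<Sigma> T (source f) \<and> is_model \<kappa> lam \<Sigma> T (target f) \<and>
                is_homomorphism lam \<Sigma> (source f) (target f) (maps f)},
      Dom = source,
      Cod = target,
      Id = (\<lambda>M. Arrow M (\<lambda>s. \<lambda>a \<in> carr M s. a) M),
      Comp = (\<lambda>g f. Arrow (source f) (\<lambda>s. \<lambda>a \<in> carr (source f) s. maps g s (maps f s a)) (target g)) \<rparr>"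

definition closed_mono ::
  "'u rel \<Rightarrow> 'l rel \<Rightarrow> ('s, 'f, 'r, 'l) signature \<Rightarrow> ('s, 'f, 'r, 'l) sequent set \<Rightarrow>
    ('s, 'f, 'r, 'l, 'u) arrow \<Rightarrow> bool" where
  "closed_mono \<kappa> lam \<Sigma> T h \<longleftrightarrow> mono_arr (PMod \<kappa> lam \<Sigma> T) h \<and>
     (\<forall>f \<in> funs \<Sigma>. \<forall>a \<in> fun_args lam \<Sigma> (source h) f.
        fint (target h) f (fun_tuple lam \<Sigma> f (maps h) a) \<noteq> None \<longrightarrow> fint (source h) f a \<noteq> None) \<and>
     (\<forall>R \<in> rels \<Sigma>. \<forall>a \<in> rel_args lam \<Sigma> (source h) R.
        rel_tuple lam \<Sigma> R (maps h) a \<in> rint (target h) R \<longrightarrow> a \<in> rint (source h) R)"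

definition closed_under_closed_subobjects ::
  "'u rel \<Rightarrow> 'l rel \<Rightarrow> ('s, 'f, 'r, 'l) signature \<Rightarrow> ('s, 'f, 'r, 'l) sequent set \<Rightarrow>
    ('s, 'f, 'r, 'l, 'u) pstruct set \<Rightarrow> bool" where
  "closed_under_closed_subobjects \<kappa> lam \<Sigma> T E \<longleftrightarrow>
     (\<forall>h. closed_mono \<kappa> lam \<Sigma> T h \<longrightarrow> target h \<in> E \<longrightarrow> source h \<in> E)"


section \<open>Theory morphisms\<close>

text \<open>
  A morphism from \<open>\<Sigma>\<close> to \<open>\<Sigma>'\<close>.  For sorts \<open>(s\<^sub>i)\<^sub>i\<close>, the translated context consists of the variables
  \<open>x\<^sub>i = (s\<^sub>i\<^sup>\<rho>, i)\<close>; these are distinct for distinct positions even if \<open>s\<^sub>i\<^sup>\<rho> = s\<^sub>j\<^sup>\<rho>\<close>.  The images of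
  the function and relation symbols are given in these contexts.
\<close>

record ('s, 'f, 'r, 't, 'g, 'q, 'l) morphism =
  smap :: "'s \<Rightarrow> 't"
  fmap :: "'f \<Rightarrow> ('t, 'g, 'l) trm"
  rmap :: "'r \<Rightarrow> ('t, 'g, 'q, 'l) fm"

definition pos_ctx :: "'l rel \<Rightarrow> 'l \<Rightarrow> ('l \<Rightarrow> 't) \<Rightarrow> ('t, 'l) ctx" where
  "pos_ctx lam \<alpha> s = \<lparr> ctx_len = \<alpha>, ctx_var = (\<lambda>i \<in> underS lam \<alpha>. (s i, i)) \<rparr>"

definition fun_ctx ::
  "'l rel \<Rightarrow> ('s, 'f, 'r, 'l) signature \<Rightarrow> ('s, 'f, 'r, 't, 'g, 'q, 'l) morphism \<Rightarrow> 'f \<Rightarrow> ('t, 'l) ctx" where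
  "fun_ctx lam \<Sigma> \<rho> f = pos_ctx lam (fun_arity \<Sigma> f) (\<lambda>i. smap \<rho> (fun_dom \<Sigma> f i))"

definition rel_ctx ::
  "'l rel \<Rightarrow> ('s, 'f, 'r, 'l) signature \<Rightarrow> ('s, 'f, 'r, 't, 'g, 'q, 'l) morphism \<Rightarrow> 'r \<Rightarrow> ('t, 'l) ctx" where
  "rel_ctx lam \<Sigma> \<rho> R = pos_ctx lam (rel_arity \<Sigma> R) (\<lambda>i. smap \<rho> (rel_dom \<Sigma> R i))"

definition ctx_tr ::
  "'l rel \<Rightarrow> ('s, 'f, 'r, 't, 'g, 'q, 'l) morphism \<Rightarrow> ('s, 'l) ctx \<Rightarrow> ('t, 'l) ctx" where
  "ctx_tr lam \<rho> x = pos_ctx lam (ctx_len x) (\<lambda>i. smap \<rho> (fst (ctx_var x i)))"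

definition var_tr ::
  "'l rel \<Rightarrow> ('s, 'f, 'r, 't, 'g, 'q, 'l) morphism \<Rightarrow> ('s, 'l) ctx \<Rightarrow> ('s, 'l) var \<Rightarrow> ('t, 'l) var" where
  "var_tr lam \<rho> x v = (smap \<rho> (fst v), inv_into (ctx_idx lam x) (ctx_var x) v)"

primrec term_subst ::
  "'l rel \<Rightarrow> ('t, 'g, 'q, 'l) signature \<Rightarrow> (('t, 'l) var \<Rightarrow> ('t, 'g, 'l) trm) \<Rightarrow>
    ('t, 'g, 'l) trm \<Rightarrow> ('t, 'g, 'l) trm" where
  "term_subst lam \<Sigma>' \<theta> (Var v) = \<theta> v"
| "term_subst lam \<Sigma>' \<theta> (App g ts) = App g (\<lambda>i \<in> fun_idx lam \<Sigma>' g. term_subst lam \<Sigma>' \<theta> (ts i))"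

primrec fm_subst ::
  "'l rel \<Rightarrow> ('t, 'g, 'q, 'l) signature \<Rightarrow> (('t, 'l) var \<Rightarrow> ('t, 'g, 'l) trm) \<Rightarrow>
    ('t, 'g, 'q, 'l) fm \<Rightarrow> ('t, 'g, 'q, 'l) fm" where
  "fm_subst lam \<Sigma>' \<theta> (Rel Q ts) = Rel Q (\<lambda>i \<in> rel_idx lam \<Sigma>' Q. term_subst lam \<Sigma>' \<theta> (ts i))"
| "fm_subst lam \<Sigma>' \<theta> (Eq t u) = Eq (term_subst lam \<Sigma>' \<theta> t) (term_subst lam \<Sigma>' \<theta> u)"
| "fm_subst lam \<Sigma>' \<theta> Top = Top"
| "fm_subst lam \<Sigma>' \<theta> (Conj \<alpha> \<phi>) = Conj \<alpha> (\<lambda>i \<in> underS lam \<alpha>. fm_subst lam \<Sigma>' \<theta> (\<phi> i))"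

text \<open>Binary conjunction, indexed by the ordinal \<open>2 < \<lambda>\<close>.\<close>

definition two :: "'l rel \<Rightarrow> 'l" where
  "two lam = (SOME k. k \<in> Field lam \<and> card (underS lam k) = 2)"

definition And :: "'l rel \<Rightarrow> ('t, 'g, 'q, 'l) fm \<Rightarrow> ('t, 'g, 'q, 'l) fm \<Rightarrow> ('t, 'g, 'q, 'l) fm" where
  "And lam \<phi> \<psi> = Conj (two lam) (\<lambda>i \<in> underS lam (two lam). if underS lam i = {} then \<phi> else \<psi>)"

text \<open>\<open>f(\<tau>\<^sub>i)\<^sub>i\<close> translates to \<open>f\<^sup>\<rho>[\<tau>\<^sub>i\<^sup>\<rho> / x\<^sub>i]\<close>.\<close>

primrec term_tr ::
  "'l rel \<Rightarrow> ('s, 'f, 'r, 'l) signature \<Rightarrow> ('t, 'g, 'q, 'l) signature \<Rightarrow>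
    ('s, 'f, 'r, 't, 'g, 'q, 'l) morphism \<Rightarrow> ('s, 'l) ctx \<Rightarrow> ('s, 'f, 'l) trm \<Rightarrow> ('t, 'g, 'l) trm" where
  "term_tr lam \<Sigma> \<Sigma>' \<rho> x (Var v) = Var (var_tr lam \<rho> x v)"
| "term_tr lam \<Sigma> \<Sigma>' \<rho> x (App f ts) =
     term_subst lam \<Sigma>' (\<lambda>v. term_tr lam \<Sigma> \<Sigma>' \<rho> x (ts (snd v))) (fmap \<rho> f)"

text \<open>
  If \<open>x\<^sub>i\<close> does not occur in \<open>f\<^sup>\<rho>\<close>, the substitution above discards \<open>\<tau>\<^sub>i\<^sup>\<rho>\<close>, although \<open>f(\<tau>\<^sub>i)\<^sub>i\<close> is
  only defined if \<open>\<tau>\<^sub>i\<close> is.  Translated formulas therefore also assert that the translations of all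
  subterms are defined, where \<open>\<tau> = \<tau>\<close> expresses that \<open>\<tau>\<close> is defined: \<open>args_defined\<close> asserts this for
  the proper subterms, \<open>term_defined\<close> for all subterms.  The translation of \<open>\<phi>\<close> thus holds in
  \<open>M\<close> exactly where \<open>\<phi>\<close> holds in the translated structure \<open>reduct \<dots> M\<close> defined below.
\<close>

primrec args_defined ::
  "'l rel \<Rightarrow> ('s, 'f, 'r, 'l) signature \<Rightarrow> ('t, 'g, 'q, 'l) signature \<Rightarrow>
    ('s, 'f, 'r, 't, 'g, 'q, 'l) morphism \<Rightarrow> ('s, 'l) ctx \<Rightarrow> ('s, 'f, 'l) trm \<Rightarrow> ('t, 'g, 'q, 'l) fm" where
  "args_defined lam \<Sigma> \<Sigma>' \<rho> x (Var v) = Top"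
| "args_defined lam \<Sigma> \<Sigma>' \<rho> x (App f ts) =
     Conj (fun_arity \<Sigma> f) (\<lambda>i \<in> fun_idx lam \<Sigma> f.
       And lam (args_defined lam \<Sigma> \<Sigma>' \<rho> x (ts i))
         (Eq (term_tr lam \<Sigma> \<Sigma>' \<rho> x (ts i)) (term_tr lam \<Sigma> \<Sigma>' \<rho> x (ts i))))"

definition term_defined ::
  "'l rel \<Rightarrow> ('s, 'f, 'r, 'l) signature \<Rightarrow> ('t, 'g, 'q, 'l) signature \<Rightarrow>
    ('s, 'f, 'r, 't, 'g, 'q, 'l) morphism \<Rightarrow> ('s, 'l) ctx \<Rightarrow> ('s, 'f, 'l) trm \<Rightarrow> ('t, 'g, 'q, 'l) fm" where
  "term_defined lam \<Sigma> \<Sigma>' \<rho> x t =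
     And lam (args_defined lam \<Sigma> \<Sigma>' \<rho> x t) (Eq (term_tr lam \<Sigma> \<Sigma>' \<rho> x t) (term_tr lam \<Sigma> \<Sigma>' \<rho> x t))"

primrec fm_tr ::
  "'l rel \<Rightarrow> ('s, 'f, 'r, 'l) signature \<Rightarrow> ('t, 'g, 'q, 'l) signature \<Rightarrow>
    ('s, 'f, 'r, 't, 'g, 'q, 'l) morphism \<Rightarrow> ('s, 'l) ctx \<Rightarrow> ('s, 'f, 'r, 'l) fm \<Rightarrow> ('t, 'g, 'q, 'l) fm" where
  "fm_tr lam \<Sigma> \<Sigma>' \<rho> x (Rel R ts) =
     And lam (Conj (rel_arity \<Sigma> R) (\<lambda>i \<in> rel_idx lam \<Sigma> R. term_defined lam \<Sigma> \<Sigma>' \<rho> x (ts i)))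
       (fm_subst lam \<Sigma>' (\<lambda>v. term_tr lam \<Sigma> \<Sigma>' \<rho> x (ts (snd v))) (rmap \<rho> R))"
| "fm_tr lam \<Sigma> \<Sigma>' \<rho> x (Eq t u) =
     And lam (And lam (args_defined lam \<Sigma> \<Sigma>' \<rho> x t) (args_defined lam \<Sigma> \<Sigma>' \<rho> x u))
       (Eq (term_tr lam \<Sigma> \<Sigma>' \<rho> x t) (term_tr lam \<Sigma> \<Sigma>' \<rho> x u))"
| "fm_tr lam \<Sigma> \<Sigma>' \<rho> x Top = Top"
| "fm_tr lam \<Sigma> \<Sigma>' \<rho> x (Conj \<alpha> \<phi>) = Conj \<alpha> (\<lambda>i \<in> underS lam \<alpha>. fm_tr lam \<Sigma> \<Sigma>' \<rho> x (\<phi> i))"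

primrec sequent_tr ::
  "'l rel \<Rightarrow> ('s, 'f, 'r, 'l) signature \<Rightarrow> ('t, 'g, 'q, 'l) signature \<Rightarrow>
    ('s, 'f, 'r, 't, 'g, 'q, 'l) morphism \<Rightarrow> ('s, 'f, 'r, 'l) sequent \<Rightarrow> ('t, 'g, 'q, 'l) sequent" where
  "sequent_tr lam \<Sigma> \<Sigma>' \<rho> (Sequent x \<phi> \<psi>) =
     Sequent (ctx_tr lam \<rho> x) (fm_tr lam \<Sigma> \<Sigma>' \<rho> x \<phi>) (fm_tr lam \<Sigma> \<Sigma>' \<rho> x \<psi>)"

text \<open>
  Derivability in \<open>\<lambda>\<close>-ary partial Horn logic, expressed semantically through completeness
  (the models constructed in the completeness proof are \<open>\<kappa>\<close>-small).
\<close>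

definition entails ::
  "'u rel \<Rightarrow> 'l rel \<Rightarrow> ('t, 'g, 'q, 'l) signature \<Rightarrow> ('t, 'g, 'q, 'l) sequent set \<Rightarrow>
    ('t, 'g, 'q, 'l) sequent \<Rightarrow> bool" where
  "entails \<kappa> lam \<Sigma> T \<sigma> \<longleftrightarrow>
     (\<forall>M :: ('t, 'g, 'q, 'l, 'u) pstruct. is_model \<kappa> lam \<Sigma> T M \<longrightarrow> valid_in lam \<Sigma> M \<sigma>)"

definition is_theory_morphism ::
  "'u rel \<Rightarrow> 'l rel \<Rightarrow> ('s, 'f, 'r, 'l) signature \<Rightarrow> ('s, 'f, 'r, 'l) sequent set \<Rightarrow>
    ('t, 'g, 'q, 'l) signature \<Rightarrow> ('t, 'g, 'q, 'l) sequent set \<Rightarrow>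
    ('s, 'f, 'r, 't, 'g, 'q, 'l) morphism \<Rightarrow> bool" where
  "is_theory_morphism \<kappa> lam \<Sigma> S \<Sigma>' T \<rho> \<longleftrightarrow>
     (\<forall>s \<in> sorts \<Sigma>. smap \<rho> s \<in> sorts \<Sigma>') \<and>
     (\<forall>f \<in> funs \<Sigma>. term_in_ctx lam \<Sigma>' (fun_ctx lam \<Sigma> \<rho> f) (fmap \<rho> f) (smap \<rho> (fun_cod \<Sigma> f))) \<and>
     (\<forall>R \<in> rels \<Sigma>. fm_in_ctx lam \<Sigma>' (rel_ctx lam \<Sigma> \<rho> R) (rmap \<rho> R)) \<and>
     (\<forall>\<sigma> \<in> S. entails \<kappa> lam \<Sigma>' T (sequent_tr lam \<Sigma> \<Sigma>' \<rho> \<sigma>))"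

definition reduct ::
  "'l rel \<Rightarrow> ('s, 'f, 'r, 'l) signature \<Rightarrow> ('t, 'g, 'q, 'l) signature \<Rightarrow>
    ('s, 'f, 'r, 't, 'g, 'q, 'l) morphism \<Rightarrow> ('t, 'g, 'q, 'l, 'u) pstruct \<Rightarrow>
    ('s, 'f, 'r, 'l, 'u) pstruct" where
  "reduct lam \<Sigma> \<Sigma>' \<rho> M =
    \<lparr> carr = (\<lambda>s. if s \<in> sorts \<Sigma> then carr M (smap \<rho> s) else {}),
      fint = (\<lambda>f. if f \<in> funs \<Sigma> then term_interp lam \<Sigma>' M (fun_ctx lam \<Sigma> \<rho> f) (fmap \<rho> f) else (\<lambda>_. None)),
      rint = (\<lambda>R. if R \<in> rels \<Sigma> then fm_interp lam \<Sigma>' M (rel_ctx lam \<Sigma> \<rho> R) (rmap \<rho> R) else {}) \<rparr>"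

definition translation_functor ::
  "'l rel \<Rightarrow> ('s, 'f, 'r, 'l) signature \<Rightarrow> ('t, 'g, 'q, 'l) signature \<Rightarrow>
    ('s, 'f, 'r, 't, 'g, 'q, 'l) morphism \<Rightarrow>
    (('t, 'g, 'q, 'l, 'u) pstruct, ('t, 'g, 'q, 'l, 'u) arrow,
     ('s, 'f, 'r, 'l, 'u) pstruct, ('s, 'f, 'r, 'l, 'u) arrow) func" where
  "translation_functor lam \<Sigma> \<Sigma>' \<rho> =
    \<lparr> fobj = reduct lam \<Sigma> \<Sigma>' \<rho>,
      farr = (\<lambda>h. Arrow (reduct lam \<Sigma> \<Sigma>' \<rho> (source h))
                    (\<lambda>s. if s \<in> sorts \<Sigma> then maps h (smap \<rho> s) else (\<lambda>_. undefined))
                    (reduct lam \<Sigma> \<Sigma>' \<rho> (target h))) \<rparr>"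

definition relative_judgment ::
  "'l rel \<Rightarrow> ('s, 'f, 'r, 'l) signature \<Rightarrow> ('t, 'g, 'q, 'l) signature \<Rightarrow>
    ('s, 'f, 'r, 't, 'g, 'q, 'l) morphism \<Rightarrow> ('t, 'g, 'q, 'l) sequent \<Rightarrow> bool" where
  "relative_judgment lam \<Sigma> \<Sigma>' \<rho> \<sigma> \<longleftrightarrow>
     (\<exists>x \<phi> \<psi>. fm_in_ctx lam \<Sigma> x \<phi> \<and> fm_in_ctx lam \<Sigma>' (ctx_tr lam \<rho> x) \<psi> \<and>
        \<sigma> = Sequent (ctx_tr lam \<rho> x) (fm_tr lam \<Sigma> \<Sigma>' \<rho> x \<phi>) \<psi>)"

definition definable_by_relative_judgments ::
  "'u rel \<Rightarrow> 'l rel \<Rightarrow> ('s, 'f, 'r, 'l) signature \<Rightarrow> ('t, 'g, 'q, 'l) signature \<Rightarrow>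
    ('t, 'g, 'q, 'l) sequent set \<Rightarrow> ('s, 'f, 'r, 't, 'g, 'q, 'l) morphism \<Rightarrow>
    ('t, 'g, 'q, 'l, 'u) pstruct set \<Rightarrow> bool" where
  "definable_by_relative_judgments \<kappa> lam \<Sigma> \<Sigma>' T \<rho> E \<longleftrightarrow>
     (\<exists>T'. (\<forall>\<sigma> \<in> T'. relative_judgment lam \<Sigma> \<Sigma>' \<rho> \<sigma>) \<and> E = Obj (PMod \<kappa> lam \<Sigma>' (T \<union> T')))"

end

theory Submission
  imports Defs
begin

text \<open>
  If homomorphisms \<open>K \<rightarrow> A\<^sub>i\<close> are jointly injective and jointly reflect definedness and relations, then
  \<open>K\<close> satisfies every Horn sequent that all \<open>A\<^sub>i\<close> satisfy.  This applies to products, closed subobjects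
  and kernel pairs (so monomorphisms are injective), and it also yields generic models without any
  calculus of derivations: the terms that are defined in all members of a class of pointed structures,
  identified when they agree in all of them, form a structure that embeds jointly into the class.

  The generic \<open>\<S>\<close>-model of a Horn formula \<open>\<phi>\<close> is \<open>\<lambda>\<close>-presentable, so tuples satisfying \<open>\<phi>\<^sup>\<rho>\<close> lift
  along \<open>(U\<^sup>\<rho>, \<lambda>)\<close>-pure epimorphisms; hence (i) implies (ii).

  For (ii) implies (iii), the ascending chain condition provides a stage of a \<open>\<lambda>\<close>-filtered diagram
  beyond which all reducts are strongly connected.  The families of elements beyond this stage whose
  images in the colimit are eventually constant form a closed subobject of a product, and it maps onto
  the colimit by a \<open>(U\<^sup>\<rho>, \<lambda>)\<close>-pure epimorphism because strong connectedness extends every element of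
  a stage to such a family.

  For (iii) implies (i), let \<open>M\<close> satisfy all relative judgments valid in \<open>\<E>\<close>.  Each set \<open>F\<close> of fewer
  than \<open>\<lambda>\<close> facts of \<open>U\<^sup>\<rho>M\<close> has a generic model \<open>D\<^sub>F\<close> in \<open>\<E>\<close>, and the judgments give a homomorphism
  \<open>D\<^sub>F \<rightarrow> M\<close>.  The \<open>D\<^sub>F\<close> form a \<open>\<lambda>\<close>-directed diagram; sending each element of \<open>U\<^sup>\<rho>M\<close> to its name is a
  section of the reduct of the induced map from the colimit to \<open>M\<close>.
\<close>


section \<open>Sets of bounded size\<close>

text \<open>Two obstacles shape the constructions. The first is size: generic structures are carved
  out of products over all members of a class, which need not be \<open>\<kappa>\<close>-small. The
  number of terms bounds their carriers, and \<open>joint_emb_subfamily\<close> then replaces the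
  class by a \<open>\<kappa>\<close>-small subfamily, so that closure under products becomes
  applicable. The second is the lack of maps between incomparable stages: an element of a stage
  \<open>i\<close> has canonical images only in stages above \<open>i\<close>, whereas an element of
  a product needs a coordinate everywhere. Strong connectedness supplies the missing coordinates by
  going back to a fixed stage and up again. These detours are homomorphisms of reducts only, so the
  elements of a stage lift to the cover only after applying \<open>U\<^sup>\<rho>\<close>; this is
  where relative purity, rather than absolute purity, is required. The same asymmetry recurs for the
  retraction onto \<open>M\<close>: the facts that name its elements are facts over
  \<open>\<Sigma>\<close>, while the conclusions of judgments, over \<open>\<Sigma>'\<close>, are
  what allows the generic models to map to \<open>M\<close>.\<close>

locale universe =
  fixes \<kappa> :: "'u rel" and lam :: "'l rel"
  assumes inacc: "inaccessible \<kappa>"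
    and lam_inf: "Cinfinite lam" and lam_reg: "regularCard lam" and lam_less: "lam <o \<kappa>"
begin

lemma kappa_inf: "Cinfinite \<kappa>"
proof -
  have "natLeq \<le>o \<kappa>" "Card_order \<kappa>"
    using inacc ordLess_imp_ordLeq unfolding inaccessible_def by blast+
  then show ?thesis using cinfinite_mono[OF _ natLeq_cinfinite] by blast
qed

lemma kappa_reg: "regularCard \<kappa>"
  using inacc unfolding inaccessible_def by blast

lemma lam_card: "Card_order lam"
  using lam_inf by blast

lemma small_subset: "A \<subseteq> B \<Longrightarrow> |B| <o \<kappa> \<Longrightarrow> |A| <o \<kappa>"
  using ordLeq_ordLess_trans[OF card_of_mono1] .

lemma small_image: "|A| <o \<kappa> \<Longrightarrow> |f ` A| <o \<kappa>"
  using ordLeq_ordLess_trans[OF card_of_image] .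

lemma small_inj_on: "inj_on f A \<Longrightarrow> f ` A \<subseteq> B \<Longrightarrow> |B| <o \<kappa> \<Longrightarrow> |A| <o \<kappa>"
  using ordLeq_ordLess_trans card_of_ordLeq[of A B] by blast

lemma small_UN: "|I| <o \<kappa> \<Longrightarrow> (\<And>i. i \<in> I \<Longrightarrow> |A i| <o \<kappa>) \<Longrightarrow> |\<Union>i\<in>I. A i| <o \<kappa>"
  by (rule card_of_UNION_ordLess_infinite_Field_regularCard[OF kappa_reg kappa_inf]) auto

lemma small_Sigma:
  assumes "|I| <o \<kappa>" "\<And>i. i \<in> I \<Longrightarrow> |A i| <o \<kappa>"
  shows "|Sigma I A| <o \<kappa>"
proof -
  have "Sigma I A = (\<Union>i\<in>I. Pair i ` A i)" by auto
  moreover have "|\<Union>i\<in>I. Pair i ` A i| <o \<kappa>" by (intro small_UN small_image assms)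
  ultimately show ?thesis by simp
qed

lemma small_finite: "finite A \<Longrightarrow> |A| <o \<kappa>"
  by (rule finite_ordLess_infinite[OF card_of_Well_order])
    (use kappa_inf in \<open>auto simp: cinfinite_def Field_card_of card_order_on_well_order_on\<close>)

lemma small_Un: "|A| <o \<kappa> \<Longrightarrow> |B| <o \<kappa> \<Longrightarrow> |A \<union> B| <o \<kappa>"
  using small_UN[of "{True, False}" "\<lambda>b. if b then A else B"] small_finite[of "{True, False}"]
  by (simp add: Un_commute)

lemma small_Plus: "|A| <o \<kappa> \<Longrightarrow> |B| <o \<kappa> \<Longrightarrow> |A <+> B| <o \<kappa>"
  unfolding Plus_def by (intro small_Un small_image)

text \<open>Structures take their elements from \<open>'u\<close>, while the constructions below
  produce families, equivalence classes and pairs. Smallness allows such sets to be copied into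
  \<open>'u\<close>; the carriers and index categories built later use encodings of this
  kind.\<close>

lemma small_encode:
  fixes A :: "'a set"
  assumes "|A| <o \<kappa>"
  shows "\<exists>enc :: 'a \<Rightarrow> 'u. inj_on enc A"
proof -
  have "|A| \<le>o |Field \<kappa>|"
    using assms kappa_inf card_of_Field_ordIso ordIso_symmetric ordLess_imp_ordLeq
      ordLeq_ordIso_trans by blast
  then show ?thesis using card_of_ordLeq[of A "Field \<kappa>"] by blast
qed

text \<open>The strong limit condition in \<open>inaccessible\<close> speaks only of subsets of
  \<open>'u\<close>, so an arbitrary small set is first moved there.\<close>

lemma small_Pow:
  assumes "|A| <o \<kappa>" shows "|Pow A| <o \<kappa>"
proof -
  obtain enc :: "'a \<Rightarrow> 'u" where "inj_on enc A" using small_encode[OF assms] by blast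
  then have "inj_on (image enc) (Pow A)" by (simp add: inj_on_image_Pow)
  moreover have "|Pow (enc ` A)| <o \<kappa>"
    using small_image[OF assms, of enc] inacc unfolding inaccessible_def by blast
  moreover have "image enc ` Pow A \<subseteq> Pow (enc ` A)" by auto
  ultimately show ?thesis using small_inj_on by blast
qed

text \<open>A family is determined by its graph, a subset of \<open>Sigma I A\<close>; hence
  products are bounded by a power set.\<close>

lemma small_PiE:
  assumes "|I| <o \<kappa>" "\<And>i. i \<in> I \<Longrightarrow> |A i| <o \<kappa>"
  shows "|Pi\<^sub>E I A| <o \<kappa>"
proof (rule small_inj_on)
  show "inj_on (\<lambda>g. {(i, g i) |i. i \<in> I}) (Pi\<^sub>E I A)"
  proof (rule inj_onI)
    fix g h assume "g \<in> Pi\<^sub>E I A" "h \<in> Pi\<^sub>E I A" and eq: "{(i, g i) |i. i \<in> I} = {(i, h i) |i. i \<in> I}"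
    moreover have "g i = h i" if "i \<in> I" for i using eq that by auto
    ultimately show "g = h" by (meson PiE_ext)
  qed
  show "(\<lambda>g. {(i, g i) |i. i \<in> I}) ` Pi\<^sub>E I A \<subseteq> Pow (Sigma I A)" by auto
qed (intro small_Pow small_Sigma assms; assumption)

lemma small_lam: "|A| <o lam \<Longrightarrow> |A| <o \<kappa>"
  using lam_less ordLess_transitive by blast

lemma small_Field_lam: "|Field lam| <o \<kappa>"
  using lam_less lam_card card_of_Field_ordIso ordIso_ordLess_trans by blast

text \<open>Lists of a fixed length are iterated products, and the union over all lengths stays
  small because \<open>\<kappa>\<close> is uncountable.\<close>

lemma small_lists:
  assumes "|A| <o \<kappa>" shows "|lists A| <o \<kappa>"
proof -
  have "|{xs \<in> lists A. length xs = n}| <o \<kappa>" for n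
  proof (induction n)
    case 0
    have "{xs \<in> lists A. length xs = 0} = {[]}" by auto
    then show ?case using small_finite[of "{[]}"] by simp
  next
    case (Suc n)
    have "{xs \<in> lists A. length xs = Suc n} \<subseteq>
        (\<lambda>(x, xs). x # xs) ` (A \<times> {xs \<in> lists A. length xs = n})"
      by (auto simp: length_Suc_conv)
    then show ?case by (rule small_subset) (intro small_image small_Sigma assms Suc)
  qed
  moreover have "|UNIV :: nat set| <o \<kappa>"
    using inacc unfolding inaccessible_def by (meson card_of_nat ordIso_ordLess_trans)
  moreover have "lists A = (\<Union>n. {xs \<in> lists A. length xs = n})" by auto
  ultimately show ?thesis using small_UN[of UNIV "\<lambda>n. {xs \<in> lists A. length xs = n}"] by simp
qed

lemma lam_image: "|A| <o lam \<Longrightarrow> |f ` A| <o lam"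
  using ordLeq_ordLess_trans[OF card_of_image] .

lemma lam_UN: "|I| <o lam \<Longrightarrow> (\<And>i. i \<in> I \<Longrightarrow> |A i| <o lam) \<Longrightarrow> |\<Union>i\<in>I. A i| <o lam"
  by (rule card_of_UNION_ordLess_infinite_Field_regularCard[OF lam_reg lam_inf]) auto

lemma lam_finite: "finite A \<Longrightarrow> |A| <o lam"
  by (rule finite_ordLess_infinite[OF card_of_Well_order])
    (use lam_inf in \<open>auto simp: cinfinite_def Field_card_of card_order_on_well_order_on\<close>)

lemma lam_Un:
  assumes "|A| <o lam" "|B| <o lam" shows "|A \<union> B| <o lam"
proof -
  have "|\<Union>b \<in> {True, False}. if b then A else B| <o lam"
    by (rule lam_UN) (use assms lam_finite[of "{True, False}"] in auto)
  then show ?thesis by (simp add: Un_commute)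
qed

lemma lam_insert: "|A| <o lam \<Longrightarrow> |insert a A| <o lam"
  using lam_Un[of "{a}" A] lam_finite[of "{a}"] by simp

lemma lam_underS: "a \<in> Field lam \<Longrightarrow> |underS lam a| <o lam"
  using card_of_underS[OF lam_card] .

lemma underS_subset_Field: "underS lam a \<subseteq> Field lam"
  by (auto simp: underS_def Field_def)

text \<open>A cardinal below \<open>lam\<close> is isomorphic to a proper initial segment of
  \<open>lam\<close>, and these segments are the lengths of contexts and conjunctions. Any set of
  fewer than \<open>lam\<close> things can thus be turned into variables or conjuncts.\<close>

lemma lam_index:
  assumes "|A| <o lam"
  shows "\<exists>a \<in> Field lam. \<exists>en. bij_betw en (underS lam a) A"
proof -
  have wo: "Well_order lam" using lam_card card_order_on_well_order_on by blast
  then obtain a where a: "a \<in> Field lam" and iso: "|A| =o Restr lam (underS lam a)"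
    using assms card_of_Well_order ordLess_iff_ordIso_Restr[of lam "|A|"] by blast
  have "Field (Restr lam (underS lam a)) = underS lam a"
    using wo by (simp add: wo_rel.intro wo_rel.underS_ofilter wo_rel_def Field_Restr_ofilter)
  then have "\<exists>f. bij_betw f A (underS lam a)"
    using iso by (auto simp: ordIso_def iso_def Field_card_of)
  then show ?thesis using a bij_betw_inv by blast
qed

text \<open>\<open>two\<close> is chosen by its cardinality alone, whereas \<open>And\<close>
  recognizes its first component by the absence of predecessors. The order on the two elements
  provides exactly one such component.\<close>

lemma two_lam:
  obtains k0 k1 where "underS lam (two lam) = {k0, k1}" "k0 \<noteq> k1"
    "underS lam k0 = {}" "underS lam k1 \<noteq> {}" "two lam \<in> Field lam"
proof -
  note hyp = that
  obtain a en where "a \<in> Field lam" "bij_betw en (underS lam a) {True, False}"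
    using lam_index[OF lam_finite[of "{True, False}"]] by auto
  then have "a \<in> Field lam \<and> card (underS lam a) = 2"
    using bij_betw_same_card by fastforce
  then have two: "two lam \<in> Field lam" "card (underS lam (two lam)) = 2"
    unfolding two_def using someI[of "\<lambda>k. k \<in> Field lam \<and> card (underS lam k) = 2" a] by auto
  then obtain x y where xy: "underS lam (two lam) = {x, y}" "x \<noteq> y" by (meson card_2_iff)
  have wo: "Well_order lam" using lam_card card_order_on_well_order_on by blast
  then have tot: "total_on (Field lam) lam" and tr: "trans lam" and anti: "antisym lam"
    unfolding well_order_on_def linear_order_on_def partial_order_on_def preorder_on_def by auto
  have xF: "x \<in> Field lam" "y \<in> Field lam" using xy underS_subset_Field by blast+
  \<comment> \<open>Once the two elements are ordered, a predecessor of the smaller one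
    \<open>u\<close> lies below \<open>two lam\<close> by transitivity, so it could only be
    \<open>u\<close> or \<open>v\<close>; strictness excludes the one and antisymmetry the other.
    Totality later decides which element plays the role of \<open>u\<close>.\<close>
  have *: thesis if u: "underS lam (two lam) = {u, v}" "(u, v) \<in> lam" "u \<noteq> v" for u v
  proof (rule hyp[of u v])
    have "w \<in> {u, v}" if "w \<in> underS lam u" for w
    proof -
      have "(w, u) \<in> lam" "(u, two lam) \<in> lam" "u \<noteq> two lam" "w \<noteq> u"
        using that u(1) by (auto simp: underS_def)
      then have "(w, two lam) \<in> lam" "w \<noteq> two lam" using tr anti by (auto dest: transD antisymD)
      then have "w \<in> underS lam (two lam)" by (simp add: underS_def)
      then show ?thesis using u by simp
    qed
    then show "underS lam u = {}" using u anti by (fastforce simp: underS_def dest: antisymD)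
    show "underS lam v \<noteq> {}" using u by (auto simp: underS_def)
  qed (use u two in auto)
  show thesis using *[of x y] *[of y x] xy tot xF by (metis insert_commute total_on_def)
qed

end

section \<open>Homomorphisms and joint embeddings\<close>

locale structures = universe \<kappa> lam
  for \<kappa> :: "'u rel" and lam :: "'l rel" +
  fixes \<Sigma> :: "('s, 'f, 'r, 'l) signature"
  assumes sgn: "is_signature \<kappa> lam \<Sigma>"
begin

abbreviation ps :: "('s, 'f, 'r, 'l, 'u) pstruct \<Rightarrow> bool" where
  "ps M \<equiv> is_pstruct \<kappa> lam \<Sigma> M"

abbreviation hm ::
  "('s, 'f, 'r, 'l, 'u) pstruct \<Rightarrow> ('s, 'f, 'r, 'l, 'u) pstruct \<Rightarrow> ('s \<Rightarrow> 'u \<Rightarrow> 'u) \<Rightarrow> bool" where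
  "hm M N h \<equiv> is_homomorphism lam \<Sigma> M N h"

lemma fun_sorts: "f \<in> funs \<Sigma> \<Longrightarrow> fun_cod \<Sigma> f \<in> sorts \<Sigma>"
  "f \<in> funs \<Sigma> \<Longrightarrow> i \<in> fun_idx lam \<Sigma> f \<Longrightarrow> fun_dom \<Sigma> f i \<in> sorts \<Sigma>"
  "R \<in> rels \<Sigma> \<Longrightarrow> i \<in> rel_idx lam \<Sigma> R \<Longrightarrow> rel_dom \<Sigma> R i \<in> sorts \<Sigma>"
  "f \<in> funs \<Sigma> \<Longrightarrow> fun_arity \<Sigma> f \<in> Field lam"
  "R \<in> rels \<Sigma> \<Longrightarrow> rel_arity \<Sigma> R \<in> Field lam"
  using sgn unfolding is_signature_def fun_idx_def rel_idx_def by blast+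

lemma fun_idx_lam: "f \<in> funs \<Sigma> \<Longrightarrow> |fun_idx lam \<Sigma> f| <o lam"
  "R \<in> rels \<Sigma> \<Longrightarrow> |rel_idx lam \<Sigma> R| <o lam"
  by (simp_all add: fun_idx_def rel_idx_def fun_sorts lam_underS)

lemma fintD:
  "ps M \<Longrightarrow> f \<in> funs \<Sigma> \<Longrightarrow> fint M f a = Some y \<Longrightarrow> a \<in> fun_args lam \<Sigma> M f"
  "ps M \<Longrightarrow> f \<in> funs \<Sigma> \<Longrightarrow> fint M f a = Some y \<Longrightarrow> y \<in> carr M (fun_cod \<Sigma> f)"
  "ps M \<Longrightarrow> R \<in> rels \<Sigma> \<Longrightarrow> a \<in> rint M R \<Longrightarrow> a \<in> rel_args lam \<Sigma> M R"
  unfolding is_pstruct_def by blast+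

lemma carr_sort: "ps M \<Longrightarrow> y \<in> carr M s \<Longrightarrow> s \<in> sorts \<Sigma>"
  unfolding is_pstruct_def by fastforce

lemma hmD:
  "hm M N h \<Longrightarrow> y \<in> carr M s \<Longrightarrow> h s y \<in> carr N s"
  "hm M N h \<Longrightarrow> ps M \<Longrightarrow> f \<in> funs \<Sigma> \<Longrightarrow> fint M f a = Some y \<Longrightarrow>
    fint N f (fun_tuple lam \<Sigma> f h a) = Some (h (fun_cod \<Sigma> f) y)"
  "hm M N h \<Longrightarrow> ps M \<Longrightarrow> R \<in> rels \<Sigma> \<Longrightarrow> a \<in> rint M R \<Longrightarrow> rel_tuple lam \<Sigma> R h a \<in> rint N R"
  "hm M N h \<Longrightarrow> h s \<in> extensional (carr M s)"
  unfolding is_homomorphism_def by (blast, blast dest: fintD, blast dest: fintD, simp add: PiE_def)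

lemma hm_ext:
  assumes "hm M N h" "hm M N' h'" "\<And>s y. y \<in> carr M s \<Longrightarrow> h s y = h' s y"
  shows "h = h'"
proof (intro ext)
  fix s y show "h s y = h' s y"
    using assms(3)[of y s] hmD(4)[OF assms(1), of s] hmD(4)[OF assms(2), of s]
    by (cases "y \<in> carr M s") (auto simp: extensional_def)
qed

lemma fun_tuple_args:
  "hm M N h \<Longrightarrow> a \<in> fun_args lam \<Sigma> M f \<Longrightarrow> fun_tuple lam \<Sigma> f h a \<in> fun_args lam \<Sigma> N f"
  unfolding fun_args_def fun_tuple_def by (auto simp: PiE_iff intro: hmD(1))

lemma rel_tuple_args:
  "hm M N h \<Longrightarrow> a \<in> rel_args lam \<Sigma> M R \<Longrightarrow> rel_tuple lam \<Sigma> R h a \<in> rel_args lam \<Sigma> N R"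
  unfolding rel_args_def rel_tuple_def by (auto simp: PiE_iff intro: hmD(1))

text \<open>Cutting off outside the carrier keeps composites extensional, as the maps of arrows in
  \<open>PMod\<close> have to be.\<close>

definition hcomp ::
  "('s, 'f, 'r, 'l, 'u) pstruct \<Rightarrow> ('s \<Rightarrow> 'u \<Rightarrow> 'u) \<Rightarrow> ('s \<Rightarrow> 'u \<Rightarrow> 'u) \<Rightarrow> 's \<Rightarrow> 'u \<Rightarrow> 'u" where
  "hcomp M g h = (\<lambda>s. \<lambda>a \<in> carr M s. g s (h s a))"

lemma hm_id: "ps M \<Longrightarrow> hm M M (\<lambda>s. \<lambda>a \<in> carr M s. a)"
proof -
  assume M: "ps M"
  have "fun_tuple lam \<Sigma> f (\<lambda>s. \<lambda>a \<in> carr M s. a) a = a" if "a \<in> fun_args lam \<Sigma> M f" for f a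
    using that unfolding fun_tuple_def fun_args_def by (auto intro!: ext simp: PiE_def extensional_def)
  moreover have "rel_tuple lam \<Sigma> R (\<lambda>s. \<lambda>a \<in> carr M s. a) a = a" if "a \<in> rel_args lam \<Sigma> M R" for R a
    using that unfolding rel_tuple_def rel_args_def by (auto intro!: ext simp: PiE_def extensional_def)
  ultimately show ?thesis
    unfolding is_homomorphism_def using fintD(2)[OF M] by auto
qed

lemma hcomp_tuples:
  "a \<in> fun_args lam \<Sigma> M f \<Longrightarrow>
    fun_tuple lam \<Sigma> f (hcomp M g h) a = fun_tuple lam \<Sigma> f g (fun_tuple lam \<Sigma> f h a)"
  "a \<in> rel_args lam \<Sigma> M R \<Longrightarrow>
    rel_tuple lam \<Sigma> R (hcomp M g h) a = rel_tuple lam \<Sigma> R g (rel_tuple lam \<Sigma> R h a)"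
  unfolding fun_tuple_def fun_args_def rel_tuple_def rel_args_def hcomp_def
  by (auto intro!: ext simp: PiE_def Pi_def)

lemma hm_comp:
  assumes "ps M" "ps N" "hm M N h" "hm N Q g"
  shows "hm M Q (hcomp M g h)"
  unfolding is_homomorphism_def
proof (intro conjI allI ballI impI)
  fix s show "hcomp M g h s \<in> carr M s \<rightarrow>\<^sub>E carr Q s"
    unfolding hcomp_def using assms hmD(1) by fastforce
next
  fix f a y assume f: "f \<in> funs \<Sigma>" and a: "a \<in> fun_args lam \<Sigma> M f" and y: "fint M f a = Some y"
  have "fint Q f (fun_tuple lam \<Sigma> f g (fun_tuple lam \<Sigma> f h a)) = Some (g (fun_cod \<Sigma> f) (h (fun_cod \<Sigma> f) y))"
    by (rule hmD(2)[OF assms(4,2) f]) (rule hmD(2)[OF assms(3,1) f y])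
  then show "fint Q f (fun_tuple lam \<Sigma> f (hcomp M g h) a) = Some (hcomp M g h (fun_cod \<Sigma> f) y)"
    using hcomp_tuples(1)[OF a] fintD(2)[OF assms(1) f y] by (simp add: hcomp_def)
next
  fix R a assume R: "R \<in> rels \<Sigma>" and a: "a \<in> rel_args lam \<Sigma> M R" "a \<in> rint M R"
  have "rel_tuple lam \<Sigma> R g (rel_tuple lam \<Sigma> R h a) \<in> rint Q R"
    by (rule hmD(3)[OF assms(4,2) R]) (rule hmD(3)[OF assms(3,1) R a(2)])
  then show "rel_tuple lam \<Sigma> R (hcomp M g h) a \<in> rint Q R"
    using hcomp_tuples(2)[OF a(1)] by simp
qed

lemma term_val_cong:
  "(\<And>v. v \<in> term_vars lam \<Sigma> t \<Longrightarrow> e v = e' v) \<Longrightarrow> term_val lam \<Sigma> M e t = term_val lam \<Sigma> M e' t"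
proof (induction t)
  case (App f ts)
  have "term_val lam \<Sigma> M e (ts i) = term_val lam \<Sigma> M e' (ts i)" if "i \<in> fun_idx lam \<Sigma> f" for i
    using App that by auto
  then show ?case by (auto intro!: arg_cong[of _ _ "fint M f"])
qed auto

lemma fm_holds_cong:
  "(\<And>v. v \<in> fm_vars lam \<Sigma> \<phi> \<Longrightarrow> e v = e' v) \<Longrightarrow> fm_holds lam \<Sigma> M e \<phi> = fm_holds lam \<Sigma> M e' \<phi>"
proof (induction \<phi>)
  case (Rel R ts)
  have *: "term_val lam \<Sigma> M e (ts i) = term_val lam \<Sigma> M e' (ts i)" if "i \<in> rel_idx lam \<Sigma> R" for i
    using Rel that by (auto intro!: term_val_cong)
  then have "(\<lambda>i \<in> rel_idx lam \<Sigma> R. the (term_val lam \<Sigma> M e (ts i))) =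
      (\<lambda>i \<in> rel_idx lam \<Sigma> R. the (term_val lam \<Sigma> M e' (ts i)))" by auto
  then show ?case using * by simp
next
  case (Eq t u)
  then show ?case using term_val_cong[of t e e'] term_val_cong[of u e e'] by simp
next
  case (Conj \<alpha> \<phi>)
  have "fm_holds lam \<Sigma> M e (\<phi> i) = fm_holds lam \<Sigma> M e' (\<phi> i)" if "i \<in> underS lam \<alpha>" for i
    using Conj that by auto
  then show ?case by simp
qed auto

lemma term_val_typed:
  assumes "raw_term lam \<Sigma> t s" "ps M" "\<And>v. v \<in> term_vars lam \<Sigma> t \<Longrightarrow> e v \<in> carr M (fst v)"
    "term_val lam \<Sigma> M e t = Some y"
  shows "y \<in> carr M s"
  using assms by (induction arbitrary: y rule: raw_term.induct) (auto split: if_splits dest: fintD)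

lemma term_val_hom:
  assumes M: "ps M" and h: "hm M N h"
  shows "raw_term lam \<Sigma> t s \<Longrightarrow> term_val lam \<Sigma> M e t = Some y \<Longrightarrow>
    term_val lam \<Sigma> N (\<lambda>v. h (fst v) (e v)) t = Some (h s y)"
proof (induction arbitrary: y rule: raw_term.induct)
  case (2 f ts)
  let ?e = "\<lambda>v. h (fst v) (e v)"
  have def: "\<forall>i \<in> fun_idx lam \<Sigma> f. term_val lam \<Sigma> M e (ts i) \<noteq> None"
    and y: "fint M f (\<lambda>i \<in> fun_idx lam \<Sigma> f. the (term_val lam \<Sigma> M e (ts i))) = Some y"
    using 2 by (auto split: if_splits)
  have *: "term_val lam \<Sigma> N ?e (ts i) = Some (h (fun_dom \<Sigma> f i) (the (term_val lam \<Sigma> M e (ts i))))"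
    if "i \<in> fun_idx lam \<Sigma> f" for i
    using 2(3) that def by fastforce
  have "fun_tuple lam \<Sigma> f h (\<lambda>i \<in> fun_idx lam \<Sigma> f. the (term_val lam \<Sigma> M e (ts i))) =
      (\<lambda>i \<in> fun_idx lam \<Sigma> f. the (term_val lam \<Sigma> N ?e (ts i)))"
    using * by (auto simp: fun_tuple_def)
  then show ?case using hmD(2)[OF h M 2(1) y] * by simp
qed simp

text \<open>Horn formulas are conjunctions of atoms, without negation or implication, so their truth
  travels forwards along homomorphisms.\<close>

lemma fm_holds_hom:
  assumes M: "ps M" and h: "hm M N h"
  shows "raw_formula lam \<Sigma> \<phi> \<Longrightarrow> fm_holds lam \<Sigma> M e \<phi> \<Longrightarrow>
    fm_holds lam \<Sigma> N (\<lambda>v. h (fst v) (e v)) \<phi>"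
proof (induction rule: raw_formula.induct)
  case (1 R ts)
  let ?e = "\<lambda>v. h (fst v) (e v)"
  have *: "term_val lam \<Sigma> N ?e (ts i) = Some (h (rel_dom \<Sigma> R i) (the (term_val lam \<Sigma> M e (ts i))))"
    if "i \<in> rel_idx lam \<Sigma> R" for i
    using 1 that term_val_hom[OF M h] by fastforce
  have "(\<lambda>i \<in> rel_idx lam \<Sigma> R. the (term_val lam \<Sigma> N ?e (ts i))) =
      rel_tuple lam \<Sigma> R h (\<lambda>i \<in> rel_idx lam \<Sigma> R. the (term_val lam \<Sigma> M e (ts i)))"
    using * by (auto simp: rel_tuple_def)
  moreover have "\<dots> \<in> rint N R" using hmD(3)[OF h M 1(1)] 1(4) by simp
  ultimately show ?case using * by simp
next
  case (2 t s u)
  then obtain y where y: "term_val lam \<Sigma> M e t = Some y" "term_val lam \<Sigma> M e u = Some y" by fastforce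
  show ?case using term_val_hom[OF M h 2(1) y(1)] term_val_hom[OF M h 2(2) y(2)] by simp
qed auto

text \<open>A closed embedding into the product of the \<open>A i\<close>, phrased without the
  product, so that \<open>I\<close> may be arbitrarily large. For empty \<open>I\<close> it
  describes a structure with at most one element per sort in which all functions are total and all
  relations hold.\<close>

definition joint_emb ::
  "('s, 'f, 'r, 'l, 'u) pstruct \<Rightarrow> 'i set \<Rightarrow> ('i \<Rightarrow> ('s, 'f, 'r, 'l, 'u) pstruct) \<Rightarrow>
    ('i \<Rightarrow> 's \<Rightarrow> 'u \<Rightarrow> 'u) \<Rightarrow> bool" where
  "joint_emb K I A p \<longleftrightarrow> (\<forall>i \<in> I. hm K (A i) (p i)) \<and>
     (\<forall>s. \<forall>x \<in> carr K s. \<forall>y \<in> carr K s. (\<forall>i \<in> I. p i s x = p i s y) \<longrightarrow> x = y) \<and>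
     (\<forall>f \<in> funs \<Sigma>. \<forall>a \<in> fun_args lam \<Sigma> K f.
        (\<forall>i \<in> I. fint (A i) f (fun_tuple lam \<Sigma> f (p i) a) \<noteq> None) \<longrightarrow> fint K f a \<noteq> None) \<and>
     (\<forall>R \<in> rels \<Sigma>. \<forall>a \<in> rel_args lam \<Sigma> K R.
        (\<forall>i \<in> I. rel_tuple lam \<Sigma> R (p i) a \<in> rint (A i) R) \<longrightarrow> a \<in> rint K R)"

lemma joint_embD:
  assumes "joint_emb K I A p"
  shows "i \<in> I \<Longrightarrow> hm K (A i) (p i)"
    and "x \<in> carr K s \<Longrightarrow> y \<in> carr K s \<Longrightarrow> (\<And>i. i \<in> I \<Longrightarrow> p i s x = p i s y) \<Longrightarrow> x = y"
    and "f \<in> funs \<Sigma> \<Longrightarrow> a \<in> fun_args lam \<Sigma> K f \<Longrightarrow>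
      (\<And>i. i \<in> I \<Longrightarrow> fint (A i) f (fun_tuple lam \<Sigma> f (p i) a) \<noteq> None) \<Longrightarrow> fint K f a \<noteq> None"
    and "R \<in> rels \<Sigma> \<Longrightarrow> a' \<in> rel_args lam \<Sigma> K R \<Longrightarrow>
      (\<And>i. i \<in> I \<Longrightarrow> rel_tuple lam \<Sigma> R (p i) a' \<in> rint (A i) R) \<Longrightarrow> a' \<in> rint K R"
  using assms unfolding joint_emb_def by blast+

text \<open>Definedness is reflected one symbol at a time. A composite that is defined in every
  \<open>A i\<close> has defined arguments there, hence in \<open>K\<close> by induction;
  homomorphisms carry the values in \<open>K\<close> to the values in \<open>A i\<close>, so the
  outermost symbol is reflected as well.\<close>

lemma joint_emb_term:
  assumes K: "ps K" and je: "joint_emb K I A p"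
  shows "raw_term lam \<Sigma> t s \<Longrightarrow> (\<And>v. v \<in> term_vars lam \<Sigma> t \<Longrightarrow> e v \<in> carr K (fst v)) \<Longrightarrow>
    (\<And>i. i \<in> I \<Longrightarrow> term_val lam \<Sigma> (A i) (\<lambda>v. p i (fst v) (e v)) t \<noteq> None) \<Longrightarrow>
    term_val lam \<Sigma> K e t \<noteq> None"
proof (induction rule: raw_term.induct)
  case (2 f ts)
  have sub: "term_val lam \<Sigma> K e (ts j) \<noteq> None" if j: "j \<in> fun_idx lam \<Sigma> f" for j
  proof -
    have "term_val lam \<Sigma> (A i) (\<lambda>v. p i (fst v) (e v)) (ts j) \<noteq> None" if "i \<in> I" for i
      using 2(5)[OF that] j by (auto split: if_splits)
    moreover have "e v \<in> carr K (fst v)" if "v \<in> term_vars lam \<Sigma> (ts j)" for v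
      using 2(4)[of v] that j by auto
    ultimately show ?thesis using 2(3) j by blast
  qed
  let ?a = "\<lambda>j \<in> fun_idx lam \<Sigma> f. the (term_val lam \<Sigma> K e (ts j))"
  have typd: "the (term_val lam \<Sigma> K e (ts j)) \<in> carr K (fun_dom \<Sigma> f j)" if j: "j \<in> fun_idx lam \<Sigma> f" for j
  proof -
    have raw: "raw_term lam \<Sigma> (ts j) (fun_dom \<Sigma> f j)" using 2(3) j by blast
    have env: "e v \<in> carr K (fst v)" if "v \<in> term_vars lam \<Sigma> (ts j)" for v
      using 2(4)[of v] that j by auto
    show ?thesis using term_val_typed[OF raw K env] sub[OF j] by auto
  qed
  have "?a \<in> fun_args lam \<Sigma> K f" using typd by (auto simp: fun_args_def)
  moreover have "fint (A i) f (fun_tuple lam \<Sigma> f (p i) ?a) \<noteq> None" if i: "i \<in> I" for i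
  proof -
    have *: "term_val lam \<Sigma> (A i) (\<lambda>v. p i (fst v) (e v)) (ts j) =
        Some (p i (fun_dom \<Sigma> f j) (the (term_val lam \<Sigma> K e (ts j))))"
      if j: "j \<in> fun_idx lam \<Sigma> f" for j
      using term_val_hom[OF K joint_embD(1)[OF je i], of "ts j"] 2(3) j sub[OF j] by fastforce
    have "fun_tuple lam \<Sigma> f (p i) ?a =
        (\<lambda>j \<in> fun_idx lam \<Sigma> f. the (term_val lam \<Sigma> (A i) (\<lambda>v. p i (fst v) (e v)) (ts j)))"
      using * by (auto simp: fun_tuple_def)
    then show ?thesis using 2(5)[OF i] by (auto split: if_splits)
  qed
  ultimately have "fint K f ?a \<noteq> None" using joint_embD(3)[OF je 2(1)] by blast
  then show ?case using sub by simp
qed simp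

text \<open>Relations are reflected by assumption. For an equation, both sides acquire values in
  \<open>K\<close> by reflection of definedness, and joint injectivity identifies these
  values.\<close>

lemma joint_emb_fm:
  assumes K: "ps K" and je: "joint_emb K I A p"
  shows "raw_formula lam \<Sigma> \<phi> \<Longrightarrow> (\<And>v. v \<in> fm_vars lam \<Sigma> \<phi> \<Longrightarrow> e v \<in> carr K (fst v)) \<Longrightarrow>
    (\<And>i. i \<in> I \<Longrightarrow> fm_holds lam \<Sigma> (A i) (\<lambda>v. p i (fst v) (e v)) \<phi>) \<Longrightarrow>
    fm_holds lam \<Sigma> K e \<phi>"
proof (induction rule: raw_formula.induct)
  case (1 R ts)
  have sub: "term_val lam \<Sigma> K e (ts j) \<noteq> None" if j: "j \<in> rel_idx lam \<Sigma> R" for j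
    by (rule joint_emb_term[OF K je, of _ "rel_dom \<Sigma> R j"]) (use 1 j in auto)
  let ?a = "\<lambda>j \<in> rel_idx lam \<Sigma> R. the (term_val lam \<Sigma> K e (ts j))"
  have typd: "the (term_val lam \<Sigma> K e (ts j)) \<in> carr K (rel_dom \<Sigma> R j)" if j: "j \<in> rel_idx lam \<Sigma> R" for j
    by (rule term_val_typed[OF _ K, where t = "ts j" and e = e]) (use 1 j sub[OF j] in auto)
  have "?a \<in> rel_args lam \<Sigma> K R" using typd by (auto simp: rel_args_def)
  moreover have "rel_tuple lam \<Sigma> R (p i) ?a \<in> rint (A i) R" if i: "i \<in> I" for i
  proof -
    have *: "term_val lam \<Sigma> (A i) (\<lambda>v. p i (fst v) (e v)) (ts j) =
        Some (p i (rel_dom \<Sigma> R j) (the (term_val lam \<Sigma> K e (ts j))))"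
      if j: "j \<in> rel_idx lam \<Sigma> R" for j
      using term_val_hom[OF K joint_embD(1)[OF je i], of "ts j"] 1(3) j sub[OF j] by fastforce
    have "rel_tuple lam \<Sigma> R (p i) ?a =
        (\<lambda>j \<in> rel_idx lam \<Sigma> R. the (term_val lam \<Sigma> (A i) (\<lambda>v. p i (fst v) (e v)) (ts j)))"
      using * by (auto simp: rel_tuple_def)
    then show ?thesis using 1(5)[OF i] by auto
  qed
  ultimately show ?case using joint_embD(4)[OF je 1(1)] sub by simp
next
  case (2 t s u)
  have dt: "term_val lam \<Sigma> (A i) (\<lambda>v. p i (fst v) (e v)) t \<noteq> None"
    and du: "term_val lam \<Sigma> (A i) (\<lambda>v. p i (fst v) (e v)) u \<noteq> None" if "i \<in> I" for i
    using 2(4)[OF that] unfolding fm_holds.simps by metis+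
  have "term_val lam \<Sigma> K e t \<noteq> None"
    by (rule joint_emb_term[OF K je 2(1)]) (use 2(3) dt in auto)
  moreover have "term_val lam \<Sigma> K e u \<noteq> None"
    by (rule joint_emb_term[OF K je 2(2)]) (use 2(3) du in auto)
  ultimately obtain x y where xy: "term_val lam \<Sigma> K e t = Some x" "term_val lam \<Sigma> K e u = Some y" by blast
  have "x \<in> carr K s" "y \<in> carr K s"
    by (rule term_val_typed[OF 2(1) K _ xy(1)], use 2 in simp)
       (rule term_val_typed[OF 2(2) K _ xy(2)], use 2 in simp)
  moreover have "p i s x = p i s y" if "i \<in> I" for i
    using 2(4)[OF that] term_val_hom[OF K joint_embD(1)[OF je that] 2(1) xy(1)]
      term_val_hom[OF K joint_embD(1)[OF je that] 2(2) xy(2)] by simp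
  ultimately show ?case using xy joint_embD(2)[OF je] by simp
next
  case (4 \<alpha> \<phi>)
  have "fm_holds lam \<Sigma> K e (\<phi> j)" if j: "j \<in> underS lam \<alpha>" for j
  proof -
    have "e v \<in> carr K (fst v)" if "v \<in> fm_vars lam \<Sigma> (\<phi> j)" for v
      using 4(4)[of v] that j by auto
    moreover have "fm_holds lam \<Sigma> (A i) (\<lambda>v. p i (fst v) (e v)) (\<phi> j)" if "i \<in> I" for i
      using 4(5)[OF that] j by simp
    ultimately show ?thesis using 4(3) j by blast
  qed
  then show ?case by simp
qed simp

definition ctx_map :: "('s, 'l) ctx \<Rightarrow> ('s \<Rightarrow> 'u \<Rightarrow> 'u) \<Rightarrow> ('l \<Rightarrow> 'u) \<Rightarrow> 'l \<Rightarrow> 'u" where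
  "ctx_map x h m = (\<lambda>i \<in> ctx_idx lam x. h (fst (ctx_var x i)) (m i))"

lemma ctx_env_var:
  "is_context lam \<Sigma> x \<Longrightarrow> i \<in> ctx_idx lam x \<Longrightarrow> ctx_env lam x m (ctx_var x i) = m i"
  unfolding is_context_def ctx_env_def by (simp add: inv_into_f_f)

lemma ctx_env_typed:
  "is_context lam \<Sigma> x \<Longrightarrow> m \<in> ctx_prod lam M x \<Longrightarrow> v \<in> ctx_var x ` ctx_idx lam x \<Longrightarrow>
    ctx_env lam x m v \<in> carr M (fst v)"
  by (auto simp: ctx_env_var ctx_prod_def)

lemma ctx_idx_lam: "is_context lam \<Sigma> x \<Longrightarrow> |ctx_idx lam x| <o lam"
  unfolding is_context_def ctx_idx_def using lam_underS by blast

lemma ctx_sort: "is_context lam \<Sigma> x \<Longrightarrow> i \<in> ctx_idx lam x \<Longrightarrow> fst (ctx_var x i) \<in> sorts \<Sigma>"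
  unfolding is_context_def vars_def by (auto simp: PiE_iff mem_Times_iff)

lemma ctx_map_prod: "hm M N h \<Longrightarrow> m \<in> ctx_prod lam M x \<Longrightarrow> ctx_map x h m \<in> ctx_prod lam N x"
  unfolding ctx_prod_def ctx_map_def by (auto simp: PiE_iff intro: hmD(1))

lemma ctx_env_map:
  "is_context lam \<Sigma> x \<Longrightarrow> v \<in> ctx_var x ` ctx_idx lam x \<Longrightarrow>
    ctx_env lam x (ctx_map x h m) v = h (fst v) (ctx_env lam x m v)"
  by (auto simp: ctx_env_var) (simp add: ctx_map_def)

lemma ctx_term_hom:
  assumes "ps M" "hm M N h" "term_in_ctx lam \<Sigma> x t s" "term_val lam \<Sigma> M (ctx_env lam x m) t = Some y"
  shows "term_val lam \<Sigma> N (ctx_env lam x (ctx_map x h m)) t = Some (h s y)"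
proof -
  have "term_val lam \<Sigma> N (ctx_env lam x (ctx_map x h m)) t =
      term_val lam \<Sigma> N (\<lambda>v. h (fst v) (ctx_env lam x m v)) t"
    by (rule term_val_cong) (use assms(3) in \<open>auto simp: term_in_ctx_def intro: ctx_env_map\<close>)
  then show ?thesis using term_val_hom[OF assms(1,2) _ assms(4)] assms(3) by (simp add: term_in_ctx_def)
qed

lemma ctx_term_typed:
  assumes "ps M" "term_in_ctx lam \<Sigma> x t s" "m \<in> ctx_prod lam M x"
    "term_val lam \<Sigma> M (ctx_env lam x m) t = Some y"
  shows "y \<in> carr M s"
  by (rule term_val_typed[OF _ assms(1) _ assms(4)])
    (use assms(2,3) in \<open>auto simp: term_in_ctx_def intro!: ctx_env_typed\<close>)

lemma ctx_fm_map_cong: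
  assumes "fm_in_ctx lam \<Sigma> x \<phi>"
  shows "fm_holds lam \<Sigma> N (ctx_env lam x (ctx_map x h m)) \<phi> =
    fm_holds lam \<Sigma> N (\<lambda>v. h (fst v) (ctx_env lam x m v)) \<phi>"
  by (rule fm_holds_cong) (use assms in \<open>auto simp: fm_in_ctx_def intro: ctx_env_map\<close>)

lemma ctx_fm_hom:
  assumes "ps M" "hm M N h" "fm_in_ctx lam \<Sigma> x \<phi>" "fm_holds lam \<Sigma> M (ctx_env lam x m) \<phi>"
  shows "fm_holds lam \<Sigma> N (ctx_env lam x (ctx_map x h m)) \<phi>"
  using fm_holds_hom[OF assms(1,2) _ assms(4)] assms(3) ctx_fm_map_cong[OF assms(3)]
  by (simp add: fm_in_ctx_def)

lemma ctx_term_joint: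
  assumes K: "ps K" and je: "joint_emb K I A p" and t: "term_in_ctx lam \<Sigma> x t s"
    and m: "m \<in> ctx_prod lam K x"
    and h: "\<And>i. i \<in> I \<Longrightarrow> term_val lam \<Sigma> (A i) (ctx_env lam x (ctx_map x (p i) m)) t \<noteq> None"
  shows "term_val lam \<Sigma> K (ctx_env lam x m) t \<noteq> None"
proof (rule joint_emb_term[OF K je, of _ s])
  show "raw_term lam \<Sigma> t s" using t by (simp add: term_in_ctx_def)
  show "ctx_env lam x m v \<in> carr K (fst v)" if "v \<in> term_vars lam \<Sigma> t" for v
    using that t m ctx_env_typed unfolding term_in_ctx_def by blast
  fix i assume i: "i \<in> I"
  have "term_val lam \<Sigma> (A i) (\<lambda>v. p i (fst v) (ctx_env lam x m v)) t =
      term_val lam \<Sigma> (A i) (ctx_env lam x (ctx_map x (p i) m)) t"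
    by (rule term_val_cong, rule ctx_env_map[symmetric]) (use t in \<open>auto simp: term_in_ctx_def\<close>)
  then show "term_val lam \<Sigma> (A i) (\<lambda>v. p i (fst v) (ctx_env lam x m v)) t \<noteq> None"
    using h[OF i] by simp
qed

lemma ctx_fm_joint:
  assumes K: "ps K" and je: "joint_emb K I A p" and \<phi>: "fm_in_ctx lam \<Sigma> x \<phi>"
    and m: "m \<in> ctx_prod lam K x"
    and h: "\<And>i. i \<in> I \<Longrightarrow> fm_holds lam \<Sigma> (A i) (ctx_env lam x (ctx_map x (p i) m)) \<phi>"
  shows "fm_holds lam \<Sigma> K (ctx_env lam x m) \<phi>"
proof (rule joint_emb_fm[OF K je])
  show "raw_formula lam \<Sigma> \<phi>" using \<phi> by (simp add: fm_in_ctx_def)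
  show "ctx_env lam x m v \<in> carr K (fst v)" if "v \<in> fm_vars lam \<Sigma> \<phi>" for v
    using that \<phi> m ctx_env_typed unfolding fm_in_ctx_def by blast
  show "fm_holds lam \<Sigma> (A i) (\<lambda>v. p i (fst v) (ctx_env lam x m v)) \<phi>" if "i \<in> I" for i
    using h[OF that] ctx_fm_map_cong[OF \<phi>] by simp
qed

lemma valid_inI:
  assumes "\<And>m. m \<in> ctx_prod lam M x \<Longrightarrow> fm_holds lam \<Sigma> M (ctx_env lam x m) \<phi> \<Longrightarrow>
    fm_holds lam \<Sigma> M (ctx_env lam x m) \<psi>"
  shows "valid_in lam \<Sigma> M (Sequent x \<phi> \<psi>)"
  using assms by (auto simp: fm_interp_def)

lemma valid_inD:
  assumes "valid_in lam \<Sigma> M (Sequent x \<phi> \<psi>)" "m \<in> ctx_prod lam M x"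
    "fm_holds lam \<Sigma> M (ctx_env lam x m) \<phi>"
  shows "fm_holds lam \<Sigma> M (ctx_env lam x m) \<psi>"
  using assms by (auto simp: fm_interp_def)

text \<open>The premise is pushed forward to every \<open>A i\<close>, the sequent is applied there,
  and the conclusion is reflected back to \<open>K\<close>.\<close>

lemma joint_emb_valid:
  assumes K: "ps K" and je: "joint_emb K I A p" and \<sigma>: "is_sequent lam \<Sigma> \<sigma>"
    and v: "\<And>i. i \<in> I \<Longrightarrow> valid_in lam \<Sigma> (A i) \<sigma>"
  shows "valid_in lam \<Sigma> K \<sigma>"
proof (cases \<sigma>)
  case (Sequent x \<phi> \<psi>)
  show ?thesis unfolding Sequent
  proof (rule valid_inI)
    fix m assume m: "m \<in> ctx_prod lam K x" and \<phi>: "fm_holds lam \<Sigma> K (ctx_env lam x m) \<phi>"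
    have fc: "fm_in_ctx lam \<Sigma> x \<phi>" "fm_in_ctx lam \<Sigma> x \<psi>" using \<sigma> Sequent by auto
    show "fm_holds lam \<Sigma> K (ctx_env lam x m) \<psi>"
    proof (rule ctx_fm_joint[OF K je fc(2) m])
      fix i assume i: "i \<in> I"
      note hi = joint_embD(1)[OF je i]
      show "fm_holds lam \<Sigma> (A i) (ctx_env lam x (ctx_map x (p i) m)) \<psi>"
        by (rule valid_inD[OF v[OF i, unfolded Sequent] ctx_map_prod[OF hi m] ctx_fm_hom[OF K hi fc(1) \<phi>]])
    qed
  qed
qed

text \<open>\<open>K\<close> carries the initial structure for the maps \<open>p i\<close>, so the
  homomorphism property of a map into \<open>K\<close> can be tested after composing with
  them.\<close>

lemma hm_into_joint_emb:
  assumes "joint_emb K I A p" "ps K" "ps M"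
    and h: "\<And>s. h s \<in> carr M s \<rightarrow>\<^sub>E carr K s"
    and c: "\<And>i. i \<in> I \<Longrightarrow> hm M (A i) (hcomp M (p i) h)"
  shows "hm M K h"
  unfolding is_homomorphism_def
proof (intro conjI allI ballI impI)
  fix f a y assume f: "f \<in> funs \<Sigma>" and a: "a \<in> fun_args lam \<Sigma> M f" and y: "fint M f a = Some y"
  let ?b = "fun_tuple lam \<Sigma> f h a"
  have b: "?b \<in> fun_args lam \<Sigma> K f" using a h by (auto simp: fun_args_def fun_tuple_def PiE_iff)
  have *: "fint (A i) f (fun_tuple lam \<Sigma> f (p i) ?b) = Some (p i (fun_cod \<Sigma> f) (h (fun_cod \<Sigma> f) y))"
    if "i \<in> I" for i
    using hmD(2)[OF c[OF that] assms(3) f y] hcomp_tuples(1)[OF a] fintD(2)[OF assms(3) f y]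
    by (simp add: hcomp_def)
  then have "fint K f ?b \<noteq> None" using joint_embD(3)[OF assms(1) f b] by blast
  then obtain z where z: "fint K f ?b = Some z" by blast
  have "z = h (fun_cod \<Sigma> f) y"
  proof (rule joint_embD(2)[OF assms(1)])
    show "z \<in> carr K (fun_cod \<Sigma> f)" using fintD(2)[OF assms(2) f z] .
    show "h (fun_cod \<Sigma> f) y \<in> carr K (fun_cod \<Sigma> f)" using h fintD(2)[OF assms(3) f y] by blast
    show "p i (fun_cod \<Sigma> f) z = p i (fun_cod \<Sigma> f) (h (fun_cod \<Sigma> f) y)" if "i \<in> I" for i
      using *[OF that] hmD(2)[OF joint_embD(1)[OF assms(1) that] assms(2) f z] by simp
  qed
  then show "fint K f ?b = Some (h (fun_cod \<Sigma> f) y)" using z by simp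
next
  fix R a assume R: "R \<in> rels \<Sigma>" and a: "a \<in> rel_args lam \<Sigma> M R" "a \<in> rint M R"
  let ?b = "rel_tuple lam \<Sigma> R h a"
  have b: "?b \<in> rel_args lam \<Sigma> K R" using a h by (auto simp: rel_args_def rel_tuple_def PiE_iff)
  have "rel_tuple lam \<Sigma> R (p i) ?b \<in> rint (A i) R" if "i \<in> I" for i
    using hmD(3)[OF c[OF that] assms(3) R a(2)] hcomp_tuples(2)[OF a(1)] by simp
  then show "?b \<in> rint K R" using joint_embD(4)[OF assms(1) R b] by blast
qed (use h in blast)

text \<open>The common source of products, kernel pairs, generic structures and the cover of a
  filtered colimit. Only the chosen set \<open>Z\<close> of families has to be small, not the index
  set \<open>I\<close>. A function is made defined exactly where it is defined in all coordinates,
  and a relation holds exactly where it holds in all coordinates; this is the largest structure for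
  which the coordinates are homomorphisms.\<close>

lemma joint_struct_exists:
  fixes A :: "'i \<Rightarrow> ('s, 'f, 'r, 'l, 'u) pstruct" and Z :: "'s \<Rightarrow> ('i \<Rightarrow> 'u) set"
  assumes A: "\<And>i. i \<in> I \<Longrightarrow> ps (A i)"
    and Z: "\<And>s. s \<in> sorts \<Sigma> \<Longrightarrow> Z s \<subseteq> (\<Pi>\<^sub>E i \<in> I. carr (A i) s)"
    and small: "\<And>s. s \<in> sorts \<Sigma> \<Longrightarrow> |Z s| <o \<kappa>"
    and closed: "\<And>f z. f \<in> funs \<Sigma> \<Longrightarrow> (\<And>j. j \<in> fun_idx lam \<Sigma> f \<Longrightarrow> z j \<in> Z (fun_dom \<Sigma> f j)) \<Longrightarrow>
      (\<And>i. i \<in> I \<Longrightarrow> fint (A i) f (\<lambda>j \<in> fun_idx lam \<Sigma> f. z j i) \<noteq> None) \<Longrightarrow>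
      (\<lambda>i \<in> I. the (fint (A i) f (\<lambda>j \<in> fun_idx lam \<Sigma> f. z j i))) \<in> Z (fun_cod \<Sigma> f)"
  obtains K p where "ps K" "joint_emb K I A p"
    "\<And>s z. s \<in> sorts \<Sigma> \<Longrightarrow> z \<in> Z s \<Longrightarrow> \<exists>y \<in> carr K s. \<forall>i \<in> I. p i s y = z i"
    "\<And>s y. y \<in> carr K s \<Longrightarrow> (\<lambda>i \<in> I. p i s y) \<in> Z s"
proof -
  have "\<forall>s. \<exists>enc :: ('i \<Rightarrow> 'u) \<Rightarrow> 'u. s \<in> sorts \<Sigma> \<longrightarrow> inj_on enc (Z s)"
    using small_encode[OF small] by blast
  then obtain enc :: "'s \<Rightarrow> ('i \<Rightarrow> 'u) \<Rightarrow> 'u" where enc: "\<And>s. s \<in> sorts \<Sigma> \<Longrightarrow> inj_on (enc s) (Z s)"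
    by metis
  \<comment> \<open>Families are not elements of \<open>'u\<close>, so the carrier consists of their
    codes, with a separate code for each sort.\<close>
  define C where "C s = (if s \<in> sorts \<Sigma> then enc s ` Z s else {})" for s
  define dec where "dec s = inv_into (Z s) (enc s)" for s
  define p where "p i s = (\<lambda>u \<in> C s. dec s u i)" for i s
  have dec: "dec s u \<in> Z s" "enc s (dec s u) = u" "s \<in> sorts \<Sigma>" if "u \<in> C s" for s u
    using that by (auto simp: C_def dec_def inv_into_into f_inv_into_f split: if_splits)
  have encdec: "enc s z \<in> C s" "dec s (enc s z) = z" if "s \<in> sorts \<Sigma>" "z \<in> Z s" for s z
    using that enc by (auto simp: C_def dec_def)
  have pC: "p i s u \<in> carr (A i) s" if "u \<in> C s" "i \<in> I" for i s u
    using dec[OF that(1)] Z[of s] that by (auto simp: p_def)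
  have dec_p: "(\<lambda>i \<in> I. p i s u) = dec s u" if "u \<in> C s" for s u
    using dec[OF that] Z[of s] that by (auto simp: p_def PiE_iff extensional_def intro!: ext)
  \<comment> \<open>Functions act coordinatewise; the resulting family lies in \<open>Z\<close> by
    \<open>closed\<close> and is then encoded.\<close>
  define val where "val f a = enc (fun_cod \<Sigma> f) (\<lambda>i \<in> I. the (fint (A i) f (fun_tuple lam \<Sigma> f (p i) a)))"
    for f a
  define K :: "('s, 'f, 'r, 'l, 'u) pstruct" where "K = \<lparr> carr = C,
    fint = (\<lambda>f a. if f \<in> funs \<Sigma> \<and> a \<in> (\<Pi>\<^sub>E i \<in> fun_idx lam \<Sigma> f. C (fun_dom \<Sigma> f i)) \<and>
        (\<forall>i \<in> I. fint (A i) f (fun_tuple lam \<Sigma> f (p i) a) \<noteq> None) then Some (val f a) else None),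
    rint = (\<lambda>R. if R \<in> rels \<Sigma> then {a \<in> (\<Pi>\<^sub>E i \<in> rel_idx lam \<Sigma> R. C (rel_dom \<Sigma> R i)).
        \<forall>i \<in> I. rel_tuple lam \<Sigma> R (p i) a \<in> rint (A i) R} else {}) \<rparr>"
  have K[simp]: "carr K = C" by (simp add: K_def)
  have valZ: "(\<lambda>i \<in> I. the (fint (A i) f (fun_tuple lam \<Sigma> f (p i) a))) \<in> Z (fun_cod \<Sigma> f)"
    if f: "f \<in> funs \<Sigma>" and a: "a \<in> (\<Pi>\<^sub>E i \<in> fun_idx lam \<Sigma> f. C (fun_dom \<Sigma> f i))"
      and d: "\<And>i. i \<in> I \<Longrightarrow> fint (A i) f (fun_tuple lam \<Sigma> f (p i) a) \<noteq> None" for f a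
  proof -
    have *: "fun_tuple lam \<Sigma> f (p i) a = (\<lambda>j \<in> fun_idx lam \<Sigma> f. dec (fun_dom \<Sigma> f j) (a j) i)" for i
      using a by (auto simp: fun_tuple_def p_def PiE_iff intro!: ext)
    show ?thesis unfolding *
      by (rule closed[OF f]) (use a d dec(1) * in \<open>auto simp: PiE_iff\<close>)
  qed
  have valC: "val f a \<in> C (fun_cod \<Sigma> f)"
    if "f \<in> funs \<Sigma>" "a \<in> (\<Pi>\<^sub>E i \<in> fun_idx lam \<Sigma> f. C (fun_dom \<Sigma> f i))"
      "\<forall>i \<in> I. fint (A i) f (fun_tuple lam \<Sigma> f (p i) a) \<noteq> None" for f a
    using encdec(1)[OF fun_sorts(1) valZ] that unfolding val_def by blast
  have smallC: "|C s| <o \<kappa>" if "s \<in> sorts \<Sigma>" for s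
    using small_image[OF small[OF that]] that by (simp add: C_def)
  have outC: "C s = {}" if "s \<notin> sorts \<Sigma>" for s using that by (simp add: C_def)
  have psK: "ps K"
    unfolding is_pstruct_def
  proof (intro conjI ballI allI impI)
    fix f a y assume "f \<in> funs \<Sigma>" "fint K f a = Some y"
    then show "a \<in> fun_args lam \<Sigma> K f" "y \<in> carr K (fun_cod \<Sigma> f)"
      using valC[of f a] by (auto simp: K_def fun_args_def split: if_splits)
  qed (simp_all add: smallC outC, auto simp: K_def rel_args_def)
  moreover have "joint_emb K I A p"
    unfolding joint_emb_def
  proof (intro conjI ballI allI impI)
    fix i assume i: "i \<in> I"
    show "hm K (A i) (p i)"
      unfolding is_homomorphism_def
    proof (intro conjI allI ballI impI)
      show "p i s \<in> carr K s \<rightarrow>\<^sub>E carr (A i) s" for s using pC i by (auto simp: p_def)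
    next
      fix f a y assume f: "f \<in> funs \<Sigma>" and a: "a \<in> fun_args lam \<Sigma> K f" and y: "fint K f a = Some y"
      have a': "a \<in> (\<Pi>\<^sub>E i \<in> fun_idx lam \<Sigma> f. C (fun_dom \<Sigma> f i))"
        and d: "\<And>i. i \<in> I \<Longrightarrow> fint (A i) f (fun_tuple lam \<Sigma> f (p i) a) \<noteq> None" and yv: "y = val f a"
        using y by (auto simp: K_def split: if_splits)
      have "p i (fun_cod \<Sigma> f) y = the (fint (A i) f (fun_tuple lam \<Sigma> f (p i) a))"
        using encdec[OF fun_sorts(1)[OF f] valZ[OF f a' d]] i by (simp add: yv val_def p_def)
      then show "fint (A i) f (fun_tuple lam \<Sigma> f (p i) a) = Some (p i (fun_cod \<Sigma> f) y)"
        using d[OF i] by auto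
    next
      show "rel_tuple lam \<Sigma> R (p i) a \<in> rint (A i) R" if "R \<in> rels \<Sigma>" "a \<in> rint K R" for R a
        using that i by (simp add: K_def)
    qed
  next
    fix s x y assume xy: "x \<in> carr K s" "y \<in> carr K s" and eq: "\<forall>i \<in> I. p i s x = p i s y"
    have "(\<lambda>i \<in> I. p i s x) = (\<lambda>i \<in> I. p i s y)" using eq by auto
    then have "dec s x = dec s y" using xy dec_p by simp
    then show "x = y" using xy dec(2) by (metis K)
  next
    fix f a assume "f \<in> funs \<Sigma>" "a \<in> fun_args lam \<Sigma> K f"
      "\<forall>i \<in> I. fint (A i) f (fun_tuple lam \<Sigma> f (p i) a) \<noteq> None"
    then show "fint K f a \<noteq> None" by (simp add: K_def fun_args_def)
  next
    fix R a assume "R \<in> rels \<Sigma>" "a \<in> rel_args lam \<Sigma> K R"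
      "\<forall>i \<in> I. rel_tuple lam \<Sigma> R (p i) a \<in> rint (A i) R"
    then show "a \<in> rint K R" by (simp add: K_def rel_args_def)
  qed
  moreover have "\<exists>y \<in> carr K s. \<forall>i \<in> I. p i s y = z i" if "s \<in> sorts \<Sigma>" "z \<in> Z s" for s z
    using encdec[OF that] by (auto simp: p_def intro!: bexI[of _ "enc s z"])
  moreover have "(\<lambda>i \<in> I. p i s y) \<in> Z s" if "y \<in> carr K s" for s y
    using that dec_p dec(1) by simp
  ultimately show thesis using that by blast
qed

end

section \<open>Products, monomorphisms and closed subobjects\<close>

context structures
begin

abbreviation model :: "('s, 'f, 'r, 'l) sequent set \<Rightarrow> ('s, 'f, 'r, 'l, 'u) pstruct \<Rightarrow> bool" where
  "model T M \<equiv> is_model \<kappa> lam \<Sigma> T M"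

abbreviation Mod :: "('s, 'f, 'r, 'l) sequent set \<Rightarrow>
    (('s, 'f, 'r, 'l, 'u) pstruct, ('s, 'f, 'r, 'l, 'u) arrow) category" where
  "Mod T \<equiv> PMod \<kappa> lam \<Sigma> T"

definition hid :: "('s, 'f, 'r, 'l, 'u) pstruct \<Rightarrow> 's \<Rightarrow> 'u \<Rightarrow> 'u" where
  "hid M = (\<lambda>s. \<lambda>a \<in> carr M s. a)"

lemma model_ps: "model T M \<Longrightarrow> ps M"
  unfolding is_model_def by simp

lemma Mod_simps:
  "Obj (Mod T) = {M. model T M}"
  "Arrow M h N \<in> Arr (Mod T) \<longleftrightarrow> model T M \<and> model T N \<and> hm M N h"
  "Dom (Mod T) = source" "Cod (Mod T) = target"
  "Id (Mod T) M = Arrow M (hid M) M"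
  "Comp (Mod T) (Arrow N' g Q) (Arrow M h N) = Arrow M (hcomp M g h) Q"
  by (simp_all add: PMod_def hid_def hcomp_def)

lemma Mod_hom: "Arrow M' h N' \<in> Defs.hom (Mod T) M N \<longleftrightarrow>
    M' = M \<and> N' = N \<and> model T M \<and> model T N \<and> hm M N h"
  by (auto simp: Defs.hom_def Mod_simps)

lemma Mod_homE:
  assumes "f \<in> Defs.hom (Mod T) M N"
  obtains h where "f = Arrow M h N" "model T M" "model T N" "hm M N h"
  using assms by (cases f) (auto simp: Mod_hom)

lemma maps_Comp: "maps (Comp (Mod T) g f) = hcomp (source f) (maps g) (maps f)"
  by (cases g; cases f) (simp add: Mod_simps)

lemma Mod_homD:
  assumes "f \<in> Defs.hom (Mod T) M N"
  shows "f = Arrow M (maps f) N" "source f = M" "target f = N" "model T M" "model T N" "hm M N (maps f)"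
  using assms by (auto elim!: Mod_homE)

lemma hcomp_eqI:
  assumes "\<And>s y. y \<in> carr M s \<Longrightarrow> g s (h s y) = g' s (h' s y)"
  shows "hcomp M g h = hcomp M g' h'"
  using assms by (auto simp: hcomp_def intro!: ext)

lemma hcomp_eqD: "hcomp M g h = k \<Longrightarrow> y \<in> carr M s \<Longrightarrow> g s (h s y) = k s y"
  by (auto simp: hcomp_def)

lemma hcomp_eq_iff:
  assumes "hm M Q k"
  shows "hcomp M g h = k \<longleftrightarrow> (\<forall>s. \<forall>y \<in> carr M s. g s (h s y) = k s y)"
  using hmD(4)[OF assms] by (fastforce simp: hcomp_def extensional_def)

lemma hid_eq_iff: "hcomp M g h = hid M \<longleftrightarrow> (\<forall>s. \<forall>y \<in> carr M s. g s (h s y) = y)"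
  by (auto simp: hcomp_def hid_def fun_eq_iff)

lemma hid_hm: "ps M \<Longrightarrow> hm M M (hid M)"
  unfolding hid_def by (rule hm_id)

lemma joint_emb_model:
  assumes "is_horn_theory lam \<Sigma> T" "ps K" "joint_emb K I A p" "\<And>i. i \<in> I \<Longrightarrow> model T (A i)"
  shows "model T K"
  using joint_emb_valid[OF assms(2,3)] assms(1,2,4) unfolding is_model_def is_horn_theory_def by blast

text \<open>Since \<open>K\<close> has the initial structure, a pointwise choice of elements with
  the prescribed coordinates is automatically a homomorphism.\<close>

lemma joint_emb_lift:
  assumes K: "ps K" "joint_emb K I A p" and M: "ps M" and g: "\<And>i. i \<in> I \<Longrightarrow> hm M (A i) (g i)"
    and ex: "\<And>s y. y \<in> carr M s \<Longrightarrow> \<exists>w \<in> carr K s. \<forall>i \<in> I. p i s w = g i s y"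
  obtains u where "hm M K u" "\<And>i s y. i \<in> I \<Longrightarrow> y \<in> carr M s \<Longrightarrow> p i s (u s y) = g i s y"
proof -
  define u where "u s = (\<lambda>y \<in> carr M s. SOME w. w \<in> carr K s \<and> (\<forall>i \<in> I. p i s w = g i s y))" for s
  have u: "u s y \<in> carr K s \<and> (\<forall>i \<in> I. p i s (u s y) = g i s y)" if "y \<in> carr M s" for s y
    using someI_ex[of "\<lambda>w. w \<in> carr K s \<and> (\<forall>i \<in> I. p i s w = g i s y)"] ex[OF that] that
    by (auto simp: u_def)
  have "hm M K u"
  proof (rule hm_into_joint_emb[OF K(2,1) M])
    show "u s \<in> carr M s \<rightarrow>\<^sub>E carr K s" for s using u by (auto simp: u_def)
    fix i assume i: "i \<in> I"
    have "hcomp M (p i) u = g i" using hcomp_eq_iff[OF g[OF i]] u i by blast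
    then show "hm M (A i) (hcomp M (p i) u)" using g[OF i] by simp
  qed
  then show thesis using that u by blast
qed

text \<open>There is only a \<open>\<kappa>\<close>-small set of possible failures in
  \<open>K\<close>: a pair of distinct elements, an undefined application, a tuple outside a
  relation. One index that detects each of them is enough.\<close>

lemma joint_emb_subfamily:
  assumes K: "ps K" and je: "joint_emb K I A p"
  obtains I0 where "I0 \<subseteq> I" "|I0| <o \<kappa>" "joint_emb K I0 A p"
proof -
  have sig_small: "|sorts \<Sigma>| <o \<kappa>" "|funs \<Sigma>| <o \<kappa>" "|rels \<Sigma>| <o \<kappa>"
    using sgn unfolding is_signature_def by auto
  have carr_small: "|carr K s| <o \<kappa>" for s
  proof (cases "s \<in> sorts \<Sigma>")
    case False
    then have "carr K s = {}" using K unfolding is_pstruct_def by auto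
    then show ?thesis using small_finite[of "{}"] by simp
  qed (use K in \<open>auto simp: is_pstruct_def\<close>)
  let ?W1 = "Sigma (sorts \<Sigma>) (\<lambda>s. carr K s \<times> carr K s)"
  let ?W2 = "Sigma (funs \<Sigma>) (fun_args lam \<Sigma> K)"
  let ?W3 = "Sigma (rels \<Sigma>) (rel_args lam \<Sigma> K)"
  have W: "|?W1| <o \<kappa>" "|?W2| <o \<kappa>" "|?W3| <o \<kappa>"
    unfolding fun_args_def rel_args_def
    by (intro small_Sigma small_PiE sig_small carr_small small_lam fun_idx_lam; assumption)+
  define w1 where "w1 = (\<lambda>(s, x, y). SOME i. i \<in> I \<and> p i s x \<noteq> p i s y)"
  define w2 where "w2 = (\<lambda>(f, a). SOME i. i \<in> I \<and> fint (A i) f (fun_tuple lam \<Sigma> f (p i) a) = None)"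
  define w3 where "w3 = (\<lambda>(R, a). SOME i. i \<in> I \<and> rel_tuple lam \<Sigma> R (p i) a \<notin> rint (A i) R)"
  \<comment> \<open>Where there is no failure, \<open>SOME\<close> may pick something outside
    \<open>I\<close>; the intersection discards it.\<close>
  define I0 where "I0 = I \<inter> (w1 ` ?W1 \<union> w2 ` ?W2 \<union> w3 ` ?W3)"
  have "|w1 ` ?W1 \<union> w2 ` ?W2 \<union> w3 ` ?W3| <o \<kappa>" by (intro small_Un small_image W)
  then have small: "|I0| <o \<kappa>" by (rule small_subset[rotated]) (simp add: I0_def)
  have "joint_emb K I0 A p"
    unfolding joint_emb_def
  proof (intro conjI ballI allI impI)
    show "hm K (A i) (p i)" if "i \<in> I0" for i using joint_embD(1)[OF je] that by (simp add: I0_def)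
  next
    fix s x y assume xy: "x \<in> carr K s" "y \<in> carr K s" and eq: "\<forall>i \<in> I0. p i s x = p i s y"
    show "x = y"
    proof (rule ccontr)
      assume "x \<noteq> y"
      then have "\<exists>i. i \<in> I \<and> p i s x \<noteq> p i s y" using joint_embD(2)[OF je xy] by blast
      from someI_ex[OF this] have "w1 (s, x, y) \<in> I" "p (w1 (s, x, y)) s x \<noteq> p (w1 (s, x, y)) s y"
        by (auto simp: w1_def)
      moreover have "(s, x, y) \<in> ?W1" using xy carr_sort[OF K] by auto
      ultimately show False using eq unfolding I0_def by blast
    qed
  next
    fix f a assume f: "f \<in> funs \<Sigma>" "a \<in> fun_args lam \<Sigma> K f"
      and eq: "\<forall>i \<in> I0. fint (A i) f (fun_tuple lam \<Sigma> f (p i) a) \<noteq> None"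
    show "fint K f a \<noteq> None"
    proof (rule joint_embD(3)[OF je f], rule ccontr)
      fix i assume "i \<in> I" "\<not> fint (A i) f (fun_tuple lam \<Sigma> f (p i) a) \<noteq> None"
      then have "\<exists>i. i \<in> I \<and> fint (A i) f (fun_tuple lam \<Sigma> f (p i) a) = None"
        by (intro exI[of _ i]) simp
      from someI_ex[OF this] have "w2 (f, a) \<in> I"
        "fint (A (w2 (f, a))) f (fun_tuple lam \<Sigma> f (p (w2 (f, a))) a) = None"
        by (auto simp: w2_def)
      moreover have "(f, a) \<in> ?W2" using f by auto
      ultimately show False using eq unfolding I0_def by blast
    qed
  next
    fix R a assume R: "R \<in> rels \<Sigma>" "a \<in> rel_args lam \<Sigma> K R"
      and eq: "\<forall>i \<in> I0. rel_tuple lam \<Sigma> R (p i) a \<in> rint (A i) R"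
    show "a \<in> rint K R"
    proof (rule joint_embD(4)[OF je R], rule ccontr)
      fix i assume "i \<in> I" "rel_tuple lam \<Sigma> R (p i) a \<notin> rint (A i) R"
      then have "\<exists>i. i \<in> I \<and> rel_tuple lam \<Sigma> R (p i) a \<notin> rint (A i) R" by blast
      from someI_ex[OF this] have "w3 (R, a) \<in> I"
        "rel_tuple lam \<Sigma> R (p (w3 (R, a))) a \<notin> rint (A (w3 (R, a))) R"
        by (auto simp: w3_def)
      moreover have "(R, a) \<in> ?W3" using R by auto
      ultimately show False using eq unfolding I0_def by blast
    qed
  qed
  then show thesis using that[of I0] small by (auto simp: I0_def)
qed

text \<open>The instance of \<open>joint_struct_exists\<close> in which \<open>Z\<close> consists of
  all families. Being jointly embedded in models, the result is again a model.\<close>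

lemma product_exists:
  assumes T: "is_horn_theory lam \<Sigma> T" and I: "|I| <o \<kappa>" and A: "\<And>i. i \<in> I \<Longrightarrow> model T (A i)"
  obtains P p where "model T P" "joint_emb P I A p"
    "is_product (Mod T) I A P (\<lambda>i. Arrow P (p i) (A i))"
    "\<And>s z. s \<in> sorts \<Sigma> \<Longrightarrow> z \<in> (\<Pi>\<^sub>E i \<in> I. carr (A i) s) \<Longrightarrow> \<exists>y \<in> carr P s. \<forall>i \<in> I. p i s y = z i"
proof -
  have psA: "ps (A i)" if "i \<in> I" for i using A[OF that] by (rule model_ps)
  have small: "|\<Pi>\<^sub>E i \<in> I. carr (A i) s| <o \<kappa>" if "s \<in> sorts \<Sigma>" for s
    by (rule small_PiE[OF I]) (use psA that in \<open>auto simp: is_pstruct_def\<close>)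
  have closed: "(\<lambda>i \<in> I. the (fint (A i) f (\<lambda>j \<in> fun_idx lam \<Sigma> f. z j i))) \<in> (\<Pi>\<^sub>E i \<in> I. carr (A i) (fun_cod \<Sigma> f))"
    if f: "f \<in> funs \<Sigma>" and d: "\<And>i. i \<in> I \<Longrightarrow> fint (A i) f (\<lambda>j \<in> fun_idx lam \<Sigma> f. z j i) \<noteq> None"
    for f and z :: "'l \<Rightarrow> 'a \<Rightarrow> 'u"
    using d fintD(2)[OF psA f] by fastforce
  obtain P p where P: "ps P" "joint_emb P I A p"
    and sur: "\<And>s z. s \<in> sorts \<Sigma> \<Longrightarrow> z \<in> (\<Pi>\<^sub>E i \<in> I. carr (A i) s) \<Longrightarrow> \<exists>y \<in> carr P s. \<forall>i \<in> I. p i s y = z i"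
    by (rule joint_struct_exists[of I A "\<lambda>s. \<Pi>\<^sub>E i \<in> I. carr (A i) s"])
      (use psA small closed in auto)
  have mP: "model T P" by (rule joint_emb_model[OF T P A])
  have "is_product (Mod T) I A P (\<lambda>i. Arrow P (p i) (A i))"
    unfolding is_product_def
  proof (intro conjI ballI allI impI)
    show "P \<in> Obj (Mod T)" using mP by (simp add: Mod_simps)
    show "Arrow P (p i) (A i) \<in> Defs.hom (Mod T) P (A i)" if "i \<in> I" for i
      using that mP A joint_embD(1)[OF P(2)] by (simp add: Mod_hom)
  next
    fix Y g assume Y: "Y \<in> Obj (Mod T)" and g: "\<forall>i \<in> I. g i \<in> Defs.hom (Mod T) Y (A i)"
    have mY: "model T Y" using Y by (simp add: Mod_simps)
    have g': "g i = Arrow Y (maps (g i)) (A i)" "hm Y (A i) (maps (g i))" if "i \<in> I" for i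
      using g that by (auto elim!: Mod_homE)
    have ex: "\<exists>w \<in> carr P s. \<forall>i \<in> I. p i s w = maps (g i) s y" if y: "y \<in> carr Y s" for s y
    proof -
      have "(\<lambda>i \<in> I. maps (g i) s y) \<in> (\<Pi>\<^sub>E i \<in> I. carr (A i) s)" using hmD(1)[OF g'(2) y] by auto
      from sur[OF carr_sort[OF model_ps[OF mY] y] this] show ?thesis by auto
    qed
    obtain u where u: "hm Y P u" "\<And>i s y. i \<in> I \<Longrightarrow> y \<in> carr Y s \<Longrightarrow> p i s (u s y) = maps (g i) s y"
      using joint_emb_lift[OF P model_ps[OF mY] g'(2) ex] by metis
    show "\<exists>!u. u \<in> Defs.hom (Mod T) Y P \<and> (\<forall>i \<in> I. Comp (Mod T) (Arrow P (p i) (A i)) u = g i)"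
    proof (rule ex1I[of _ "Arrow Y u P"], intro conjI ballI)
      show "Arrow Y u P \<in> Defs.hom (Mod T) Y P" using u mY mP by (simp add: Mod_hom)
      fix i assume i: "i \<in> I"
      have "hcomp Y (p i) u = maps (g i)" using hcomp_eq_iff[OF g'(2)[OF i]] u(2)[OF i] by blast
      then show "Comp (Mod T) (Arrow P (p i) (A i)) (Arrow Y u P) = g i"
        using g'(1)[OF i] by (simp add: Mod_simps)
    next
      fix w assume w: "w \<in> Defs.hom (Mod T) Y P \<and> (\<forall>i \<in> I. Comp (Mod T) (Arrow P (p i) (A i)) w = g i)"
      then obtain w' where w': "w = Arrow Y w' P" "hm Y P w'" by (auto elim: Mod_homE)
      have "w' = u"
      proof (rule hm_ext[OF w'(2) u(1)])
        fix s y assume y: "y \<in> carr Y s"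
        show "w' s y = u s y"
        proof (rule joint_embD(2)[OF P(2)])
          show "w' s y \<in> carr P s" "u s y \<in> carr P s" using hmD(1) w'(2) u(1) y by blast+
          fix i assume i: "i \<in> I"
          have "hcomp Y (p i) w' = maps (g i)"
            using w i w'(1) maps_Comp[of T "Arrow P (p i) (A i)" w] by simp
          then show "p i s (w' s y) = p i s (u s y)" using hcomp_eqD[OF _ y] u(2)[OF i y] by metis
        qed
      qed
      then show "w = Arrow Y u P" using w' by simp
    qed
  qed
  then show thesis using that mP P(2) sur by blast
qed

text \<open>A tuple of \<open>P\<close> is tested after applying \<open>v\<close>, where
  \<open>Q\<close> reflects, and the answer is carried back by \<open>u\<close>. This transfers the
  elementwise description of a constructed object to any object with the same universal property,
  and only one of the two composites has to be an identity.\<close>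

lemma joint_emb_retract:
  assumes Q: "ps Q" "joint_emb Q I A q" and P: "ps P" and v: "hm P Q v" and u: "hm Q P u"
    and uv: "\<And>s x. x \<in> carr P s \<Longrightarrow> u s (v s x) = x"
    and \<pi>: "\<And>i. i \<in> I \<Longrightarrow> hm P (A i) (\<pi> i)" "\<And>i s x. i \<in> I \<Longrightarrow> x \<in> carr P s \<Longrightarrow> q i s (v s x) = \<pi> i s x"
  shows "joint_emb P I A \<pi>"
  unfolding joint_emb_def
proof (intro conjI ballI allI impI)
  fix s x y assume xy: "x \<in> carr P s" "y \<in> carr P s" and eq: "\<forall>i \<in> I. \<pi> i s x = \<pi> i s y"
  have "v s x = v s y"
    by (rule joint_embD(2)[OF Q(2)]) (use hmD(1)[OF v] xy eq \<pi>(2) in auto)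
  then show "x = y" using uv xy by metis
next
  fix f a assume f: "f \<in> funs \<Sigma>" and a: "a \<in> fun_args lam \<Sigma> P f"
    and d: "\<forall>i \<in> I. fint (A i) f (fun_tuple lam \<Sigma> f (\<pi> i) a) \<noteq> None"
  let ?b = "fun_tuple lam \<Sigma> f v a"
  have "fun_tuple lam \<Sigma> f (q i) ?b = fun_tuple lam \<Sigma> f (\<pi> i) a" if "i \<in> I" for i
    using a \<pi>(2)[OF that] by (auto simp: fun_tuple_def fun_args_def PiE_iff intro!: ext)
  then have "fint Q f ?b \<noteq> None"
    using joint_embD(3)[OF Q(2) f fun_tuple_args[OF v a]] d by simp
  then obtain z where "fint Q f ?b = Some z" by blast
  from hmD(2)[OF u Q(1) f this] have "fint P f (fun_tuple lam \<Sigma> f u ?b) \<noteq> None" by simp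
  moreover have "fun_tuple lam \<Sigma> f u ?b = a"
    using a uv by (auto simp: fun_tuple_def fun_args_def PiE_iff extensional_def intro!: ext)
  ultimately show "fint P f a \<noteq> None" by simp
next
  fix R a assume R: "R \<in> rels \<Sigma>" and a: "a \<in> rel_args lam \<Sigma> P R"
    and d: "\<forall>i \<in> I. rel_tuple lam \<Sigma> R (\<pi> i) a \<in> rint (A i) R"
  let ?b = "rel_tuple lam \<Sigma> R v a"
  have "rel_tuple lam \<Sigma> R (q i) ?b = rel_tuple lam \<Sigma> R (\<pi> i) a" if "i \<in> I" for i
    using a \<pi>(2)[OF that] by (auto simp: rel_tuple_def rel_args_def PiE_iff intro!: ext)
  then have "?b \<in> rint Q R"
    using joint_embD(4)[OF Q(2) R rel_tuple_args[OF v a]] d by simp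
  from hmD(3)[OF u Q(1) R this] have "rel_tuple lam \<Sigma> R u ?b \<in> rint P R" .
  moreover have "rel_tuple lam \<Sigma> R u ?b = a"
    using a uv by (auto simp: rel_tuple_def rel_args_def PiE_iff extensional_def intro!: ext)
  ultimately show "a \<in> rint P R" by simp
qed (use \<pi> in blast)

lemma is_productD:
  assumes "is_product C I A P \<pi>"
  shows "P \<in> Obj C" "i \<in> I \<Longrightarrow> \<pi> i \<in> Defs.hom C P (A i)"
    and "Y \<in> Obj C \<Longrightarrow> (\<And>i. i \<in> I \<Longrightarrow> g i \<in> Defs.hom C Y (A i)) \<Longrightarrow>
      \<exists>!u. u \<in> Defs.hom C Y P \<and> (\<forall>i \<in> I. Comp C (\<pi> i) u = g i)"
  using assms unfolding is_product_def by simp_all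

text \<open>An abstract product is compared with the constructed one; the universal properties give
  maps in both directions, and \<open>joint_emb_retract\<close> applies.\<close>

lemma is_product_joint_emb:
  assumes T: "is_horn_theory lam \<Sigma> T" and I: "|I| <o \<kappa>" and prod: "is_product (Mod T) I A P \<pi>"
  shows "joint_emb P I A (\<lambda>i. maps (\<pi> i))"
proof -
  have \<pi>: "\<pi> i = Arrow P (maps (\<pi> i)) (A i)" "hm P (A i) (maps (\<pi> i))" "model T (A i)"
    if "i \<in> I" for i
    using prod that unfolding is_product_def by (auto elim!: Mod_homE)
  have mP: "model T P" using prod unfolding is_product_def by (simp add: Mod_simps)
  obtain Q q where Q: "model T Q" "joint_emb Q I A q" "is_product (Mod T) I A Q (\<lambda>i. Arrow Q (q i) (A i))"
    by (rule product_exists[OF T I, of A]) (erule \<pi>(3), rule that)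
  have "\<exists>!v. v \<in> Defs.hom (Mod T) P Q \<and> (\<forall>i \<in> I. Comp (Mod T) (Arrow Q (q i) (A i)) v = \<pi> i)"
    by (rule is_productD(3)[OF Q(3)]) (simp_all add: is_productD[OF prod])
  then obtain v0 where v0: "v0 \<in> Defs.hom (Mod T) P Q"
    "\<And>i. i \<in> I \<Longrightarrow> Comp (Mod T) (Arrow Q (q i) (A i)) v0 = \<pi> i" by blast
  define v where "v = maps v0"
  have v: "hm P Q v" "\<And>i. i \<in> I \<Longrightarrow> hcomp P (q i) v = maps (\<pi> i)"
    using Mod_homD(2,6)[OF v0(1)] arg_cong[OF v0(2), of _ maps] by (simp_all add: v_def maps_Comp)
  have "\<exists>!u. u \<in> Defs.hom (Mod T) Q P \<and> (\<forall>i \<in> I. Comp (Mod T) (\<pi> i) u = Arrow Q (q i) (A i))"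
    by (rule is_productD(3)[OF prod]) (simp_all add: is_productD[OF Q(3)])
  then obtain u0 where u0: "u0 \<in> Defs.hom (Mod T) Q P"
    "\<And>i. i \<in> I \<Longrightarrow> Comp (Mod T) (\<pi> i) u0 = Arrow Q (q i) (A i)" by blast
  define u where "u = maps u0"
  have u: "hm Q P u" "\<And>i. i \<in> I \<Longrightarrow> hcomp Q (maps (\<pi> i)) u = q i"
    using Mod_homD(2,6)[OF u0(1)] arg_cong[OF u0(2), of _ maps] by (simp_all add: u_def maps_Comp)
  \<comment> \<open>The composite through \<open>Q\<close> and the identity of \<open>P\<close> both
    commute with all projections, so they coincide.\<close>
  have "\<exists>!w. w \<in> Defs.hom (Mod T) P P \<and> (\<forall>i \<in> I. Comp (Mod T) (\<pi> i) w = \<pi> i)"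
    by (rule is_productD(3)[OF prod]) (simp_all add: is_productD[OF prod])
  moreover have "Arrow P (hcomp P u v) P \<in> Defs.hom (Mod T) P P"
    using hm_comp[OF model_ps model_ps v(1) u(1)] mP Q(1) by (simp add: Mod_hom)
  moreover have "Comp (Mod T) (\<pi> i) (Arrow P (hcomp P u v) P) = \<pi> i" if i: "i \<in> I" for i
  proof -
    have "maps (\<pi> i) s (hcomp P u v s y) = maps (\<pi> i) s y" if y: "y \<in> carr P s" for s y
      using hcomp_eqD[OF u(2)[OF i] hmD(1)[OF v(1) y]] hcomp_eqD[OF v(2)[OF i] y] y
      by (simp add: hcomp_def)
    then have "hcomp P (maps (\<pi> i)) (hcomp P u v) = maps (\<pi> i)" using hcomp_eq_iff[OF \<pi>(2)[OF i]] by blast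
    then show ?thesis using \<pi>(1)[OF i] by (metis Mod_simps(6))
  qed
  moreover have "Arrow P (hid P) P \<in> Defs.hom (Mod T) P P" using hid_hm[OF model_ps[OF mP]] mP by (simp add: Mod_hom)
  moreover have "Comp (Mod T) (\<pi> i) (Arrow P (hid P) P) = \<pi> i" if i: "i \<in> I" for i
  proof -
    have "hcomp P (maps (\<pi> i)) (hid P) = maps (\<pi> i)" using hcomp_eq_iff[OF \<pi>(2)[OF i]] by (auto simp: hid_def)
    then show ?thesis using \<pi>(1)[OF i] by (metis Mod_simps(6))
  qed
  ultimately have "hcomp P u v = hid P" by (metis (no_types, lifting) arrow.inject)
  then have uv: "u s (v s x) = x" if "x \<in> carr P s" for s x using that hid_eq_iff by blast
  show ?thesis
    by (rule joint_emb_retract[OF model_ps[OF Q(1)] Q(2) model_ps[OF mP] v(1) u(1) uv \<pi>(2)])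
      (use hcomp_eqD[OF v(2)] in auto)
qed

text \<open>The kernel pair of \<open>h\<close> is closed under all defined functions, because
  \<open>h\<close> is a homomorphism. It is therefore a substructure jointly embedded in
  \<open>M\<close> by its two projections, hence a model and a legitimate test object for the
  monomorphism \<open>h\<close>.\<close>

lemma mono_injective:
  assumes T: "is_horn_theory lam \<Sigma> T" and h: "mono_arr (Mod T) (Arrow M h N)"
    and xy: "x \<in> carr M s" "y \<in> carr M s" "h s x = h s y"
  shows "x = y"
proof -
  have M: "model T M" "model T N" "hm M N h" using h unfolding mono_arr_def by (auto simp: Mod_simps)
  note psM = model_ps[OF M(1)] and psN = model_ps[OF M(2)]
  \<comment> \<open>Pairs are encoded as families indexed by \<open>bool\<close>.\<close>
  let ?Z = "\<lambda>s. {z \<in> (\<Pi>\<^sub>E i \<in> (UNIV :: bool set). carr M s). h s (z True) = h s (z False)}"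
  have small: "|?Z s| <o \<kappa>" if "s \<in> sorts \<Sigma>" for s
    by (rule small_subset[of _ "\<Pi>\<^sub>E i \<in> (UNIV :: bool set). carr M s"])
      (use psM that small_finite[of "UNIV :: bool set"] in \<open>auto simp: is_pstruct_def intro!: small_PiE\<close>)
  have closed: "(\<lambda>i \<in> UNIV. the (fint M f (\<lambda>j \<in> fun_idx lam \<Sigma> f. z j i))) \<in> ?Z (fun_cod \<Sigma> f)"
    if f: "f \<in> funs \<Sigma>" and z: "\<And>j. j \<in> fun_idx lam \<Sigma> f \<Longrightarrow> z j \<in> ?Z (fun_dom \<Sigma> f j)"
      and d: "\<And>i. i \<in> UNIV \<Longrightarrow> fint M f (\<lambda>j \<in> fun_idx lam \<Sigma> f. z j i) \<noteq> None" for f z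
  proof -
    let ?a = "\<lambda>i. \<lambda>j \<in> fun_idx lam \<Sigma> f. z j i"
    have ft: "fun_tuple lam \<Sigma> f h (?a True) = fun_tuple lam \<Sigma> f h (?a False)"
      using z by (auto simp: fun_tuple_def)
    obtain y1 y0 where y: "fint M f (?a True) = Some y1" "fint M f (?a False) = Some y0" using d by blast
    have "h (fun_cod \<Sigma> f) y1 = h (fun_cod \<Sigma> f) y0"
      using hmD(2)[OF M(3) psM f y(1)] hmD(2)[OF M(3) psM f y(2)] ft by simp
    moreover have "the (fint M f (?a i)) \<in> carr M (fun_cod \<Sigma> f)" for i
      using y fintD(2)[OF psM f] by (cases i) auto
    ultimately show ?thesis using y by simp
  qed
  obtain K p where K: "ps K" "joint_emb K UNIV (\<lambda>_ :: bool. M) p"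
    and sur: "\<And>s z. s \<in> sorts \<Sigma> \<Longrightarrow> z \<in> ?Z s \<Longrightarrow> \<exists>y \<in> carr K s. \<forall>i \<in> UNIV. p i s y = z i"
    and inZ: "\<And>s y. y \<in> carr K s \<Longrightarrow> (\<lambda>i \<in> UNIV. p i s y) \<in> ?Z s"
    by (rule joint_struct_exists[of UNIV "\<lambda>_ :: bool. M" ?Z]) (use psM small closed in auto)
  have mK: "model T K" by (rule joint_emb_model[OF T K]) (rule M(1))
  have "hcomp K h (p True) = hcomp K h (p False)"
    by (rule hcomp_eqI) (use inZ in auto)
  then have "Arrow K (p True) M = Arrow K (p False) M"
    using h mK M(1) joint_embD(1)[OF K(2)] unfolding mono_arr_def
    by (metis (no_types, lifting) Mod_simps(2,3,4,6) UNIV_I arrow.sel(1,3))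
  then have p: "p True = p False" by simp
  \<comment> \<open>The pair of \<open>x\<close> and \<open>y\<close> is itself an element of the
    kernel pair, and equality of the two projections at this element is the claim.\<close>
  have "(\<lambda>b. if b then x else y) \<in> ?Z s" using xy by auto
  from sur[OF carr_sort[OF psM xy(1)] this] obtain k where "p True s k = x" "p False s k = y"
    by (metis UNIV_I)
  then show ?thesis using p by simp
qed

text \<open>The single-index case of a joint embedding: closedness provides reflection, and
  \<open>mono_injective\<close> provides injectivity.\<close>

lemma closed_mono_joint_emb:
  assumes "is_horn_theory lam \<Sigma> T" and "closed_mono \<kappa> lam \<Sigma> T (Arrow M h N)"
  shows "joint_emb M {()} (\<lambda>_. N) (\<lambda>_. h)"
proof -
  have "mono_arr (Mod T) (Arrow M h N)" using assms(2) by (simp add: closed_mono_def)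
  then have "hm M N h" unfolding mono_arr_def by (auto simp: Mod_simps)
  then show ?thesis
    using assms(2) mono_injective[OF assms(1) \<open>mono_arr (Mod T) (Arrow M h N)\<close>]
    unfolding joint_emb_def closed_mono_def by simp
qed

lemma joint_emb_closed_mono:
  assumes "model T M" "model T N" and je: "joint_emb M {()} (\<lambda>_. N) (\<lambda>_. h)"
  shows "closed_mono \<kappa> lam \<Sigma> T (Arrow M h N)"
proof -
  have h: "hm M N h" using joint_embD(1)[OF je] by simp
  have "f = g" if f: "f \<in> Arr (Mod T)" and g: "g \<in> Arr (Mod T)" and dc: "Dom (Mod T) f = Dom (Mod T) g"
    "Cod (Mod T) f = M" "Cod (Mod T) g = M"
    and eq: "Comp (Mod T) (Arrow M h N) f = Comp (Mod T) (Arrow M h N) g" for f g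
  proof -
    obtain K f' g' where fg: "f = Arrow K f' M" "g = Arrow K g' M" using dc
      by (cases f; cases g) (auto simp: Mod_simps)
    have hf: "hm K M f'" "hm K M g'" using f g fg by (auto simp: Mod_simps)
    have "f' = g'"
    proof (rule hm_ext[OF hf])
      fix s y assume y: "y \<in> carr K s"
      have "hcomp K h f' = hcomp K h g'" using eq fg by (simp add: Mod_simps)
      then have "h s (f' s y) = h s (g' s y)" using hcomp_eqD[OF _ y] y by (metis hcomp_eqD)
      then show "f' s y = g' s y"
        using joint_embD(2)[OF je hmD(1)[OF hf(1) y] hmD(1)[OF hf(2) y]] by simp
    qed
    then show ?thesis using fg by simp
  qed
  then have "mono_arr (Mod T) (Arrow M h N)"
    unfolding mono_arr_def using assms(1,2) h by (auto simp: Mod_simps)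
  then show ?thesis using je unfolding closed_mono_def joint_emb_def by simp
qed

text \<open>Closure under products and under closed subobjects is used through this form. A
  \<open>\<kappa>\<close>-small subfamily already embeds \<open>K\<close> jointly, and the induced
  map exhibits \<open>K\<close> as a closed subobject of the product of that subfamily.\<close>

lemma joint_emb_in_class:
  assumes T: "is_horn_theory lam \<Sigma> T" and E: "E \<subseteq> Obj (Mod T)"
    and prods: "closed_under_products \<kappa> (Mod T) E"
    and subs: "closed_under_closed_subobjects \<kappa> lam \<Sigma> T E"
    and K: "ps K" and je: "joint_emb K I A p" and A: "\<And>i. i \<in> I \<Longrightarrow> A i \<in> E"
  shows "K \<in> E"
proof -
  obtain I0 where I0: "I0 \<subseteq> I" "|I0| <o \<kappa>" "joint_emb K I0 A p"
    using joint_emb_subfamily[OF K je] .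
  \<comment> \<open>\<open>closed_under_products\<close> quantifies over index sets in
    \<open>'u\<close>, so the small subfamily is reindexed.\<close>
  obtain enc :: "_ \<Rightarrow> 'u" where enc: "inj_on enc I0" using small_encode[OF I0(2)] by blast
  define dec where "dec = inv_into I0 enc"
  have dec: "dec i \<in> I0" if "i \<in> enc ` I0" for i using that by (auto simp: dec_def inv_into_into)
  have AE: "A (dec i) \<in> E" "model T (A (dec i))" if "i \<in> enc ` I0" for i
    using A I0(1) dec[OF that] E by (auto simp: Mod_simps)
  have mK: "model T K" by (rule joint_emb_model[OF T K je]) (use A E in \<open>auto simp: Mod_simps\<close>)
  obtain P q where P: "model T P" "joint_emb P (enc ` I0) (\<lambda>i. A (dec i)) q"
    "is_product (Mod T) (enc ` I0) (\<lambda>i. A (dec i)) P (\<lambda>i. Arrow P (q i) (A (dec i)))"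
    "\<And>s z. s \<in> sorts \<Sigma> \<Longrightarrow> z \<in> (\<Pi>\<^sub>E i \<in> enc ` I0. carr (A (dec i)) s) \<Longrightarrow>
      \<exists>y \<in> carr P s. \<forall>i \<in> enc ` I0. q i s y = z i"
    by (rule product_exists[OF T small_image[OF I0(2)], of enc "\<lambda>i. A (dec i)"]) (erule AE(2), rule that)
  have PE: "P \<in> E"
    by (rule prods[unfolded closed_under_products_def, rule_format, OF small_image[OF I0(2)] AE(1) P(3)])
  have g: "hm K (A (dec i)) (p (dec i))" if "i \<in> enc ` I0" for i
    using joint_embD(1)[OF I0(3) dec[OF that]] .
  have ex: "\<exists>w \<in> carr P s. \<forall>i \<in> enc ` I0. q i s w = p (dec i) s y" if y: "y \<in> carr K s" for s y
  proof -
    have "(\<lambda>i \<in> enc ` I0. p (dec i) s y) \<in> (\<Pi>\<^sub>E i \<in> enc ` I0. carr (A (dec i)) s)"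
      using hmD(1)[OF g y] by auto
    from P(4)[OF carr_sort[OF K y] this] show ?thesis by auto
  qed
  obtain u where u: "hm K P u"
    "\<And>i s y. i \<in> enc ` I0 \<Longrightarrow> y \<in> carr K s \<Longrightarrow> q i s (u s y) = p (dec i) s y"
    using joint_emb_lift[OF model_ps[OF P(1)] P(2) K g ex] by blast
  have u': "q (enc i) s (u s y) = p i s y" if "i \<in> I0" "y \<in> carr K s" for i s y
    using u(2)[of "enc i" y s] that enc by (simp add: dec_def)
  have qi: "hm P (A i) (q (enc i))" if "i \<in> I0" for i
    using joint_embD(1)[OF P(2), of "enc i"] that enc by (simp add: dec_def)
  have "joint_emb K {()} (\<lambda>_. P) (\<lambda>_. u)"
    unfolding joint_emb_def
  proof (intro conjI ballI allI impI)
    fix s x y assume xy: "x \<in> carr K s" "y \<in> carr K s" and eq: "\<forall>i \<in> {()}. u s x = u s y"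
    show "x = y"
    proof (rule joint_embD(2)[OF I0(3) xy])
      fix i assume "i \<in> I0"
      then show "p i s x = p i s y" using u'[of i x s] u'[of i y s] xy eq by simp
    qed
  next
    fix f a assume f: "f \<in> funs \<Sigma>" and a: "a \<in> fun_args lam \<Sigma> K f"
      and d: "\<forall>i \<in> {()}. fint P f (fun_tuple lam \<Sigma> f u a) \<noteq> None"
    then obtain z where z: "fint P f (fun_tuple lam \<Sigma> f u a) = Some z" by blast
    show "fint K f a \<noteq> None"
    proof (rule joint_embD(3)[OF I0(3) f a])
      fix i assume i: "i \<in> I0"
      have "fun_tuple lam \<Sigma> f (q (enc i)) (fun_tuple lam \<Sigma> f u a) = fun_tuple lam \<Sigma> f (p i) a"
        using a u'[OF i] by (auto simp: fun_tuple_def fun_args_def PiE_iff intro!: ext)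
      then show "fint (A i) f (fun_tuple lam \<Sigma> f (p i) a) \<noteq> None"
        using hmD(2)[OF qi[OF i] model_ps[OF P(1)] f z] by simp
    qed
  next
    fix R a assume R: "R \<in> rels \<Sigma>" and a: "a \<in> rel_args lam \<Sigma> K R"
      and d: "\<forall>i \<in> {()}. rel_tuple lam \<Sigma> R u a \<in> rint P R"
    show "a \<in> rint K R"
    proof (rule joint_embD(4)[OF I0(3) R a])
      fix i assume i: "i \<in> I0"
      have "rel_tuple lam \<Sigma> R (q (enc i)) (rel_tuple lam \<Sigma> R u a) = rel_tuple lam \<Sigma> R (p i) a"
        using a u'[OF i] by (auto simp: rel_tuple_def rel_args_def PiE_iff intro!: ext)
      then show "rel_tuple lam \<Sigma> R (p i) a \<in> rint (A i) R"
        using hmD(3)[OF qi[OF i] model_ps[OF P(1)] R] d by force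
    qed
  qed (use u in simp)
  from joint_emb_closed_mono[OF mK P(1) this] PE subs show ?thesis
    unfolding closed_under_closed_subobjects_def by fastforce
qed

end

section \<open>Terms and generic structures\<close>

context structures
begin

text \<open>A term is determined by the labels at its positions; this bounds the number of terms.\<close>

primrec paths :: "('s, 'f, 'l) trm \<Rightarrow> ('l list \<times> (('s, 'l) var + 'f)) set" where
  "paths (Var v) = {([], Inl v)}"
| "paths (App f ts) = insert ([], Inr f) (\<Union>i \<in> fun_idx lam \<Sigma> f. (\<lambda>(q, c). (i # q, c)) ` paths (ts i))"

lemma paths_App_child:
  "i \<in> fun_idx lam \<Sigma> f \<Longrightarrow> {(q, c). (i # q, c) \<in> paths (App f ts)} = paths (ts i)"
  by auto

lemma paths_root: "([], c) \<in> paths t \<Longrightarrow> c = (case t of Var v \<Rightarrow> Inl v | App f ts \<Rightarrow> Inr f)"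
  by (cases t) auto

lemma paths_inj: "raw_term lam \<Sigma> t s \<Longrightarrow> raw_term lam \<Sigma> u s' \<Longrightarrow> paths t = paths u \<Longrightarrow> t = u"
proof (induction arbitrary: u s' rule: raw_term.induct)
  case (1 v)
  from 1(2) show ?case by cases (use 1(3) in auto)
next
  case (2 f ts)
  from 2(4) show ?case
  proof cases
    case (1 v)
    then show ?thesis using 2(5) by auto
  next
    case (2 g us)
    have "([], Inr f) \<in> paths (App f ts)" by simp
    then have "([], Inr f) \<in> paths u" unfolding \<open>paths (App f ts) = paths u\<close> .
    from paths_root[OF this] have "f = g" by (simp add: 2(1))
    have "ts i = us i" for i
    proof (cases "i \<in> fun_idx lam \<Sigma> f")
      case True
      have "paths (ts i) = paths (us i)"
        using paths_App_child[OF True, of ts] paths_App_child[of i g us] True \<open>f = g\<close>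
          \<open>paths (App f ts) = paths u\<close> unfolding 2(1) by metis
      then show ?thesis using \<open>\<forall>i \<in> fun_idx lam \<Sigma> f. _\<close> 2(5) True \<open>f = g\<close> by blast
    next
      \<comment> \<open>Beyond the arity both argument functions are \<open>undefined\<close>, by
        the extensionality built into \<open>raw_term\<close>; otherwise the labels could not
        determine the term.\<close>
      case False
      then show ?thesis using 2(4) \<open>ts \<in> extensional _\<close> \<open>f = g\<close> by (simp add: extensional_def)
    qed
    then show ?thesis using 2(1) \<open>f = g\<close> by auto
  qed
qed

text \<open>A path is a list over \<open>Field lam\<close> together with a variable or a function
  symbol as label. Terms may branch infinitely, but as sets of paths they embed into the power set
  of a small set.\<close>

lemma small_terms: "|{t. \<exists>s. raw_term lam \<Sigma> t s}| <o \<kappa>"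
proof (rule small_inj_on)
  show "inj_on paths {t. \<exists>s. raw_term lam \<Sigma> t s}" using paths_inj by (auto intro!: inj_onI)
  have "paths t \<subseteq> lists (Field lam) \<times> (vars lam \<Sigma> <+> funs \<Sigma>)" if "raw_term lam \<Sigma> t s" for t s
    using that
  proof induction
    case (2 f ts)
    then show ?case using underS_subset_Field by (fastforce simp: fun_idx_def)
  qed auto
  then show "paths ` {t. \<exists>s. raw_term lam \<Sigma> t s} \<subseteq> Pow (lists (Field lam) \<times> (vars lam \<Sigma> <+> funs \<Sigma>))"
    by blast
  show "|Pow (lists (Field lam) \<times> (vars lam \<Sigma> <+> funs \<Sigma>))| <o \<kappa>"
    unfolding vars_def
    by (intro small_Pow small_Sigma small_lists small_Plus small_Field_lam)
      (use sgn in \<open>auto simp: is_signature_def\<close>)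
qed

text \<open>Generation is expressed by terms so that a homomorphism out of \<open>G\<close> is
  determined by the image of the tuple \<open>g\<close> and can be computed by evaluating terms at
  that image.\<close>

definition generated :: "('s, 'l) ctx \<Rightarrow> ('s, 'f, 'r, 'l, 'u) pstruct \<Rightarrow> ('l \<Rightarrow> 'u) \<Rightarrow> bool" where
  "generated x G g \<longleftrightarrow> g \<in> ctx_prod lam G x \<and>
     (\<forall>s. \<forall>y \<in> carr G s. \<exists>t. term_in_ctx lam \<Sigma> x t s \<and> term_val lam \<Sigma> G (ctx_env lam x g) t = Some y)"

lemma term_in_ctx_Var:
  "is_context lam \<Sigma> x \<Longrightarrow> i \<in> ctx_idx lam x \<Longrightarrow> term_in_ctx lam \<Sigma> x (Var (ctx_var x i)) (fst (ctx_var x i))"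
  unfolding term_in_ctx_def is_context_def by (auto intro!: raw_term.intros)

lemma term_in_ctx_App:
  "is_context lam \<Sigma> x \<Longrightarrow> f \<in> funs \<Sigma> \<Longrightarrow>
    (\<And>j. j \<in> fun_idx lam \<Sigma> f \<Longrightarrow> term_in_ctx lam \<Sigma> x (ts j) (fun_dom \<Sigma> f j)) \<Longrightarrow>
    term_in_ctx lam \<Sigma> x (App f (\<lambda>j \<in> fun_idx lam \<Sigma> f. ts j)) (fun_cod \<Sigma> f)"
  unfolding term_in_ctx_def by (auto intro!: raw_term.intros)

lemma fm_in_ctx_Rel:
  "is_context lam \<Sigma> x \<Longrightarrow> R \<in> rels \<Sigma> \<Longrightarrow>
    (\<And>j. j \<in> rel_idx lam \<Sigma> R \<Longrightarrow> term_in_ctx lam \<Sigma> x (ts j) (rel_dom \<Sigma> R j)) \<Longrightarrow>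
    fm_in_ctx lam \<Sigma> x (Rel R (\<lambda>j \<in> rel_idx lam \<Sigma> R. ts j))"
  unfolding term_in_ctx_def fm_in_ctx_def by (auto intro!: raw_formula.intros)

lemma fm_in_ctx_Eq:
  "term_in_ctx lam \<Sigma> x t s \<Longrightarrow> term_in_ctx lam \<Sigma> x u s \<Longrightarrow> fm_in_ctx lam \<Sigma> x (Eq t u)"
  unfolding term_in_ctx_def fm_in_ctx_def by (auto intro!: raw_formula.intros)

lemma term_val_App_Some:
  assumes "\<And>j. j \<in> fun_idx lam \<Sigma> f \<Longrightarrow> term_val lam \<Sigma> M e (ts j) = Some (a j)"
  shows "term_val lam \<Sigma> M e (App f (\<lambda>j \<in> fun_idx lam \<Sigma> f. ts j)) = fint M f (\<lambda>j \<in> fun_idx lam \<Sigma> f. a j)"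
proof -
  have "(\<lambda>j \<in> fun_idx lam \<Sigma> f. the (term_val lam \<Sigma> M e ((\<lambda>j \<in> fun_idx lam \<Sigma> f. ts j) j))) =
      (\<lambda>j \<in> fun_idx lam \<Sigma> f. a j)" using assms by auto
  then show ?thesis using assms by simp
qed

lemma fm_holds_Rel_Some:
  assumes "\<And>j. j \<in> rel_idx lam \<Sigma> R \<Longrightarrow> term_val lam \<Sigma> M e (ts j) = Some (a j)"
  shows "fm_holds lam \<Sigma> M e (Rel R (\<lambda>j \<in> rel_idx lam \<Sigma> R. ts j)) \<longleftrightarrow> (\<lambda>j \<in> rel_idx lam \<Sigma> R. a j) \<in> rint M R"
proof -
  have "(\<lambda>j \<in> rel_idx lam \<Sigma> R. the (term_val lam \<Sigma> M e ((\<lambda>j \<in> rel_idx lam \<Sigma> R. ts j) j))) =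
      (\<lambda>j \<in> rel_idx lam \<Sigma> R. a j)" using assms by auto
  then show ?thesis using assms by simp
qed

lemma generated_hom_unique:
  assumes gen: "generated x G g" and G: "ps G" and h: "hm G N h" "hm G N h'"
    and eq: "ctx_map x h g = ctx_map x h' g"
  shows "h = h'"
proof (rule hm_ext[OF h])
  fix s y assume "y \<in> carr G s"
  then obtain t where t: "term_in_ctx lam \<Sigma> x t s" "term_val lam \<Sigma> G (ctx_env lam x g) t = Some y"
    using gen unfolding generated_def by blast
  show "h s y = h' s y"
    using ctx_term_hom[OF G h(1) t] ctx_term_hom[OF G h(2) t] eq by simp
qed

text \<open>The value of a term at \<open>g\<close> is sent to its value at \<open>m\<close>.
  Well-definedness, definedness, compatibility with functions and preservation of relations are all
  instances of formulas that hold at \<open>g\<close>, so \<open>sat\<close> transports them to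
  \<open>m\<close>.\<close>

lemma generated_hom_exists:
  assumes x: "is_context lam \<Sigma> x" and gen: "generated x G g" and G: "ps G" and M: "ps M"
    and m: "m \<in> ctx_prod lam M x"
    and sat: "\<And>\<psi>. fm_in_ctx lam \<Sigma> x \<psi> \<Longrightarrow> fm_holds lam \<Sigma> G (ctx_env lam x g) \<psi> \<Longrightarrow>
      fm_holds lam \<Sigma> M (ctx_env lam x m) \<psi>"
  obtains h where "hm G M h" "ctx_map x h g = m"
proof -
  define t where "t s y = (SOME t. term_in_ctx lam \<Sigma> x t s \<and> term_val lam \<Sigma> G (ctx_env lam x g) t = Some y)"
    for s y
  have t: "term_in_ctx lam \<Sigma> x (t s y) s" "term_val lam \<Sigma> G (ctx_env lam x g) (t s y) = Some y"
    if "y \<in> carr G s" for s y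
    using someI_ex[of "\<lambda>t. term_in_ctx lam \<Sigma> x t s \<and> term_val lam \<Sigma> G (ctx_env lam x g) t = Some y"]
      gen that unfolding generated_def t_def by blast+
  define h where "h s = (\<lambda>y \<in> carr G s. the (term_val lam \<Sigma> M (ctx_env lam x m) (t s y)))" for s
  \<comment> \<open>Any term that denotes \<open>y\<close> may replace the chosen one: their
    equation holds at \<open>g\<close>, hence at \<open>m\<close>, and it also asserts that both
    sides are defined there.\<close>
  have key: "term_val lam \<Sigma> M (ctx_env lam x m) u = Some (h s y)"
    if u: "term_in_ctx lam \<Sigma> x u s" "term_val lam \<Sigma> G (ctx_env lam x g) u = Some y" for u s y
  proof -
    have y: "y \<in> carr G s"
      by (rule ctx_term_typed[OF G u(1) _ u(2)]) (use gen in \<open>simp add: generated_def\<close>)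
    have "fm_holds lam \<Sigma> G (ctx_env lam x g) (Eq u (t s y))" using u t[OF y] by simp
    from sat[OF fm_in_ctx_Eq[OF u(1) t(1)[OF y]] this]
    have "term_val lam \<Sigma> M (ctx_env lam x m) u \<noteq> None"
      "term_val lam \<Sigma> M (ctx_env lam x m) (t s y) = term_val lam \<Sigma> M (ctx_env lam x m) u"
      unfolding fm_holds.simps by metis+
    then obtain z where "term_val lam \<Sigma> M (ctx_env lam x m) u = Some z"
      "term_val lam \<Sigma> M (ctx_env lam x m) (t s y) = Some z" by auto
    then show ?thesis using y by (simp add: h_def)
  qed
  have typd: "h s y \<in> carr M s" if "y \<in> carr G s" for s y
    using ctx_term_typed[OF M t(1)[OF that] m key[OF t[OF that]]] .
  have "hm G M h"
    unfolding is_homomorphism_def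
  proof (intro conjI allI ballI impI)
    show "h s \<in> carr G s \<rightarrow>\<^sub>E carr M s" for s using typd by (auto simp: h_def)
  next
    fix f a y assume f: "f \<in> funs \<Sigma>" and a: "a \<in> fun_args lam \<Sigma> G f" and y: "fint G f a = Some y"
    let ?ts = "\<lambda>j. t (fun_dom \<Sigma> f j) (a j)"
    have aj: "a j \<in> carr G (fun_dom \<Sigma> f j)" if "j \<in> fun_idx lam \<Sigma> f" for j
      using a that by (auto simp: fun_args_def)
    have ar: "(\<lambda>j \<in> fun_idx lam \<Sigma> f. a j) = a"
      using a by (auto simp: fun_args_def PiE_iff extensional_def intro!: ext)
    have "term_val lam \<Sigma> G (ctx_env lam x g) (App f (\<lambda>j \<in> fun_idx lam \<Sigma> f. ?ts j)) = Some y"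
      using term_val_App_Some[of f G "ctx_env lam x g" ?ts a] t(2)[OF aj] y ar by simp
    from key[OF term_in_ctx_App[OF x f t(1)[OF aj]] this]
    show "fint M f (fun_tuple lam \<Sigma> f h a) = Some (h (fun_cod \<Sigma> f) y)"
      using term_val_App_Some[of f M "ctx_env lam x m" ?ts "\<lambda>j. h (fun_dom \<Sigma> f j) (a j)"]
        key[OF t[OF aj]] by (simp add: fun_tuple_def)
  next
    fix R a assume R: "R \<in> rels \<Sigma>" and a: "a \<in> rel_args lam \<Sigma> G R" and y: "a \<in> rint G R"
    let ?ts = "\<lambda>j. t (rel_dom \<Sigma> R j) (a j)"
    have aj: "a j \<in> carr G (rel_dom \<Sigma> R j)" if "j \<in> rel_idx lam \<Sigma> R" for j
      using a that by (auto simp: rel_args_def)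
    have ar: "(\<lambda>j \<in> rel_idx lam \<Sigma> R. a j) = a"
      using a by (auto simp: rel_args_def PiE_iff extensional_def intro!: ext)
    have "fm_holds lam \<Sigma> G (ctx_env lam x g) (Rel R (\<lambda>j \<in> rel_idx lam \<Sigma> R. ?ts j))"
      using fm_holds_Rel_Some[of R G "ctx_env lam x g" ?ts a] t(2)[OF aj] y ar by simp
    from sat[OF fm_in_ctx_Rel[OF x R t(1)[OF aj]] this]
    show "rel_tuple lam \<Sigma> R h a \<in> rint M R"
      using fm_holds_Rel_Some[of R M "ctx_env lam x m" ?ts "\<lambda>j. h (rel_dom \<Sigma> R j) (a j)"]
        key[OF t[OF aj]] by (simp add: rel_tuple_def)
  qed
  moreover have "ctx_map x h g = m"
  proof
    fix i show "ctx_map x h g i = m i"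
    proof (cases "i \<in> ctx_idx lam x")
      case True
      have "term_val lam \<Sigma> G (ctx_env lam x g) (Var (ctx_var x i)) = Some (g i)"
        using ctx_env_var[OF x True] by simp
      from key[OF term_in_ctx_Var[OF x True] this] show ?thesis
        using True by (simp add: ctx_map_def ctx_env_var[OF x True])
    next
      case False
      then show ?thesis using m by (auto simp: ctx_map_def ctx_prod_def)
    qed
  qed
  ultimately show thesis using that by blast
qed

text \<open>A term is represented by the family of its values over all members of \<open>K\<close>,
  so no quotient of terms has to be formed. The class \<open>K\<close> may be large: the families in
  use are no more numerous than terms.\<close>

lemma generic_exists:
  assumes x: "is_context lam \<Sigma> x" and K: "\<And>M m. (M, m) \<in> K \<Longrightarrow> ps M \<and> m \<in> ctx_prod lam M x"
  obtains G g p where "ps G" "generated x G g" "joint_emb G K fst p"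
    "\<And>M m. (M, m) \<in> K \<Longrightarrow> ctx_map x (p (M, m)) g = m"
proof -
  let ?tv = "\<lambda>k t. term_val lam \<Sigma> (fst k) (ctx_env lam x (snd k)) t"
  define Z where "Z s = {\<lambda>k \<in> K. the (?tv k t) |t. term_in_ctx lam \<Sigma> x t s \<and> (\<forall>k \<in> K. ?tv k t \<noteq> None)}"
    for s
  have psK: "ps (fst k)" "snd k \<in> ctx_prod lam (fst k) x" if "k \<in> K" for k
    using K[of "fst k" "snd k"] that by auto
  have Zsub: "Z s \<subseteq> (\<Pi>\<^sub>E k \<in> K. carr (fst k) s)" for s
  proof
    fix z assume "z \<in> Z s"
    then obtain t where t: "z = (\<lambda>k \<in> K. the (?tv k t))" "term_in_ctx lam \<Sigma> x t s" "\<forall>k \<in> K. ?tv k t \<noteq> None"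
      unfolding Z_def by blast
    have "the (?tv k t) \<in> carr (fst k) s" if "k \<in> K" for k
      using ctx_term_typed[OF psK(1)[OF that] t(2) psK(2)[OF that]] t(3) that by fastforce
    then show "z \<in> (\<Pi>\<^sub>E k \<in> K. carr (fst k) s)" using t(1) by auto
  qed
  have small: "|Z s| <o \<kappa>" for s
  proof (rule small_subset[OF _ small_image[OF small_terms]])
    show "Z s \<subseteq> (\<lambda>t. \<lambda>k \<in> K. the (?tv k t)) ` {t. \<exists>s. raw_term lam \<Sigma> t s}"
      unfolding Z_def term_in_ctx_def by blast
  qed
  have closed: "(\<lambda>k \<in> K. the (fint (fst k) f (\<lambda>j \<in> fun_idx lam \<Sigma> f. z j k))) \<in> Z (fun_cod \<Sigma> f)"
    if f: "f \<in> funs \<Sigma>" and z: "\<And>j. j \<in> fun_idx lam \<Sigma> f \<Longrightarrow> z j \<in> Z (fun_dom \<Sigma> f j)"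
      and d: "\<And>k. k \<in> K \<Longrightarrow> fint (fst k) f (\<lambda>j \<in> fun_idx lam \<Sigma> f. z j k) \<noteq> None" for f z
  proof -
    have "\<forall>j \<in> fun_idx lam \<Sigma> f. \<exists>t. z j = (\<lambda>k \<in> K. the (?tv k t)) \<and>
        term_in_ctx lam \<Sigma> x t (fun_dom \<Sigma> f j) \<and> (\<forall>k \<in> K. ?tv k t \<noteq> None)"
      using z by (simp add: Z_def)
    from bchoice[OF this] obtain t where t0: "\<forall>j \<in> fun_idx lam \<Sigma> f. z j = (\<lambda>k \<in> K. the (?tv k (t j))) \<and>
        term_in_ctx lam \<Sigma> x (t j) (fun_dom \<Sigma> f j) \<and> (\<forall>k \<in> K. ?tv k (t j) \<noteq> None)" ..
    then have t: "\<And>j. j \<in> fun_idx lam \<Sigma> f \<Longrightarrow> z j = (\<lambda>k \<in> K. the (?tv k (t j)))"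
      "\<And>j. j \<in> fun_idx lam \<Sigma> f \<Longrightarrow> term_in_ctx lam \<Sigma> x (t j) (fun_dom \<Sigma> f j)"
      "\<And>j k. j \<in> fun_idx lam \<Sigma> f \<Longrightarrow> k \<in> K \<Longrightarrow> ?tv k (t j) \<noteq> None" by blast+
    \<comment> \<open>The family of values of \<open>f\<close> is represented by applying
      \<open>f\<close> to terms that represent the arguments.\<close>
    let ?u = "App f (\<lambda>j \<in> fun_idx lam \<Sigma> f. t j)"
    have u: "?tv k ?u = fint (fst k) f (\<lambda>j \<in> fun_idx lam \<Sigma> f. z j k)" if "k \<in> K" for k
    proof -
      have "?tv k (t j) = Some (z j k)" if "j \<in> fun_idx lam \<Sigma> f" for j
        using t(1,3)[OF that] \<open>k \<in> K\<close> by auto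
      then show ?thesis by (rule term_val_App_Some)
    qed
    have "term_in_ctx lam \<Sigma> x ?u (fun_cod \<Sigma> f)" by (rule term_in_ctx_App[OF x f t(2)])
    moreover have "\<forall>k \<in> K. ?tv k ?u \<noteq> None" using u d by simp
    moreover have "(\<lambda>k \<in> K. the (fint (fst k) f (\<lambda>j \<in> fun_idx lam \<Sigma> f. z j k))) = (\<lambda>k \<in> K. the (?tv k ?u))"
      using u by auto
    ultimately show ?thesis unfolding Z_def by blast
  qed
  obtain G p where G: "ps G" "joint_emb G K fst p"
    and sur: "\<And>s z. s \<in> sorts \<Sigma> \<Longrightarrow> z \<in> Z s \<Longrightarrow> \<exists>y \<in> carr G s. \<forall>k \<in> K. p k s y = z k"
    and inZ: "\<And>s y. y \<in> carr G s \<Longrightarrow> (\<lambda>k \<in> K. p k s y) \<in> Z s"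
    by (rule joint_struct_exists[of K fst Z]) (use psK Zsub small closed in auto)
  have "\<exists>y \<in> carr G (fst (ctx_var x i)). \<forall>k \<in> K. p k (fst (ctx_var x i)) y = snd k i"
    if i: "i \<in> ctx_idx lam x" for i
  proof -
    have "(\<lambda>k \<in> K. snd k i) = (\<lambda>k \<in> K. the (?tv k (Var (ctx_var x i))))"
      by (intro restrict_ext) (simp add: ctx_env_var[OF x i])
    then have "(\<lambda>k \<in> K. snd k i) \<in> Z (fst (ctx_var x i))"
      unfolding Z_def using term_in_ctx_Var[OF x i] by fastforce
    from sur[OF ctx_sort[OF x i] this] show ?thesis by auto
  qed
  then obtain g0 where g0: "\<And>i. i \<in> ctx_idx lam x \<Longrightarrow> g0 i \<in> carr G (fst (ctx_var x i))"
    "\<And>i k. i \<in> ctx_idx lam x \<Longrightarrow> k \<in> K \<Longrightarrow> p k (fst (ctx_var x i)) (g0 i) = snd k i" by metis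
  define g where "g = (\<lambda>i \<in> ctx_idx lam x. g0 i)"
  have g: "g \<in> ctx_prod lam G x" using g0 by (auto simp: g_def ctx_prod_def)
  have pg: "ctx_map x (p k) g = snd k" if "k \<in> K" for k
    using g0(2)[OF _ that] psK(2)[OF that]
    by (auto simp: g_def ctx_map_def ctx_prod_def PiE_iff extensional_def intro!: ext)
  have "\<exists>t. term_in_ctx lam \<Sigma> x t s \<and> term_val lam \<Sigma> G (ctx_env lam x g) t = Some y"
    if y: "y \<in> carr G s" for s y
  proof -
    obtain t where t: "(\<lambda>k \<in> K. p k s y) = (\<lambda>k \<in> K. the (?tv k t))" "term_in_ctx lam \<Sigma> x t s"
      "\<And>k. k \<in> K \<Longrightarrow> ?tv k t \<noteq> None"
      using inZ[OF y] unfolding Z_def by blast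
    \<comment> \<open>The term that represents the coordinates of \<open>y\<close> also denotes
      \<open>y\<close> inside \<open>G\<close>: it is defined there by reflection, and its value has
      the same coordinates as \<open>y\<close>.\<close>
    have "term_val lam \<Sigma> G (ctx_env lam x g) t \<noteq> None"
      by (rule ctx_term_joint[OF G t(2) g]) (use t(3) pg in simp)
    then obtain y' where y': "term_val lam \<Sigma> G (ctx_env lam x g) t = Some y'" by blast
    have "y' = y"
    proof (rule joint_embD(2)[OF G(2) ctx_term_typed[OF G(1) t(2) g y'] y])
      fix k assume k: "k \<in> K"
      have "?tv k t = Some (p k s y')"
        using ctx_term_hom[OF G(1) joint_embD(1)[OF G(2) k] t(2) y'] pg[OF k] by simp
      then show "p k s y' = p k s y" using fun_cong[OF t(1), of k] k by simp
    qed
    then show ?thesis using t(2) y' by blast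
  qed
  then have "generated x G g" using g unfolding generated_def by blast
  then show thesis using that[OF G(1) _ G(2)] pg by auto
qed

end

section \<open>Filtered colimits\<close>

locale filtered_diagram = structures \<kappa> lam \<Sigma>
  for \<kappa> :: "'u rel" and lam :: "'l rel" and \<Sigma> :: "('s, 'f, 'r, 'l) signature" +
  fixes T :: "('s, 'f, 'r, 'l) sequent set" and J :: "('j, 'b) category"
    and D :: "('j, 'b, ('s, 'f, 'r, 'l, 'u) pstruct, ('s, 'f, 'r, 'l, 'u) arrow) func"
  assumes horn: "is_horn_theory lam \<Sigma> T" and filtered: "filtered_category lam J"
    and smallJ: "small_category \<kappa> J" and diag_functor: "is_functor J (PMod \<kappa> lam \<Sigma> T) D"
begin

abbreviation dob where "dob j \<equiv> fobj D j"
abbreviation dm where "dm a \<equiv> maps (farr D a)"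

lemma catJ: "is_category J"
  using filtered unfolding filtered_category_def by blast

lemma Arr_J: "a \<in> Arr J \<Longrightarrow> Dom J a \<in> Obj J" "a \<in> Arr J \<Longrightarrow> Cod J a \<in> Obj J"
  using catJ unfolding is_category_def by blast+

lemma Id_J:
  assumes "j \<in> Obj J" shows "Id J j \<in> Arr J" "Dom J (Id J j) = j" "Cod J (Id J j) = j"
  using catJ assms unfolding is_category_def Defs.hom_def by blast+

lemma Comp_J:
  assumes "a \<in> Arr J" "b \<in> Arr J" "Dom J b = Cod J a"
  shows "Comp J b a \<in> Arr J" "Dom J (Comp J b a) = Dom J a" "Cod J (Comp J b a) = Cod J b"
  using catJ assms unfolding is_category_def Defs.hom_def by blast+

lemma Comp_J_assoc:
  "a \<in> Arr J \<Longrightarrow> b \<in> Arr J \<Longrightarrow> c \<in> Arr J \<Longrightarrow> Dom J b = Cod J a \<Longrightarrow> Dom J c = Cod J b \<Longrightarrow>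
    Comp J c (Comp J b a) = Comp J (Comp J c b) a"
  using catJ unfolding is_category_def by blast

lemma dob_model: "j \<in> Obj J \<Longrightarrow> model T (dob j)" "j \<in> Obj J \<Longrightarrow> ps (dob j)"
  using diag_functor unfolding is_functor_def by (auto simp: Mod_simps intro: model_ps)

lemma dm_hom: "a \<in> Arr J \<Longrightarrow> farr D a \<in> Defs.hom (Mod T) (dob (Dom J a)) (dob (Cod J a))"
  using diag_functor unfolding is_functor_def by blast

lemma dm_hm: "a \<in> Arr J \<Longrightarrow> hm (dob (Dom J a)) (dob (Cod J a)) (dm a)"
  using Mod_homD(6)[OF dm_hom] .

lemma dm_carr: "a \<in> Arr J \<Longrightarrow> y \<in> carr (dob (Dom J a)) s \<Longrightarrow> dm a s y \<in> carr (dob (Cod J a)) s"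
  using hmD(1)[OF dm_hm] .

lemma dm_Id: "j \<in> Obj J \<Longrightarrow> y \<in> carr (dob j) s \<Longrightarrow> dm (Id J j) s y = y"
  using diag_functor unfolding is_functor_def by (simp add: Mod_simps hid_def)

lemma dm_Comp:
  assumes "a \<in> Arr J" "b \<in> Arr J" "Dom J b = Cod J a" "y \<in> carr (dob (Dom J a)) s"
  shows "dm (Comp J b a) s y = dm b s (dm a s y)"
proof -
  have "farr D (Comp J b a) = Comp (Mod T) (farr D b) (farr D a)"
    using diag_functor assms unfolding is_functor_def by blast
  then have "dm (Comp J b a) = hcomp (dob (Dom J a)) (dm b) (dm a)"
    using maps_Comp[of T] Mod_homD(2)[OF dm_hom[OF assms(1)]] by simp
  then show ?thesis using hcomp_eqD[OF _ assms(4)] by metis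
qed

lemma bound_J:
  assumes "X \<subseteq> Obj J" "|X| <o lam"
  obtains c where "c \<in> Obj J" "\<And>x. x \<in> X \<Longrightarrow> Defs.hom J x c \<noteq> {}"
  using filtered[unfolded filtered_category_def, THEN conjunct2, THEN conjunct1, rule_format, OF assms]
    that by blast

lemma coeq_J:
  assumes "F \<subseteq> Arr J" "\<And>f. f \<in> F \<Longrightarrow> Dom J f = x \<and> Cod J f = y" "|F| <o lam" "x \<in> Obj J" "y \<in> Obj J"
  obtains h where "h \<in> Arr J" "Dom J h = y" "\<And>f g. f \<in> F \<Longrightarrow> g \<in> F \<Longrightarrow> Comp J h f = Comp J h g"
proof -
  have "F \<subseteq> Defs.hom J x y" using assms(1,2) by (auto simp: Defs.hom_def)
  then have "\<exists>z \<in> Obj J. \<exists>h \<in> Defs.hom J y z. \<forall>f \<in> F. \<forall>g \<in> F. Comp J h f = Comp J h g"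
    by (rule filtered[unfolded filtered_category_def, THEN conjunct2, THEN conjunct2, rule_format,
        OF assms(4,5) _ assms(3)])
  then show thesis using that by (auto simp: Defs.hom_def)
qed

text \<open>The codomains of the given arrows have a common upper bound \<open>c\<close>. The
  composites into \<open>c\<close> are parallel arrows, fewer than \<open>lam\<close> in number, and
  one further arrow makes them all equal.\<close>

lemma common_extension:
  assumes j: "j \<in> Obj J" and F: "F \<subseteq> Arr J" "\<And>f. f \<in> F \<Longrightarrow> Dom J f = j" "|F| <o lam"
  obtains a where "a \<in> Arr J" "Dom J a = j"
    "\<And>f. f \<in> F \<Longrightarrow> \<exists>b \<in> Arr J. Dom J b = Cod J f \<and> Comp J b f = a"
proof -
  \<comment> \<open>Adding the identity provides a reference composite, also when \<open>F\<close>
    is empty.\<close>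
  define F0 where "F0 = insert (Id J j) F"
  have F0: "F0 \<subseteq> Arr J" "\<And>f. f \<in> F0 \<Longrightarrow> Dom J f = j"
    using F Id_J[OF j] by (auto simp: F0_def)
  have F0l: "|F0| <o lam" unfolding F0_def by (rule lam_insert[OF F(3)])
  obtain c where c: "c \<in> Obj J" "\<And>x. x \<in> Cod J ` F0 \<Longrightarrow> Defs.hom J x c \<noteq> {}"
    by (rule bound_J[of "Cod J ` F0"]) (use F0 Arr_J lam_image[OF F0l] in auto)
  have "\<forall>f \<in> F0. \<exists>v. v \<in> Arr J \<and> Dom J v = Cod J f \<and> Cod J v = c"
  proof
    fix f assume "f \<in> F0"
    then have "Defs.hom J (Cod J f) c \<noteq> {}" using c(2) by blast
    then show "\<exists>v. v \<in> Arr J \<and> Dom J v = Cod J f \<and> Cod J v = c" by (auto simp: Defs.hom_def)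
  qed
  from bchoice[OF this] obtain v where v: "\<forall>f \<in> F0. v f \<in> Arr J \<and> Dom J (v f) = Cod J f \<and> Cod J (v f) = c" ..
  let ?F1 = "(\<lambda>f. Comp J (v f) f) ` F0"
  have vf: "v f \<in> Arr J" "Dom J (v f) = Cod J f" "Cod J (v f) = c" "f \<in> Arr J" "Dom J f = j" if "f \<in> F0" for f
    using v F0 that by auto
  have vc: "Comp J (v f) f \<in> Arr J" "Dom J (Comp J (v f) f) = j" "Cod J (Comp J (v f) f) = c" if "f \<in> F0" for f
    using Comp_J[OF vf(4,1,2)[OF that]] vf[OF that] by simp_all
  obtain h where h: "h \<in> Arr J" "Dom J h = c"
    "\<And>f g. f \<in> ?F1 \<Longrightarrow> g \<in> ?F1 \<Longrightarrow> Comp J h f = Comp J h g"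
  proof (rule coeq_J[of ?F1 j c])
    show "?F1 \<subseteq> Arr J" using vc(1) by blast
    show "Dom J f = j \<and> Cod J f = c" if "f \<in> ?F1" for f using vc(2,3) that by blast
    show "|?F1| <o lam" by (rule lam_image[OF F0l])
  qed (rule j, rule c(1), rule that, assumption+)
  have Id0: "Id J j \<in> F0" by (simp add: F0_def)
  let ?a = "Comp J h (Comp J (v (Id J j)) (Id J j))"
  show thesis
  proof (rule that)
    show "?a \<in> Arr J" "Dom J ?a = j" using Comp_J[OF vc(1)[OF Id0] h(1)] vc[OF Id0] h(2) by simp_all
    fix f assume "f \<in> F"
    then have f: "f \<in> F0" by (simp add: F0_def)
    have "Comp J h (Comp J (v f) f) = ?a" using h(3) f Id0 by blast
    then have "Comp J (Comp J h (v f)) f = ?a" using Comp_J_assoc[OF vf(4,1)[OF f] h(1) vf(2)[OF f]] vf[OF f] h(2) by simp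
    moreover have "Comp J h (v f) \<in> Arr J" "Dom J (Comp J h (v f)) = Cod J f"
      using Comp_J[OF vf(1)[OF f] h(1)] vf[OF f] h(2) by simp_all
    ultimately show "\<exists>b \<in> Arr J. Dom J b = Cod J f \<and> Comp J b f = ?a" by blast
  qed
qed

text \<open>Properties that persist along the diagram and each hold eventually can be achieved
  simultaneously, as long as there are fewer than \<open>lam\<close> of them. This is what makes
  arities and conjunctions below \<open>lam\<close> decidable at a single stage.\<close>

lemma eventually_ball:
  assumes j: "j \<in> Obj J" and I: "|I| <o lam"
    and ex: "\<And>i. i \<in> I \<Longrightarrow> \<exists>a \<in> Arr J. Dom J a = j \<and> P i a"
    and mono: "\<And>i a b. i \<in> I \<Longrightarrow> a \<in> Arr J \<Longrightarrow> Dom J a = j \<Longrightarrow> b \<in> Arr J \<Longrightarrow> Dom J b = Cod J a \<Longrightarrow>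
      P i a \<Longrightarrow> P i (Comp J b a)"
  obtains a where "a \<in> Arr J" "Dom J a = j" "\<And>i. i \<in> I \<Longrightarrow> P i a"
proof -
  have "\<forall>i \<in> I. \<exists>a. a \<in> Arr J \<and> Dom J a = j \<and> P i a" using ex by blast
  from bchoice[OF this] obtain g where g: "\<forall>i \<in> I. g i \<in> Arr J \<and> Dom J (g i) = j \<and> P i (g i)" ..
  obtain a where a: "a \<in> Arr J" "Dom J a = j"
    "\<And>f. f \<in> g ` I \<Longrightarrow> \<exists>b \<in> Arr J. Dom J b = Cod J f \<and> Comp J b f = a"
    by (rule common_extension[OF j, of "g ` I"]) (use g lam_image[OF I] in auto)
  have "P i a" if "i \<in> I" for i
    using a(3)[of "g i"] mono[OF that] g that by blast
  then show thesis using that a by blast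
qed

lemma merge_objects:
  assumes "j \<in> Obj J" "j' \<in> Obj J"
  obtains a a' where "a \<in> Arr J" "a' \<in> Arr J" "Dom J a = j" "Dom J a' = j'" "Cod J a = Cod J a'"
proof -
  obtain c where "c \<in> Obj J" "\<And>x. x \<in> {j, j'} \<Longrightarrow> Defs.hom J x c \<noteq> {}"
    by (rule bound_J[of "{j, j'}"]) (use assms lam_finite[of "{j, j'}"] in auto)
  then have "Defs.hom J j c \<noteq> {}" "Defs.hom J j' c \<noteq> {}" by auto
  then show thesis using that by (auto simp: Defs.hom_def)
qed

definition compatible :: "('s, 'f, 'r, 'l, 'u) pstruct \<Rightarrow> ('j \<Rightarrow> 's \<Rightarrow> 'u \<Rightarrow> 'u) \<Rightarrow> bool" where
  "compatible X k \<longleftrightarrow> (\<forall>j \<in> Obj J. hm (dob j) X (k j)) \<and>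
     (\<forall>a \<in> Arr J. \<forall>s. \<forall>y \<in> carr (dob (Dom J a)) s. k (Cod J a) s (dm a s y) = k (Dom J a) s y)"

text \<open>The elementwise description of filtered colimits: everything that holds in \<open>X\<close> already holds at some
  stage of the diagram.\<close>

definition good_cocone :: "('s, 'f, 'r, 'l, 'u) pstruct \<Rightarrow> ('j \<Rightarrow> 's \<Rightarrow> 'u \<Rightarrow> 'u) \<Rightarrow> bool" where
  "good_cocone X k \<longleftrightarrow> compatible X k \<and>
     (\<forall>s. \<forall>x \<in> carr X s. \<exists>j \<in> Obj J. \<exists>y \<in> carr (dob j) s. k j s y = x) \<and>
     (\<forall>j \<in> Obj J. \<forall>s. \<forall>y \<in> carr (dob j) s. \<forall>y' \<in> carr (dob j) s. k j s y = k j s y' \<longrightarrow>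
        (\<exists>a \<in> Arr J. Dom J a = j \<and> dm a s y = dm a s y')) \<and>
     (\<forall>j \<in> Obj J. \<forall>f \<in> funs \<Sigma>. \<forall>b \<in> fun_args lam \<Sigma> (dob j) f. fint X f (fun_tuple lam \<Sigma> f (k j) b) \<noteq> None \<longrightarrow>
        (\<exists>a \<in> Arr J. Dom J a = j \<and> fint (dob (Cod J a)) f (fun_tuple lam \<Sigma> f (dm a) b) \<noteq> None)) \<and>
     (\<forall>j \<in> Obj J. \<forall>R \<in> rels \<Sigma>. \<forall>b \<in> rel_args lam \<Sigma> (dob j) R. rel_tuple lam \<Sigma> R (k j) b \<in> rint X R \<longrightarrow>
        (\<exists>a \<in> Arr J. Dom J a = j \<and> rel_tuple lam \<Sigma> R (dm a) b \<in> rint (dob (Cod J a)) R))"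

lemma compatibleD:
  assumes "compatible X k"
  shows "j \<in> Obj J \<Longrightarrow> hm (dob j) X (k j)"
    and "a \<in> Arr J \<Longrightarrow> y \<in> carr (dob (Dom J a)) s \<Longrightarrow> k (Cod J a) s (dm a s y) = k (Dom J a) s y"
  using assms unfolding compatible_def by blast+

lemma good_coconeD:
  assumes "good_cocone X k"
  shows "compatible X k"
    and "x \<in> carr X s \<Longrightarrow> \<exists>j \<in> Obj J. \<exists>y \<in> carr (dob j) s. k j s y = x"
    and "j \<in> Obj J \<Longrightarrow> y \<in> carr (dob j) s \<Longrightarrow> y' \<in> carr (dob j) s \<Longrightarrow> k j s y = k j s y' \<Longrightarrow>
      \<exists>a \<in> Arr J. Dom J a = j \<and> dm a s y = dm a s y'"
    and "j \<in> Obj J \<Longrightarrow> f \<in> funs \<Sigma> \<Longrightarrow> b \<in> fun_args lam \<Sigma> (dob j) f \<Longrightarrow>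
      fint X f (fun_tuple lam \<Sigma> f (k j) b) \<noteq> None \<Longrightarrow>
      \<exists>a \<in> Arr J. Dom J a = j \<and> fint (dob (Cod J a)) f (fun_tuple lam \<Sigma> f (dm a) b) \<noteq> None"
    and "j \<in> Obj J \<Longrightarrow> R \<in> rels \<Sigma> \<Longrightarrow> b' \<in> rel_args lam \<Sigma> (dob j) R \<Longrightarrow>
      rel_tuple lam \<Sigma> R (k j) b' \<in> rint X R \<Longrightarrow>
      \<exists>a \<in> Arr J. Dom J a = j \<and> rel_tuple lam \<Sigma> R (dm a) b' \<in> rint (dob (Cod J a)) R"
  using assms unfolding good_cocone_def by simp_all

lemma eventually_equal:
  assumes j: "j \<in> Obj J" and I: "|I| <o lam"
    and b: "\<And>i. i \<in> I \<Longrightarrow> b i \<in> carr (dob j) (s i)" "\<And>i. i \<in> I \<Longrightarrow> b' i \<in> carr (dob j) (s i)"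
    and eq: "\<And>i. i \<in> I \<Longrightarrow> \<exists>a \<in> Arr J. Dom J a = j \<and> dm a (s i) (b i) = dm a (s i) (b' i)"
  obtains a where "a \<in> Arr J" "Dom J a = j" "\<And>i. i \<in> I \<Longrightarrow> dm a (s i) (b i) = dm a (s i) (b' i)"
proof (rule eventually_ball[OF j I, of "\<lambda>i a. dm a (s i) (b i) = dm a (s i) (b' i)"])
  fix i a c assume "i \<in> I" "a \<in> Arr J" "Dom J a = j" "c \<in> Arr J" "Dom J c = Cod J a"
    "dm a (s i) (b i) = dm a (s i) (b' i)"
  then show "dm (Comp J c a) (s i) (b i) = dm (Comp J c a) (s i) (b' i)" using dm_Comp b by simp
qed (use eq that in blast)+

text \<open>The hypotheses concern \<open>k\<close> alone because the lemma also serves to construct the colimit.\<close>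

lemma tuple_merge:
  assumes comp: "\<And>a s y. a \<in> Arr J \<Longrightarrow> y \<in> carr (dob (Dom J a)) s \<Longrightarrow> k (Cod J a) s (dm a s y) = k (Dom J a) s y"
    and sep: "\<And>j s y y'. j \<in> Obj J \<Longrightarrow> y \<in> carr (dob j) s \<Longrightarrow> y' \<in> carr (dob j) s \<Longrightarrow> k j s y = k j s y' \<Longrightarrow>
      \<exists>a \<in> Arr J. Dom J a = j \<and> dm a s y = dm a s y'"
    and j: "j \<in> Obj J" "j' \<in> Obj J" and I: "|I| <o lam"
    and b: "\<And>i. i \<in> I \<Longrightarrow> b i \<in> carr (dob j) (s i)" "\<And>i. i \<in> I \<Longrightarrow> b' i \<in> carr (dob j') (s i)"
    and eq: "\<And>i. i \<in> I \<Longrightarrow> k j (s i) (b i) = k j' (s i) (b' i)"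
  obtains a a' where "a \<in> Arr J" "a' \<in> Arr J" "Dom J a = j" "Dom J a' = j'" "Cod J a = Cod J a'"
    "\<And>i. i \<in> I \<Longrightarrow> dm a (s i) (b i) = dm a' (s i) (b' i)"
proof -
  obtain u u' where u: "u \<in> Arr J" "u' \<in> Arr J" "Dom J u = j" "Dom J u' = j'" "Cod J u = Cod J u'"
    using merge_objects[OF j] .
  have cu: "Cod J u \<in> Obj J" using Arr_J u by blast
  have du: "dm u (s i) (b i) \<in> carr (dob (Cod J u)) (s i)" "dm u' (s i) (b' i) \<in> carr (dob (Cod J u)) (s i)"
    if "i \<in> I" for i
    using dm_carr[OF u(1), of "b i" "s i"] dm_carr[OF u(2), of "b' i" "s i"] b that u by auto
  \<comment> \<open>At a common stage the two tuples still have equal images under \<open>k\<close>.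
    Each coordinate is therefore equalized by some arrow, and one arrow serves all
    coordinates.\<close>
  obtain w where w: "w \<in> Arr J" "Dom J w = Cod J u"
    "\<And>i. i \<in> I \<Longrightarrow> dm w (s i) (dm u (s i) (b i)) = dm w (s i) (dm u' (s i) (b' i))"
  proof (rule eventually_equal[OF cu I du])
    fix i assume i: "i \<in> I"
    have "k (Cod J u) (s i) (dm u (s i) (b i)) = k (Cod J u) (s i) (dm u' (s i) (b' i))"
      using comp[OF u(1), of "b i" "s i"] comp[OF u(2), of "b' i" "s i"] b i eq u by simp
    from sep[OF cu du[OF i] this]
    show "\<exists>a \<in> Arr J. Dom J a = Cod J u \<and> dm a (s i) (dm u (s i) (b i)) = dm a (s i) (dm u' (s i) (b' i))" .
  qed auto
  show thesis
    by (rule that[of "Comp J w u" "Comp J w u'"])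
      (use Comp_J u w dm_Comp b in auto)
qed

lemma env_cocone:
  assumes k: "compatible X k" and a: "a \<in> Arr J"
    and e: "\<And>v. v \<in> V \<Longrightarrow> e v \<in> carr (dob (Dom J a)) (fst v)" and v: "v \<in> V"
  shows "k (Cod J a) (fst v) (dm a (fst v) (e v)) = k (Dom J a) (fst v) (e v)"
  using compatibleD(2)[OF k a e[OF v]] .

lemma term_push:
  assumes a: "a \<in> Arr J" "b \<in> Arr J" "Dom J b = Cod J a" and t: "raw_term lam \<Sigma> t s"
    and e: "\<And>v. v \<in> term_vars lam \<Sigma> t \<Longrightarrow> e v \<in> carr (dob (Dom J a)) (fst v)"
    and d: "term_val lam \<Sigma> (dob (Cod J a)) (\<lambda>v. dm a (fst v) (e v)) t = Some y"
  shows "term_val lam \<Sigma> (dob (Cod J b)) (\<lambda>v. dm (Comp J b a) (fst v) (e v)) t = Some (dm b s y)"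
proof -
  have "term_val lam \<Sigma> (dob (Cod J b)) (\<lambda>v. dm b (fst v) (dm a (fst v) (e v))) t = Some (dm b s y)"
    using term_val_hom[OF dob_model(2) dm_hm[OF a(2)] t] Arr_J a d by simp
  moreover have "term_val lam \<Sigma> (dob (Cod J b)) (\<lambda>v. dm b (fst v) (dm a (fst v) (e v))) t =
      term_val lam \<Sigma> (dob (Cod J b)) (\<lambda>v. dm (Comp J b a) (fst v) (e v)) t"
    by (rule term_val_cong) (simp add: dm_Comp[OF a e])
  ultimately show ?thesis by simp
qed

lemma fm_push:
  assumes a: "a \<in> Arr J" "b \<in> Arr J" "Dom J b = Cod J a" and \<phi>: "raw_formula lam \<Sigma> \<phi>"
    and e: "\<And>v. v \<in> fm_vars lam \<Sigma> \<phi> \<Longrightarrow> e v \<in> carr (dob (Dom J a)) (fst v)"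
    and d: "fm_holds lam \<Sigma> (dob (Cod J a)) (\<lambda>v. dm a (fst v) (e v)) \<phi>"
  shows "fm_holds lam \<Sigma> (dob (Cod J b)) (\<lambda>v. dm (Comp J b a) (fst v) (e v)) \<phi>"
proof -
  have "fm_holds lam \<Sigma> (dob (Cod J b)) (\<lambda>v. dm b (fst v) (dm a (fst v) (e v))) \<phi>"
    using fm_holds_hom[OF dob_model(2) dm_hm[OF a(2)] \<phi>] Arr_J a d by simp
  moreover have "fm_holds lam \<Sigma> (dob (Cod J b)) (\<lambda>v. dm b (fst v) (dm a (fst v) (e v))) \<phi> =
      fm_holds lam \<Sigma> (dob (Cod J b)) (\<lambda>v. dm (Comp J b a) (fst v) (e v)) \<phi>"
    by (rule fm_holds_cong) (simp add: dm_Comp[OF a e])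
  ultimately show ?thesis by simp
qed

lemma term_val_stage:
  assumes k: "compatible X k" and a: "a \<in> Arr J" and t: "raw_term lam \<Sigma> t s"
    and e: "\<And>v. v \<in> term_vars lam \<Sigma> t \<Longrightarrow> e v \<in> carr (dob (Dom J a)) (fst v)"
    and d: "term_val lam \<Sigma> (dob (Cod J a)) (\<lambda>v. dm a (fst v) (e v)) t = Some y"
  shows "term_val lam \<Sigma> X (\<lambda>v. k (Dom J a) (fst v) (e v)) t = Some (k (Cod J a) s y)"
    and "y \<in> carr (dob (Cod J a)) s"
proof -
  have ca: "Cod J a \<in> Obj J" using Arr_J a by blast
  have "term_val lam \<Sigma> X (\<lambda>v. k (Cod J a) (fst v) (dm a (fst v) (e v))) t = Some (k (Cod J a) s y)"
    using term_val_hom[OF dob_model(2)[OF ca] compatibleD(1)[OF k ca] t d] .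
  moreover have "term_val lam \<Sigma> X (\<lambda>v. k (Cod J a) (fst v) (dm a (fst v) (e v))) t =
      term_val lam \<Sigma> X (\<lambda>v. k (Dom J a) (fst v) (e v)) t"
    by (rule term_val_cong) (rule env_cocone[OF k a e])
  ultimately show "term_val lam \<Sigma> X (\<lambda>v. k (Dom J a) (fst v) (e v)) t = Some (k (Cod J a) s y)" by simp
  show "y \<in> carr (dob (Cod J a)) s"
    by (rule term_val_typed[OF t dob_model(2)[OF ca] _ d]) (use dm_carr[OF a e] in auto)
qed

text \<open>The arguments become defined at a common stage, by induction and
  \<open>eventually_ball\<close>. The application is then defined in \<open>X\<close> at the images
  of their values, so a further arrow makes it defined in the diagram.\<close>

lemma term_stage:
  assumes X: "ps X" and gc: "good_cocone X k" and j: "j \<in> Obj J"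
  shows "raw_term lam \<Sigma> t s \<Longrightarrow> (\<And>v. v \<in> term_vars lam \<Sigma> t \<Longrightarrow> e v \<in> carr (dob j) (fst v)) \<Longrightarrow>
    term_val lam \<Sigma> X (\<lambda>v. k j (fst v) (e v)) t \<noteq> None \<Longrightarrow>
    \<exists>a \<in> Arr J. Dom J a = j \<and> term_val lam \<Sigma> (dob (Cod J a)) (\<lambda>v. dm a (fst v) (e v)) t \<noteq> None"
proof (induction rule: raw_term.induct)
  case (1 v)
  then show ?case using Id_J[OF j] by auto
next
  case (2 f ts)
  note k = good_coconeD(1)[OF gc]
  have raw: "raw_term lam \<Sigma> (ts i) (fun_dom \<Sigma> f i)" if "i \<in> fun_idx lam \<Sigma> f" for i using 2(3) that by blast
  have ev: "e v \<in> carr (dob j) (fst v)" if "i \<in> fun_idx lam \<Sigma> f" "v \<in> term_vars lam \<Sigma> (ts i)" for i v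
    using 2(4)[of v] that by auto
  obtain a where a: "a \<in> Arr J" "Dom J a = j"
    and da: "\<And>i. i \<in> fun_idx lam \<Sigma> f \<Longrightarrow> term_val lam \<Sigma> (dob (Cod J a)) (\<lambda>v. dm a (fst v) (e v)) (ts i) \<noteq> None"
  proof (rule eventually_ball[OF j fun_idx_lam(1)[OF 2(1)],
        of "\<lambda>i a. term_val lam \<Sigma> (dob (Cod J a)) (\<lambda>v. dm a (fst v) (e v)) (ts i) \<noteq> None"])
    fix i assume i: "i \<in> fun_idx lam \<Sigma> f"
    have "term_val lam \<Sigma> X (\<lambda>v. k j (fst v) (e v)) (ts i) \<noteq> None"
      using 2(5) i by (auto split: if_splits)
    then show "\<exists>a \<in> Arr J. Dom J a = j \<and> term_val lam \<Sigma> (dob (Cod J a)) (\<lambda>v. dm a (fst v) (e v)) (ts i) \<noteq> None"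
      using 2(3) i ev[OF i] by blast
  next
    fix i a b assume i: "i \<in> fun_idx lam \<Sigma> f" and ab: "a \<in> Arr J" "Dom J a = j" "b \<in> Arr J" "Dom J b = Cod J a"
      and "term_val lam \<Sigma> (dob (Cod J a)) (\<lambda>v. dm a (fst v) (e v)) (ts i) \<noteq> None"
    then obtain y where y: "term_val lam \<Sigma> (dob (Cod J a)) (\<lambda>v. dm a (fst v) (e v)) (ts i) = Some y" by blast
    have ev': "e v \<in> carr (dob (Dom J a)) (fst v)" if "v \<in> term_vars lam \<Sigma> (ts i)" for v
      using ev[OF i that] ab(2) by simp
    show "term_val lam \<Sigma> (dob (Cod J (Comp J b a))) (\<lambda>v. dm (Comp J b a) (fst v) (e v)) (ts i) \<noteq> None"
      using term_push[OF ab(1,3,4) raw[OF i] ev' y] Comp_J(3)[OF ab(1,3,4)] by simp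
  qed blast
  define b where "b = (\<lambda>i \<in> fun_idx lam \<Sigma> f. the (term_val lam \<Sigma> (dob (Cod J a)) (\<lambda>v. dm a (fst v) (e v)) (ts i)))"
  have bi: "term_val lam \<Sigma> (dob (Cod J a)) (\<lambda>v. dm a (fst v) (e v)) (ts i) = Some (b i)"
    if "i \<in> fun_idx lam \<Sigma> f" for i
    using da[OF that] that by (auto simp: b_def)
  have Xi: "term_val lam \<Sigma> X (\<lambda>v. k j (fst v) (e v)) (ts i) = Some (k (Cod J a) (fun_dom \<Sigma> f i) (b i))"
    and bt: "b i \<in> carr (dob (Cod J a)) (fun_dom \<Sigma> f i)" if "i \<in> fun_idx lam \<Sigma> f" for i
    using term_val_stage[OF k a(1) raw[OF that] _ bi[OF that]] ev[OF that] a(2) by auto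
  have bargs: "b \<in> fun_args lam \<Sigma> (dob (Cod J a)) f" using bt by (auto simp: fun_args_def b_def)
  have "fun_tuple lam \<Sigma> f (k (Cod J a)) b =
      (\<lambda>i \<in> fun_idx lam \<Sigma> f. the (term_val lam \<Sigma> X (\<lambda>v. k j (fst v) (e v)) (ts i)))"
    using Xi by (auto simp: fun_tuple_def)
  then have "fint X f (fun_tuple lam \<Sigma> f (k (Cod J a)) b) \<noteq> None" using 2(5) by (auto split: if_splits)
  from good_coconeD(4)[OF gc Arr_J(2)[OF a(1)] 2(1) bargs this]
  obtain c where c: "c \<in> Arr J" "Dom J c = Cod J a" "fint (dob (Cod J c)) f (fun_tuple lam \<Sigma> f (dm c) b) \<noteq> None"
    by blast
  have ci: "term_val lam \<Sigma> (dob (Cod J c)) (\<lambda>v. dm (Comp J c a) (fst v) (e v)) (ts i) = Some (dm c (fun_dom \<Sigma> f i) (b i))"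
    if "i \<in> fun_idx lam \<Sigma> f" for i
    by (rule term_push[OF a(1) c(1,2) raw[OF that] _ bi[OF that]]) (use ev[OF that] a(2) in simp)
  have "fun_tuple lam \<Sigma> f (dm c) b =
      (\<lambda>i \<in> fun_idx lam \<Sigma> f. the (term_val lam \<Sigma> (dob (Cod J c)) (\<lambda>v. dm (Comp J c a) (fst v) (e v)) (ts i)))"
    using ci by (auto simp: fun_tuple_def)
  then have "term_val lam \<Sigma> (dob (Cod J c)) (\<lambda>v. dm (Comp J c a) (fst v) (e v)) (App f ts) \<noteq> None"
    using c(3) ci by simp
  then show ?case using Comp_J[OF a(1) c(1,2)] a(2) by (intro bexI[of _ "Comp J c a"]) auto
qed

text \<open>Terms are first made defined at one stage. A relation or an equation between their
  values that holds in \<open>X\<close> then appears after one further arrow, and conjunctions are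
  handled by \<open>eventually_ball\<close>.\<close>

lemma fm_stage:
  assumes X: "ps X" and gc: "good_cocone X k" and j: "j \<in> Obj J"
  shows "raw_formula lam \<Sigma> \<phi> \<Longrightarrow> (\<And>v. v \<in> fm_vars lam \<Sigma> \<phi> \<Longrightarrow> e v \<in> carr (dob j) (fst v)) \<Longrightarrow>
    fm_holds lam \<Sigma> X (\<lambda>v. k j (fst v) (e v)) \<phi> \<Longrightarrow>
    \<exists>a \<in> Arr J. Dom J a = j \<and> fm_holds lam \<Sigma> (dob (Cod J a)) (\<lambda>v. dm a (fst v) (e v)) \<phi>"
proof (induction rule: raw_formula.induct)
  case (1 R ts)
  note k = good_coconeD(1)[OF gc]
  have raw: "raw_term lam \<Sigma> (ts i) (rel_dom \<Sigma> R i)" if "i \<in> rel_idx lam \<Sigma> R" for i using 1(3) that by blast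
  have ev: "e v \<in> carr (dob j) (fst v)" if "i \<in> rel_idx lam \<Sigma> R" "v \<in> term_vars lam \<Sigma> (ts i)" for i v
    using 1(4)[of v] that by auto
  obtain a where a: "a \<in> Arr J" "Dom J a = j"
    and da: "\<And>i. i \<in> rel_idx lam \<Sigma> R \<Longrightarrow> term_val lam \<Sigma> (dob (Cod J a)) (\<lambda>v. dm a (fst v) (e v)) (ts i) \<noteq> None"
  proof (rule eventually_ball[OF j fun_idx_lam(2)[OF 1(1)],
        of "\<lambda>i a. term_val lam \<Sigma> (dob (Cod J a)) (\<lambda>v. dm a (fst v) (e v)) (ts i) \<noteq> None"])
    fix i assume i: "i \<in> rel_idx lam \<Sigma> R"
    have "term_val lam \<Sigma> X (\<lambda>v. k j (fst v) (e v)) (ts i) \<noteq> None"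
      using 1(5) i by auto
    then show "\<exists>a \<in> Arr J. Dom J a = j \<and> term_val lam \<Sigma> (dob (Cod J a)) (\<lambda>v. dm a (fst v) (e v)) (ts i) \<noteq> None"
      using term_stage[OF X gc j raw[OF i] ev[OF i]] by blast
  next
    fix i a b assume i: "i \<in> rel_idx lam \<Sigma> R" and ab: "a \<in> Arr J" "Dom J a = j" "b \<in> Arr J" "Dom J b = Cod J a"
      and "term_val lam \<Sigma> (dob (Cod J a)) (\<lambda>v. dm a (fst v) (e v)) (ts i) \<noteq> None"
    then obtain y where y: "term_val lam \<Sigma> (dob (Cod J a)) (\<lambda>v. dm a (fst v) (e v)) (ts i) = Some y" by blast
    have ev': "e v \<in> carr (dob (Dom J a)) (fst v)" if "v \<in> term_vars lam \<Sigma> (ts i)" for v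
      using ev[OF i that] ab(2) by simp
    show "term_val lam \<Sigma> (dob (Cod J (Comp J b a))) (\<lambda>v. dm (Comp J b a) (fst v) (e v)) (ts i) \<noteq> None"
      using term_push[OF ab(1,3,4) raw[OF i] ev' y] Comp_J(3)[OF ab(1,3,4)] by simp
  qed blast
  define b where "b = (\<lambda>i \<in> rel_idx lam \<Sigma> R. the (term_val lam \<Sigma> (dob (Cod J a)) (\<lambda>v. dm a (fst v) (e v)) (ts i)))"
  have bi: "term_val lam \<Sigma> (dob (Cod J a)) (\<lambda>v. dm a (fst v) (e v)) (ts i) = Some (b i)"
    if "i \<in> rel_idx lam \<Sigma> R" for i
    using da[OF that] that by (auto simp: b_def)
  have Xi: "term_val lam \<Sigma> X (\<lambda>v. k j (fst v) (e v)) (ts i) = Some (k (Cod J a) (rel_dom \<Sigma> R i) (b i))"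
    and bt: "b i \<in> carr (dob (Cod J a)) (rel_dom \<Sigma> R i)" if "i \<in> rel_idx lam \<Sigma> R" for i
    using term_val_stage[OF k a(1) raw[OF that] _ bi[OF that]] ev[OF that] a(2) by auto
  have bargs: "b \<in> rel_args lam \<Sigma> (dob (Cod J a)) R" using bt by (auto simp: rel_args_def b_def)
  have "rel_tuple lam \<Sigma> R (k (Cod J a)) b =
      (\<lambda>i \<in> rel_idx lam \<Sigma> R. the (term_val lam \<Sigma> X (\<lambda>v. k j (fst v) (e v)) (ts i)))"
    using Xi by (auto simp: rel_tuple_def)
  then have "rel_tuple lam \<Sigma> R (k (Cod J a)) b \<in> rint X R" using 1(5) by auto
  from good_coconeD(5)[OF gc Arr_J(2)[OF a(1)] 1(1) bargs this]
  obtain c where c: "c \<in> Arr J" "Dom J c = Cod J a" "rel_tuple lam \<Sigma> R (dm c) b \<in> rint (dob (Cod J c)) R"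
    by blast
  have ci: "term_val lam \<Sigma> (dob (Cod J c)) (\<lambda>v. dm (Comp J c a) (fst v) (e v)) (ts i) = Some (dm c (rel_dom \<Sigma> R i) (b i))"
    if "i \<in> rel_idx lam \<Sigma> R" for i
    by (rule term_push[OF a(1) c(1,2) raw[OF that] _ bi[OF that]]) (use ev[OF that] a(2) in simp)
  have "rel_tuple lam \<Sigma> R (dm c) b =
      (\<lambda>i \<in> rel_idx lam \<Sigma> R. the (term_val lam \<Sigma> (dob (Cod J c)) (\<lambda>v. dm (Comp J c a) (fst v) (e v)) (ts i)))"
    using ci by (auto simp: rel_tuple_def)
  then have "fm_holds lam \<Sigma> (dob (Cod J c)) (\<lambda>v. dm (Comp J c a) (fst v) (e v)) (Rel R ts)"
    using c(3) ci by simp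
  then show ?case using Comp_J[OF a(1) c(1,2)] a(2) by (intro bexI[of _ "Comp J c a"]) auto
next
  case (2 t s u)
  note k = good_coconeD(1)[OF gc]
  let ?d = "\<lambda>u a. term_val lam \<Sigma> (dob (Cod J a)) (\<lambda>v. dm a (fst v) (e v)) u"
  have Xd: "term_val lam \<Sigma> X (\<lambda>v. k j (fst v) (e v)) t \<noteq> None"
    "term_val lam \<Sigma> X (\<lambda>v. k j (fst v) (e v)) u \<noteq> None"
    "term_val lam \<Sigma> X (\<lambda>v. k j (fst v) (e v)) t = term_val lam \<Sigma> X (\<lambda>v. k j (fst v) (e v)) u"
    using 2(4) unfolding fm_holds.simps by metis+
  have raw: "raw_term lam \<Sigma> w s" and ev: "\<And>v. v \<in> term_vars lam \<Sigma> w \<Longrightarrow> e v \<in> carr (dob j) (fst v)"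
    if "w \<in> {t, u}" for w
    using 2 that by auto
  obtain a where a: "a \<in> Arr J" "Dom J a = j" and da: "\<And>w. w \<in> {t, u} \<Longrightarrow> ?d w a \<noteq> None"
  proof (rule eventually_ball[OF j lam_finite[of "{t, u}"], of "\<lambda>w a. ?d w a \<noteq> None"])
    show "\<exists>a \<in> Arr J. Dom J a = j \<and> ?d w a \<noteq> None" if "w \<in> {t, u}" for w
      by (rule term_stage[OF X gc j raw[OF that] ev[OF that]]) (use that Xd in auto)
  next
    fix w a b assume w: "w \<in> {t, u}" and ab: "a \<in> Arr J" "Dom J a = j" "b \<in> Arr J" "Dom J b = Cod J a"
      and "?d w a \<noteq> None"
    then obtain y where y: "?d w a = Some y" by blast
    have ev': "e v \<in> carr (dob (Dom J a)) (fst v)" if "v \<in> term_vars lam \<Sigma> w" for v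
      using ev[OF w that] ab(2) by simp
    show "?d w (Comp J b a) \<noteq> None"
      using term_push[OF ab(1,3,4) raw[OF w] ev' y] Comp_J(3)[OF ab(1,3,4)] by simp
  qed auto
  obtain y z where y: "?d t a = Some y" and z: "?d u a = Some z" using da[of t] da[of u] by auto
  have ev': "e v \<in> carr (dob (Dom J a)) (fst v)" if "w \<in> {t, u}" "v \<in> term_vars lam \<Sigma> w" for v w
    using ev[OF that] a(2) by simp
  have yz: "y \<in> carr (dob (Cod J a)) s" "z \<in> carr (dob (Cod J a)) s"
    "k (Cod J a) s y = k (Cod J a) s z"
    using term_val_stage[OF k a(1) 2(1) ev'[of t] y] term_val_stage[OF k a(1) 2(2) ev'[of u] z] Xd(3) a(2)
    by auto
  from good_coconeD(3)[OF gc Arr_J(2)[OF a(1)] yz]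
  obtain c where c: "c \<in> Arr J" "Dom J c = Cod J a" "dm c s y = dm c s z" by blast
  have "?d t (Comp J c a) = Some (dm c s y)" "?d u (Comp J c a) = Some (dm c s z)"
    using term_push[OF a(1) c(1,2) 2(1) ev'[of t] y] term_push[OF a(1) c(1,2) 2(2) ev'[of u] z]
      Comp_J(3)[OF a(1) c(1,2)] by auto
  then have "fm_holds lam \<Sigma> (dob (Cod J (Comp J c a))) (\<lambda>v. dm (Comp J c a) (fst v) (e v)) (Eq t u)"
    using c(3) by simp
  moreover have "Comp J c a \<in> Arr J" "Dom J (Comp J c a) = j" using Comp_J[OF a(1) c(1,2)] a(2) by simp_all
  ultimately show ?case by blast
next
  case 3
  then show ?case using Id_J[OF j] by auto
next
  case (4 \<alpha> \<phi>)
  have raw: "raw_formula lam \<Sigma> (\<phi> i)" if "i \<in> underS lam \<alpha>" for i using 4(3) that by blast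
  have ev: "e v \<in> carr (dob j) (fst v)" if "i \<in> underS lam \<alpha>" "v \<in> fm_vars lam \<Sigma> (\<phi> i)" for i v
    using 4(4)[of v] that by auto
  obtain a where a: "a \<in> Arr J" "Dom J a = j"
    and da: "\<And>i. i \<in> underS lam \<alpha> \<Longrightarrow> fm_holds lam \<Sigma> (dob (Cod J a)) (\<lambda>v. dm a (fst v) (e v)) (\<phi> i)"
  proof (rule eventually_ball[OF j lam_underS[OF 4(1)],
        of "\<lambda>i a. fm_holds lam \<Sigma> (dob (Cod J a)) (\<lambda>v. dm a (fst v) (e v)) (\<phi> i)"])
    fix i assume i: "i \<in> underS lam \<alpha>"
    have "fm_holds lam \<Sigma> X (\<lambda>v. k j (fst v) (e v)) (\<phi> i)" using 4(5) i by simp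
    then show "\<exists>a \<in> Arr J. Dom J a = j \<and> fm_holds lam \<Sigma> (dob (Cod J a)) (\<lambda>v. dm a (fst v) (e v)) (\<phi> i)"
      using 4(3) i ev[OF i] by blast
  next
    fix i a b assume i: "i \<in> underS lam \<alpha>" and ab: "a \<in> Arr J" "Dom J a = j" "b \<in> Arr J" "Dom J b = Cod J a"
      and d: "fm_holds lam \<Sigma> (dob (Cod J a)) (\<lambda>v. dm a (fst v) (e v)) (\<phi> i)"
    have ev': "e v \<in> carr (dob (Dom J a)) (fst v)" if "v \<in> fm_vars lam \<Sigma> (\<phi> i)" for v
      using ev[OF i that] ab(2) by simp
    show "fm_holds lam \<Sigma> (dob (Cod J (Comp J b a))) (\<lambda>v. dm (Comp J b a) (fst v) (e v)) (\<phi> i)"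
      using fm_push[OF ab(1,3,4) raw[OF i] ev' d] Comp_J(3)[OF ab(1,3,4)] by simp
  qed blast
  then show ?case by (intro bexI[of _ a]) auto
qed

text \<open>Each entry comes from some stage, and fewer than \<open>lam\<close> stages have a common
  upper bound to which all entries can be moved.\<close>

lemma lift_tuple:
  assumes gc: "good_cocone X k" and I: "|I| <o lam" and x: "\<And>i. i \<in> I \<Longrightarrow> x i \<in> carr X (s i)"
  obtains j b where "j \<in> Obj J" "\<And>i. i \<in> I \<Longrightarrow> b i \<in> carr (dob j) (s i)"
    "\<And>i. i \<in> I \<Longrightarrow> k j (s i) (b i) = x i"
proof -
  have "\<forall>i \<in> I. \<exists>jy. fst jy \<in> Obj J \<and> snd jy \<in> carr (dob (fst jy)) (s i) \<and> k (fst jy) (s i) (snd jy) = x i"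
    using good_coconeD(2)[OF gc x] by fastforce
  from bchoice[OF this] obtain g where g: "\<forall>i \<in> I. fst (g i) \<in> Obj J \<and>
    snd (g i) \<in> carr (dob (fst (g i))) (s i) \<and> k (fst (g i)) (s i) (snd (g i)) = x i" ..
  obtain c where c: "c \<in> Obj J" "\<And>x. x \<in> (\<lambda>i. fst (g i)) ` I \<Longrightarrow> Defs.hom J x c \<noteq> {}"
  proof (rule bound_J[of "(\<lambda>i. fst (g i)) ` I"])
    show "(\<lambda>i. fst (g i)) ` I \<subseteq> Obj J" using g by blast
    show "|(\<lambda>i. fst (g i)) ` I| <o lam" by (rule lam_image[OF I])
  qed (rule that, assumption+)
  have "\<forall>i \<in> I. \<exists>a. a \<in> Arr J \<and> Dom J a = fst (g i) \<and> Cod J a = c"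
  proof
    fix i assume "i \<in> I"
    then have "Defs.hom J (fst (g i)) c \<noteq> {}" using c(2) by blast
    then show "\<exists>a. a \<in> Arr J \<and> Dom J a = fst (g i) \<and> Cod J a = c" by (auto simp: Defs.hom_def)
  qed
  from bchoice[OF this] obtain a where a: "\<forall>i \<in> I. a i \<in> Arr J \<and> Dom J (a i) = fst (g i) \<and> Cod J (a i) = c" ..
  show thesis
  proof (rule that[OF c(1), of "\<lambda>i. dm (a i) (s i) (snd (g i))"])
    fix i assume i: "i \<in> I"
    have ai: "a i \<in> Arr J" "Dom J (a i) = fst (g i)" "Cod J (a i) = c" using a i by auto
    have gi: "snd (g i) \<in> carr (dob (Dom J (a i))) (s i)" using g i ai by simp
    show "dm (a i) (s i) (snd (g i)) \<in> carr (dob c) (s i)" using dm_carr[OF ai(1) gi] ai(3) by simp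
    show "k c (s i) (dm (a i) (s i) (snd (g i))) = x i"
      using compatibleD(2)[OF good_coconeD(1)[OF gc] ai(1) gi] ai g i by simp
  qed
qed

lemma lift_ctx:
  assumes gc: "good_cocone X k" and x: "is_context lam \<Sigma> x" and m: "m \<in> ctx_prod lam X x"
  obtains j m' where "j \<in> Obj J" "m' \<in> ctx_prod lam (dob j) x" "ctx_map x (k j) m' = m"
proof -
  have mi: "m i \<in> carr X (fst (ctx_var x i))" if "i \<in> ctx_idx lam x" for i
    using m that by (auto simp: ctx_prod_def)
  obtain j b where j: "j \<in> Obj J" and b: "\<And>i. i \<in> ctx_idx lam x \<Longrightarrow> b i \<in> carr (dob j) (fst (ctx_var x i))"
    "\<And>i. i \<in> ctx_idx lam x \<Longrightarrow> k j (fst (ctx_var x i)) (b i) = m i"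
    by (rule lift_tuple[OF gc ctx_idx_lam[OF x], of m "\<lambda>i. fst (ctx_var x i)"]) (erule mi, rule that)
  show thesis
    by (rule that[OF j, of "\<lambda>i \<in> ctx_idx lam x. b i"])
      (use b m in \<open>auto simp: ctx_prod_def ctx_map_def PiE_iff extensional_def intro!: ext\<close>)
qed

lemma ctx_fm_stage:
  assumes X: "ps X" and gc: "good_cocone X k" and j: "j \<in> Obj J" and \<phi>: "fm_in_ctx lam \<Sigma> x \<phi>"
    and m: "m \<in> ctx_prod lam (dob j) x" and h: "fm_holds lam \<Sigma> X (ctx_env lam x (ctx_map x (k j) m)) \<phi>"
  obtains a where "a \<in> Arr J" "Dom J a = j"
    "fm_holds lam \<Sigma> (dob (Cod J a)) (ctx_env lam x (ctx_map x (dm a) m)) \<phi>"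
proof -
  have x: "is_context lam \<Sigma> x" and raw: "raw_formula lam \<Sigma> \<phi>" using \<phi> by (auto simp: fm_in_ctx_def)
  have e: "ctx_env lam x m v \<in> carr (dob j) (fst v)" if "v \<in> fm_vars lam \<Sigma> \<phi>" for v
    using ctx_env_typed[OF x m, of v] \<phi> that unfolding fm_in_ctx_def by blast
  have "fm_holds lam \<Sigma> X (\<lambda>v. k j (fst v) (ctx_env lam x m v)) \<phi>"
    using h ctx_fm_map_cong[OF \<phi>] by simp
  from fm_stage[OF X gc j raw e this] show thesis using that ctx_fm_map_cong[OF \<phi>] by blast
qed

lemma fint_stage:
  assumes X: "ps X" and gc: "good_cocone X k" and f: "f \<in> funs \<Sigma>" and y: "fint X f a = Some y"
  obtains j b z where "j \<in> Obj J" "b \<in> fun_args lam \<Sigma> (dob j) f" "fint (dob j) f b = Some z"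
    "fun_tuple lam \<Sigma> f (k j) b = a" "k j (fun_cod \<Sigma> f) z = y"
proof -
  have args: "a \<in> fun_args lam \<Sigma> X f" by (rule fintD(1)[OF X f y])
  obtain j b where j: "j \<in> Obj J" and b: "\<And>i. i \<in> fun_idx lam \<Sigma> f \<Longrightarrow> b i \<in> carr (dob j) (fun_dom \<Sigma> f i)"
    "\<And>i. i \<in> fun_idx lam \<Sigma> f \<Longrightarrow> k j (fun_dom \<Sigma> f i) (b i) = a i"
    by (rule lift_tuple[OF gc fun_idx_lam(1)[OF f], of a "fun_dom \<Sigma> f"])
      (use args in \<open>simp add: fun_args_def PiE_iff\<close>, rule that, assumption+)
  let ?b = "\<lambda>i \<in> fun_idx lam \<Sigma> f. b i"
  have b': "?b \<in> fun_args lam \<Sigma> (dob j) f" using b by (auto simp: fun_args_def)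
  have kb: "fun_tuple lam \<Sigma> f (k j) ?b = a"
    using b args by (auto simp: fun_tuple_def fun_args_def PiE_iff extensional_def intro!: ext)
  have "fint X f (fun_tuple lam \<Sigma> f (k j) ?b) \<noteq> None" using kb y by simp
  from good_coconeD(4)[OF gc j f b' this]
  obtain c z where c: "c \<in> Arr J" "Dom J c = j" and z: "fint (dob (Cod J c)) f (fun_tuple lam \<Sigma> f (dm c) ?b) = Some z"
    by blast
  have cc: "Cod J c \<in> Obj J" using Arr_J c by blast
  have kc: "fun_tuple lam \<Sigma> f (k (Cod J c)) (fun_tuple lam \<Sigma> f (dm c) ?b) = a"
  proof -
    have "k (Cod J c) (fun_dom \<Sigma> f i) (dm c (fun_dom \<Sigma> f i) (b i)) = k j (fun_dom \<Sigma> f i) (b i)"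
      if "i \<in> fun_idx lam \<Sigma> f" for i
      using compatibleD(2)[OF good_coconeD(1)[OF gc] c(1)] b(1)[OF that] c(2) by simp
    then show ?thesis unfolding kb[symmetric] by (auto simp: fun_tuple_def)
  qed
  have "fint X f a = Some (k (Cod J c) (fun_cod \<Sigma> f) z)"
    using hmD(2)[OF compatibleD(1)[OF good_coconeD(1)[OF gc] cc] dob_model(2)[OF cc] f z] kc by simp
  then show thesis using that[OF cc _ z kc] y fintD(1)[OF dob_model(2)[OF cc] f z] by simp
qed

lemma rint_stage:
  assumes X: "ps X" and gc: "good_cocone X k" and R: "R \<in> rels \<Sigma>" and y: "a \<in> rint X R"
  obtains j b where "j \<in> Obj J" "b \<in> rint (dob j) R" "rel_tuple lam \<Sigma> R (k j) b = a"
proof -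
  have args: "a \<in> rel_args lam \<Sigma> X R" by (rule fintD(3)[OF X R y])
  obtain j b where j: "j \<in> Obj J" and b: "\<And>i. i \<in> rel_idx lam \<Sigma> R \<Longrightarrow> b i \<in> carr (dob j) (rel_dom \<Sigma> R i)"
    "\<And>i. i \<in> rel_idx lam \<Sigma> R \<Longrightarrow> k j (rel_dom \<Sigma> R i) (b i) = a i"
    by (rule lift_tuple[OF gc fun_idx_lam(2)[OF R], of a "rel_dom \<Sigma> R"])
      (use args in \<open>simp add: rel_args_def PiE_iff\<close>, rule that, assumption+)
  let ?b = "\<lambda>i \<in> rel_idx lam \<Sigma> R. b i"
  have b': "?b \<in> rel_args lam \<Sigma> (dob j) R" using b by (auto simp: rel_args_def)
  have kb: "rel_tuple lam \<Sigma> R (k j) ?b = a"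
    using b args by (auto simp: rel_tuple_def rel_args_def PiE_iff extensional_def intro!: ext)
  have "rel_tuple lam \<Sigma> R (k j) ?b \<in> rint X R" using kb y by simp
  from good_coconeD(5)[OF gc j R b' this]
  obtain c where c: "c \<in> Arr J" "Dom J c = j" and z: "rel_tuple lam \<Sigma> R (dm c) ?b \<in> rint (dob (Cod J c)) R"
    by blast
  have "k (Cod J c) (rel_dom \<Sigma> R i) (dm c (rel_dom \<Sigma> R i) (b i)) = k j (rel_dom \<Sigma> R i) (b i)"
    if "i \<in> rel_idx lam \<Sigma> R" for i
    using compatibleD(2)[OF good_coconeD(1)[OF gc] c(1)] b(1)[OF that] c(2) by simp
  then have "rel_tuple lam \<Sigma> R (k (Cod J c)) (rel_tuple lam \<Sigma> R (dm c) ?b) = a"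
    unfolding kb[symmetric] by (auto simp: rel_tuple_def)
  then show thesis using that z Arr_J(2)[OF c(1)] by blast
qed

text \<open>A tuple satisfying the premise is lifted to a stage where the premise already holds. The
  sequent gives the conclusion at that stage, and the cocone carries it to \<open>X\<close>.\<close>

lemma good_cocone_valid:
  assumes X: "ps X" and gc: "good_cocone X k" and \<phi>: "fm_in_ctx lam \<Sigma> x \<phi>" and \<psi>: "fm_in_ctx lam \<Sigma> x \<psi>"
    and v: "\<And>j. j \<in> Obj J \<Longrightarrow> valid_in lam \<Sigma> (dob j) (Sequent x \<phi> \<psi>)"
  shows "valid_in lam \<Sigma> X (Sequent x \<phi> \<psi>)"
proof (rule valid_inI)
  fix m assume m: "m \<in> ctx_prod lam X x" and h: "fm_holds lam \<Sigma> X (ctx_env lam x m) \<phi>"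
  have x: "is_context lam \<Sigma> x" using \<phi> by (simp add: fm_in_ctx_def)
  obtain j m' where j: "j \<in> Obj J" and m': "m' \<in> ctx_prod lam (dob j) x" "ctx_map x (k j) m' = m"
    using lift_ctx[OF gc x m] .
  obtain a where a: "a \<in> Arr J" "Dom J a = j"
    and ha: "fm_holds lam \<Sigma> (dob (Cod J a)) (ctx_env lam x (ctx_map x (dm a) m')) \<phi>"
    by (rule ctx_fm_stage[OF X gc j \<phi> m'(1)]) (use h m' in simp, rule that, assumption+)
  have ca: "Cod J a \<in> Obj J" using Arr_J a by blast
  have "ctx_map x (dm a) m' \<in> ctx_prod lam (dob (Cod J a)) x"
    by (rule ctx_map_prod[OF dm_hm[OF a(1)]]) (use m' a in simp)
  from valid_inD[OF v[OF ca] this ha]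
  have "fm_holds lam \<Sigma> X (ctx_env lam x (ctx_map x (k (Cod J a)) (ctx_map x (dm a) m'))) \<psi>"
    by (rule ctx_fm_hom[OF dob_model(2)[OF ca] compatibleD(1)[OF good_coconeD(1)[OF gc] ca] \<psi>])
  moreover have "ctx_map x (k (Cod J a)) (ctx_map x (dm a) m') = m"
  proof -
    have "k (Cod J a) (fst (ctx_var x i)) (dm a (fst (ctx_var x i)) (m' i)) = k j (fst (ctx_var x i)) (m' i)"
      if "i \<in> ctx_idx lam x" for i
      using compatibleD(2)[OF good_coconeD(1)[OF gc] a(1)] a(2) m'(1) that by (auto simp: ctx_prod_def)
    then show ?thesis unfolding m'(2)[symmetric] by (auto simp: ctx_map_def)
  qed
  ultimately show "fm_holds lam \<Sigma> X (ctx_env lam x m) \<psi>" by simp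
qed

lemma good_cocone_model:
  assumes X: "ps X" and gc: "good_cocone X k"
  shows "model T X"
proof -
  have "valid_in lam \<Sigma> X \<sigma>" if \<sigma>: "\<sigma> \<in> T" for \<sigma>
  proof (cases \<sigma>)
    case (Sequent x \<phi> \<psi>)
    have "is_sequent lam \<Sigma> \<sigma>" using horn \<sigma> by (simp add: is_horn_theory_def)
    then have "fm_in_ctx lam \<Sigma> x \<phi>" "fm_in_ctx lam \<Sigma> x \<psi>" using Sequent by auto
    then show ?thesis unfolding Sequent
      by (rule good_cocone_valid[OF X gc])
        (use dob_model(1) \<sigma> Sequent in \<open>auto simp: is_model_def simp del: valid_in.simps\<close>)
  qed
  then show ?thesis using X by (simp add: is_model_def)
qed

lemma is_cocone_iff:
  "is_cocone J (Mod T) D X k \<longleftrightarrow> model T X \<and> compatible X (\<lambda>j. maps (k j)) \<and>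
     (\<forall>j \<in> Obj J. k j = Arrow (dob j) (maps (k j)) X)"
proof (intro iffI conjI)
  assume c: "is_cocone J (Mod T) D X k"
  show "model T X" using c by (simp add: is_cocone_def Mod_simps)
  have kj: "k j \<in> Defs.hom (Mod T) (dob j) X" if "j \<in> Obj J" for j
    using c that by (simp add: is_cocone_def)
  show "\<forall>j \<in> Obj J. k j = Arrow (dob j) (maps (k j)) X" using Mod_homD(1)[OF kj] by blast
  show "compatible X (\<lambda>j. maps (k j))"
    unfolding compatible_def
  proof (intro conjI ballI allI)
    show "hm (dob j) X (maps (k j))" if "j \<in> Obj J" for j using Mod_homD(6)[OF kj[OF that]] .
    fix a s y assume a: "a \<in> Arr J" and y: "y \<in> carr (dob (Dom J a)) s"
    have "Comp (Mod T) (k (Cod J a)) (farr D a) = k (Dom J a)" using c a by (simp add: is_cocone_def)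
    then have "hcomp (dob (Dom J a)) (maps (k (Cod J a))) (dm a) = maps (k (Dom J a))"
      using maps_Comp[of T "k (Cod J a)" "farr D a"] Mod_homD(2)[OF dm_hom[OF a]] by simp
    then show "maps (k (Cod J a)) s (dm a s y) = maps (k (Dom J a)) s y" by (rule hcomp_eqD[OF _ y])
  qed
next
  assume a: "model T X \<and> compatible X (\<lambda>j. maps (k j)) \<and> (\<forall>j \<in> Obj J. k j = Arrow (dob j) (maps (k j)) X)"
  show "is_cocone J (Mod T) D X k"
    unfolding is_cocone_def
  proof (intro conjI ballI)
    show "X \<in> Obj (Mod T)" using a by (simp add: Mod_simps)
    fix j assume j: "j \<in> Obj J"
    have "hm (dob j) X (maps (k j))" by (rule compatibleD(1)[OF _ j]) (use a in blast)
    then have "Arrow (dob j) (maps (k j)) X \<in> Defs.hom (Mod T) (dob j) X"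
      using a dob_model[OF j] by (simp add: Mod_hom)
    then show "k j \<in> Defs.hom (Mod T) (dob j) X" using a j by metis
  next
    fix b assume b: "b \<in> Arr J"
    have k: "k (Cod J b) = Arrow (dob (Cod J b)) (maps (k (Cod J b))) X"
      "k (Dom J b) = Arrow (dob (Dom J b)) (maps (k (Dom J b))) X" using a Arr_J b by auto
    have "hcomp (dob (Dom J b)) (maps (k (Cod J b))) (dm b) = maps (k (Dom J b))"
      using hcomp_eq_iff[OF compatibleD(1)] compatibleD(2) a b Arr_J(1)[OF b] by blast
    moreover have "farr D b = Arrow (dob (Dom J b)) (dm b) (dob (Cod J b))" using Mod_homD(1)[OF dm_hom[OF b]] .
    ultimately show "Comp (Mod T) (k (Cod J b)) (farr D b) = k (Dom J b)"
      using k Mod_simps(6) by metis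
  qed
qed

text \<open>The value at an element is read off any representative. Two representatives meet at a
  common stage, and compatibility of \<open>l\<close> gives them the same image. Facts about
  functions and relations in \<open>X\<close> come from stages, where \<open>l\<close> preserves
  them.\<close>

lemma good_cocone_factor:
  assumes X: "ps X" and gc: "good_cocone X k" and Y: "ps Y" and l: "compatible Y l"
  obtains u where "hm X Y u" "\<And>j s y. j \<in> Obj J \<Longrightarrow> y \<in> carr (dob j) s \<Longrightarrow> u s (k j s y) = l j s y"
proof -
  note k = good_coconeD(1)[OF gc]
  have wd: "l j s y = l j' s y'"
    if j: "j \<in> Obj J" "j' \<in> Obj J" and y: "y \<in> carr (dob j) s" "y' \<in> carr (dob j') s"
      and eq: "k j s y = k j' s y'" for j j' s y y'
  proof -
    obtain a a' where a: "a \<in> Arr J" "a' \<in> Arr J" "Dom J a = j" "Dom J a' = j'" "Cod J a = Cod J a'"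
      "\<And>i. i \<in> {()} \<Longrightarrow> dm a s y = dm a' s y'"
      by (rule tuple_merge[of k j j' "{()}" "\<lambda>_. y" "\<lambda>_. s" "\<lambda>_. y'"])
        (use compatibleD(2)[OF k] good_coconeD(3)[OF gc] j y eq lam_finite[of "{()}"] in blast)+
    show ?thesis
      using compatibleD(2)[OF l a(1), of y s] compatibleD(2)[OF l a(2), of y' s] y a by simp
  qed
  define u where "u s = (\<lambda>x \<in> carr X s. THE z. \<exists>j \<in> Obj J. \<exists>y \<in> carr (dob j) s. k j s y = x \<and> z = l j s y)" for s
  have uk: "u s (k j s y) = l j s y" if "j \<in> Obj J" "y \<in> carr (dob j) s" for j s y
  proof -
    have "(THE z. \<exists>j' \<in> Obj J. \<exists>y' \<in> carr (dob j') s. k j' s y' = k j s y \<and> z = l j' s y') = l j s y"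
      by (rule the_equality) (use that wd in blast)+
    then show ?thesis using hmD(1)[OF compatibleD(1)[OF k that(1)] that(2)] by (simp add: u_def)
  qed
  have "hm X Y u"
    unfolding is_homomorphism_def
  proof (intro conjI allI ballI impI)
    fix s
    have "u s x \<in> carr Y s" if x: "x \<in> carr X s" for x
    proof -
      obtain j y where "j \<in> Obj J" "y \<in> carr (dob j) s" "k j s y = x" using good_coconeD(2)[OF gc x] by blast
      then show ?thesis using uk hmD(1)[OF compatibleD(1)[OF l]] by metis
    qed
    then show "u s \<in> carr X s \<rightarrow>\<^sub>E carr Y s" by (auto simp: u_def)
  next
    fix f a y assume f: "f \<in> funs \<Sigma>" and y: "fint X f a = Some y"
    obtain j b z where j: "j \<in> Obj J" and b: "b \<in> fun_args lam \<Sigma> (dob j) f" and z: "fint (dob j) f b = Some z"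
      and a: "fun_tuple lam \<Sigma> f (k j) b = a" and yz: "k j (fun_cod \<Sigma> f) z = y"
      using fint_stage[OF X gc f y] .
    have "fun_tuple lam \<Sigma> f u a = fun_tuple lam \<Sigma> f (l j) b"
      unfolding a[symmetric] using uk[OF j] b by (auto simp: fun_tuple_def fun_args_def PiE_iff)
    moreover have "u (fun_cod \<Sigma> f) y = l j (fun_cod \<Sigma> f) z"
      using uk[OF j] fintD(2)[OF dob_model(2)[OF j] f z] yz by blast
    ultimately show "fint Y f (fun_tuple lam \<Sigma> f u a) = Some (u (fun_cod \<Sigma> f) y)"
      using hmD(2)[OF compatibleD(1)[OF l j] dob_model(2)[OF j] f z] by simp
  next
    fix R a assume R: "R \<in> rels \<Sigma>" and y: "a \<in> rint X R"
    obtain j b where j: "j \<in> Obj J" and b: "b \<in> rint (dob j) R" and a: "rel_tuple lam \<Sigma> R (k j) b = a"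
      using rint_stage[OF X gc R y] .
    have "rel_tuple lam \<Sigma> R u a = rel_tuple lam \<Sigma> R (l j) b"
      unfolding a[symmetric] using uk[OF j] fintD(3)[OF dob_model(2)[OF j] R b]
      by (auto simp: rel_tuple_def rel_args_def PiE_iff)
    then show "rel_tuple lam \<Sigma> R u a \<in> rint Y R"
      using hmD(3)[OF compatibleD(1)[OF l j] dob_model(2)[OF j] R b] by simp
  qed
  then show thesis using that uk by blast
qed

lemma good_cocone_is_colimit:
  assumes X: "ps X" and gc: "good_cocone X k"
  shows "is_colimit J (Mod T) D X (\<lambda>j. Arrow (dob j) (k j) X)"
  unfolding is_colimit_def
proof (intro conjI allI impI)
  note k = good_coconeD(1)[OF gc]
  have mX: "model T X" by (rule good_cocone_model[OF X gc])
  show "is_cocone J (Mod T) D X (\<lambda>j. Arrow (dob j) (k j) X)"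
    using mX k by (simp add: is_cocone_iff)
  fix Y l assume c: "is_cocone J (Mod T) D Y l"
  then have Y: "model T Y" "compatible Y (\<lambda>j. maps (l j))" and l: "\<forall>j \<in> Obj J. l j = Arrow (dob j) (maps (l j)) Y"
    by (simp_all add: is_cocone_iff)
  obtain u where u: "hm X Y u" "\<And>j s y. j \<in> Obj J \<Longrightarrow> y \<in> carr (dob j) s \<Longrightarrow> u s (k j s y) = maps (l j) s y"
    by (rule good_cocone_factor[OF X gc model_ps[OF Y(1)] Y(2)]) (rule that)
  show "\<exists>!u. u \<in> Defs.hom (Mod T) X Y \<and> (\<forall>j \<in> Obj J. Comp (Mod T) u (Arrow (dob j) (k j) X) = l j)"
  proof (rule ex1I[of _ "Arrow X u Y"], intro conjI ballI)
    show "Arrow X u Y \<in> Defs.hom (Mod T) X Y" using mX Y u by (simp add: Mod_hom)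
    fix j assume j: "j \<in> Obj J"
    have "hcomp (dob j) u (k j) = maps (l j)"
      using hcomp_eq_iff[OF compatibleD(1)[OF Y(2) j]] u(2)[OF j] by blast
    then show "Comp (Mod T) (Arrow X u Y) (Arrow (dob j) (k j) X) = l j"
      using l j Mod_simps(6) by metis
  next
    fix w assume w: "w \<in> Defs.hom (Mod T) X Y \<and> (\<forall>j \<in> Obj J. Comp (Mod T) w (Arrow (dob j) (k j) X) = l j)"
    then have "w \<in> Defs.hom (Mod T) X Y" by blast
    then have wh: "w = Arrow X (maps w) Y" "hm X Y (maps w)" by (rule Mod_homD)+
    have "maps w = u"
    proof (rule hm_ext[OF wh(2) u(1)])
      fix s x assume "x \<in> carr X s"
      then obtain j y where j: "j \<in> Obj J" and y: "y \<in> carr (dob j) s" "k j s y = x"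
        using good_coconeD(2)[OF gc] by blast
      have "Comp (Mod T) w (Arrow (dob j) (k j) X) = l j" using w j by blast
      then have "hcomp (dob j) (maps w) (k j) = maps (l j)"
        using maps_Comp[of T w "Arrow (dob j) (k j) X"] by simp
      from hcomp_eqD[OF this y(1)] show "maps w s x = u s x" using u(2)[OF j y(1)] y(2) by simp
    qed
    then show "w = Arrow X u Y" using wh by simp
  qed
qed

text \<open>The disjoint union of the stages modulo eventual equality, with classes encoded in
  \<open>'u\<close>. Functions are defined, and relations hold, as soon as they do so at some
  stage.\<close>

lemma good_cocone_exists:
  obtains X k where "ps X" "good_cocone X k"
proof -
  define El where "El s = (SIGMA j:Obj J. carr (dob j) s)" for s
  define sim where "sim s p q \<longleftrightarrow> (\<exists>a \<in> Arr J. \<exists>a' \<in> Arr J. Dom J a = fst p \<and> Dom J a' = fst q \<and>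
    Cod J a = Cod J a' \<and> dm a s (snd p) = dm a' s (snd q))" for s p q
  define cls where "cls s p = {q \<in> El s. sim s p q}" for s p
  have sim_refl: "sim s p p" if "p \<in> El s" for s p
    using that Id_J[of "fst p"] unfolding sim_def El_def by fastforce
  have sim_sym: "sim s q p" if "sim s p q" for s p q using that unfolding sim_def by metis
  \<comment> \<open>The two arrows that leave the stage of the middle element \<open>q\<close> are
    completed to one common arrow \<open>w\<close>, and the outer arrows are prolonged
    accordingly.\<close>
  have sim_trans: "sim s p r" if pqr: "p \<in> El s" "q \<in> El s" "r \<in> El s" and pq: "sim s p q" and qr: "sim s q r" for s p q r
  proof -
    obtain a a' where a: "a \<in> Arr J" "a' \<in> Arr J" "Dom J a = fst p" "Dom J a' = fst q" "Cod J a = Cod J a'"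
      "dm a s (snd p) = dm a' s (snd q)" using pq unfolding sim_def by blast
    obtain b b' where b: "b \<in> Arr J" "b' \<in> Arr J" "Dom J b = fst q" "Dom J b' = fst r" "Cod J b = Cod J b'"
      "dm b s (snd q) = dm b' s (snd r)" using qr unfolding sim_def by blast
    have q: "fst q \<in> Obj J" using pqr by (auto simp: El_def)
    obtain w where w: "w \<in> Arr J" "Dom J w = fst q"
      "\<And>f. f \<in> {a', b} \<Longrightarrow> \<exists>c \<in> Arr J. Dom J c = Cod J f \<and> Comp J c f = w"
    proof (rule common_extension[OF q, of "{a', b}"])
      show "|{a', b}| <o lam" by (rule lam_finite) simp
    qed (use a b in auto)
    obtain c where c: "c \<in> Arr J" "Dom J c = Cod J a'" "Comp J c a' = w" using w(3) by blast
    obtain d where d: "d \<in> Arr J" "Dom J d = Cod J b" "Comp J d b = w" using w(3) by blast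
    have "dm (Comp J c a) s (snd p) = dm w s (snd q)"
      using dm_Comp[of a c "snd p" s] dm_Comp[of a' c "snd q" s] a c pqr by (auto simp: El_def)
    moreover have "dm (Comp J d b') s (snd r) = dm w s (snd q)"
      using dm_Comp[of b' d "snd r" s] dm_Comp[of b d "snd q" s] b d pqr by (auto simp: El_def)
    moreover have "Cod J (Comp J c a) = Cod J w" "Comp J c a \<in> Arr J" "Dom J (Comp J c a) = fst p"
      using Comp_J[of a c] Comp_J[of a' c] a c by auto
    moreover have "Cod J (Comp J d b') = Cod J w" "Comp J d b' \<in> Arr J" "Dom J (Comp J d b') = fst r"
      using Comp_J[of b' d] Comp_J[of b d] b d by auto
    ultimately show ?thesis unfolding sim_def by metis
  qed
  have cls_eq: "cls s p = cls s q \<longleftrightarrow> sim s p q" if "p \<in> El s" "q \<in> El s" for s p q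
  proof
    assume "cls s p = cls s q"
    moreover have "q \<in> cls s q" using sim_refl that by (simp add: cls_def)
    ultimately have "q \<in> cls s p" by (simp only:)
    then show "sim s p q" by (simp add: cls_def)
  next
    assume "sim s p q"
    then show "cls s p = cls s q" using sim_trans sim_sym that unfolding cls_def by blast
  qed
  have smallEl: "|El s| <o \<kappa>" if "s \<in> sorts \<Sigma>" for s
    unfolding El_def
    by (rule small_Sigma) (use smallJ that dob_model(2) in \<open>auto simp: small_category_def is_pstruct_def\<close>)
  have "\<exists>enc :: ('j \<times> 'u) set \<Rightarrow> 'u. inj_on enc (cls s ` El s)" if "s \<in> sorts \<Sigma>" for s
    by (rule small_encode[OF small_image[OF smallEl[OF that]]])
  then have "\<forall>s \<in> sorts \<Sigma>. \<exists>enc :: ('j \<times> 'u) set \<Rightarrow> 'u. inj_on enc (cls s ` El s)" by blast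
  from bchoice[OF this] obtain enc :: "'s \<Rightarrow> ('j \<times> 'u) set \<Rightarrow> 'u"
    where enc: "\<forall>s \<in> sorts \<Sigma>. inj_on (enc s) (cls s ` El s)" ..
  define k where "k j s = (\<lambda>y \<in> carr (dob j) s. enc s (cls s (j, y)))" for j s
  have k_eq: "k j s y = k j' s y' \<longleftrightarrow> sim s (j, y) (j', y')"
    if "j \<in> Obj J" "j' \<in> Obj J" "y \<in> carr (dob j) s" "y' \<in> carr (dob j') s" for j j' s y y'
  proof -
    have s: "s \<in> sorts \<Sigma>" using carr_sort[OF dob_model(2)] that by blast
    have "(j, y) \<in> El s" "(j', y') \<in> El s" using that by (auto simp: El_def)
    then show ?thesis using cls_eq enc s that by (simp add: k_def inj_on_eq_iff[of "enc s" "cls s ` El s"])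
  qed
  have sep: "\<exists>a \<in> Arr J. Dom J a = j \<and> dm a s y = dm a s y'"
    if j: "j \<in> Obj J" and y: "y \<in> carr (dob j) s" "y' \<in> carr (dob j) s" and eq: "k j s y = k j s y'" for j s y y'
  proof -
    obtain a a' where a: "a \<in> Arr J" "a' \<in> Arr J" "Dom J a = j" "Dom J a' = j" "Cod J a = Cod J a'"
      "dm a s y = dm a' s y'"
      using k_eq[OF j j y] eq unfolding sim_def by auto
    \<comment> \<open>Equality of the classes only yields two parallel arrows that match
      \<open>y\<close> with \<open>y'\<close>; coequalizing them leaves a single arrow that
      identifies both elements.\<close>
    obtain h where h: "h \<in> Arr J" "Dom J h = Cod J a" "\<And>f g. f \<in> {a, a'} \<Longrightarrow> g \<in> {a, a'} \<Longrightarrow> Comp J h f = Comp J h g"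
    proof (rule coeq_J[of "{a, a'}" j "Cod J a"])
      show "|{a, a'}| <o lam" by (rule lam_finite) simp
      show "Dom J f = j \<and> Cod J f = Cod J a" if "f \<in> {a, a'}" for f using a that by auto
      show "{a, a'} \<subseteq> Arr J" "Cod J a \<in> Obj J" using a Arr_J(2)[OF a(1)] by auto
    qed (rule j, rule that, assumption+)
    have eqc: "Comp J h a' = Comp J h a" using h(3) by blast
    have "dm (Comp J h a) s y = dm (Comp J h a) s y'"
      using dm_Comp[of a h y s] dm_Comp[of a' h y' s, unfolded eqc] a(1-6) h(1,2) y by simp
    then show ?thesis using Comp_J[of a h] a h by auto
  qed
  have comp: "k (Cod J a) s (dm a s y) = k (Dom J a) s y" if a: "a \<in> Arr J" and y: "y \<in> carr (dob (Dom J a)) s" for a s y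
  proof -
    have "sim s (Cod J a, dm a s y) (Dom J a, y)"
      unfolding sim_def using Id_J[OF Arr_J(2)[OF a]] a dm_Id[OF Arr_J(2)[OF a] dm_carr[OF a y]]
      by (intro bexI[of _ "Id J (Cod J a)"] bexI[of _ a]) auto
    then show ?thesis using k_eq[OF Arr_J(2,1)[OF a] dm_carr[OF a y] y] by simp
  qed
  \<comment> \<open>The candidate values of \<open>f\<close> at \<open>a\<close> are the images of
    values at stages. \<open>fun_merge\<close> brings two such stages to one where the arguments
    agree, so there is at most one candidate and \<open>SOME\<close> selects it.\<close>
  define FV where "FV f a y \<longleftrightarrow> (\<exists>j \<in> Obj J. \<exists>b z. fint (dob j) f b = Some z \<and>
    a = fun_tuple lam \<Sigma> f (k j) b \<and> y = k j (fun_cod \<Sigma> f) z)" for f a y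
  define X :: "('s, 'f, 'r, 'l, 'u) pstruct" where "X = \<lparr>
    carr = (\<lambda>s. \<Union>j \<in> Obj J. k j s ` carr (dob j) s),
    fint = (\<lambda>f a. if f \<in> funs \<Sigma> \<and> (\<exists>y. FV f a y) then Some (SOME y. FV f a y) else None),
    rint = (\<lambda>R. if R \<in> rels \<Sigma> then {a. \<exists>j \<in> Obj J. \<exists>b \<in> rint (dob j) R. a = rel_tuple lam \<Sigma> R (k j) b} else {}) \<rparr>"
  have fun_merge: "\<exists>c \<in> Arr J. \<exists>c' \<in> Arr J. Dom J c = j \<and> Dom J c' = j' \<and> Cod J c = Cod J c' \<and>
      fun_tuple lam \<Sigma> f (dm c) b = fun_tuple lam \<Sigma> f (dm c') b'"
    if f: "f \<in> funs \<Sigma>" and j: "j \<in> Obj J" "j' \<in> Obj J" and b: "b \<in> fun_args lam \<Sigma> (dob j) f" "b' \<in> fun_args lam \<Sigma> (dob j') f"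
      and eq: "fun_tuple lam \<Sigma> f (k j) b = fun_tuple lam \<Sigma> f (k j') b'" for f j j' b b'
  proof -
    have eqi: "k j (fun_dom \<Sigma> f i) (b i) = k j' (fun_dom \<Sigma> f i) (b' i)" if "i \<in> fun_idx lam \<Sigma> f" for i
      using fun_cong[OF eq, of i] that by (simp add: fun_tuple_def)
    obtain c c' where "c \<in> Arr J" "c' \<in> Arr J" "Dom J c = j" "Dom J c' = j'" "Cod J c = Cod J c'"
      "\<And>i. i \<in> fun_idx lam \<Sigma> f \<Longrightarrow> dm c (fun_dom \<Sigma> f i) (b i) = dm c' (fun_dom \<Sigma> f i) (b' i)"
      by (rule tuple_merge[of k j j' "fun_idx lam \<Sigma> f" b "fun_dom \<Sigma> f" b', OF comp sep j fun_idx_lam(1)[OF f] _ _ eqi])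
        (use b in \<open>auto simp: fun_args_def PiE_iff\<close>)
    then show ?thesis by (intro bexI[of _ c] bexI[of _ c']) (auto simp: fun_tuple_def)
  qed
  have rel_merge: "\<exists>c \<in> Arr J. \<exists>c' \<in> Arr J. Dom J c = j \<and> Dom J c' = j' \<and> Cod J c = Cod J c' \<and>
      rel_tuple lam \<Sigma> R (dm c) b = rel_tuple lam \<Sigma> R (dm c') b'"
    if R: "R \<in> rels \<Sigma>" and j: "j \<in> Obj J" "j' \<in> Obj J" and b: "b \<in> rel_args lam \<Sigma> (dob j) R" "b' \<in> rel_args lam \<Sigma> (dob j') R"
      and eq: "rel_tuple lam \<Sigma> R (k j) b = rel_tuple lam \<Sigma> R (k j') b'" for R j j' b b'
  proof -
    have eqi: "k j (rel_dom \<Sigma> R i) (b i) = k j' (rel_dom \<Sigma> R i) (b' i)" if "i \<in> rel_idx lam \<Sigma> R" for i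
      using fun_cong[OF eq, of i] that by (simp add: rel_tuple_def)
    obtain c c' where "c \<in> Arr J" "c' \<in> Arr J" "Dom J c = j" "Dom J c' = j'" "Cod J c = Cod J c'"
      "\<And>i. i \<in> rel_idx lam \<Sigma> R \<Longrightarrow> dm c (rel_dom \<Sigma> R i) (b i) = dm c' (rel_dom \<Sigma> R i) (b' i)"
      by (rule tuple_merge[of k j j' "rel_idx lam \<Sigma> R" b "rel_dom \<Sigma> R" b', OF comp sep j fun_idx_lam(2)[OF R] _ _ eqi])
        (use b in \<open>auto simp: rel_args_def PiE_iff\<close>)
    then show ?thesis by (intro bexI[of _ c] bexI[of _ c']) (auto simp: rel_tuple_def)
  qed
  have FV_fun: "y = y'" if f: "f \<in> funs \<Sigma>" and y: "FV f a y" and y': "FV f a y'" for f a y y'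
  proof -
    obtain j b z where j: "j \<in> Obj J" and z: "fint (dob j) f b = Some z"
      and a: "a = fun_tuple lam \<Sigma> f (k j) b" and yk: "y = k j (fun_cod \<Sigma> f) z" using y unfolding FV_def by blast
    obtain j' b' z' where j': "j' \<in> Obj J" and z': "fint (dob j') f b' = Some z'"
      and a': "a = fun_tuple lam \<Sigma> f (k j') b'" and yk': "y' = k j' (fun_cod \<Sigma> f) z'" using y' unfolding FV_def by blast
    note ps = dob_model(2)[OF j] and ps' = dob_model(2)[OF j']
    obtain c c' where c: "c \<in> Arr J" "c' \<in> Arr J" "Dom J c = j" "Dom J c' = j'" "Cod J c = Cod J c'"
      "fun_tuple lam \<Sigma> f (dm c) b = fun_tuple lam \<Sigma> f (dm c') b'"
      using fun_merge[OF f j j' fintD(1)[OF ps f z] fintD(1)[OF ps' f z']] a a' by auto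
    have "dm c (fun_cod \<Sigma> f) z = dm c' (fun_cod \<Sigma> f) z'"
      using hmD(2)[OF dm_hm[OF c(1)] _ f] hmD(2)[OF dm_hm[OF c(2)] _ f] ps ps' z z' c by fastforce
    then show ?thesis
      using comp[OF c(1), of z "fun_cod \<Sigma> f"] comp[OF c(2), of z' "fun_cod \<Sigma> f"] c yk yk'
        fintD(2)[OF ps f z] fintD(2)[OF ps' f z'] by simp
  qed
  have fintX: "fint X f a = Some y \<longleftrightarrow> FV f a y" if "f \<in> funs \<Sigma>" for f a y
    using FV_fun[OF that] someI[of "FV f a"] that by (auto simp: X_def)
  have kX: "k j s y \<in> carr X s" if "j \<in> Obj J" "y \<in> carr (dob j) s" for j s y
    using that by (auto simp: X_def)
  have psX: "ps X"
    unfolding is_pstruct_def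
  proof (intro conjI ballI allI impI)
    fix s assume s: "s \<in> sorts \<Sigma>"
    show "|carr X s| <o \<kappa>"
      unfolding X_def pstruct.simps
      by (intro small_UN small_image) (use smallJ s dob_model(2) in \<open>auto simp: small_category_def is_pstruct_def\<close>)
  next
    fix f a y assume f: "f \<in> funs \<Sigma>" and "fint X f a = Some y"
    then obtain j b z where j: "j \<in> Obj J" and z: "fint (dob j) f b = Some z"
      and a: "a = fun_tuple lam \<Sigma> f (k j) b" and yk: "y = k j (fun_cod \<Sigma> f) z" using fintX unfolding FV_def by blast
    show "a \<in> fun_args lam \<Sigma> X f"
      unfolding a using fintD(1)[OF dob_model(2)[OF j] f z] kX[OF j] by (auto simp: fun_args_def fun_tuple_def PiE_iff)
    show "y \<in> carr X (fun_cod \<Sigma> f)" unfolding yk using kX[OF j] fintD(2)[OF dob_model(2)[OF j] f z] .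
  next
    fix R assume R: "R \<in> rels \<Sigma>"
    show "rint X R \<subseteq> rel_args lam \<Sigma> X R"
    proof
      fix a assume "a \<in> rint X R"
      then obtain j b where j: "j \<in> Obj J" and b: "b \<in> rint (dob j) R" and a: "a = rel_tuple lam \<Sigma> R (k j) b"
        using R by (auto simp: X_def)
      show "a \<in> rel_args lam \<Sigma> X R"
        unfolding a using fintD(3)[OF dob_model(2)[OF j] R b] kX[OF j] by (auto simp: rel_args_def rel_tuple_def PiE_iff)
    qed
  next
    fix s assume "s \<notin> sorts \<Sigma>"
    then show "carr X s = {}" using carr_sort[OF dob_model(2)] by (auto simp: X_def)
  qed (auto simp: X_def)
  have "compatible X k"
    unfolding compatible_def
  proof (intro conjI ballI allI)
    fix j assume j: "j \<in> Obj J"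
    show "hm (dob j) X (k j)"
      unfolding is_homomorphism_def
    proof (intro conjI allI ballI impI)
      show "k j s \<in> carr (dob j) s \<rightarrow>\<^sub>E carr X s" for s using kX[OF j] by (auto simp: k_def)
      show "fint X f (fun_tuple lam \<Sigma> f (k j) a) = Some (k j (fun_cod \<Sigma> f) y)"
        if "f \<in> funs \<Sigma>" "fint (dob j) f a = Some y" for f a y
        using fintX that j unfolding FV_def by blast
      show "rel_tuple lam \<Sigma> R (k j) a \<in> rint X R" if "R \<in> rels \<Sigma>" "a \<in> rint (dob j) R" for R a
        using that j by (auto simp: X_def)
    qed
  qed (use comp in blast)
  moreover have "\<exists>a \<in> Arr J. Dom J a = j \<and> fint (dob (Cod J a)) f (fun_tuple lam \<Sigma> f (dm a) b) \<noteq> None"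
    if j: "j \<in> Obj J" and f: "f \<in> funs \<Sigma>" and b: "b \<in> fun_args lam \<Sigma> (dob j) f"
      and d: "fint X f (fun_tuple lam \<Sigma> f (k j) b) \<noteq> None" for j f b
  proof -
    obtain j' b' z' where j': "j' \<in> Obj J" and z': "fint (dob j') f b' = Some z'"
      and a': "fun_tuple lam \<Sigma> f (k j) b = fun_tuple lam \<Sigma> f (k j') b'" using d fintX[OF f] unfolding FV_def by blast
    note ps' = dob_model(2)[OF j']
    obtain c c' where c: "c \<in> Arr J" "c' \<in> Arr J" "Dom J c = j" "Dom J c' = j'" "Cod J c = Cod J c'"
      "fun_tuple lam \<Sigma> f (dm c) b = fun_tuple lam \<Sigma> f (dm c') b'"
      using fun_merge[OF f j j' b fintD(1)[OF ps' f z'] a'] by auto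
    have "fint (dob (Cod J c)) f (fun_tuple lam \<Sigma> f (dm c) b) \<noteq> None"
      using hmD(2)[OF dm_hm[OF c(2)] _ f] ps' z' c by fastforce
    then show ?thesis using c by blast
  qed
  moreover have "\<exists>a \<in> Arr J. Dom J a = j \<and> rel_tuple lam \<Sigma> R (dm a) b \<in> rint (dob (Cod J a)) R"
    if j: "j \<in> Obj J" and R: "R \<in> rels \<Sigma>" and b: "b \<in> rel_args lam \<Sigma> (dob j) R"
      and d: "rel_tuple lam \<Sigma> R (k j) b \<in> rint X R" for j R b
  proof -
    obtain j' b' where j': "j' \<in> Obj J" and b': "b' \<in> rint (dob j') R"
      and a': "rel_tuple lam \<Sigma> R (k j) b = rel_tuple lam \<Sigma> R (k j') b'" using d R by (auto simp: X_def)
    note ps' = dob_model(2)[OF j']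
    obtain c c' where c: "c \<in> Arr J" "c' \<in> Arr J" "Dom J c = j" "Dom J c' = j'" "Cod J c = Cod J c'"
      "rel_tuple lam \<Sigma> R (dm c) b = rel_tuple lam \<Sigma> R (dm c') b'"
      using rel_merge[OF R j j' b fintD(3)[OF ps' R b'] a'] by auto
    have "rel_tuple lam \<Sigma> R (dm c) b \<in> rint (dob (Cod J c)) R"
      using hmD(3)[OF dm_hm[OF c(2)] _ R, of b'] ps' b' c by simp
    then show ?thesis using c by blast
  qed
  moreover have "\<exists>j \<in> Obj J. \<exists>y \<in> carr (dob j) s. k j s y = x" if "x \<in> carr X s" for x s
    using that by (auto simp: X_def)
  ultimately have "good_cocone X k" unfolding good_cocone_def using sep by blast
  then show thesis using that psX by blast
qed

lemma is_colimitD: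
  assumes "is_colimit J C D' X k"
  shows "is_cocone J C D' X k" and "is_cocone J C D' Y l \<Longrightarrow>
    \<exists>!u. u \<in> Defs.hom C X Y \<and> (\<forall>j \<in> Obj J. Comp C u (k j) = l j)"
  using assms unfolding is_colimit_def by simp_all

text \<open>The given colimit is compared with the constructed one, \<open>L\<close>. It is a
  retract of \<open>L\<close> compatibly with both cocones, which is enough: a fact in
  \<open>X\<close> is sent to \<open>L\<close> by \<open>u\<close> and pulled back to a stage there,
  while \<open>v\<close> shows that every element of \<open>X\<close> comes from a stage.\<close>

lemma is_colimit_good:
  assumes col: "is_colimit J (Mod T) D X \<xi>"
  shows "good_cocone X (\<lambda>j. maps (\<xi> j))"
proof -
  let ?k = "\<lambda>j. maps (\<xi> j)"
  have c: "is_cocone J (Mod T) D X \<xi>" by (rule is_colimitD(1)[OF col])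
  then have X: "model T X" and k: "compatible X ?k" and \<xi>: "\<And>j. j \<in> Obj J \<Longrightarrow> \<xi> j = Arrow (dob j) (?k j) X"
    by (simp_all add: is_cocone_iff)
  obtain L l where L: "ps L" "good_cocone L l" using good_cocone_exists .
  note l = good_coconeD(1)[OF L(2)]
  have mL: "model T L" by (rule good_cocone_model[OF L])
  have "is_cocone J (Mod T) D L (\<lambda>j. Arrow (dob j) (l j) L)" using mL l by (simp add: is_cocone_iff)
  from is_colimitD(2)[OF col this] obtain u where u: "u \<in> Defs.hom (Mod T) X L"
    "\<And>j. j \<in> Obj J \<Longrightarrow> Comp (Mod T) u (\<xi> j) = Arrow (dob j) (l j) L" by blast
  have u_hm: "hm X L (maps u)" using Mod_homD(6)[OF u(1)] .
  have uk: "maps u s (?k j s y) = l j s y" if j: "j \<in> Obj J" and y: "y \<in> carr (dob j) s" for j s y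
  proof -
    have "hcomp (dob j) (maps u) (?k j) = l j"
      using arg_cong[OF u(2)[OF j], of maps] \<xi>[OF j] maps_Comp[of T u "\<xi> j"] by (metis arrow.sel(1,2))
    then show ?thesis by (rule hcomp_eqD[OF _ y])
  qed
  obtain v where v: "hm L X v" "\<And>j s y. j \<in> Obj J \<Longrightarrow> y \<in> carr (dob j) s \<Longrightarrow> v s (l j s y) = ?k j s y"
    by (rule good_cocone_factor[OF L model_ps[OF X] k]) (rule that)
  \<comment> \<open>The composite through \<open>L\<close> and the identity both commute with the
    colimit cocone, hence are equal.\<close>
  have "\<exists>!w. w \<in> Defs.hom (Mod T) X X \<and> (\<forall>j \<in> Obj J. Comp (Mod T) w (\<xi> j) = \<xi> j)"
    by (rule is_colimitD(2)[OF col c])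
  moreover have "Arrow X (hcomp X v (maps u)) X \<in> Defs.hom (Mod T) X X"
    using hm_comp[OF model_ps[OF X] L(1) u_hm v(1)] X by (simp add: Mod_hom)
  moreover have "Comp (Mod T) (Arrow X (hcomp X v (maps u)) X) (\<xi> j) = \<xi> j" if j: "j \<in> Obj J" for j
  proof -
    have "hcomp (dob j) (hcomp X v (maps u)) (?k j) = ?k j"
      unfolding hcomp_eq_iff[OF compatibleD(1)[OF k j]]
      using uk[OF j] v(2)[OF j] hmD(1)[OF compatibleD(1)[OF k j]] by (simp add: hcomp_def)
    then show ?thesis using \<xi>[OF j] Mod_simps(6) by metis
  qed
  moreover have "Arrow X (hid X) X \<in> Defs.hom (Mod T) X X" using hid_hm[OF model_ps[OF X]] X by (simp add: Mod_hom)
  moreover have "Comp (Mod T) (Arrow X (hid X) X) (\<xi> j) = \<xi> j" if j: "j \<in> Obj J" for j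
  proof -
    have "hcomp (dob j) (hid X) (?k j) = ?k j"
      unfolding hcomp_eq_iff[OF compatibleD(1)[OF k j]]
      using hmD(1)[OF compatibleD(1)[OF k j]] by (simp add: hid_def)
    then show ?thesis using \<xi>[OF j] Mod_simps(6) by metis
  qed
  ultimately have "hcomp X v (maps u) = hid X" by (metis (no_types, lifting) arrow.inject)
  then have vu: "v s (maps u s x) = x" if "x \<in> carr X s" for s x using that hid_eq_iff by blast
  show ?thesis
    unfolding good_cocone_def
  proof (intro conjI ballI allI impI)
    show "compatible X ?k" by (rule k)
  next
    fix s x assume x: "x \<in> carr X s"
    obtain j y where j: "j \<in> Obj J" "y \<in> carr (dob j) s" "l j s y = maps u s x"
      using good_coconeD(2)[OF L(2) hmD(1)[OF u_hm x]] by blast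
    then have "?k j s y = x" using v(2)[OF j(1,2)] vu[OF x] by simp
    then show "\<exists>j \<in> Obj J. \<exists>y \<in> carr (dob j) s. ?k j s y = x" using j by blast
  next
    fix j s y y' assume a: "j \<in> Obj J" "y \<in> carr (dob j) s" "y' \<in> carr (dob j) s" "?k j s y = ?k j s y'"
    then have "l j s y = l j s y'" using uk by metis
    then show "\<exists>a \<in> Arr J. Dom J a = j \<and> dm a s y = dm a s y'" using good_coconeD(3)[OF L(2)] a by blast
  next
    fix j f b assume a: "j \<in> Obj J" "f \<in> funs \<Sigma>" "b \<in> fun_args lam \<Sigma> (dob j) f"
      and d: "fint X f (fun_tuple lam \<Sigma> f (?k j) b) \<noteq> None"
    then obtain z where z: "fint X f (fun_tuple lam \<Sigma> f (?k j) b) = Some z" by blast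
    have "fun_tuple lam \<Sigma> f (maps u) (fun_tuple lam \<Sigma> f (?k j) b) = fun_tuple lam \<Sigma> f (l j) b"
      using uk[OF a(1)] a(3) by (auto simp: fun_tuple_def fun_args_def PiE_iff)
    then have "fint L f (fun_tuple lam \<Sigma> f (l j) b) \<noteq> None"
      using hmD(2)[OF u_hm model_ps[OF X] a(2) z] by simp
    from good_coconeD(4)[OF L(2) a this]
    show "\<exists>a \<in> Arr J. Dom J a = j \<and> fint (dob (Cod J a)) f (fun_tuple lam \<Sigma> f (dm a) b) \<noteq> None" .
  next
    fix j R b assume a: "j \<in> Obj J" "R \<in> rels \<Sigma>" "b \<in> rel_args lam \<Sigma> (dob j) R"
      and d: "rel_tuple lam \<Sigma> R (?k j) b \<in> rint X R"
    have "rel_tuple lam \<Sigma> R (maps u) (rel_tuple lam \<Sigma> R (?k j) b) = rel_tuple lam \<Sigma> R (l j) b"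
      using uk[OF a(1)] a(3) by (auto simp: rel_tuple_def rel_args_def PiE_iff)
    then have "rel_tuple lam \<Sigma> R (l j) b \<in> rint L R"
      using hmD(3)[OF u_hm model_ps[OF X] a(2) d] by simp
    from good_coconeD(5)[OF L(2) a this]
    show "\<exists>a \<in> Arr J. Dom J a = j \<and> rel_tuple lam \<Sigma> R (dm a) b \<in> rint (dob (Cod J a)) R" .
  qed
qed

end

section \<open>Semantics of binary conjunction and of substitution\<close>

context structures
begin

lemma fm_holds_And:
  "fm_holds lam \<Sigma> M e (And lam \<phi> \<psi>) \<longleftrightarrow> fm_holds lam \<Sigma> M e \<phi> \<and> fm_holds lam \<Sigma> M e \<psi>"
proof -
  obtain k0 k1 where "underS lam (two lam) = {k0, k1}" "underS lam k0 = {}" "underS lam k1 \<noteq> {}"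
    using two_lam by metis
  then show ?thesis by (simp add: And_def)
qed

lemma term_val_subst:
  "(\<And>v. v \<in> term_vars lam \<Sigma> t \<Longrightarrow> term_val lam \<Sigma> M e (\<theta> v) = Some (e' v)) \<Longrightarrow>
    term_val lam \<Sigma> M e (term_subst lam \<Sigma> \<theta> t) = term_val lam \<Sigma> M e' t"
proof (induction t)
  case (App f ts)
  have "term_val lam \<Sigma> M e (term_subst lam \<Sigma> \<theta> (ts i)) = term_val lam \<Sigma> M e' (ts i)"
    if "i \<in> fun_idx lam \<Sigma> f" for i
    using App that by auto
  then show ?case by (auto intro!: arg_cong[of _ _ "fint M f"])
qed auto

lemma fm_holds_subst:
  "(\<And>v. v \<in> fm_vars lam \<Sigma> \<phi> \<Longrightarrow> term_val lam \<Sigma> M e (\<theta> v) = Some (e' v)) \<Longrightarrow>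
    fm_holds lam \<Sigma> M e (fm_subst lam \<Sigma> \<theta> \<phi>) = fm_holds lam \<Sigma> M e' \<phi>"
proof (induction \<phi>)
  case (Rel R ts)
  have *: "term_val lam \<Sigma> M e (term_subst lam \<Sigma> \<theta> (ts i)) = term_val lam \<Sigma> M e' (ts i)"
    if "i \<in> rel_idx lam \<Sigma> R" for i
    by (rule term_val_subst) (use Rel that in auto)
  then have "(\<lambda>i \<in> rel_idx lam \<Sigma> R. the (term_val lam \<Sigma> M e ((\<lambda>i \<in> rel_idx lam \<Sigma> R. term_subst lam \<Sigma> \<theta> (ts i)) i))) =
      (\<lambda>i \<in> rel_idx lam \<Sigma> R. the (term_val lam \<Sigma> M e' (ts i)))" by auto
  then show ?case using * by simp
next
  case (Eq t u)
  have "term_val lam \<Sigma> M e (term_subst lam \<Sigma> \<theta> t) = term_val lam \<Sigma> M e' t"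
    "term_val lam \<Sigma> M e (term_subst lam \<Sigma> \<theta> u) = term_val lam \<Sigma> M e' u"
    by (rule term_val_subst; use Eq in simp)+
  then show ?case by simp
next
  case (Conj \<alpha> \<phi>)
  have "fm_holds lam \<Sigma> M e (fm_subst lam \<Sigma> \<theta> (\<phi> i)) = fm_holds lam \<Sigma> M e' (\<phi> i)" if "i \<in> underS lam \<alpha>" for i
    using Conj that by auto
  then show ?case by simp
qed auto

end

section \<open>Translation along a theory morphism\<close>

locale theory_morphism = src: structures \<kappa> lam \<Sigma> + tgt: structures \<kappa> lam \<Sigma>'
  for \<kappa> :: "'u rel" and lam :: "'l rel"
    and \<Sigma> :: "('s, 'f, 'r, 'l) signature" and \<Sigma>' :: "('t, 'g, 'q, 'l) signature" +
  fixes S :: "('s, 'f, 'r, 'l) sequent set" and T :: "('t, 'g, 'q, 'l) sequent set"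
    and \<rho> :: "('s, 'f, 'r, 't, 'g, 'q, 'l) morphism"
  assumes hornS: "is_horn_theory lam \<Sigma> S" and hornT: "is_horn_theory lam \<Sigma>' T"
    and morph: "is_theory_morphism \<kappa> lam \<Sigma> S \<Sigma>' T \<rho>"
begin

abbreviation rd :: "('t, 'g, 'q, 'l, 'u) pstruct \<Rightarrow> ('s, 'f, 'r, 'l, 'u) pstruct" where
  "rd M \<equiv> reduct lam \<Sigma> \<Sigma>' \<rho> M"

abbreviation U :: "(('t, 'g, 'q, 'l, 'u) pstruct, ('t, 'g, 'q, 'l, 'u) arrow,
    ('s, 'f, 'r, 'l, 'u) pstruct, ('s, 'f, 'r, 'l, 'u) arrow) func" where
  "U \<equiv> translation_functor lam \<Sigma> \<Sigma>' \<rho>"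

text \<open>Outside the sorts of \<open>\<Sigma>\<close> the carriers of a reduct are empty, so
  extensionality forces the value \<open>undefined\<close> there.\<close>

definition rdm :: "('t \<Rightarrow> 'u \<Rightarrow> 'u) \<Rightarrow> 's \<Rightarrow> 'u \<Rightarrow> 'u" where
  "rdm h = (\<lambda>s. if s \<in> sorts \<Sigma> then h (smap \<rho> s) else (\<lambda>_. undefined))"

lemma rdm_at: "s \<in> sorts \<Sigma> \<Longrightarrow> rdm h s = h (smap \<rho> s)"
  by (simp add: rdm_def)

lemma morphD:
  "s \<in> sorts \<Sigma> \<Longrightarrow> smap \<rho> s \<in> sorts \<Sigma>'"
  "f \<in> funs \<Sigma> \<Longrightarrow> term_in_ctx lam \<Sigma>' (fun_ctx lam \<Sigma> \<rho> f) (fmap \<rho> f) (smap \<rho> (fun_cod \<Sigma> f))"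
  "R \<in> rels \<Sigma> \<Longrightarrow> fm_in_ctx lam \<Sigma>' (rel_ctx lam \<Sigma> \<rho> R) (rmap \<rho> R)"
  "\<sigma> \<in> S \<Longrightarrow> entails \<kappa> lam \<Sigma>' T (sequent_tr lam \<Sigma> \<Sigma>' \<rho> \<sigma>)"
  using morph unfolding is_theory_morphism_def by blast+

lemma pos_ctx_simps[simp]:
  "ctx_idx lam (pos_ctx lam \<alpha> s) = underS lam \<alpha>"
  "i \<in> underS lam \<alpha> \<Longrightarrow> ctx_var (pos_ctx lam \<alpha> s) i = (s i, i)"
  by (simp_all add: pos_ctx_def ctx_idx_def)

lemma fun_ctx_simps[simp]:
  "ctx_idx lam (fun_ctx lam \<Sigma> \<rho> f) = fun_idx lam \<Sigma> f"
  "i \<in> fun_idx lam \<Sigma> f \<Longrightarrow> ctx_var (fun_ctx lam \<Sigma> \<rho> f) i = (smap \<rho> (fun_dom \<Sigma> f i), i)"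
  by (simp_all add: fun_ctx_def fun_idx_def)

lemma rel_ctx_simps[simp]:
  "ctx_idx lam (rel_ctx lam \<Sigma> \<rho> R) = rel_idx lam \<Sigma> R"
  "i \<in> rel_idx lam \<Sigma> R \<Longrightarrow> ctx_var (rel_ctx lam \<Sigma> \<rho> R) i = (smap \<rho> (rel_dom \<Sigma> R i), i)"
  by (simp_all add: rel_ctx_def rel_idx_def)

lemma ctx_tr_simps[simp]:
  "ctx_idx lam (ctx_tr lam \<rho> x) = ctx_idx lam x"
  "i \<in> ctx_idx lam x \<Longrightarrow> ctx_var (ctx_tr lam \<rho> x) i = (smap \<rho> (fst (ctx_var x i)), i)"
  by (simp_all add: ctx_tr_def ctx_idx_def pos_ctx_def)

lemma ctx_tr_context:
  assumes "is_context lam \<Sigma> x" shows "is_context lam \<Sigma>' (ctx_tr lam \<rho> x)"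
proof -
  have "smap \<rho> (fst (ctx_var x i)) \<in> sorts \<Sigma>'" "i \<in> Field lam" if "i \<in> ctx_idx lam x" for i
    using morphD(1)[OF src.ctx_sort[OF assms that]] that src.underS_subset_Field[of "ctx_len x"]
    by (auto simp: ctx_idx_def)
  moreover have "ctx_len (ctx_tr lam \<rho> x) \<in> Field lam"
    using assms by (simp add: is_context_def ctx_tr_def pos_ctx_def)
  moreover have "ctx_var (ctx_tr lam \<rho> x) \<in> extensional (ctx_idx lam x)"
    by (simp add: ctx_tr_def pos_ctx_def ctx_idx_def)
  ultimately show ?thesis
    unfolding is_context_def by (auto simp: vars_def PiE_iff inj_on_def)
qed

lemma fun_ctx_context: "f \<in> funs \<Sigma> \<Longrightarrow> is_context lam \<Sigma>' (fun_ctx lam \<Sigma> \<rho> f)"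
  using morphD(2) by (simp add: term_in_ctx_def)

lemma rel_ctx_context: "R \<in> rels \<Sigma> \<Longrightarrow> is_context lam \<Sigma>' (rel_ctx lam \<Sigma> \<rho> R)"
  using morphD(3) by (simp add: fm_in_ctx_def)

lemma rd_carr: "s \<in> sorts \<Sigma> \<Longrightarrow> carr (rd M) s = carr M (smap \<rho> s)"
  by (simp add: reduct_def)

lemma ctx_prod_fun: "f \<in> funs \<Sigma> \<Longrightarrow> ctx_prod lam M (fun_ctx lam \<Sigma> \<rho> f) = fun_args lam \<Sigma> (rd M) f"
  by (auto simp: ctx_prod_def fun_args_def rd_carr src.fun_sorts intro!: PiE_cong)

lemma ctx_prod_rel: "R \<in> rels \<Sigma> \<Longrightarrow> ctx_prod lam M (rel_ctx lam \<Sigma> \<rho> R) = rel_args lam \<Sigma> (rd M) R"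
  by (auto simp: ctx_prod_def rel_args_def rd_carr src.fun_sorts intro!: PiE_cong)

lemma ctx_prod_tr: "is_context lam \<Sigma> x \<Longrightarrow> ctx_prod lam M (ctx_tr lam \<rho> x) = ctx_prod lam (rd M) x"
  by (auto simp: ctx_prod_def rd_carr src.ctx_sort intro!: PiE_cong)

lemma rd_fint:
  "f \<in> funs \<Sigma> \<Longrightarrow> a \<in> fun_args lam \<Sigma> (rd M) f \<Longrightarrow>
    fint (rd M) f a = term_val lam \<Sigma>' M (ctx_env lam (fun_ctx lam \<Sigma> \<rho> f) a) (fmap \<rho> f)"
  "f \<in> funs \<Sigma> \<Longrightarrow> fint (rd M) f a = Some y \<Longrightarrow> a \<in> fun_args lam \<Sigma> (rd M) f"
  by (auto simp: reduct_def term_interp_def ctx_prod_fun split: if_splits)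

lemma rd_rint:
  "R \<in> rels \<Sigma> \<Longrightarrow> a \<in> rint (rd M) R \<longleftrightarrow> a \<in> rel_args lam \<Sigma> (rd M) R \<and>
    fm_holds lam \<Sigma>' M (ctx_env lam (rel_ctx lam \<Sigma> \<rho> R) a) (rmap \<rho> R)"
  by (auto simp: reduct_def fm_interp_def ctx_prod_rel)

lemma rd_ps:
  assumes M: "tgt.ps M" shows "src.ps (rd M)"
  unfolding is_pstruct_def
proof (intro conjI ballI allI impI)
  fix s assume "s \<in> sorts \<Sigma>"
  then show "|carr (rd M) s| <o \<kappa>" using M morphD(1) by (simp add: rd_carr is_pstruct_def)
next
  fix f a y assume f: "f \<in> funs \<Sigma>" and y: "fint (rd M) f a = Some y"
  show a: "a \<in> fun_args lam \<Sigma> (rd M) f" by (rule rd_fint(2)[OF f y])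
  show "y \<in> carr (rd M) (fun_cod \<Sigma> f)"
    using tgt.ctx_term_typed[OF M morphD(2)[OF f], of a y] a y rd_fint(1)[OF f a] ctx_prod_fun[OF f]
    by (simp add: rd_carr src.fun_sorts f)
next
  fix R assume "R \<in> rels \<Sigma>"
  then show "rint (rd M) R \<subseteq> rel_args lam \<Sigma> (rd M) R" using rd_rint by blast
qed (auto simp: reduct_def)

lemma fun_tuple_ctx_map:
  "f \<in> funs \<Sigma> \<Longrightarrow> fun_tuple lam \<Sigma> f (rdm h) a = tgt.ctx_map (fun_ctx lam \<Sigma> \<rho> f) h a"
  by (auto simp: fun_tuple_def tgt.ctx_map_def rdm_def src.fun_sorts)

lemma rel_tuple_ctx_map:
  "R \<in> rels \<Sigma> \<Longrightarrow> rel_tuple lam \<Sigma> R (rdm h) a = tgt.ctx_map (rel_ctx lam \<Sigma> \<rho> R) h a"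
  by (auto simp: rel_tuple_def tgt.ctx_map_def rdm_def src.fun_sorts)

lemma ctx_map_tr:
  "is_context lam \<Sigma> x \<Longrightarrow> tgt.ctx_map (ctx_tr lam \<rho> x) h m = src.ctx_map x (rdm h) m"
  by (auto simp: src.ctx_map_def tgt.ctx_map_def rdm_def src.ctx_sort)

lemma rdm_hm:
  assumes M: "tgt.ps M" and h: "tgt.hm M N h"
  shows "src.hm (rd M) (rd N) (rdm h)"
  unfolding is_homomorphism_def
proof (intro conjI allI ballI impI)
  fix s show "rdm h s \<in> carr (rd M) s \<rightarrow>\<^sub>E carr (rd N) s"
    using h unfolding is_homomorphism_def by (auto simp: rdm_def reduct_def)
next
  fix f a y assume f: "f \<in> funs \<Sigma>" and a: "a \<in> fun_args lam \<Sigma> (rd M) f" and y: "fint (rd M) f a = Some y"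
  have "fun_tuple lam \<Sigma> f (rdm h) a \<in> fun_args lam \<Sigma> (rd N) f"
    unfolding fun_tuple_ctx_map[OF f] using tgt.ctx_map_prod[OF h] a ctx_prod_fun[OF f] by blast
  from rd_fint(1)[OF f this] show "fint (rd N) f (fun_tuple lam \<Sigma> f (rdm h) a) = Some (rdm h (fun_cod \<Sigma> f) y)"
    using tgt.ctx_term_hom[OF M h morphD(2)[OF f], of a y] y rd_fint(1)[OF f a]
      rdm_at[OF src.fun_sorts(1)[OF f], of h] by (simp add: fun_tuple_ctx_map[OF f])
next
  fix R a assume R: "R \<in> rels \<Sigma>" and a: "a \<in> rel_args lam \<Sigma> (rd M) R" and y: "a \<in> rint (rd M) R"
  have "rel_tuple lam \<Sigma> R (rdm h) a \<in> rel_args lam \<Sigma> (rd N) R"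
    unfolding rel_tuple_ctx_map[OF R] using tgt.ctx_map_prod[OF h] a ctx_prod_rel[OF R] by blast
  then show "rel_tuple lam \<Sigma> R (rdm h) a \<in> rint (rd N) R"
    using tgt.ctx_fm_hom[OF M h morphD(3)[OF R]] y
    by (simp add: rd_rint[OF R] rel_tuple_ctx_map[OF R])
qed

text \<open>A reduct interprets function symbols by terms and relation symbols by Horn formulas over
  \<open>\<Sigma>'\<close>, and joint embeddings reflect both.\<close>

lemma rd_joint_emb:
  assumes K: "tgt.ps K" and je: "tgt.joint_emb K I A p"
  shows "src.joint_emb (rd K) I (\<lambda>i. rd (A i)) (\<lambda>i. rdm (p i))"
  unfolding src.joint_emb_def
proof (intro conjI ballI allI impI)
  show "src.hm (rd K) (rd (A i)) (rdm (p i))" if "i \<in> I" for i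
    by (rule rdm_hm[OF K tgt.joint_embD(1)[OF je that]])
next
  fix s x y assume xy: "x \<in> carr (rd K) s" "y \<in> carr (rd K) s" "\<forall>i \<in> I. rdm (p i) s x = rdm (p i) s y"
  have s: "s \<in> sorts \<Sigma>" using src.carr_sort[OF rd_ps[OF K] xy(1)] .
  show "x = y"
    using tgt.joint_embD(2)[OF je, of x "smap \<rho> s" y] xy by (simp add: rdm_at[OF s] rd_carr[OF s])
next
  fix f a assume f: "f \<in> funs \<Sigma>" and a: "a \<in> fun_args lam \<Sigma> (rd K) f"
    and d: "\<forall>i \<in> I. fint (rd (A i)) f (fun_tuple lam \<Sigma> f (rdm (p i)) a) \<noteq> None"
  have "term_val lam \<Sigma>' K (ctx_env lam (fun_ctx lam \<Sigma> \<rho> f) a) (fmap \<rho> f) \<noteq> None"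
  proof (rule tgt.ctx_term_joint[OF K je morphD(2)[OF f]])
    show "a \<in> ctx_prod lam K (fun_ctx lam \<Sigma> \<rho> f)" using a ctx_prod_fun[OF f] by simp
    fix i assume i: "i \<in> I"
    then obtain y where "fint (rd (A i)) f (fun_tuple lam \<Sigma> f (rdm (p i)) a) = Some y" using d by blast
    then show "term_val lam \<Sigma>' (A i) (ctx_env lam (fun_ctx lam \<Sigma> \<rho> f) (tgt.ctx_map (fun_ctx lam \<Sigma> \<rho> f) (p i) a)) (fmap \<rho> f) \<noteq> None"
      using rd_fint(1)[OF f rd_fint(2)[OF f]] fun_tuple_ctx_map[OF f] by (metis option.distinct(1))
  qed
  then show "fint (rd K) f a \<noteq> None" using rd_fint(1)[OF f a] by simp
next
  fix R a assume R: "R \<in> rels \<Sigma>" and a: "a \<in> rel_args lam \<Sigma> (rd K) R"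
    and d: "\<forall>i \<in> I. rel_tuple lam \<Sigma> R (rdm (p i)) a \<in> rint (rd (A i)) R"
  have "fm_holds lam \<Sigma>' K (ctx_env lam (rel_ctx lam \<Sigma> \<rho> R) a) (rmap \<rho> R)"
    by (rule tgt.ctx_fm_joint[OF K je morphD(3)[OF R]])
      (use a d ctx_prod_rel[OF R] rd_rint[OF R] rel_tuple_ctx_map[OF R] in auto)
  then show "a \<in> rint (rd K) R" using rd_rint[OF R] a by simp
qed

text \<open>Substitution alone may be defined too often, since an argument whose variable does not
  occur disappears. The case distinction on \<open>args_defined\<close> restores the requirement
  that every argument has a value.\<close>

lemma term_tr_val:
  assumes M: "tgt.ps M" and x: "is_context lam \<Sigma> x" and m: "m \<in> ctx_prod lam (rd M) x"
  shows "raw_term lam \<Sigma> t s \<Longrightarrow> term_vars lam \<Sigma> t \<subseteq> ctx_var x ` ctx_idx lam x \<Longrightarrow>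
    term_val lam \<Sigma> (rd M) (ctx_env lam x m) t =
      (if fm_holds lam \<Sigma>' M (ctx_env lam (ctx_tr lam \<rho> x) m) (args_defined lam \<Sigma> \<Sigma>' \<rho> x t)
       then term_val lam \<Sigma>' M (ctx_env lam (ctx_tr lam \<rho> x) m) (term_tr lam \<Sigma> \<Sigma>' \<rho> x t) else None)"
proof (induction rule: raw_term.induct)
  case (1 v)
  then obtain i where i: "i \<in> ctx_idx lam x" "v = ctx_var x i" by auto
  have inv: "inv_into (ctx_idx lam x) (ctx_var x) v = i"
    using x i by (simp add: is_context_def inv_into_f_f)
  have "ctx_env lam (ctx_tr lam \<rho> x) m (ctx_var (ctx_tr lam \<rho> x) i) = m i"
    by (rule tgt.ctx_env_var[OF ctx_tr_context[OF x]]) (use i in simp)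
  then show ?case using i inv src.ctx_env_var[OF x i(1)] by (simp add: var_tr_def)
next
  case (2 f ts)
  let ?e = "ctx_env lam x m" and ?e' = "ctx_env lam (ctx_tr lam \<rho> x) m"
  have vs: "term_vars lam \<Sigma> (ts i) \<subseteq> ctx_var x ` ctx_idx lam x" if "i \<in> fun_idx lam \<Sigma> f" for i
    using 2(4) that by auto
  have IH: "term_val lam \<Sigma> (rd M) ?e (ts i) = (if fm_holds lam \<Sigma>' M ?e' (args_defined lam \<Sigma> \<Sigma>' \<rho> x (ts i))
      then term_val lam \<Sigma>' M ?e' (term_tr lam \<Sigma> \<Sigma>' \<rho> x (ts i)) else None)" if "i \<in> fun_idx lam \<Sigma> f" for i
    using 2(3) vs[OF that] that by blast
  \<comment> \<open>By the induction hypothesis, each conjunct says exactly that the corresponding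
    argument has a value in the reduct.\<close>
  have AD: "fm_holds lam \<Sigma>' M ?e' (args_defined lam \<Sigma> \<Sigma>' \<rho> x (App f ts)) \<longleftrightarrow>
      (\<forall>i \<in> fun_idx lam \<Sigma> f. term_val lam \<Sigma> (rd M) ?e (ts i) \<noteq> None)"
    using IH by (auto simp: tgt.fm_holds_And fun_idx_def)
  show ?case
  proof (cases "\<forall>i \<in> fun_idx lam \<Sigma> f. term_val lam \<Sigma> (rd M) ?e (ts i) \<noteq> None")
    case True
    define a where "a = (\<lambda>i \<in> fun_idx lam \<Sigma> f. the (term_val lam \<Sigma> (rd M) ?e (ts i)))"
    have ai: "term_val lam \<Sigma> (rd M) ?e (ts i) = Some (a i)" if "i \<in> fun_idx lam \<Sigma> f" for i
      using True that by (auto simp: a_def)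
    have "a i \<in> carr (rd M) (fun_dom \<Sigma> f i)" if i: "i \<in> fun_idx lam \<Sigma> f" for i
      by (rule src.term_val_typed[OF _ rd_ps[OF M] _ ai[OF i]])
        (use 2(3) i vs[OF i] src.ctx_env_typed[OF x m] in blast)+
    then have a: "a \<in> fun_args lam \<Sigma> (rd M) f" by (auto simp: fun_args_def a_def)
    have tr: "term_val lam \<Sigma>' M ?e' (term_tr lam \<Sigma> \<Sigma>' \<rho> x (ts i)) = Some (a i)" if "i \<in> fun_idx lam \<Sigma> f" for i
      using IH[OF that] ai[OF that] by (auto split: if_splits)
    have "term_val lam \<Sigma>' M ?e' (term_tr lam \<Sigma> \<Sigma>' \<rho> x (App f ts)) =
        term_val lam \<Sigma>' M (ctx_env lam (fun_ctx lam \<Sigma> \<rho> f) a) (fmap \<rho> f)"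
      unfolding term_tr.simps
    proof (rule tgt.term_val_subst)
      \<comment> \<open>Variables of the image of \<open>f\<close> have the form
        \<open>(s, i)\<close> with \<open>i\<close> the position of the argument, so
        \<open>snd v\<close> selects the argument to be inserted.\<close>
      fix v assume "v \<in> term_vars lam \<Sigma>' (fmap \<rho> f)"
      then have "v \<in> ctx_var (fun_ctx lam \<Sigma> \<rho> f) ` fun_idx lam \<Sigma> f"
        using morphD(2)[OF 2(1)] unfolding term_in_ctx_def fun_ctx_simps by blast
      then obtain i where i: "i \<in> fun_idx lam \<Sigma> f" "v = ctx_var (fun_ctx lam \<Sigma> \<rho> f) i" by blast
      then have "ctx_env lam (fun_ctx lam \<Sigma> \<rho> f) a v = a i"
        using tgt.ctx_env_var[OF fun_ctx_context[OF 2(1)], of i a] by simp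
      then show "term_val lam \<Sigma>' M ?e' (term_tr lam \<Sigma> \<Sigma>' \<rho> x (ts (snd v))) =
          Some (ctx_env lam (fun_ctx lam \<Sigma> \<rho> f) a v)" using tr[OF i(1)] i by simp
    qed
    moreover have "term_val lam \<Sigma> (rd M) ?e (App f ts) = fint (rd M) f a"
      using True by (simp add: a_def)
    ultimately show ?thesis using AD True rd_fint(1)[OF 2(1) a] by simp
  next
    case False
    then show ?thesis using AD by auto
  qed
qed

text \<open>If a term in an atom has no value in the reduct, the definedness conjuncts fail on the
  translated side too. Otherwise the image of the relation symbol is evaluated at the tuple of
  values, which is how the reduct interprets the symbol.\<close>

lemma fm_tr_holds:
  assumes M: "tgt.ps M" and x: "is_context lam \<Sigma> x" and m: "m \<in> ctx_prod lam (rd M) x"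
  shows "raw_formula lam \<Sigma> \<phi> \<Longrightarrow> fm_vars lam \<Sigma> \<phi> \<subseteq> ctx_var x ` ctx_idx lam x \<Longrightarrow>
    fm_holds lam \<Sigma>' M (ctx_env lam (ctx_tr lam \<rho> x) m) (fm_tr lam \<Sigma> \<Sigma>' \<rho> x \<phi>) \<longleftrightarrow>
    fm_holds lam \<Sigma> (rd M) (ctx_env lam x m) \<phi>"
proof (induction rule: raw_formula.induct)
  case (1 R ts)
  let ?e = "ctx_env lam x m" and ?e' = "ctx_env lam (ctx_tr lam \<rho> x) m"
  have vs: "term_vars lam \<Sigma> (ts i) \<subseteq> ctx_var x ` ctx_idx lam x" if "i \<in> rel_idx lam \<Sigma> R" for i
    using 1(4) that by auto
  have raw: "raw_term lam \<Sigma> (ts i) (rel_dom \<Sigma> R i)" if "i \<in> rel_idx lam \<Sigma> R" for i using 1(3) that by blast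
  note IH = term_tr_val[OF M x m raw vs]
  have AD: "fm_holds lam \<Sigma>' M ?e' (Conj (rel_arity \<Sigma> R) (\<lambda>i \<in> rel_idx lam \<Sigma> R. term_defined lam \<Sigma> \<Sigma>' \<rho> x (ts i))) \<longleftrightarrow>
      (\<forall>i \<in> rel_idx lam \<Sigma> R. term_val lam \<Sigma> (rd M) ?e (ts i) \<noteq> None)"
    using IH by (auto simp: tgt.fm_holds_And rel_idx_def term_defined_def)
  show ?case
  proof (cases "\<forall>i \<in> rel_idx lam \<Sigma> R. term_val lam \<Sigma> (rd M) ?e (ts i) \<noteq> None")
    case True
    define a where "a = (\<lambda>i \<in> rel_idx lam \<Sigma> R. the (term_val lam \<Sigma> (rd M) ?e (ts i)))"
    have ai: "term_val lam \<Sigma> (rd M) ?e (ts i) = Some (a i)" if "i \<in> rel_idx lam \<Sigma> R" for i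
      using True that by (auto simp: a_def)
    have "a i \<in> carr (rd M) (rel_dom \<Sigma> R i)" if i: "i \<in> rel_idx lam \<Sigma> R" for i
      by (rule src.term_val_typed[OF _ rd_ps[OF M] _ ai[OF i]])
        (use raw[OF i] vs[OF i] src.ctx_env_typed[OF x m] in blast)+
    then have a: "a \<in> rel_args lam \<Sigma> (rd M) R" by (auto simp: rel_args_def a_def)
    have tr: "term_val lam \<Sigma>' M ?e' (term_tr lam \<Sigma> \<Sigma>' \<rho> x (ts i)) = Some (a i)" if "i \<in> rel_idx lam \<Sigma> R" for i
      using IH[OF that that] ai[OF that] by (auto split: if_splits)
    have "fm_holds lam \<Sigma>' M ?e' (fm_subst lam \<Sigma>' (\<lambda>v. term_tr lam \<Sigma> \<Sigma>' \<rho> x (ts (snd v))) (rmap \<rho> R)) =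
        fm_holds lam \<Sigma>' M (ctx_env lam (rel_ctx lam \<Sigma> \<rho> R) a) (rmap \<rho> R)"
    proof (rule tgt.fm_holds_subst)
      fix v assume "v \<in> fm_vars lam \<Sigma>' (rmap \<rho> R)"
      then have "v \<in> ctx_var (rel_ctx lam \<Sigma> \<rho> R) ` rel_idx lam \<Sigma> R"
        using morphD(3)[OF 1(1)] unfolding fm_in_ctx_def rel_ctx_simps by blast
      then obtain i where i: "i \<in> rel_idx lam \<Sigma> R" "v = ctx_var (rel_ctx lam \<Sigma> \<rho> R) i" by blast
      then have "ctx_env lam (rel_ctx lam \<Sigma> \<rho> R) a v = a i"
        using tgt.ctx_env_var[OF rel_ctx_context[OF 1(1)], of i a] by simp
      then show "term_val lam \<Sigma>' M ?e' (term_tr lam \<Sigma> \<Sigma>' \<rho> x (ts (snd v))) =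
          Some (ctx_env lam (rel_ctx lam \<Sigma> \<rho> R) a v)" using tr[OF i(1)] i by simp
    qed
    moreover have "fm_holds lam \<Sigma> (rd M) ?e (Rel R ts) \<longleftrightarrow> a \<in> rint (rd M) R"
      using True by (simp add: a_def)
    ultimately show ?thesis using AD True rd_rint[OF 1(1)] a by (simp add: tgt.fm_holds_And)
  next
    case False
    then show ?thesis using AD by (auto simp: tgt.fm_holds_And)
  qed
next
  case (2 t s u)
  have "term_vars lam \<Sigma> t \<subseteq> ctx_var x ` ctx_idx lam x" "term_vars lam \<Sigma> u \<subseteq> ctx_var x ` ctx_idx lam x"
    using 2(3) by auto
  then show ?case
    using term_tr_val[OF M x m 2(1)] term_tr_val[OF M x m 2(2)] by (auto simp: tgt.fm_holds_And)
next
  case (4 \<alpha> \<phi>)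
  have "fm_vars lam \<Sigma> (\<phi> i) \<subseteq> ctx_var x ` ctx_idx lam x" if "i \<in> underS lam \<alpha>" for i
    using 4(4) that by auto
  then show ?case using 4(3) by simp
qed simp

lemma ctx_fm_tr_holds:
  "tgt.ps M \<Longrightarrow> fm_in_ctx lam \<Sigma> x \<phi> \<Longrightarrow> m \<in> ctx_prod lam (rd M) x \<Longrightarrow>
    fm_holds lam \<Sigma>' M (ctx_env lam (ctx_tr lam \<rho> x) m) (fm_tr lam \<Sigma> \<Sigma>' \<rho> x \<phi>) \<longleftrightarrow>
    fm_holds lam \<Sigma> (rd M) (ctx_env lam x m) \<phi>"
  using fm_tr_holds unfolding fm_in_ctx_def by blast

lemma rd_model:
  assumes M: "tgt.model T M" shows "src.model S (rd M)"
proof -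
  note ps = tgt.model_ps[OF M]
  have "valid_in lam \<Sigma> (rd M) \<sigma>" if \<sigma>: "\<sigma> \<in> S" for \<sigma>
  proof (cases \<sigma>)
    case (Sequent x \<phi> \<psi>)
    have "is_sequent lam \<Sigma> \<sigma>" using hornS \<sigma> by (simp add: is_horn_theory_def)
    then have fc: "fm_in_ctx lam \<Sigma> x \<phi>" "fm_in_ctx lam \<Sigma> x \<psi>" using Sequent by auto
    have x: "is_context lam \<Sigma> x" using fc by (simp add: fm_in_ctx_def)
    have v: "valid_in lam \<Sigma>' M (Sequent (ctx_tr lam \<rho> x) (fm_tr lam \<Sigma> \<Sigma>' \<rho> x \<phi>) (fm_tr lam \<Sigma> \<Sigma>' \<rho> x \<psi>))"
      using morphD(4)[OF \<sigma>] M Sequent by (simp add: entails_def)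
    show ?thesis unfolding Sequent
    proof (rule src.valid_inI)
      fix m assume m: "m \<in> ctx_prod lam (rd M) x" and h: "fm_holds lam \<Sigma> (rd M) (ctx_env lam x m) \<phi>"
      have "m \<in> ctx_prod lam M (ctx_tr lam \<rho> x)" using m ctx_prod_tr[OF x] by simp
      from tgt.valid_inD[OF v this] show "fm_holds lam \<Sigma> (rd M) (ctx_env lam x m) \<psi>"
        using h ctx_fm_tr_holds[OF ps fc(1) m] ctx_fm_tr_holds[OF ps fc(2) m] by simp
    qed
  qed
  then show ?thesis using rd_ps[OF ps] by (simp add: is_model_def)
qed

text \<open>From here on the premise of a relative judgment is read in the reduct and the conclusion
  in the structure itself; the syntactic translation is no longer visible.\<close>

lemma relative_valid_iff:
  assumes "tgt.ps M" "fm_in_ctx lam \<Sigma> x \<phi>"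
  shows "valid_in lam \<Sigma>' M (Sequent (ctx_tr lam \<rho> x) (fm_tr lam \<Sigma> \<Sigma>' \<rho> x \<phi>) \<psi>) \<longleftrightarrow>
    (\<forall>m \<in> ctx_prod lam (rd M) x. fm_holds lam \<Sigma> (rd M) (ctx_env lam x m) \<phi> \<longrightarrow>
       fm_holds lam \<Sigma>' M (ctx_env lam (ctx_tr lam \<rho> x) m) \<psi>)"
proof -
  have x: "is_context lam \<Sigma> x" using assms by (simp add: fm_in_ctx_def)
  show ?thesis
    using ctx_fm_tr_holds[OF assms] ctx_prod_tr[OF x, of M] by (auto simp: fm_interp_def)
qed

lemma U_simps:
  "fobj U M = rd M"
  "farr U (Arrow M h N) = Arrow (rd M) (rdm h) (rd N)"
  "source (farr U f) = rd (source f)" "target (farr U f) = rd (target f)" "maps (farr U f) = rdm (maps f)"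
  by (auto simp: translation_functor_def rdm_def intro!: ext)

lemma rdm_hid: "rdm (tgt.hid M) = src.hid (rd M)"
  by (rule ext) (simp add: rdm_def tgt.hid_def src.hid_def reduct_def restrict_def)

lemma rdm_hcomp: "rdm (tgt.hcomp M g h) = src.hcomp (rd M) (rdm g) (rdm h)"
  by (rule ext) (simp add: rdm_def tgt.hcomp_def src.hcomp_def reduct_def restrict_def)

end

section \<open>Presentable objects\<close>

context structures
begin

lemma filtered_colimit_diagram:
  assumes "is_horn_theory lam \<Sigma> T" "filtered_colimit \<kappa> lam (Mod T) J D X k"
  shows "filtered_diagram \<kappa> lam \<Sigma> T J D"
  using assms structures_axioms
  by (simp add: filtered_diagram_def filtered_diagram_axioms_def filtered_colimit_def)

text \<open>The generic structure over all models pointed by a tuple satisfying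
  \<open>\<phi>\<close>. It satisfies \<open>T\<close> and \<open>\<phi>\<close> by reflection, and
  its projections are the required homomorphisms.\<close>

lemma representing_exists:
  assumes T: "is_horn_theory lam \<Sigma> T" and \<phi>: "fm_in_ctx lam \<Sigma> x \<phi>"
  obtains G g where "model T G" "generated x G g" "fm_holds lam \<Sigma> G (ctx_env lam x g) \<phi>"
    "\<And>M m. model T M \<Longrightarrow> m \<in> ctx_prod lam M x \<Longrightarrow> fm_holds lam \<Sigma> M (ctx_env lam x m) \<phi> \<Longrightarrow>
      \<exists>h. hm G M h \<and> ctx_map x h g = m"
proof -
  have x: "is_context lam \<Sigma> x" using \<phi> by (simp add: fm_in_ctx_def)
  define K where "K = {(M, m). model T M \<and> m \<in> ctx_prod lam M x \<and> fm_holds lam \<Sigma> M (ctx_env lam x m) \<phi>}"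
  obtain G g p where G: "ps G" "generated x G g" "joint_emb G K fst p"
    and pg: "\<And>M m. (M, m) \<in> K \<Longrightarrow> ctx_map x (p (M, m)) g = m"
  proof (rule generic_exists[OF x, of K])
    show "ps M \<and> m \<in> ctx_prod lam M x" if "(M, m) \<in> K" for M m
      using that model_ps by (auto simp: K_def)
  qed (rule that, assumption+)
  have mG: "model T G" by (rule joint_emb_model[OF T G(1,3)]) (auto simp: K_def)
  have g: "g \<in> ctx_prod lam G x" using G(2) by (simp add: generated_def)
  have "fm_holds lam \<Sigma> G (ctx_env lam x g) \<phi>"
  proof (rule ctx_fm_joint[OF G(1,3) \<phi> g])
    fix k assume k: "k \<in> K"
    then show "fm_holds lam \<Sigma> (fst k) (ctx_env lam x (ctx_map x (p k) g)) \<phi>"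
      using pg[of "fst k" "snd k"] by (auto simp: K_def)
  qed
  moreover have "\<exists>h. hm G M h \<and> ctx_map x h g = m"
    if "model T M" "m \<in> ctx_prod lam M x" "fm_holds lam \<Sigma> M (ctx_env lam x m) \<phi>" for M m
  proof -
    have k: "(M, m) \<in> K" using that by (simp add: K_def)
    then show ?thesis using joint_embD(1)[OF G(3) k] pg[OF k] by auto
  qed
  ultimately show thesis using that[OF mG G(2)] by blast
qed

lemma ctx_map_hcomp:
  "m \<in> ctx_prod lam M x \<Longrightarrow> ctx_map x (hcomp M g h) m = ctx_map x g (ctx_map x h m)"
  unfolding ctx_map_def ctx_prod_def hcomp_def by (auto simp: PiE_iff intro!: ext)

text \<open>A homomorphism out of \<open>G\<close> amounts to a tuple satisfying
  \<open>\<phi>\<close>. Such a tuple has fewer than \<open>lam\<close> entries and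
  \<open>\<phi>\<close> is built from conjunctions below \<open>lam\<close>, so both are available
  at a stage of any \<open>lam\<close>-filtered colimit.\<close>

lemma representing_presentable:
  assumes T: "is_horn_theory lam \<Sigma> T" and \<phi>: "fm_in_ctx lam \<Sigma> x \<phi>"
    and G: "model T G" "generated x G g" "fm_holds lam \<Sigma> G (ctx_env lam x g) \<phi>"
    and univ: "\<And>M m. model T M \<Longrightarrow> m \<in> ctx_prod lam M x \<Longrightarrow> fm_holds lam \<Sigma> M (ctx_env lam x m) \<phi> \<Longrightarrow>
      \<exists>h. hm G M h \<and> ctx_map x h g = m"
  shows "presentable \<kappa> lam (Mod T) G"
  unfolding presentable_def
proof (intro conjI allI impI ballI)
  show "G \<in> Obj (Mod T)" using G by (simp add: Mod_simps)
  have x: "is_context lam \<Sigma> x" using \<phi> by (simp add: fm_in_ctx_def)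
  have g: "g \<in> ctx_prod lam G x" using G(2) by (simp add: generated_def)
  note psG = model_ps[OF G(1)]
  fix J :: "('u, 'u) category" and D X \<xi>
  assume fc: "filtered_colimit \<kappa> lam (Mod T) J D X \<xi>"
  interpret filtered_diagram \<kappa> lam \<Sigma> T J D by (rule filtered_colimit_diagram[OF T fc])
  let ?k = "\<lambda>j. maps (\<xi> j)"
  have col: "is_colimit J (Mod T) D X \<xi>" using fc by (simp add: filtered_colimit_def)
  have gc: "good_cocone X ?k" by (rule is_colimit_good[OF col])
  have X: "model T X" and \<xi>: "\<And>j. j \<in> Obj J \<Longrightarrow> \<xi> j = Arrow (dob j) (?k j) X"
    using is_colimitD(1)[OF col] by (simp_all add: is_cocone_iff)
  note kh = compatibleD(1)[OF good_coconeD(1)[OF gc]]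
  {
    fix f assume f: "f \<in> Defs.hom (Mod T) G X"
    note fh = Mod_homD(6)[OF f]
    have m: "ctx_map x (maps f) g \<in> ctx_prod lam X x" by (rule ctx_map_prod[OF fh g])
    \<comment> \<open>The stage \<open>j\<close> is found for the tuple alone and
      \<open>\<phi>\<close> may still fail there; it holds from \<open>Cod J a\<close> on.\<close>
    obtain j m' where j: "j \<in> Obj J" and m': "m' \<in> ctx_prod lam (dob j) x" "ctx_map x (?k j) m' = ctx_map x (maps f) g"
      using lift_ctx[OF gc x m] .
    have "fm_holds lam \<Sigma> X (ctx_env lam x (ctx_map x (?k j) m')) \<phi>"
      unfolding m'(2) by (rule ctx_fm_hom[OF psG fh \<phi> G(3)])
    from ctx_fm_stage[OF model_ps[OF X] gc j \<phi> m'(1) this]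
    obtain a where a: "a \<in> Arr J" "Dom J a = j"
      and ha: "fm_holds lam \<Sigma> (dob (Cod J a)) (ctx_env lam x (ctx_map x (dm a) m')) \<phi>" .
    have ca: "Cod J a \<in> Obj J" using Arr_J a by blast
    have ma: "ctx_map x (dm a) m' \<in> ctx_prod lam (dob (Cod J a)) x"
      using ctx_map_prod[OF dm_hm[OF a(1)]] m'(1) a(2) by simp
    obtain h where h: "hm G (dob (Cod J a)) h" "ctx_map x h g = ctx_map x (dm a) m'"
      using univ[OF dob_model(1)[OF ca] ma ha] by blast
    have kc: "hm G X (hcomp G (?k (Cod J a)) h)" by (rule hm_comp[OF psG dob_model(2)[OF ca] h(1) kh[OF ca]])
    have "ctx_map x (?k (Cod J a)) (ctx_map x (dm a) m') = ctx_map x (?k j) m'"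
      using compatibleD(2)[OF good_coconeD(1)[OF gc] a(1)] a(2) m'(1)
      by (auto simp: ctx_map_def ctx_prod_def PiE_iff)
    then have "ctx_map x (hcomp G (?k (Cod J a)) h) g = ctx_map x (maps f) g"
      using ctx_map_hcomp[OF g] h(2) m'(2) by simp
    then have "hcomp G (?k (Cod J a)) h = maps f" by (rule generated_hom_unique[OF G(2) psG kc fh])
    then have "Comp (Mod T) (\<xi> (Cod J a)) (Arrow G h (dob (Cod J a))) = f"
      using \<xi>[OF ca] Mod_homD(1)[OF f] Mod_simps(6) by metis
    moreover have "Arrow G h (dob (Cod J a)) \<in> Defs.hom (Mod T) G (dob (Cod J a))"
      using h G(1) dob_model(1)[OF ca] by (simp add: Mod_hom)
    ultimately show "\<exists>j \<in> Obj J. \<exists>g \<in> Defs.hom (Mod T) G (dob j). Comp (Mod T) (\<xi> j) g = f"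
      using ca by blast
  }
  {
    fix j u u' assume j: "j \<in> Obj J" and u: "u \<in> Defs.hom (Mod T) G (dob j)" and u': "u' \<in> Defs.hom (Mod T) G (dob j)"
      and eq: "Comp (Mod T) (\<xi> j) u = Comp (Mod T) (\<xi> j) u'"
    note uh = Mod_homD(6)[OF u] and uh' = Mod_homD(6)[OF u']
    have eq': "?k j s (maps u s y) = ?k j s (maps u' s y)" if "y \<in> carr G s" for s y
    proof -
      have "hcomp G (?k j) (maps u) = hcomp G (?k j) (maps u')"
        using arg_cong[OF eq, of maps] maps_Comp[of T "\<xi> j" u] maps_Comp[of T "\<xi> j" u']
          Mod_homD(2)[OF u] Mod_homD(2)[OF u'] by simp
      then show ?thesis using hcomp_eqD[OF _ that] that by (metis hcomp_eqD)
    qed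
    let ?s = "\<lambda>i. fst (ctx_var x i)"
    have gi: "g i \<in> carr G (?s i)" if "i \<in> ctx_idx lam x" for i using g that by (auto simp: ctx_prod_def)
    \<comment> \<open>It suffices to identify the two homomorphisms on the entries of
      \<open>g\<close>, fewer than \<open>lam\<close> in number, since these generate
      \<open>G\<close>.\<close>
    obtain a where a: "a \<in> Arr J" "Dom J a = j"
      and eqa: "\<And>i. i \<in> ctx_idx lam x \<Longrightarrow> dm a (?s i) (maps u (?s i) (g i)) = dm a (?s i) (maps u' (?s i) (g i))"
    proof (rule eventually_equal[OF j ctx_idx_lam[OF x], of "\<lambda>i. maps u (?s i) (g i)" ?s "\<lambda>i. maps u' (?s i) (g i)"])
      fix i assume i: "i \<in> ctx_idx lam x"
      show c: "maps u (?s i) (g i) \<in> carr (dob j) (?s i)" "maps u' (?s i) (g i) \<in> carr (dob j) (?s i)"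
        using hmD(1)[OF uh gi[OF i]] hmD(1)[OF uh' gi[OF i]] .
      show "\<exists>a \<in> Arr J. Dom J a = j \<and> dm a (?s i) (maps u (?s i) (g i)) = dm a (?s i) (maps u' (?s i) (g i))"
        by (rule good_coconeD(3)[OF gc j c eq'[OF gi[OF i]]])
    qed (rule that, assumption+)
    have da: "hm (dob j) (dob (Cod J a)) (dm a)" using dm_hm[OF a(1)] a(2) by simp
    have "hcomp G (dm a) (maps u) = hcomp G (dm a) (maps u')"
      by (rule generated_hom_unique[OF G(2) psG hm_comp[OF psG dob_model(2)[OF j] uh da]
            hm_comp[OF psG dob_model(2)[OF j] uh' da]])
        (use eqa gi in \<open>auto simp: ctx_map_def hcomp_def\<close>)
    then have "Comp (Mod T) (farr D a) u = Comp (Mod T) (farr D a) u'"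
      using Mod_homD(1)[OF u] Mod_homD(1)[OF u'] Mod_homD(1)[OF dm_hom[OF a(1)]] Mod_simps(6) by metis
    then show "\<exists>a \<in> Arr J. Dom J a = j \<and> Comp (Mod T) (farr D a) u = Comp (Mod T) (farr D a) u'"
      using a by blast
  }
qed

lemma has_section_pure_epi:
  assumes "has_section (Mod T) p"
  shows "pure_epi \<kappa> lam (Mod T) p"
proof -
  obtain X q Y where p: "p = Arrow X q Y" by (cases p)
  have X: "model T X" "model T Y" "hm X Y q" using assms unfolding has_section_def p by (auto simp: Mod_simps)
  obtain w where w: "w \<in> Defs.hom (Mod T) Y X" "Comp (Mod T) p w = Id (Mod T) Y"
    using assms unfolding has_section_def p by (auto simp: Mod_simps)
  note wh = Mod_homD[OF w(1)]
  have "hcomp Y q (maps w) = hid Y"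
    using arg_cong[OF w(2), of maps] maps_Comp[of T p w] wh(2) by (simp add: p Mod_simps)
  then have qw: "q s (maps w s y) = y" if "y \<in> carr Y s" for s y using that hid_eq_iff by blast
  have "\<exists>g \<in> Defs.hom (Mod T) G X. Comp (Mod T) p g = f" if f: "f \<in> Defs.hom (Mod T) G Y" for G f
  proof (intro bexI)
    note fh = Mod_homD[OF f]
    show "Arrow G (hcomp G (maps w) (maps f)) X \<in> Defs.hom (Mod T) G X"
      using hm_comp[OF model_ps[OF fh(4)] model_ps[OF X(2)] fh(6) wh(6)] fh X by (simp add: Mod_hom)
    have "hcomp G q (hcomp G (maps w) (maps f)) = maps f"
      unfolding hcomp_eq_iff[OF fh(6)] using qw hmD(1)[OF fh(6)] by (simp add: hcomp_def)
    then show "Comp (Mod T) p (Arrow G (hcomp G (maps w) (maps f)) X) = f"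
      using fh(1) p Mod_simps(6) by metis
  qed
  then show ?thesis unfolding pure_epi_def using X p by (auto simp: Mod_simps)
qed

end

section \<open>Relative judgments\<close>

context theory_morphism
begin

lemma relative_judgmentE:
  assumes "relative_judgment lam \<Sigma> \<Sigma>' \<rho> \<sigma>"
  obtains x \<phi> \<psi> where "fm_in_ctx lam \<Sigma> x \<phi>" "fm_in_ctx lam \<Sigma>' (ctx_tr lam \<rho> x) \<psi>"
    "\<sigma> = Sequent (ctx_tr lam \<rho> x) (fm_tr lam \<Sigma> \<Sigma>' \<rho> x \<phi>) \<psi>" "is_context lam \<Sigma> x"
  using assms unfolding relative_judgment_def fm_in_ctx_def by blast

text \<open>The premise is pushed forward along the reducts of the \<open>p i\<close>, and the
  conclusion is reflected by the \<open>p i\<close> themselves.\<close>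

lemma relative_joint_emb:
  assumes \<sigma>: "relative_judgment lam \<Sigma> \<Sigma>' \<rho> \<sigma>" and K: "tgt.ps K" and je: "tgt.joint_emb K I A p"
    and A: "\<And>i. i \<in> I \<Longrightarrow> tgt.ps (A i)" "\<And>i. i \<in> I \<Longrightarrow> valid_in lam \<Sigma>' (A i) \<sigma>"
  shows "valid_in lam \<Sigma>' K \<sigma>"
proof -
  obtain x \<phi> \<psi> where \<phi>: "fm_in_ctx lam \<Sigma> x \<phi>" and \<psi>: "fm_in_ctx lam \<Sigma>' (ctx_tr lam \<rho> x) \<psi>"
    and \<sigma>': "\<sigma> = Sequent (ctx_tr lam \<rho> x) (fm_tr lam \<Sigma> \<Sigma>' \<rho> x \<phi>) \<psi>" and x: "is_context lam \<Sigma> x"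
    by (rule relative_judgmentE[OF \<sigma>])
  show ?thesis
    unfolding \<sigma>' relative_valid_iff[OF K \<phi>]
  proof (intro ballI impI)
    fix m assume m: "m \<in> ctx_prod lam (rd K) x" and h: "fm_holds lam \<Sigma> (rd K) (ctx_env lam x m) \<phi>"
    show "fm_holds lam \<Sigma>' K (ctx_env lam (ctx_tr lam \<rho> x) m) \<psi>"
    proof (rule tgt.ctx_fm_joint[OF K je \<psi>])
      show "m \<in> ctx_prod lam K (ctx_tr lam \<rho> x)" using m ctx_prod_tr[OF x] by simp
      fix i assume i: "i \<in> I"
      have ph: "src.hm (rd K) (rd (A i)) (rdm (p i))" by (rule rdm_hm[OF K tgt.joint_embD(1)[OF je i]])
      have "fm_holds lam \<Sigma> (rd (A i)) (ctx_env lam x (src.ctx_map x (rdm (p i)) m)) \<phi>"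
        by (rule src.ctx_fm_hom[OF rd_ps[OF K] ph \<phi> h])
      then show "fm_holds lam \<Sigma>' (A i) (ctx_env lam (ctx_tr lam \<rho> x) (tgt.ctx_map (ctx_tr lam \<rho> x) (p i) m)) \<psi>"
        using A(2)[OF i] relative_valid_iff[OF A(1)[OF i] \<phi>] src.ctx_map_prod[OF ph m]
        unfolding \<sigma>' ctx_map_tr[OF x] by blast
    qed
  qed
qed

text \<open>A tuple of the reduct of \<open>Y\<close> satisfying \<open>\<phi>\<close> is an arrow
  from the presentable object that represents \<open>\<phi>\<close>. Purity lifts this arrow to the
  reduct of \<open>X\<close>; there the judgment yields \<open>\<psi>\<close>, which the
  homomorphism \<open>q\<close> carries to \<open>Y\<close>.\<close>

lemma relative_pure_quotient:
  assumes \<sigma>: "relative_judgment lam \<Sigma> \<Sigma>' \<rho> \<sigma>" and p: "p \<in> Arr (tgt.Mod T)"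
    and pure: "pure_epi \<kappa> lam (src.Mod S) (farr U p)" and v: "valid_in lam \<Sigma>' (source p) \<sigma>"
  shows "valid_in lam \<Sigma>' (target p) \<sigma>"
proof -
  obtain X q Y where pq: "p = Arrow X q Y" by (cases p)
  have X: "tgt.model T X" "tgt.model T Y" "tgt.hm X Y q" using p by (simp_all add: pq tgt.Mod_simps)
  note psX = tgt.model_ps[OF X(1)] and psY = tgt.model_ps[OF X(2)]
  obtain x \<phi> \<psi> where \<phi>: "fm_in_ctx lam \<Sigma> x \<phi>" and \<psi>: "fm_in_ctx lam \<Sigma>' (ctx_tr lam \<rho> x) \<psi>"
    and \<sigma>': "\<sigma> = Sequent (ctx_tr lam \<rho> x) (fm_tr lam \<Sigma> \<Sigma>' \<rho> x \<phi>) \<psi>" and x: "is_context lam \<Sigma> x"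
    by (rule relative_judgmentE[OF \<sigma>])
  obtain G g where G: "src.model S G" "src.generated x G g" "fm_holds lam \<Sigma> G (ctx_env lam x g) \<phi>"
    and univ: "\<And>M m. src.model S M \<Longrightarrow> m \<in> ctx_prod lam M x \<Longrightarrow> fm_holds lam \<Sigma> M (ctx_env lam x m) \<phi> \<Longrightarrow>
      \<exists>h. src.hm G M h \<and> src.ctx_map x h g = m"
    by (rule src.representing_exists[OF hornS \<phi>]) (rule that)
  have g: "g \<in> ctx_prod lam G x" using G(2) by (simp add: src.generated_def)
  have "presentable \<kappa> lam (src.Mod S) G" by (rule src.representing_presentable[OF hornS \<phi> G univ])
  then have lift: "\<exists>w \<in> Defs.hom (src.Mod S) G (rd X). Comp (src.Mod S) (farr U p) w = f"
    if "f \<in> Defs.hom (src.Mod S) G (rd Y)" for f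
    using pure that unfolding pure_epi_def src.Mod_simps U_simps pq arrow.sel by blast
  show ?thesis
    unfolding \<sigma>' pq arrow.sel relative_valid_iff[OF psY \<phi>]
  proof (intro ballI impI)
    fix m assume m: "m \<in> ctx_prod lam (rd Y) x" and h: "fm_holds lam \<Sigma> (rd Y) (ctx_env lam x m) \<phi>"
    obtain f where f: "src.hm G (rd Y) f" "src.ctx_map x f g = m"
      using univ[OF rd_model[OF X(2)] m h] by blast
    have "Arrow G f (rd Y) \<in> Defs.hom (src.Mod S) G (rd Y)" using f G(1) rd_model[OF X(2)] by (simp add: src.Mod_hom)
    then obtain w where w: "w \<in> Defs.hom (src.Mod S) G (rd X)" "Comp (src.Mod S) (farr U p) w = Arrow G f (rd Y)"
      using lift by blast
    note wh = src.Mod_homD[OF w(1)]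
    have "src.hcomp G (rdm q) (maps w) = f"
      using arg_cong[OF w(2), of maps] src.maps_Comp[of S "farr U p" w] wh(2) by (simp add: U_simps pq)
    then have qw: "src.ctx_map x (rdm q) (src.ctx_map x (maps w) g) = m"
      using src.ctx_map_hcomp[OF g] f(2) by metis
    have wp: "src.ctx_map x (maps w) g \<in> ctx_prod lam (rd X) x" by (rule src.ctx_map_prod[OF wh(6) g])
    have "fm_holds lam \<Sigma> (rd X) (ctx_env lam x (src.ctx_map x (maps w) g)) \<phi>"
      by (rule src.ctx_fm_hom[OF src.model_ps[OF G(1)] wh(6) \<phi> G(3)])
    then have "fm_holds lam \<Sigma>' X (ctx_env lam (ctx_tr lam \<rho> x) (src.ctx_map x (maps w) g)) \<psi>"
      using v wp relative_valid_iff[OF psX \<phi>] unfolding \<sigma>' pq arrow.sel by blast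
    from tgt.ctx_fm_hom[OF psX X(3) \<psi> this]
    show "fm_holds lam \<Sigma>' Y (ctx_env lam (ctx_tr lam \<rho> x) m) \<psi>"
      unfolding ctx_map_tr[OF x] qw .
  qed
qed

end

section \<open>Reducts of filtered diagrams\<close>

locale morphism_diagram = theory_morphism \<kappa> lam \<Sigma> \<Sigma>' S T \<rho> + td: filtered_diagram \<kappa> lam \<Sigma>' T J D
  for \<kappa> :: "'u rel" and lam :: "'l rel"
    and \<Sigma> :: "('s, 'f, 'r, 'l) signature" and \<Sigma>' :: "('t, 'g, 'q, 'l) signature"
    and S :: "('s, 'f, 'r, 'l) sequent set" and T :: "('t, 'g, 'q, 'l) sequent set"
    and \<rho> :: "('s, 'f, 'r, 't, 'g, 'q, 'l) morphism"
    and J :: "('j, 'b) category"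
    and D :: "('j, 'b, ('t, 'g, 'q, 'l, 'u) pstruct, ('t, 'g, 'q, 'l, 'u) arrow) func"
begin

definition D' :: "('j, 'b, ('s, 'f, 'r, 'l, 'u) pstruct, ('s, 'f, 'r, 'l, 'u) arrow) func" where
  "D' = \<lparr> fobj = (\<lambda>j. rd (fobj D j)), farr = (\<lambda>a. farr U (farr D a)) \<rparr>"

lemma D'_simps:
  "fobj D' j = rd (fobj D j)" "maps (farr D' a) = rdm (maps (farr D a))"
  by (simp_all add: D'_def U_simps)

lemma D'_farr: "farr D' a = farr U (farr D a)"
  by (simp add: D'_def)

lemma D'_functor: "is_functor J (src.Mod S) D'"
  unfolding is_functor_def
proof (intro conjI ballI impI)
  show "fobj D' j \<in> Obj (src.Mod S)" if "j \<in> Obj J" for j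
    using rd_model[OF td.dob_model(1)[OF that]] by (simp add: D'_simps src.Mod_simps)
  fix a assume a: "a \<in> Arr J"
  note ah = tgt.Mod_homD[OF td.dm_hom[OF a]]
  have fa: "farr D' a = Arrow (fobj D' (Dom J a)) (rdm (td.dm a)) (fobj D' (Cod J a))"
    using ah(1) U_simps(2) D'_simps D'_farr by metis
  show "farr D' a \<in> Defs.hom (src.Mod S) (fobj D' (Dom J a)) (fobj D' (Cod J a))"
    unfolding fa src.Mod_hom
    using rd_model[OF ah(4)] rd_model[OF ah(5)] rdm_hm[OF tgt.model_ps[OF ah(4)] ah(6)]
    by (simp add: D'_simps)
next
  fix j assume j: "j \<in> Obj J"
  have "farr D (Id J j) = Arrow (fobj D j) (tgt.hid (fobj D j)) (fobj D j)"
    using td.diag_functor j unfolding is_functor_def by (simp add: tgt.Mod_simps)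
  then show "farr D' (Id J j) = Id (src.Mod S) (fobj D' j)"
    by (simp add: D'_simps D'_farr U_simps src.Mod_simps rdm_hid)
next
  fix a b assume ab: "a \<in> Arr J" "b \<in> Arr J" "Dom J b = Cod J a"
  have "farr D (Comp J b a) = Comp (tgt.Mod T) (farr D b) (farr D a)"
    using td.diag_functor ab unfolding is_functor_def by blast
  also have "\<dots> = Arrow (fobj D (Dom J a)) (tgt.hcomp (fobj D (Dom J a)) (td.dm b) (td.dm a)) (fobj D (Cod J b))"
    using tgt.Mod_homD(1)[OF td.dm_hom[OF ab(1)]] tgt.Mod_homD(1)[OF td.dm_hom[OF ab(2)]]
    by (metis tgt.Mod_simps(6))
  finally have "farr D' (Comp J b a) = Arrow (rd (fobj D (Dom J a)))
      (src.hcomp (rd (fobj D (Dom J a))) (rdm (td.dm b)) (rdm (td.dm a))) (rd (fobj D (Cod J b)))"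
    by (simp add: D'_farr U_simps rdm_hcomp)
  also have "\<dots> = Comp (src.Mod S) (farr D' b) (farr D' a)"
    unfolding D'_farr using tgt.Mod_homD(1)[OF td.dm_hom[OF ab(1)]] tgt.Mod_homD(1)[OF td.dm_hom[OF ab(2)]]
    by (metis src.Mod_simps(6) U_simps(2))
  finally show "farr D' (Comp J b a) = Comp (src.Mod S) (farr D' b) (farr D' a)" .
qed

sublocale sd: filtered_diagram \<kappa> lam \<Sigma> S J D'
  by unfold_locales (rule hornS, rule td.filtered, rule td.smallJ, rule D'_functor)

text \<open>The translation functor preserves \<open>lam\<close>-filtered colimits, because the
  reduct is given by terms and Horn formulas, and these are decided at stages.\<close>

lemma rd_good_cocone:
  assumes X: "tgt.ps X" and gc: "td.good_cocone X k"
  shows "sd.good_cocone (rd X) (\<lambda>j. rdm (k j))"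
proof -
  note k = td.good_coconeD(1)[OF gc]
  have srt: "s \<in> sorts \<Sigma>" if "y \<in> carr (rd M) s" for y s and M :: "('t, 'g, 'q, 'l, 'u) pstruct"
    using that by (simp add: reduct_def split: if_splits)
  have "sd.compatible (rd X) (\<lambda>j. rdm (k j))"
    unfolding sd.compatible_def D'_simps
  proof (intro conjI ballI allI)
    show "src.hm (rd (td.dob j)) (rd X) (rdm (k j))" if "j \<in> Obj J" for j
      by (rule rdm_hm[OF td.dob_model(2)[OF that] td.compatibleD(1)[OF k that]])
    fix a s y assume a: "a \<in> Arr J" and y: "y \<in> carr (rd (td.dob (Dom J a))) s"
    show "rdm (k (Cod J a)) s (rdm (td.dm a) s y) = rdm (k (Dom J a)) s y"
      using td.compatibleD(2)[OF k a, of y "smap \<rho> s"] y by (simp add: rdm_at rd_carr srt[OF y])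
  qed
  moreover have "\<exists>j \<in> Obj J. \<exists>y \<in> carr (rd (td.dob j)) s. rdm (k j) s y = z" if z: "z \<in> carr (rd X) s" for s z
    using td.good_coconeD(2)[OF gc, of z "smap \<rho> s"] z by (simp add: rdm_at rd_carr srt[OF z])
  moreover have "\<exists>a \<in> Arr J. Dom J a = j \<and> rdm (td.dm a) s y = rdm (td.dm a) s y'"
    if "j \<in> Obj J" "y \<in> carr (rd (td.dob j)) s" "y' \<in> carr (rd (td.dob j)) s" "rdm (k j) s y = rdm (k j) s y'"
    for j s y y'
    using td.good_coconeD(3)[OF gc that(1), of y "smap \<rho> s" y'] that by (simp add: rdm_at rd_carr srt[OF that(2)])
  moreover have "\<exists>a \<in> Arr J. Dom J a = j \<and> fint (rd (td.dob (Cod J a))) f (fun_tuple lam \<Sigma> f (rdm (td.dm a)) b) \<noteq> None"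
    if j: "j \<in> Obj J" and f: "f \<in> funs \<Sigma>" and b: "b \<in> fun_args lam \<Sigma> (rd (td.dob j)) f"
      and d: "fint (rd X) f (fun_tuple lam \<Sigma> f (rdm (k j)) b) \<noteq> None" for j f b
  proof -
    let ?x = "fun_ctx lam \<Sigma> \<rho> f"
    \<comment> \<open>Definedness of \<open>f\<close> in a reduct is the Horn formula equating its
      image term with itself, so the result on formulas at stages covers it.\<close>
    have E: "fm_in_ctx lam \<Sigma>' ?x (Eq (fmap \<rho> f) (fmap \<rho> f))"
      by (rule tgt.fm_in_ctx_Eq[OF morphD(2)[OF f] morphD(2)[OF f]])
    have b': "b \<in> ctx_prod lam (td.dob j) ?x" using b ctx_prod_fun[OF f] by simp
    obtain y where y: "fint (rd X) f (tgt.ctx_map ?x (k j) b) = Some y"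
      using d unfolding fun_tuple_ctx_map[OF f] by blast
    have "fm_holds lam \<Sigma>' X (ctx_env lam ?x (tgt.ctx_map ?x (k j) b)) (Eq (fmap \<rho> f) (fmap \<rho> f))"
      using y rd_fint(1)[OF f rd_fint(2)[OF f y]] by simp
    from td.ctx_fm_stage[OF X gc j E b' this]
    obtain a where a: "a \<in> Arr J" "Dom J a = j"
      "fm_holds lam \<Sigma>' (td.dob (Cod J a)) (ctx_env lam ?x (tgt.ctx_map ?x (td.dm a) b)) (Eq (fmap \<rho> f) (fmap \<rho> f))" .
    have "tgt.ctx_map ?x (td.dm a) b \<in> fun_args lam \<Sigma> (rd (td.dob (Cod J a))) f"
      using tgt.ctx_map_prod[OF td.dm_hm[OF a(1)]] b' a(2) ctx_prod_fun[OF f] by metis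
    then show ?thesis using a rd_fint(1)[OF f] by (auto simp: fun_tuple_ctx_map[OF f])
  qed
  moreover have "\<exists>a \<in> Arr J. Dom J a = j \<and> rel_tuple lam \<Sigma> R (rdm (td.dm a)) b \<in> rint (rd (td.dob (Cod J a))) R"
    if j: "j \<in> Obj J" and R: "R \<in> rels \<Sigma>" and b: "b \<in> rel_args lam \<Sigma> (rd (td.dob j)) R"
      and d: "rel_tuple lam \<Sigma> R (rdm (k j)) b \<in> rint (rd X) R" for j R b
  proof -
    let ?x = "rel_ctx lam \<Sigma> \<rho> R"
    have b': "b \<in> ctx_prod lam (td.dob j) ?x" using b ctx_prod_rel[OF R] by simp
    have "fm_holds lam \<Sigma>' X (ctx_env lam ?x (tgt.ctx_map ?x (k j) b)) (rmap \<rho> R)"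
      using d unfolding rel_tuple_ctx_map[OF R] rd_rint[OF R] by blast
    from td.ctx_fm_stage[OF X gc j morphD(3)[OF R] b' this]
    obtain a where a: "a \<in> Arr J" "Dom J a = j"
      "fm_holds lam \<Sigma>' (td.dob (Cod J a)) (ctx_env lam ?x (tgt.ctx_map ?x (td.dm a) b)) (rmap \<rho> R)" .
    have "tgt.ctx_map ?x (td.dm a) b \<in> rel_args lam \<Sigma> (rd (td.dob (Cod J a))) R"
      using tgt.ctx_map_prod[OF td.dm_hm[OF a(1)]] b' a(2) ctx_prod_rel[OF R] by metis
    then show ?thesis using a by (auto simp: rel_tuple_ctx_map[OF R] rd_rint[OF R])
  qed
  ultimately show ?thesis unfolding sd.good_cocone_def D'_simps by blast
qed

text \<open>The premise already holds in the reduct of some stage; the judgment is applied there and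
  its conclusion is carried along the cocone.\<close>

lemma relative_good_cocone:
  assumes \<sigma>: "relative_judgment lam \<Sigma> \<Sigma>' \<rho> \<sigma>" and X: "tgt.ps X" and gc: "td.good_cocone X k"
    and v: "\<And>j. j \<in> Obj J \<Longrightarrow> valid_in lam \<Sigma>' (td.dob j) \<sigma>"
  shows "valid_in lam \<Sigma>' X \<sigma>"
proof -
  obtain x \<phi> \<psi> where \<phi>: "fm_in_ctx lam \<Sigma> x \<phi>" and \<psi>: "fm_in_ctx lam \<Sigma>' (ctx_tr lam \<rho> x) \<psi>"
    and \<sigma>': "\<sigma> = Sequent (ctx_tr lam \<rho> x) (fm_tr lam \<Sigma> \<Sigma>' \<rho> x \<phi>) \<psi>" and x: "is_context lam \<Sigma> x"
    by (rule relative_judgmentE[OF \<sigma>])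
  note gs = rd_good_cocone[OF X gc] and k = td.good_coconeD(1)[OF gc]
  show ?thesis
    unfolding \<sigma>' relative_valid_iff[OF X \<phi>]
  proof (intro ballI impI)
    fix m assume m: "m \<in> ctx_prod lam (rd X) x" and h: "fm_holds lam \<Sigma> (rd X) (ctx_env lam x m) \<phi>"
    obtain j m' where j: "j \<in> Obj J" and m': "m' \<in> ctx_prod lam (rd (td.dob j)) x" "src.ctx_map x (rdm (k j)) m' = m"
      using sd.lift_ctx[OF gs x m] unfolding D'_simps .
    have "fm_holds lam \<Sigma> (rd X) (ctx_env lam x (src.ctx_map x (rdm (k j)) m')) \<phi>" unfolding m'(2) by (rule h)
    from sd.ctx_fm_stage[OF rd_ps[OF X] gs j \<phi> _ this, unfolded D'_simps, OF m'(1)]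
    obtain a where a: "a \<in> Arr J" "Dom J a = j"
      and ha: "fm_holds lam \<Sigma> (rd (td.dob (Cod J a))) (ctx_env lam x (src.ctx_map x (rdm (td.dm a)) m')) \<phi>" .
    have ca: "Cod J a \<in> Obj J" using td.Arr_J a by blast
    let ?m = "src.ctx_map x (rdm (td.dm a)) m'"
    have ma: "?m \<in> ctx_prod lam (rd (td.dob (Cod J a))) x"
      using src.ctx_map_prod[OF sd.dm_hm[OF a(1)]] m'(1) a(2) by (simp add: D'_simps)
    have "fm_holds lam \<Sigma>' (td.dob (Cod J a)) (ctx_env lam (ctx_tr lam \<rho> x) ?m) \<psi>"
      using v[OF ca] relative_valid_iff[OF td.dob_model(2)[OF ca] \<phi>] ma ha unfolding \<sigma>' by blast
    from tgt.ctx_fm_hom[OF td.dob_model(2)[OF ca] td.compatibleD(1)[OF k ca] \<psi> this]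
    have "fm_holds lam \<Sigma>' X (ctx_env lam (ctx_tr lam \<rho> x) (src.ctx_map x (rdm (k (Cod J a))) ?m)) \<psi>"
      unfolding ctx_map_tr[OF x] .
    moreover have "src.ctx_map x (rdm (k (Cod J a))) ?m = m"
    proof -
      have "rdm (k (Cod J a)) (fst (ctx_var x i)) (rdm (td.dm a) (fst (ctx_var x i)) (m' i)) =
          rdm (k j) (fst (ctx_var x i)) (m' i)" if "i \<in> ctx_idx lam x" for i
        using sd.compatibleD(2)[OF sd.good_coconeD(1)[OF gs] a(1), of "m' i" "fst (ctx_var x i)"] a(2) m'(1) that
        by (auto simp: ctx_prod_def D'_simps)
      then show ?thesis unfolding m'(2)[symmetric] by (auto simp: src.ctx_map_def)
    qed
    ultimately show "fm_holds lam \<Sigma>' X (ctx_env lam (ctx_tr lam \<rho> x) m) \<psi>" by simp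
  qed
qed

end

section \<open>Filtered colimits as pure quotients\<close>

context filtered_diagram
begin

text \<open>The preorder underlying \<open>J\<close>. Passing to it is harmless when elements are
  compared in the colimit, where parallel arrows have the same effect.\<close>

definition reach :: "'j \<Rightarrow> 'j \<Rightarrow> bool" where
  "reach i j \<longleftrightarrow> Defs.hom J i j \<noteq> {}"

lemma reachE:
  assumes "reach i j"
  obtains a where "a \<in> Arr J" "Dom J a = i" "Cod J a = j"
  using assms unfolding reach_def Defs.hom_def by blast

lemma reachI: "a \<in> Arr J \<Longrightarrow> reach (Dom J a) (Cod J a)"
  unfolding reach_def Defs.hom_def by blast

lemma reach_refl: "j \<in> Obj J \<Longrightarrow> reach j j"
  using reachI Id_J by metis

lemma reach_trans: "reach i j \<Longrightarrow> reach j l \<Longrightarrow> reach i l"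
  by (elim reachE) (metis Comp_J reachI)

lemma reach_Obj: "reach i j \<Longrightarrow> j \<in> Obj J"
  using Arr_J by (auto elim: reachE)

lemma reach_bound:
  assumes "Y \<subseteq> Obj J" "|Y| <o lam"
  obtains c where "c \<in> Obj J" "\<And>j. j \<in> Y \<Longrightarrow> reach j c"
  by (rule bound_J[OF assms]) (use that in \<open>unfold reach_def, blast\<close>)

end

context morphism_diagram
begin

text \<open>Otherwise every stage reaches a stage whose reduct has no homomorphism back. Iterating
  gives a chain of reducts in which no two consecutive objects are strongly connected, against the
  chain condition.\<close>

lemma strongly_connected_tail:
  assumes acc: "ascending_chain_condition (src.Mod S)"
  obtains c where "c \<in> Obj J" "\<And>j. td.reach c j \<Longrightarrow> \<exists>h. src.hm (rd (td.dob j)) (rd (td.dob c)) h"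
proof (rule ccontr)
  assume "\<not> thesis"
  then have "\<forall>c \<in> Obj J. \<exists>j. td.reach c j \<and> \<not> (\<exists>h. src.hm (rd (td.dob j)) (rd (td.dob c)) h)"
    using that by blast
  from bchoice[OF this] obtain nx where nx: "\<forall>c \<in> Obj J. td.reach c (nx c) \<and>
    \<not> (\<exists>h. src.hm (rd (td.dob (nx c))) (rd (td.dob c)) h)" ..
  obtain c0 where c0: "c0 \<in> Obj J"
    by (rule td.reach_bound[of "{}"]) (use src.lam_finite[of "{}"] that in auto)
  define s where "s n = (nx ^^ n) c0" for n
  have s: "s n \<in> Obj J" for n
    by (induction n) (use c0 nx td.reach_Obj in \<open>auto simp: s_def\<close>)
  have s_Suc: "s (Suc n) = nx (s n)" for n by (simp add: s_def)
  have "\<forall>n. \<exists>a. a \<in> Arr J \<and> Dom J a = s n \<and> Cod J a = s (Suc n)"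
    using nx s s_Suc by (metis td.reachE)
  then obtain a where a: "\<And>n. a n \<in> Arr J \<and> Dom J (a n) = s n \<and> Cod J (a n) = s (Suc n)" by metis
  have "\<exists>N. \<forall>m \<ge> N. \<forall>n \<ge> N. strongly_connected (src.Mod S) (fobj D' (s m)) (fobj D' (s n))"
    using acc[unfolded ascending_chain_condition_def, rule_format, of "\<lambda>n. fobj D' (s n)" "\<lambda>n. farr D' (a n)"]
      sd.dob_model(1)[OF s] sd.dm_hom a by (simp add: src.Mod_simps) metis
  then obtain N where "strongly_connected (src.Mod S) (fobj D' (s (Suc N))) (fobj D' (s N))"
    by (meson le_SucI order_refl)
  then obtain f where "f \<in> Defs.hom (src.Mod S) (fobj D' (s (Suc N))) (fobj D' (s N))"
    unfolding strongly_connected_def by blast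
  from src.Mod_homD(6)[OF this] show False using nx s[of N] by (auto simp: s_Suc D'_simps)
qed

text \<open>\<open>P\<close> consists of families over the stages reachable from \<open>c\<close>
  whose images in \<open>X\<close> are eventually constant, and \<open>q\<close> takes the eventual
  value. Such families are closed under functions, since fewer than \<open>lam\<close> arguments
  become constant simultaneously. A section over a single stage exists only for reducts: it uses the
  arrows of the diagram wherever they exist and a detour through \<open>c\<close> elsewhere.\<close>

lemma eventually_constant_cover:
  assumes E: "E \<subseteq> Obj (tgt.Mod T)" and prods: "closed_under_products \<kappa> (tgt.Mod T) E"
    and subs: "closed_under_closed_subobjects \<kappa> lam \<Sigma>' T E"
    and X: "tgt.ps X" and gc: "td.good_cocone X k" and DE: "\<And>j. j \<in> Obj J \<Longrightarrow> td.dob j \<in> E"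
    and acc: "ascending_chain_condition (src.Mod S)"
  obtains P q where "P \<in> E" "tgt.hm P X q"
    "\<And>j. j \<in> Obj J \<Longrightarrow> \<exists>u. src.hm (rd (td.dob j)) (rd P) u \<and>
      (\<forall>s. \<forall>y \<in> carr (rd (td.dob j)) s. rdm q s (u s y) = rdm (k j) s y)"
proof -
  obtain c where c: "c \<in> Obj J" "\<And>j. td.reach c j \<Longrightarrow> \<exists>h. src.hm (rd (td.dob j)) (rd (td.dob c)) h"
    using strongly_connected_tail[OF acc] by blast
  note k = td.good_coconeD(1)[OF gc]
  note kh = td.compatibleD(1)[OF k]
  define I where "I = {j. td.reach c j}"
  have cI: "c \<in> I" using td.reach_refl[OF c(1)] by (simp add: I_def)
  have IO: "j \<in> Obj J" if "j \<in> I" for j using that td.reach_Obj by (simp add: I_def)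
  have Iup: "j' \<in> I" if "j \<in> I" "td.reach j j'" for j j' using that td.reach_trans by (auto simp: I_def)
  \<comment> \<open>The family \<open>z\<close>, mapped to the colimit, takes the value
    \<open>x\<close> at all stages beyond some \<open>j0\<close>. Earlier and incomparable
    coordinates are unrestricted.\<close>
  define ev where "ev s z x \<longleftrightarrow> (\<exists>j0 \<in> I. \<forall>j. td.reach j0 j \<longrightarrow> k j s (z j) = x)" for s z x
  have ev_bound: "\<exists>j1 \<in> I. \<forall>j. td.reach j1 j \<longrightarrow> (\<forall>i \<in> Y. k j (s i) (z i j) = x i)"
    if Y: "|Y| <o lam" and ev: "\<And>i. i \<in> Y \<Longrightarrow> ev (s i) (z i) (x i)" for Y :: "'i set" and s z x
  proof -
    have "\<forall>i \<in> Y. \<exists>j0. j0 \<in> I \<and> (\<forall>j. td.reach j0 j \<longrightarrow> k j (s i) (z i j) = x i)"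
      using ev unfolding ev_def by blast
    from bchoice[OF this] obtain j0 where j0: "\<forall>i \<in> Y. j0 i \<in> I \<and> (\<forall>j. td.reach (j0 i) j \<longrightarrow> k j (s i) (z i j) = x i)" ..
    \<comment> \<open>Including \<open>c\<close> keeps the bound inside \<open>I\<close> even when
      \<open>Y\<close> is empty.\<close>
    have sm: "|insert c (j0 ` Y)| <o lam" by (intro src.lam_insert src.lam_image Y)
    obtain j1 where j1: "\<And>j. j \<in> insert c (j0 ` Y) \<Longrightarrow> td.reach j j1"
      by (rule td.reach_bound[OF _ sm]) (use c(1) j0 IO in blast, rule that, assumption)
    have "j1 \<in> I" using j1 cI Iup by blast
    moreover have "\<forall>j. td.reach j1 j \<longrightarrow> (\<forall>i \<in> Y. k j (s i) (z i j) = x i)"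
      using j0 j1 td.reach_trans by blast
    ultimately show ?thesis by blast
  qed
  have ev_unique: "x = x'" if "ev s z x" "ev s z x'" for s z x x'
  proof -
    have "\<exists>j1 \<in> I. \<forall>j. td.reach j1 j \<longrightarrow> (\<forall>i \<in> {True, False}. k j s (z j) = (if i then x else x'))"
      by (rule ev_bound) (use that src.lam_finite[of "{True, False}"] in auto)
    then obtain j1 where j1: "j1 \<in> I" "\<forall>i \<in> {True, False}. k j1 s (z j1) = (if i then x else x')"
      using td.reach_refl[OF IO] by blast
    have "k j1 s (z j1) = x" "k j1 s (z j1) = x'"
      using j1(2)[THEN bspec, of True] j1(2)[THEN bspec, of False] by simp_all
    then show ?thesis by simp
  qed
  have ev_carr: "x \<in> carr X s" if "ev s z x" "\<And>j. j \<in> I \<Longrightarrow> z j \<in> carr (td.dob j) s" for s z x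
    using that td.reach_refl[OF IO] tgt.hmD(1)[OF kh[OF IO]] unfolding ev_def by metis
  define Z where "Z s = {z \<in> (\<Pi>\<^sub>E j \<in> I. carr (td.dob j) s). \<exists>x. ev s z x}" for s
  have psD: "tgt.ps (td.dob j)" if "j \<in> I" for j using td.dob_model(2)[OF IO[OF that]] .
  have small: "|Z s| <o \<kappa>" if s: "s \<in> sorts \<Sigma>'" for s
  proof (rule src.small_subset)
    show "Z s \<subseteq> (\<Pi>\<^sub>E j \<in> I. carr (td.dob j) s)" by (auto simp: Z_def)
    have "|I| <o \<kappa>" by (rule src.small_subset[of _ "Obj J"]) (use IO td.smallJ in \<open>auto simp: small_category_def\<close>)
    then show "|\<Pi>\<^sub>E j \<in> I. carr (td.dob j) s| <o \<kappa>"
      by (rule src.small_PiE) (use psD s in \<open>auto simp: is_pstruct_def\<close>)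
  qed
  \<comment> \<open>From the stage where all arguments have reached their eventual images, the
    images of the values \<open>w j\<close> are all equal to the value of \<open>f\<close> in
    \<open>X\<close>. This shows that \<open>P\<close> is closed under \<open>f\<close> and that
    \<open>q\<close> preserves \<open>f\<close>.\<close>
  have f_stage: "\<exists>j1 \<in> I. \<forall>j. td.reach j1 j \<longrightarrow> fint X f (\<lambda>i \<in> fun_idx lam \<Sigma>' f. x i) = Some (k j (fun_cod \<Sigma>' f) (w j))"
    if f: "f \<in> funs \<Sigma>'" and ev: "\<And>i. i \<in> fun_idx lam \<Sigma>' f \<Longrightarrow> ev (fun_dom \<Sigma>' f i) (z i) (x i)"
      and d: "\<And>j. j \<in> I \<Longrightarrow> fint (td.dob j) f (\<lambda>i \<in> fun_idx lam \<Sigma>' f. z i j) = Some (w j)" for f z x w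
  proof -
    obtain j1 where j1: "j1 \<in> I"
      "\<And>j. td.reach j1 j \<Longrightarrow> \<forall>i \<in> fun_idx lam \<Sigma>' f. k j (fun_dom \<Sigma>' f i) (z i j) = x i"
      using ev_bound[OF tgt.fun_idx_lam(1)[OF f], of "fun_dom \<Sigma>' f" z x] ev by blast
    have "fint X f (\<lambda>i \<in> fun_idx lam \<Sigma>' f. x i) = Some (k j (fun_cod \<Sigma>' f) (w j))" if j: "td.reach j1 j" for j
    proof -
      have jI: "j \<in> I" using Iup[OF j1(1) j] .
      have "fun_tuple lam \<Sigma>' f (k j) (\<lambda>i \<in> fun_idx lam \<Sigma>' f. z i j) = (\<lambda>i \<in> fun_idx lam \<Sigma>' f. x i)"
        using j1(2)[OF j] by (auto simp: fun_tuple_def)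
      then show ?thesis using tgt.hmD(2)[OF kh[OF IO[OF jI]] psD[OF jI] f d[OF jI]] by simp
    qed
    then show ?thesis using j1(1) by blast
  qed
  have closed: "(\<lambda>j \<in> I. the (fint (td.dob j) f (\<lambda>i \<in> fun_idx lam \<Sigma>' f. z i j))) \<in> Z (fun_cod \<Sigma>' f)"
    if f: "f \<in> funs \<Sigma>'" and z: "\<And>i. i \<in> fun_idx lam \<Sigma>' f \<Longrightarrow> z i \<in> Z (fun_dom \<Sigma>' f i)"
      and d: "\<And>j. j \<in> I \<Longrightarrow> fint (td.dob j) f (\<lambda>i \<in> fun_idx lam \<Sigma>' f. z i j) \<noteq> None" for f z
  proof -
    define w where "w = (\<lambda>j \<in> I. the (fint (td.dob j) f (\<lambda>i \<in> fun_idx lam \<Sigma>' f. z i j)))"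
    have w: "fint (td.dob j) f (\<lambda>i \<in> fun_idx lam \<Sigma>' f. z i j) = Some (w j)" if "j \<in> I" for j
      using d[OF that] that by (auto simp: w_def)
    have "\<forall>i \<in> fun_idx lam \<Sigma>' f. \<exists>x. ev (fun_dom \<Sigma>' f i) (z i) x" using z by (auto simp: Z_def)
    from bchoice[OF this] obtain x where x: "\<forall>i \<in> fun_idx lam \<Sigma>' f. ev (fun_dom \<Sigma>' f i) (z i) (x i)" ..
    obtain j1 where "j1 \<in> I"
      "\<And>j. td.reach j1 j \<Longrightarrow> fint X f (\<lambda>i \<in> fun_idx lam \<Sigma>' f. x i) = Some (k j (fun_cod \<Sigma>' f) (w j))"
      using f_stage[OF f, of z x w] x w by blast
    then have "ev (fun_cod \<Sigma>' f) w (the (fint X f (\<lambda>i \<in> fun_idx lam \<Sigma>' f. x i)))"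
      unfolding ev_def by (metis option.sel)
    moreover have "w \<in> (\<Pi>\<^sub>E j \<in> I. carr (td.dob j) (fun_cod \<Sigma>' f))"
      using tgt.fintD(2)[OF psD f w] by (auto simp: w_def)
    ultimately show ?thesis unfolding w_def[symmetric] Z_def by blast
  qed
  obtain P \<pi> where P: "tgt.ps P" "tgt.joint_emb P I td.dob \<pi>"
    and sur: "\<And>s z. s \<in> sorts \<Sigma>' \<Longrightarrow> z \<in> Z s \<Longrightarrow> \<exists>y \<in> carr P s. \<forall>j \<in> I. \<pi> j s y = z j"
    and inZ: "\<And>s y. y \<in> carr P s \<Longrightarrow> (\<lambda>j \<in> I. \<pi> j s y) \<in> Z s"
    by (rule tgt.joint_struct_exists[of I td.dob Z]) (use psD small closed in \<open>auto simp: Z_def\<close>)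
  have PE: "P \<in> E"
    by (rule tgt.joint_emb_in_class[OF hornT E prods subs P]) (use DE IO in blast)
  \<comment> \<open>Only coordinates beyond a member of \<open>I\<close> matter, and these lie in
    \<open>I\<close> again.\<close>
  have ev_restrict: "ev s (\<lambda>j \<in> I. z j) x \<longleftrightarrow> ev s z x" for s z x
    unfolding ev_def using Iup by (metis restrict_apply')
  \<comment> \<open>Two eventual values agree because a common upper bound of the two stages sees
    both.\<close>
  define q where "q s = (\<lambda>y \<in> carr P s. THE x. ev s (\<lambda>j. \<pi> j s y) x)" for s
  have qev: "ev s (\<lambda>j. \<pi> j s y) (q s y)" if y: "y \<in> carr P s" for s y
  proof -
    obtain x where x: "ev s (\<lambda>j. \<pi> j s y) x" using inZ[OF y] ev_restrict by (auto simp: Z_def)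
    then have "q s y = x" using ev_unique y by (auto simp: q_def)
    then show ?thesis using x by simp
  qed
  note \<pi>h = tgt.joint_embD(1)[OF P(2)]
  have q: "tgt.hm P X q"
    unfolding is_homomorphism_def
  proof (intro conjI allI ballI impI)
    show "q s \<in> carr P s \<rightarrow>\<^sub>E carr X s" for s
      using ev_carr[OF qev] tgt.hmD(1)[OF \<pi>h] by (auto simp: q_def)
  next
    fix f a y assume f: "f \<in> funs \<Sigma>'" and a: "a \<in> fun_args lam \<Sigma>' P f" and y: "fint P f a = Some y"
    have ai: "a i \<in> carr P (fun_dom \<Sigma>' f i)" if "i \<in> fun_idx lam \<Sigma>' f" for i using a that by (auto simp: fun_args_def)
    have d: "fint (td.dob j) f (\<lambda>i \<in> fun_idx lam \<Sigma>' f. \<pi> j (fun_dom \<Sigma>' f i) (a i)) = Some (\<pi> j (fun_cod \<Sigma>' f) y)"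
      if "j \<in> I" for j
      using tgt.hmD(2)[OF \<pi>h[OF that] P(1) f y] by (simp add: fun_tuple_def)
    obtain j1 where j1: "j1 \<in> I" "\<And>j. td.reach j1 j \<Longrightarrow>
        fint X f (\<lambda>i \<in> fun_idx lam \<Sigma>' f. q (fun_dom \<Sigma>' f i) (a i)) = Some (k j (fun_cod \<Sigma>' f) (\<pi> j (fun_cod \<Sigma>' f) y))"
      using f_stage[OF f qev[OF ai] d] by blast
    have "ev (fun_cod \<Sigma>' f) (\<lambda>j. \<pi> j (fun_cod \<Sigma>' f) y) (the (fint X f (\<lambda>i \<in> fun_idx lam \<Sigma>' f. q (fun_dom \<Sigma>' f i) (a i))))"
      unfolding ev_def using j1 by (metis option.sel)
    then have "the (fint X f (\<lambda>i \<in> fun_idx lam \<Sigma>' f. q (fun_dom \<Sigma>' f i) (a i))) = q (fun_cod \<Sigma>' f) y"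
      using ev_unique qev[OF tgt.fintD(2)[OF P(1) f y]] by blast
    then show "fint X f (fun_tuple lam \<Sigma>' f q a) = Some (q (fun_cod \<Sigma>' f) y)"
      using j1(2)[OF td.reach_refl[OF IO[OF j1(1)]]] by (simp add: fun_tuple_def)
  next
    fix R a assume R: "R \<in> rels \<Sigma>'" and a: "a \<in> rel_args lam \<Sigma>' P R" and y: "a \<in> rint P R"
    have ai: "a i \<in> carr P (rel_dom \<Sigma>' R i)" if "i \<in> rel_idx lam \<Sigma>' R" for i using a that by (auto simp: rel_args_def)
    obtain j1 where j1: "j1 \<in> I" "\<And>j. td.reach j1 j \<Longrightarrow>
        \<forall>i \<in> rel_idx lam \<Sigma>' R. k j (rel_dom \<Sigma>' R i) (\<pi> j (rel_dom \<Sigma>' R i) (a i)) = q (rel_dom \<Sigma>' R i) (a i)"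
      using ev_bound[OF tgt.fun_idx_lam(2)[OF R], of "rel_dom \<Sigma>' R" "\<lambda>i j. \<pi> j (rel_dom \<Sigma>' R i) (a i)"
          "\<lambda>i. q (rel_dom \<Sigma>' R i) (a i)"] qev[OF ai] by blast
    have "rel_tuple lam \<Sigma>' R (k j1) (rel_tuple lam \<Sigma>' R (\<pi> j1) a) = rel_tuple lam \<Sigma>' R q a"
      using j1(2)[OF td.reach_refl[OF IO[OF j1(1)]]] by (auto simp: rel_tuple_def)
    then show "rel_tuple lam \<Sigma>' R q a \<in> rint X R"
      using tgt.hmD(3)[OF kh[OF IO[OF j1(1)]] psD[OF j1(1)] R tgt.hmD(3)[OF \<pi>h[OF j1(1)] P(1) R y]] by simp
  qed
  have sect: "\<exists>u. src.hm (rd (td.dob i)) (rd P) u \<and>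
      (\<forall>s. \<forall>y \<in> carr (rd (td.dob i)) s. rdm q s (u s y) = rdm (k i) s y)" if i: "i \<in> I" for i
  proof -
    \<comment> \<open>A coordinate map is needed for every \<open>j\<close> in \<open>I\<close>.
      Above \<open>i\<close> it has to come from the diagram, so that images in the colimit stay
      constant; at the other stages any homomorphism will do, and the one through \<open>c\<close>
      exists by strong connectedness.\<close>
    have "\<exists>h. src.hm (rd (td.dob i)) (rd (td.dob j)) h \<and>
        (td.reach i j \<longrightarrow> (\<exists>a \<in> Arr J. Dom J a = i \<and> Cod J a = j \<and> h = rdm (td.dm a)))" if j: "j \<in> I" for j
    proof (cases "td.reach i j")
      case True
      then obtain a where a: "a \<in> Arr J" "Dom J a = i" "Cod J a = j" by (rule td.reachE)
      then show ?thesis using rdm_hm[OF td.dob_model(2) td.dm_hm[OF a(1)]] td.Arr_J by blast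
    next
      case False
      obtain h where h: "src.hm (rd (td.dob i)) (rd (td.dob c)) h" using c(2) i by (auto simp: I_def)
      obtain a where a: "a \<in> Arr J" "Dom J a = c" "Cod J a = j" using j td.reachE by (auto simp: I_def)
      have "src.hm (rd (td.dob c)) (rd (td.dob j)) (rdm (td.dm a))"
        using rdm_hm[OF td.dob_model(2) td.dm_hm[OF a(1)]] td.Arr_J a by blast
      from src.hm_comp[OF rd_ps[OF psD[OF i]] rd_ps[OF psD[OF cI]] h this] show ?thesis using False by blast
    qed
    then have "\<forall>j \<in> I. \<exists>h. src.hm (rd (td.dob i)) (rd (td.dob j)) h \<and>
        (td.reach i j \<longrightarrow> (\<exists>a \<in> Arr J. Dom J a = i \<and> Cod J a = j \<and> h = rdm (td.dm a)))" by blast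
    from bchoice[OF this] obtain H where H: "\<forall>j \<in> I. src.hm (rd (td.dob i)) (rd (td.dob j)) (H j) \<and>
        (td.reach i j \<longrightarrow> (\<exists>a \<in> Arr J. Dom J a = i \<and> Cod J a = j \<and> H j = rdm (td.dm a)))" ..
    have srt: "s \<in> sorts \<Sigma>" if "y \<in> carr (rd (td.dob i)) s" for s y
      using src.carr_sort[OF rd_ps[OF psD[OF i]] that] .
    have evH: "ev (smap \<rho> s) (\<lambda>j. H j s y) (k i (smap \<rho> s) y)" if y: "y \<in> carr (rd (td.dob i)) s" for s y
      unfolding ev_def
    proof (intro bexI[OF _ i] allI impI)
      fix j assume j: "td.reach i j"
      then obtain a where a: "a \<in> Arr J" "Dom J a = i" "Cod J a = j" "H j = rdm (td.dm a)" using H Iup[OF i j] by blast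
      show "k j (smap \<rho> s) (H j s y) = k i (smap \<rho> s) y"
        using td.compatibleD(2)[OF k a(1), of y "smap \<rho> s"] y a
        by (simp add: rdm_at[OF srt[OF y]] rd_carr[OF srt[OF y]])
    qed
    \<comment> \<open>The coordinates \<open>H j s y\<close> form an element of \<open>P\<close>
      whose eventual value is the image of \<open>y\<close>. Since \<open>rd P\<close> is jointly
      embedded by the projections, these elements assemble to a homomorphism of reducts.\<close>
    have ex: "\<exists>w \<in> carr (rd P) s. \<forall>j \<in> I. rdm (\<pi> j) s w = H j s y" if y: "y \<in> carr (rd (td.dob i)) s" for s y
    proof -
      have s: "s \<in> sorts \<Sigma>" by (rule srt[OF y])
      have "H j s y \<in> carr (td.dob j) (smap \<rho> s)" if "j \<in> I" for j
        using src.hmD(1)[of "rd (td.dob i)" "rd (td.dob j)" "H j" y s] H that y rd_carr[OF s] by auto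
      then have "(\<lambda>j \<in> I. H j s y) \<in> Z (smap \<rho> s)"
        unfolding Z_def using evH[OF y] ev_restrict by auto
      from sur[OF morphD(1)[OF s] this] show ?thesis by (auto simp: rdm_at[OF s] rd_carr[OF s])
    qed
    obtain u where u: "src.hm (rd (td.dob i)) (rd P) u"
      "\<And>j s y. j \<in> I \<Longrightarrow> y \<in> carr (rd (td.dob i)) s \<Longrightarrow> rdm (\<pi> j) s (u s y) = H j s y"
      by (rule src.joint_emb_lift[OF rd_ps[OF P(1)] rd_joint_emb[OF P] rd_ps[OF psD[OF i]], of H])
        (use H in blast, erule ex, rule that, assumption+)
    have "rdm q s (u s y) = rdm (k i) s y" if y: "y \<in> carr (rd (td.dob i)) s" for s y
    proof -
      have s: "s \<in> sorts \<Sigma>" by (rule srt[OF y])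
      have uy: "u s y \<in> carr P (smap \<rho> s)" using src.hmD(1)[OF u(1) y] by (simp add: rd_carr[OF s])
      have "ev (smap \<rho> s) (\<lambda>j. \<pi> j (smap \<rho> s) (u s y)) (k i (smap \<rho> s) y)"
        using evH[OF y] u(2)[OF _ y] Iup unfolding ev_def rdm_at[OF s] by metis
      then show ?thesis using ev_unique[OF qev[OF uy]] by (simp add: rdm_at[OF s])
    qed
    then show ?thesis using u(1) by blast
  qed
  have "\<exists>u. src.hm (rd (td.dob j)) (rd P) u \<and>
      (\<forall>s. \<forall>y \<in> carr (rd (td.dob j)) s. rdm q s (u s y) = rdm (k j) s y)" if j: "j \<in> Obj J" for j
  proof -
    \<comment> \<open>A stage that is not reachable from \<open>c\<close> is first moved into
      \<open>I\<close>, and the section over the new stage is composed with that arrow.\<close>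
    obtain a b where a: "a \<in> Arr J" "b \<in> Arr J" "Dom J a = c" "Dom J b = j" "Cod J a = Cod J b"
      by (rule td.merge_objects[OF c(1) j])
    have i: "Cod J b \<in> I" using td.reachI[OF a(1)] a by (simp add: I_def)
    obtain u where u: "src.hm (rd (td.dob (Cod J b))) (rd P) u"
      "\<forall>s. \<forall>y \<in> carr (rd (td.dob (Cod J b))) s. rdm q s (u s y) = rdm (k (Cod J b)) s y"
      using sect[OF i] by blast
    have psj: "src.ps (rd (td.dob j))" by (rule rd_ps[OF td.dob_model(2)[OF j]])
    have bh: "src.hm (rd (td.dob j)) (rd (td.dob (Cod J b))) (rdm (td.dm b))"
      using rdm_hm[OF td.dob_model(2) td.dm_hm[OF a(2)]] j a(4) by simp
    note comp = sd.compatibleD(2)[OF sd.good_coconeD(1)[OF rd_good_cocone[OF X gc]] a(2), unfolded D'_simps a(4)]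
    have "rdm q s (src.hcomp (rd (td.dob j)) u (rdm (td.dm b)) s y) = rdm (k j) s y"
      if y: "y \<in> carr (rd (td.dob j)) s" for s y
      using u(2) src.hmD(1)[OF bh y] comp[OF y] y by (simp add: src.hcomp_def)
    then show ?thesis using src.hm_comp[OF psj rd_ps[OF psD[OF i]] bh u(1)] by blast
  qed
  then show thesis using that[OF PE q] by blast
qed

end

section \<open>From pure quotients to filtered colimits\<close>

context theory_morphism
begin

lemma filtered_colimit_diagram:
  assumes "filtered_colimit \<kappa> lam (tgt.Mod T) J D X \<xi>"
  shows "morphism_diagram \<kappa> lam \<Sigma> \<Sigma>' S T \<rho> J D"
  using tgt.filtered_colimit_diagram[OF hornT assms] theory_morphism_axioms
  by (simp add: morphism_diagram_def)

text \<open>The cover \<open>P\<close> of the colimit is a pure quotient datum: an arrow from a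
  presentable object to the reduct of \<open>X\<close> factors through the reduct of some stage, and
  the partial section over that stage lifts it to the reduct of \<open>P\<close>.\<close>

lemma pure_quotients_imp_filtered_colimits:
  assumes acc: "ascending_chain_condition (src.Mod S)" and E: "E \<subseteq> Obj (tgt.Mod T)"
    and prods: "closed_under_products \<kappa> (tgt.Mod T) E"
    and subs: "closed_under_closed_subobjects \<kappa> lam \<Sigma>' T E"
    and quots: "closed_under_pure_quotients \<kappa> lam (tgt.Mod T) (src.Mod S) U E"
  shows "closed_under_filtered_colimits \<kappa> lam (tgt.Mod T) E"
  unfolding closed_under_filtered_colimits_def
proof (intro allI impI)
  fix J :: "('u, 'u) category" and D X \<xi>
  assume fc: "filtered_colimit \<kappa> lam (tgt.Mod T) J D X \<xi>" and DE: "\<forall>j \<in> Obj J. fobj D j \<in> E"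
  interpret morphism_diagram \<kappa> lam \<Sigma> \<Sigma>' S T \<rho> J D by (rule filtered_colimit_diagram[OF fc])
  have col: "is_colimit J (tgt.Mod T) D X \<xi>" using fc by (simp add: filtered_colimit_def)
  have X: "tgt.model T X" using td.is_colimitD(1)[OF col] by (simp add: td.is_cocone_iff)
  note gc = td.is_colimit_good[OF col] and psX = tgt.model_ps[OF X]
  note gs = rd_good_cocone[OF psX gc]
  obtain P q where P: "P \<in> E" "tgt.hm P X q" and sect: "\<And>j. j \<in> Obj J \<Longrightarrow> \<exists>u. src.hm (rd (td.dob j)) (rd P) u \<and>
      (\<forall>s. \<forall>y \<in> carr (rd (td.dob j)) s. rdm q s (u s y) = rdm (maps (\<xi> j)) s y)"
    by (rule eventually_constant_cover[OF E prods subs psX gc _ acc]) (use DE in blast, rule that, assumption+)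
  have mP: "tgt.model T P" using P E by (auto simp: tgt.Mod_simps)
  have p: "Arrow P q X \<in> Arr (tgt.Mod T)" using mP X P by (simp add: tgt.Mod_simps)
  have "pure_epi \<kappa> lam (src.Mod S) (farr U (Arrow P q X))"
    unfolding pure_epi_def
  proof (intro conjI allI impI ballI)
    show "farr U (Arrow P q X) \<in> Arr (src.Mod S)"
      using rd_model[OF mP] rd_model[OF X] rdm_hm[OF tgt.model_ps[OF mP] P(2)] by (simp add: U_simps src.Mod_simps)
    fix G f assume G: "presentable \<kappa> lam (src.Mod S) G" and f: "f \<in> Defs.hom (src.Mod S) G (Cod (src.Mod S) (farr U (Arrow P q X)))"
    have f': "f \<in> Defs.hom (src.Mod S) G (rd X)" using f by (simp add: src.Mod_simps U_simps)
    \<comment> \<open>Presentability speaks of colimits in the source category, so the reduct of the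
      cocone has to be recognized as a colimit there.\<close>
    have fcs: "filtered_colimit \<kappa> lam (src.Mod S) J D' (rd X) (\<lambda>j. Arrow (sd.dob j) (rdm (maps (\<xi> j))) (rd X))"
      unfolding filtered_colimit_def
      using sd.good_cocone_is_colimit[OF rd_ps[OF psX] gs] td.filtered td.smallJ D'_functor by simp
    obtain j g where j: "j \<in> Obj J" and g: "g \<in> Defs.hom (src.Mod S) G (sd.dob j)"
      "Comp (src.Mod S) (Arrow (sd.dob j) (rdm (maps (\<xi> j))) (rd X)) g = f"
      using G fcs f' unfolding presentable_def by blast
    note gh = src.Mod_homD[OF g(1)] and fh = src.Mod_homD[OF f']
    obtain u where u: "src.hm (sd.dob j) (rd P) u"
      "\<forall>s. \<forall>y \<in> carr (sd.dob j) s. rdm q s (u s y) = rdm (maps (\<xi> j)) s y"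
      using sect[OF j] unfolding D'_simps by blast
    have fe: "src.hcomp G (rdm (maps (\<xi> j))) (maps g) = maps f"
      using arg_cong[OF g(2), of maps] src.maps_Comp[of S _ g] gh(2) by simp
    have "src.hcomp G (rdm q) (src.hcomp G u (maps g)) = maps f"
      unfolding src.hcomp_eq_iff[OF fh(6)]
      using u(2) src.hmD(1)[OF gh(6)] src.hcomp_eqD[OF fe] by (simp add: src.hcomp_def)
    then have "Comp (src.Mod S) (farr U (Arrow P q X)) (Arrow G (src.hcomp G u (maps g)) (rd P)) = f"
      using fh(1) unfolding U_simps src.Mod_simps by simp
    moreover have "Arrow G (src.hcomp G u (maps g)) (rd P) \<in> Defs.hom (src.Mod S) G (rd P)"
      using src.hm_comp[OF src.model_ps[OF gh(4)] src.model_ps[OF gh(5)] gh(6) u(1)] gh(4) rd_model[OF mP]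
      by (simp add: src.Mod_hom)
    ultimately show "\<exists>g \<in> Defs.hom (src.Mod S) G (Dom (src.Mod S) (farr U (Arrow P q X))).
        Comp (src.Mod S) (farr U (Arrow P q X)) g = f"
      by (intro bexI[of _ "Arrow G (src.hcomp G u (maps g)) (rd P)"]) (simp_all add: src.Mod_simps(3) U_simps)
  qed
  then show "X \<in> E"
    using quots[unfolded closed_under_pure_quotients_def, THEN bspec, OF p] P(1)
    by (simp add: tgt.Mod_simps(3,4))
qed

end

section \<open>Models as filtered colimits of generic models\<close>

context universe
begin

text \<open>The inclusion order on \<open>\<F>\<close> as a category. It is encoded in
  \<open>'u\<close> because filtered colimits are only considered for index categories of that type;
  \<open>fo\<close> decodes objects. The union hypothesis for empty \<open>X\<close> makes the
  category nonempty.\<close>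

lemma directed_union_category:
  fixes \<F> :: "'a set set"
  assumes small: "|\<F>| <o \<kappa>" and union: "\<And>X. X \<subseteq> \<F> \<Longrightarrow> |X| <o lam \<Longrightarrow> \<Union>X \<in> \<F>"
  obtains J :: "('u, 'u) category" and fo :: "'u \<Rightarrow> 'a set" where
    "filtered_category lam J" "small_category \<kappa> J" "\<And>j. j \<in> Obj J \<Longrightarrow> fo j \<in> \<F>"
    "\<And>F. F \<in> \<F> \<Longrightarrow> \<exists>j \<in> Obj J. fo j = F" "\<And>a. a \<in> Arr J \<Longrightarrow> fo (Dom J a) \<subseteq> fo (Cod J a)"
proof -
  obtain ob :: "'a set \<Rightarrow> 'u" where ob: "inj_on ob \<F>" using small_encode[OF small] by blast
  define Q where "Q = {(F, F'). F \<in> \<F> \<and> F' \<in> \<F> \<and> F \<subseteq> F'}"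
  have smallQ: "|Q| <o \<kappa>"
    by (rule small_subset[of _ "\<F> \<times> \<F>"]) (auto simp: Q_def intro: small_Sigma small)
  obtain ar :: "'a set \<times> 'a set \<Rightarrow> 'u" where ar: "inj_on ar Q" using small_encode[OF smallQ] by blast
  define fo where "fo = inv_into \<F> ob"
  define dar where "dar = inv_into Q ar"
  define J where "J = \<lparr> Obj = ob ` \<F>, Arr = ar ` Q, Dom = (\<lambda>a. ob (fst (dar a))), Cod = (\<lambda>a. ob (snd (dar a))),
    Id = (\<lambda>j. ar (fo j, fo j)), Comp = (\<lambda>b a. ar (fst (dar a), snd (dar b))) \<rparr>"
  have fo[simp]: "fo (ob F) = F" if "F \<in> \<F>" for F using ob that by (simp add: fo_def)
  have dar[simp]: "dar (ar p) = p" if "p \<in> Q" for p using ar that by (simp add: dar_def)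
  have QD: "F \<in> \<F>" "F' \<in> \<F>" "F \<subseteq> F'" if "(F, F') \<in> Q" for F F' using that by (auto simp: Q_def)
  have QI: "(F, F') \<in> Q" if "F \<in> \<F>" "F' \<in> \<F>" "F \<subseteq> F'" for F F' using that by (auto simp: Q_def)
  have ob_eq: "ob F = ob F' \<longleftrightarrow> F = F'" if "F \<in> \<F>" "F' \<in> \<F>" for F F' using ob that by (simp add: inj_on_eq_iff)
  have Js: "Obj J = ob ` \<F>" "Arr J = ar ` Q" "\<And>a. Dom J a = ob (fst (dar a))" "\<And>a. Cod J a = ob (snd (dar a))"
    "\<And>j. Id J j = ar (fo j, fo j)" "\<And>b a. Comp J b a = ar (fst (dar a), snd (dar b))"
    by (simp_all add: J_def)
  have arrE: "\<exists>F F'. a = ar (F, F') \<and> (F, F') \<in> Q" if "a \<in> Arr J" for a using that by (auto simp: Js)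
  have cat: "is_category J"
    unfolding is_category_def
  proof (intro conjI ballI impI)
    fix a assume "a \<in> Arr J"
    then obtain F F' where a: "a = ar (F, F')" "(F, F') \<in> Q" using arrE by blast
    show "Dom J a \<in> Obj J" "Cod J a \<in> Obj J" using a QD by (auto simp: Js)
    show "Comp J a (Id J (Dom J a)) = a" "Comp J (Id J (Cod J a)) a = a"
      using a QD[OF a(2)] QI by (simp_all add: Js)
  next
    fix j assume "j \<in> Obj J"
    then show "Id J j \<in> Defs.hom J j j" using QI by (auto simp: Js Defs.hom_def)
  next
    fix a b assume "a \<in> Arr J" "b \<in> Arr J" and eq: "Dom J b = Cod J a"
    then obtain F F' H H' where a: "a = ar (F, F')" "(F, F') \<in> Q" and b: "b = ar (H, H')" "(H, H') \<in> Q"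
      using arrE by meson
    have "F' = H" using eq a b ob_eq QD by (simp add: Js)
    then have "(F, H') \<in> Q" using QD[OF a(2)] QD[OF b(2)] QI by blast
    then show "Comp J b a \<in> Defs.hom J (Dom J a) (Cod J b)" using a b by (auto simp: Js Defs.hom_def)
  next
    fix a b c assume "a \<in> Arr J" "b \<in> Arr J" "c \<in> Arr J" and eq: "Dom J b = Cod J a" "Dom J c = Cod J b"
    then obtain F F' H H' L L' where a: "a = ar (F, F')" "(F, F') \<in> Q" and b: "b = ar (H, H')" "(H, H') \<in> Q"
      and c: "c = ar (L, L')" "(L, L') \<in> Q"
      using arrE by meson
    have "F' = H" "H' = L" using eq a b c ob_eq QD by (simp_all add: Js)
    then have "(F, H') \<in> Q" "(H, L') \<in> Q" using QD[OF a(2)] QD[OF b(2)] QD[OF c(2)] QI by blast+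
    then show "Comp J c (Comp J b a) = Comp J (Comp J c b) a" using a b c by (simp add: Js)
  qed
  have "filtered_category lam J"
    unfolding filtered_category_def
  proof (intro conjI allI impI ballI cat)
    fix X assume X: "X \<subseteq> Obj J" "|X| <o lam"
    have sub: "fo ` X \<subseteq> \<F>" using X(1) by (auto simp: Js)
    then have un: "\<Union>(fo ` X) \<in> \<F>" using union lam_image[OF X(2)] by blast
    have "Defs.hom J j (ob (\<Union>(fo ` X))) \<noteq> {}" if j: "j \<in> X" for j
    proof -
      have "(fo j, \<Union>(fo ` X)) \<in> Q" using sub un j by (intro QI) auto
      moreover have "ob (fo j) = j" using X(1) j by (auto simp: Js)
      ultimately have "ar (fo j, \<Union>(fo ` X)) \<in> Defs.hom J j (ob (\<Union>(fo ` X)))" by (simp add: Js Defs.hom_def)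
      then show ?thesis by blast
    qed
    then show "\<exists>c \<in> Obj J. \<forall>x \<in> X. Defs.hom J x c \<noteq> {}" using un by (auto simp: Js)
  next
    fix x y F assume x: "x \<in> Obj J" and y: "y \<in> Obj J" and F: "F \<subseteq> Defs.hom J x y" "|F| <o lam"
    \<comment> \<open>At most one arrow exists between two objects, so parallel arrows are already
      equal and the identity coequalizes them.\<close>
    have thin: "f = g" if "f \<in> Defs.hom J x y" "g \<in> Defs.hom J x y" for f g
    proof -
      have fg: "f \<in> Arr J" "g \<in> Arr J" "Dom J f = Dom J g" "Cod J f = Cod J g"
        using that by (auto simp: Defs.hom_def)
      obtain A A' where f: "f = ar (A, A')" "(A, A') \<in> Q" using arrE[OF fg(1)] by blast
      obtain B B' where g: "g = ar (B, B')" "(B, B') \<in> Q" using arrE[OF fg(2)] by blast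
      have "A = B" "A' = B'"
        using fg(3,4) f g ob_eq[OF QD(1)[OF f(2)] QD(1)[OF g(2)]] ob_eq[OF QD(2)[OF f(2)] QD(2)[OF g(2)]]
        by (simp_all add: Js)
      then show ?thesis using f g by simp
    qed
    have "Id J y \<in> Defs.hom J y y" using cat y unfolding is_category_def by blast
    moreover have "\<forall>f \<in> F. \<forall>g \<in> F. Comp J (Id J y) f = Comp J (Id J y) g"
      using thin F(1) by (metis subsetD)
    ultimately show "\<exists>z \<in> Obj J. \<exists>h \<in> Defs.hom J y z. \<forall>f \<in> F. \<forall>g \<in> F. Comp J h f = Comp J h g" using y by blast
  qed
  moreover have "small_category \<kappa> J"
    unfolding small_category_def Js by (intro conjI small_image small smallQ)
  moreover have "fo j \<in> \<F>" if "j \<in> Obj J" for j using that by (auto simp: Js)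
  moreover have "\<exists>j \<in> Obj J. fo j = F" if "F \<in> \<F>" for F using that by (auto simp: Js)
  moreover have "fo (Dom J a) \<subseteq> fo (Cod J a)" if "a \<in> Arr J" for a
    using that QD by (fastforce simp: Js)
  ultimately show thesis using that by blast
qed

end

text \<open>The positive diagram of a structure, item by item. \<open>Elt\<close> gives a name to an
  element that may occur in no function or relation; \<open>Fun_fact\<close> omits the value, which
  is recovered from the structure.\<close>

datatype ('s, 'f, 'r, 'l, 'u) fact = Elt 's 'u | Fun_fact 'f "'l \<Rightarrow> 'u" | Rel_fact 'r "'l \<Rightarrow> 'u"

context structures
begin

definition facts :: "('s, 'f, 'r, 'l, 'u) pstruct \<Rightarrow> ('s, 'f, 'r, 'l, 'u) fact set" where
  "facts B = {Elt s y |s y. y \<in> carr B s} \<union> {Fun_fact f a |f a. f \<in> funs \<Sigma> \<and> fint B f a \<noteq> None} \<union>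
     {Rel_fact R a |R a. R \<in> rels \<Sigma> \<and> a \<in> rint B R}"

fun elts :: "('s, 'f, 'r, 'l, 'u) pstruct \<Rightarrow> ('s, 'f, 'r, 'l, 'u) fact \<Rightarrow> ('s \<times> 'u) set" where
  "elts B (Elt s y) = {(s, y)}"
| "elts B (Fun_fact f a) = insert (fun_cod \<Sigma> f, the (fint B f a)) ((\<lambda>i. (fun_dom \<Sigma> f i, a i)) ` fun_idx lam \<Sigma> f)"
| "elts B (Rel_fact R a) = (\<lambda>i. (rel_dom \<Sigma> R i, a i)) ` rel_idx lam \<Sigma> R"

fun fact_holds :: "('s, 'f, 'r, 'l, 'u) pstruct \<Rightarrow> ('s, 'f, 'r, 'l, 'u) pstruct \<Rightarrow> ('s \<Rightarrow> 'u \<Rightarrow> 'u) \<Rightarrow>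
    ('s, 'f, 'r, 'l, 'u) fact \<Rightarrow> bool" where
  "fact_holds B N n (Elt s y) \<longleftrightarrow> True"
| "fact_holds B N n (Fun_fact f a) \<longleftrightarrow> fint N f (fun_tuple lam \<Sigma> f n a) = Some (n (fun_cod \<Sigma> f) (the (fint B f a)))"
| "fact_holds B N n (Rel_fact R a) \<longleftrightarrow> rel_tuple lam \<Sigma> R n a \<in> rint N R"

text \<open>\<open>n\<close> is a homomorphism to \<open>N\<close> from the \<open>\<lambda>\<close>-small piece of \<open>B\<close> described by the facts \<open>F\<close>.\<close>

definition fits :: "('s, 'f, 'r, 'l, 'u) pstruct \<Rightarrow> ('s, 'f, 'r, 'l, 'u) fact set \<Rightarrow>
    ('s, 'f, 'r, 'l, 'u) pstruct \<Rightarrow> ('s \<Rightarrow> 'u \<Rightarrow> 'u) \<Rightarrow> bool" where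
  "fits B F N n \<longleftrightarrow> (\<forall>(s, y) \<in> \<Union>(elts B ` F). n s y \<in> carr N s) \<and> (\<forall>\<alpha> \<in> F. fact_holds B N n \<alpha>)"

lemma fits_mono: "fits B F N n \<Longrightarrow> F' \<subseteq> F \<Longrightarrow> fits B F' N n"
  unfolding fits_def by blast

lemma elts_carr:
  assumes B: "ps B" and F: "F \<subseteq> facts B" and sy: "(s, y) \<in> \<Union>(elts B ` F)"
  shows "y \<in> carr B s" "s \<in> sorts \<Sigma>"
proof -
  obtain \<alpha> where \<alpha>: "\<alpha> \<in> facts B" "(s, y) \<in> elts B \<alpha>" using F sy by blast
  show y: "y \<in> carr B s"
  proof (cases \<alpha>)
    case (Fun_fact f a)
    then obtain z where f: "f \<in> funs \<Sigma>" and z: "fint B f a = Some z" using \<alpha>(1) by (auto simp: facts_def)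
    show ?thesis using \<alpha>(2) fintD(1)[OF B f z] fintD(2)[OF B f z] z Fun_fact by (auto simp: fun_args_def)
  next
    case (Rel_fact R a)
    then have R: "R \<in> rels \<Sigma>" and a: "a \<in> rint B R" using \<alpha>(1) by (auto simp: facts_def)
    show ?thesis using \<alpha>(2) fintD(3)[OF B R a] Rel_fact by (auto simp: rel_args_def)
  qed (use \<alpha> in \<open>auto simp: facts_def\<close>)
  show "s \<in> sorts \<Sigma>" by (rule carr_sort[OF B y])
qed

lemma elts_lam:
  assumes F: "F \<subseteq> facts B" "|F| <o lam"
  shows "|\<Union>(elts B ` F)| <o lam"
proof (rule lam_UN[OF F(2)])
  fix \<alpha> assume "\<alpha> \<in> F"
  then have "\<alpha> \<in> facts B" using F by blast
  then show "|elts B \<alpha>| <o lam"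
    by (cases \<alpha>)
      (auto simp: facts_def intro!: lam_insert lam_image[OF fun_idx_lam(1)] lam_image[OF fun_idx_lam(2)]
        intro: lam_finite)
qed

lemma small_facts:
  assumes B: "ps B" shows "|facts B| <o \<kappa>"
proof -
  have sig_small: "|sorts \<Sigma>| <o \<kappa>" "|funs \<Sigma>| <o \<kappa>" "|rels \<Sigma>| <o \<kappa>"
    using sgn unfolding is_signature_def by auto
  have cs: "|carr B s| <o \<kappa>" if "s \<in> sorts \<Sigma>" for s using B that by (simp add: is_pstruct_def)
  let ?E = "(\<lambda>(s, y). Elt s y) ` (SIGMA s:sorts \<Sigma>. carr B s)"
  let ?F = "(\<lambda>(f, a). Fun_fact f a) ` (SIGMA f:funs \<Sigma>. fun_args lam \<Sigma> B f)"
  let ?R = "(\<lambda>(R, a). Rel_fact R a) ` (SIGMA R:rels \<Sigma>. rel_args lam \<Sigma> B R)"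
  have "|?E \<union> ?F \<union> ?R| <o \<kappa>"
  proof (intro small_Un small_image small_Sigma sig_small cs)
    show "|fun_args lam \<Sigma> B f| <o \<kappa>" if "f \<in> funs \<Sigma>" for f
      unfolding fun_args_def by (rule small_PiE[OF small_lam[OF fun_idx_lam(1)[OF that]]]) (rule cs[OF fun_sorts(2)[OF that]])
    show "|rel_args lam \<Sigma> B R| <o \<kappa>" if "R \<in> rels \<Sigma>" for R
      unfolding rel_args_def by (rule small_PiE[OF small_lam[OF fun_idx_lam(2)[OF that]]]) (rule cs[OF fun_sorts(3)[OF that]])
  qed
  moreover have "facts B \<subseteq> ?E \<union> ?F \<union> ?R"
  proof
    fix \<alpha> assume \<alpha>: "\<alpha> \<in> facts B"
    show "\<alpha> \<in> ?E \<union> ?F \<union> ?R"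
    proof (cases \<alpha>)
      case (Elt s y)
      then have "y \<in> carr B s" using \<alpha> by (auto simp: facts_def)
      then show ?thesis using Elt carr_sort[OF B] by force
    next
      case (Fun_fact f a)
      then have "f \<in> funs \<Sigma>" "a \<in> fun_args lam \<Sigma> B f" using \<alpha> fintD(1)[OF B] by (auto simp: facts_def)
      then show ?thesis using Fun_fact by force
    next
      case (Rel_fact R a)
      then have "R \<in> rels \<Sigma>" "a \<in> rel_args lam \<Sigma> B R" using \<alpha> fintD(3)[OF B] by (auto simp: facts_def)
      then show ?thesis using Rel_fact by force
    qed
  qed
  ultimately show ?thesis by (rule small_subset[rotated])
qed

text \<open>The elements mentioned in \<open>F\<close> become the variables, with \<open>ix\<close>
  and \<open>en\<close> translating between elements and positions, and the facts become conjuncts.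
  An \<open>Elt\<close> fact contributes a variable but no condition. Satisfying tuples are exactly
  realizations of the piece of \<open>B\<close> described by \<open>F\<close>.\<close>

lemma diagram_formula:
  assumes B: "ps B" and F: "F \<subseteq> facts B" "|F| <o lam"
  obtains x \<phi> en ix where "fm_in_ctx lam \<Sigma> x \<phi>"
    "\<And>p. p \<in> \<Union>(elts B ` F) \<Longrightarrow> ix p \<in> ctx_idx lam x \<and> en (ix p) = p"
    "\<And>i. i \<in> ctx_idx lam x \<Longrightarrow> en i \<in> \<Union>(elts B ` F) \<and> ix (en i) = i \<and> fst (ctx_var x i) = fst (en i)"
    "\<And>N m. m \<in> ctx_prod lam N x \<Longrightarrow>
      fm_holds lam \<Sigma> N (ctx_env lam x m) \<phi> \<longleftrightarrow> (\<forall>\<alpha> \<in> F. fact_holds B N (\<lambda>s y. m (ix (s, y))) \<alpha>)"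
proof -
  let ?A = "\<Union>(elts B ` F)"
  obtain l en where l: "l \<in> Field lam" and en: "bij_betw en (underS lam l) ?A"
    using lam_index[OF elts_lam[OF F]] by blast
  define ix where "ix = inv_into (underS lam l) en"
  have ix: "ix p \<in> underS lam l" "en (ix p) = p" if "p \<in> ?A" for p
    using en that unfolding ix_def by (metis bij_betw_def inv_into_into, metis bij_betw_def f_inv_into_f)
  have eni: "en i \<in> ?A" "ix (en i) = i" if "i \<in> underS lam l" for i
    using en that unfolding ix_def by (auto simp: bij_betw_def)
  \<comment> \<open>The position enters the variable, so the variables are distinct even for
    elements of equal sort.\<close>
  define x where "x = \<lparr> ctx_len = l, ctx_var = (\<lambda>i \<in> underS lam l. (fst (en i), i)) \<rparr>"
  have xi: "ctx_idx lam x = underS lam l" by (simp add: x_def ctx_idx_def)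
  have xv: "ctx_var x i = (fst (en i), i)" if "i \<in> underS lam l" for i using that by (simp add: x_def)
  have x: "is_context lam \<Sigma> x"
  proof -
    have "fst (en i) \<in> sorts \<Sigma>" "i \<in> Field lam" if "i \<in> underS lam l" for i
      using elts_carr(2)[OF B F(1), of "fst (en i)" "snd (en i)"] eni(1)[OF that] that underS_subset_Field by auto
    then show ?thesis
      unfolding is_context_def xi using l by (auto simp: x_def vars_def inj_on_def)
  qed
  define V :: "'s \<times> 'u \<Rightarrow> ('s, 'f, 'l) trm" where "V p = Var (ctx_var x (ix p))" for p
  have V: "term_in_ctx lam \<Sigma> x (V (s, y)) s" if "(s, y) \<in> ?A" for s y
    using term_in_ctx_Var[OF x, of "ix (s, y)"] ix[OF that] xv by (simp add: V_def xi)
  have Vval: "term_val lam \<Sigma> N (ctx_env lam x m) (V p) = Some (m (ix p))" if "p \<in> ?A" for N m p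
    using ctx_env_var[OF x, of "ix p" m] ix[OF that] by (simp add: V_def xi)
  define fm :: "('s, 'f, 'r, 'l, 'u) fact \<Rightarrow> ('s, 'f, 'r, 'l) fm" where "fm \<alpha> = (case \<alpha> of Elt s y \<Rightarrow> Top
    | Fun_fact f a \<Rightarrow> Eq (App f (\<lambda>i \<in> fun_idx lam \<Sigma> f. V (fun_dom \<Sigma> f i, a i))) (V (fun_cod \<Sigma> f, the (fint B f a)))
    | Rel_fact R a \<Rightarrow> Rel R (\<lambda>i \<in> rel_idx lam \<Sigma> R. V (rel_dom \<Sigma> R i, a i)))" for \<alpha>
  have fm_ctx: "fm_in_ctx lam \<Sigma> x (fm \<alpha>)" if \<alpha>: "\<alpha> \<in> F" for \<alpha>
  proof (cases \<alpha>)
    case (Elt s y)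
    then show ?thesis using x by (auto simp: fm_def fm_in_ctx_def intro: raw_formula.intros)
  next
    case (Fun_fact f a)
    then have f: "f \<in> funs \<Sigma>" using \<alpha> F(1) by (auto simp: facts_def)
    have "(fun_dom \<Sigma> f i, a i) \<in> ?A" if "i \<in> fun_idx lam \<Sigma> f" for i using \<alpha> Fun_fact that by force
    moreover have "(fun_cod \<Sigma> f, the (fint B f a)) \<in> ?A" using \<alpha> Fun_fact by force
    ultimately show ?thesis
      unfolding Fun_fact fm_def fact.case by (intro fm_in_ctx_Eq[of x _ "fun_cod \<Sigma> f"] term_in_ctx_App[OF x f] V)
  next
    case (Rel_fact R a)
    then have R: "R \<in> rels \<Sigma>" using \<alpha> F(1) by (auto simp: facts_def)
    have "(rel_dom \<Sigma> R i, a i) \<in> ?A" if "i \<in> rel_idx lam \<Sigma> R" for i using \<alpha> Rel_fact that by force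
    then show ?thesis
      unfolding Rel_fact fm_def fact.case by (intro fm_in_ctx_Rel[OF x R] V)
  qed
  have fm_sem: "fm_holds lam \<Sigma> N (ctx_env lam x m) (fm \<alpha>) \<longleftrightarrow> fact_holds B N (\<lambda>s y. m (ix (s, y))) \<alpha>"
    if \<alpha>: "\<alpha> \<in> F" for \<alpha> N m
  proof (cases \<alpha>)
    case (Elt s y)
    then show ?thesis by (simp add: fm_def)
  next
    case (Fun_fact f a)
    have d: "(fun_dom \<Sigma> f i, a i) \<in> ?A" if "i \<in> fun_idx lam \<Sigma> f" for i using \<alpha> Fun_fact that by force
    have c: "(fun_cod \<Sigma> f, the (fint B f a)) \<in> ?A" using \<alpha> Fun_fact by force
    have e: "term_val lam \<Sigma> N (ctx_env lam x m) (App f (\<lambda>i \<in> fun_idx lam \<Sigma> f. V (fun_dom \<Sigma> f i, a i))) =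
        fint N f (fun_tuple lam \<Sigma> f (\<lambda>s y. m (ix (s, y))) a)"
      unfolding fun_tuple_def by (rule term_val_App_Some) (rule Vval[OF d])
    show ?thesis
      unfolding Fun_fact fm_def fact.case fm_holds.simps fact_holds.simps e Vval[OF c] by auto
  next
    case (Rel_fact R a)
    have d: "(rel_dom \<Sigma> R i, a i) \<in> ?A" if "i \<in> rel_idx lam \<Sigma> R" for i using \<alpha> Rel_fact that by force
    show ?thesis
      unfolding Rel_fact fm_def fact.case fact_holds.simps rel_tuple_def
      by (rule fm_holds_Rel_Some) (rule Vval[OF d])
  qed
  \<comment> \<open>The facts are enumerated separately from the elements, to serve as the index set
    of the conjunction.\<close>
  obtain l' e' where l': "l' \<in> Field lam" and e': "bij_betw e' (underS lam l') F" using lam_index[OF F(2)] by blast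
  have e'F: "e' i \<in> F" if "i \<in> underS lam l'" for i using e' that by (auto simp: bij_betw_def)
  let ?\<phi> = "Conj l' (\<lambda>i \<in> underS lam l'. fm (e' i))"
  have "fm_in_ctx lam \<Sigma> x ?\<phi>"
    using fm_ctx[OF e'F] x l' by (auto simp: fm_in_ctx_def intro!: raw_formula.intros)
  moreover have "fm_holds lam \<Sigma> N (ctx_env lam x m) ?\<phi> \<longleftrightarrow> (\<forall>\<alpha> \<in> F. fact_holds B N (\<lambda>s y. m (ix (s, y))) \<alpha>)" for N m
  proof -
    have "fm_holds lam \<Sigma> N (ctx_env lam x m) ?\<phi> \<longleftrightarrow> (\<forall>i \<in> underS lam l'. fact_holds B N (\<lambda>s y. m (ix (s, y))) (e' i))"
      using fm_sem[OF e'F] by simp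
    also have "\<dots> \<longleftrightarrow> (\<forall>\<alpha> \<in> F. fact_holds B N (\<lambda>s y. m (ix (s, y))) \<alpha>)"
      by (simp add: bij_betw_imp_surj_on[OF e', symmetric])
    finally show ?thesis .
  qed
  ultimately show thesis using that[of x ?\<phi> ix en] ix eni xv xi by simp
qed

end

section \<open>Generic members of a closed class and the definability theorem\<close>

context theory_morphism
begin

text \<open>\<open>G\<close> is the generic structure over all members of \<open>E\<close> pointed
  by a realization of the diagram of \<open>F\<close>, hence a member of \<open>E\<close> and
  initial among such members. For \<open>M\<close>, a formula true at the generic tuple is true at
  every realization in \<open>E\<close>; it is thus the conclusion of a judgment valid in
  \<open>E\<close>, so it holds at the tautological realization in \<open>M\<close>.\<close>

lemma stage_exists:
  assumes E: "E \<subseteq> Obj (tgt.Mod T)" and prods: "closed_under_products \<kappa> (tgt.Mod T) E"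
    and subs: "closed_under_closed_subobjects \<kappa> lam \<Sigma>' T E"
    and M: "tgt.ps M" and MT': "\<And>\<sigma>. relative_judgment lam \<Sigma> \<Sigma>' \<rho> \<sigma> \<Longrightarrow> (\<And>N. N \<in> E \<Longrightarrow> valid_in lam \<Sigma>' N \<sigma>) \<Longrightarrow>
      valid_in lam \<Sigma>' M \<sigma>"
    and F: "F \<subseteq> src.facts (rd M)" "|F| <o lam"
  obtains G n where "G \<in> E" "src.fits (rd M) F (rd G) n"
    "\<And>N n'. N \<in> E \<Longrightarrow> src.fits (rd M) F (rd N) n' \<Longrightarrow>
      \<exists>h. tgt.hm G N h \<and> (\<forall>(s, y) \<in> \<Union>(src.elts (rd M) ` F). rdm h s (n s y) = n' s y)"
    "\<And>N h h'. tgt.hm G N h \<Longrightarrow> tgt.hm G N h' \<Longrightarrow>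
      (\<forall>(s, y) \<in> \<Union>(src.elts (rd M) ` F). rdm h s (n s y) = rdm h' s (n s y)) \<Longrightarrow> h = h'"
    "\<exists>h. tgt.hm G M h \<and> (\<forall>(s, y) \<in> \<Union>(src.elts (rd M) ` F). rdm h s (n s y) = y)"
proof -
  let ?A = "\<Union>(src.elts (rd M) ` F)"
  note psM = rd_ps[OF M]
  obtain x \<phi> en ix where \<phi>: "fm_in_ctx lam \<Sigma> x \<phi>"
    and ix: "\<And>p. p \<in> ?A \<Longrightarrow> ix p \<in> ctx_idx lam x \<and> en (ix p) = p"
    and en: "\<And>i. i \<in> ctx_idx lam x \<Longrightarrow> en i \<in> ?A \<and> ix (en i) = i \<and> fst (ctx_var x i) = fst (en i)"
    and sem: "\<And>N m. m \<in> ctx_prod lam N x \<Longrightarrow>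
      fm_holds lam \<Sigma> N (ctx_env lam x m) \<phi> \<longleftrightarrow> (\<forall>\<alpha> \<in> F. src.fact_holds (rd M) N (\<lambda>s y. m (ix (s, y))) \<alpha>)"
    by (rule src.diagram_formula[OF psM F]) (rule that, assumption+)
  have x: "is_context lam \<Sigma> x" using \<phi> by (simp add: fm_in_ctx_def)
  let ?x = "ctx_tr lam \<rho> x"
  have x': "is_context lam \<Sigma>' ?x" by (rule ctx_tr_context[OF x])
  have srt: "s \<in> sorts \<Sigma>" if "(s, y) \<in> ?A" for s y using src.elts_carr(2)[OF psM F(1) that] .
  have vix: "fst (ctx_var x (ix (s, y))) = s" if "(s, y) \<in> ?A" for s y using en[of "ix (s, y)"] ix[OF that] by simp
  \<comment> \<open>Converts an interpretation of names into a tuple in the order of the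
    context.\<close>
  define tup where "tup n = (\<lambda>i \<in> ctx_idx lam x. n (fst (en i)) (snd (en i)))" for n :: "'s \<Rightarrow> 'u \<Rightarrow> 'u"
  have tup_ix: "tup n (ix (s, y)) = n s y" if "(s, y) \<in> ?A" for n s y
    using ix[OF that] by (simp add: tup_def)
  have tup_prod: "tup n \<in> ctx_prod lam (rd N) x" if nA: "\<forall>(s, y) \<in> ?A. n s y \<in> carr (rd N) s" for N n
  proof -
    have "n (fst (en i)) (snd (en i)) \<in> carr (rd N) (fst (ctx_var x i))" if i: "i \<in> ctx_idx lam x" for i
      using nA[THEN bspec, OF conjunct1[OF en[OF i]]] en[OF i] by (simp add: case_prod_beta)
    then show ?thesis by (simp add: ctx_prod_def tup_def)
  qed
  \<comment> \<open>A fact depends only on the values at the elements it mentions, so passing to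
    tuples and back is harmless although values elsewhere are lost.\<close>
  have fact_cong: "src.fact_holds (rd M) N n \<alpha> = src.fact_holds (rd M) N n' \<alpha>"
    if \<alpha>: "\<alpha> \<in> F" and eq: "\<And>s y. (s, y) \<in> ?A \<Longrightarrow> n s y = n' s y" for N n n' \<alpha>
  proof -
    have eq': "n s y = n' s y" if "(s, y) \<in> src.elts (rd M) \<alpha>" for s y using eq \<alpha> that by blast
    show ?thesis
    proof (cases \<alpha>)
      case (Fun_fact f a)
      then have "fun_tuple lam \<Sigma> f n a = fun_tuple lam \<Sigma> f n' a" using eq' by (auto simp: fun_tuple_def)
      then show ?thesis using Fun_fact eq' by simp
    next
      case (Rel_fact R a)
      then have "rel_tuple lam \<Sigma> R n a = rel_tuple lam \<Sigma> R n' a" using eq' by (auto simp: rel_tuple_def)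
      then show ?thesis using Rel_fact by simp
    qed simp
  qed
  have tup_holds: "fm_holds lam \<Sigma> (rd N) (ctx_env lam x (tup n)) \<phi>" if fits: "src.fits (rd M) F (rd N) n" for N n
  proof -
    have "src.fact_holds (rd M) (rd N) (\<lambda>s y. tup n (ix (s, y))) \<alpha>" if \<alpha>: "\<alpha> \<in> F" for \<alpha>
    proof -
      have "src.fact_holds (rd M) (rd N) n \<alpha>" using fits \<alpha> by (simp add: src.fits_def)
      moreover have "src.fact_holds (rd M) (rd N) (\<lambda>s y. tup n (ix (s, y))) \<alpha> = src.fact_holds (rd M) (rd N) n \<alpha>"
        by (rule fact_cong[OF \<alpha>]) (rule tup_ix)
      ultimately show ?thesis by simp
    qed
    moreover have "tup n \<in> ctx_prod lam (rd N) x" by (rule tup_prod) (use fits in \<open>simp add: src.fits_def\<close>)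
    ultimately show ?thesis using sem by blast
  qed
  \<comment> \<open>The premise is evaluated in the reduct of \<open>N\<close>, while the pointed
    structure is \<open>N\<close> itself, so that \<open>G\<close> decides formulas over
    \<open>\<Sigma>'\<close>.\<close>
  define K where "K = {(N, m). N \<in> E \<and> m \<in> ctx_prod lam (rd N) x \<and> fm_holds lam \<Sigma> (rd N) (ctx_env lam x m) \<phi>}"
  have KE: "tgt.ps N" if "N \<in> E" for N using E that tgt.model_ps by (auto simp: tgt.Mod_simps)
  obtain G g p where G: "tgt.ps G" "tgt.generated ?x G g" "tgt.joint_emb G K fst p"
    and pg: "\<And>N m. (N, m) \<in> K \<Longrightarrow> tgt.ctx_map ?x (p (N, m)) g = m"
  proof (rule tgt.generic_exists[OF x', of K])
    show "tgt.ps N \<and> m \<in> ctx_prod lam N ?x" if "(N, m) \<in> K" for N m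
      using that KE ctx_prod_tr[OF x] by (auto simp: K_def)
  qed (rule that, assumption+)
  have GE: "G \<in> E" by (rule tgt.joint_emb_in_class[OF hornT E prods subs G(1,3)]) (auto simp: K_def)
  have g: "g \<in> ctx_prod lam (rd G) x" using G(2) ctx_prod_tr[OF x] by (simp add: tgt.generated_def)
  have psG: "src.ps (rd G)" by (rule rd_ps[OF G(1)])
  have "fm_holds lam \<Sigma> (rd G) (ctx_env lam x g) \<phi>"
  proof (rule src.ctx_fm_joint[OF psG rd_joint_emb[OF G(1,3)] \<phi> g])
    fix k assume "k \<in> K"
    then show "fm_holds lam \<Sigma> (rd (fst k)) (ctx_env lam x (src.ctx_map x (rdm (p k)) g)) \<phi>"
      using pg[of "fst k" "snd k"] unfolding ctx_map_tr[OF x] by (auto simp: K_def)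
  qed
  define n where "n s y = g (ix (s, y))" for s y
  have n_carr: "n s y \<in> carr (rd G) s" if "(s, y) \<in> ?A" for s y
  proof -
    have i: "ix (s, y) \<in> ctx_idx lam x" using ix[OF that] by blast
    have "g (ix (s, y)) \<in> carr (rd G) (fst (ctx_var x (ix (s, y))))"
      using g i unfolding ctx_prod_def by (rule PiE_mem)
    then show ?thesis using vix[OF that] by (simp add: n_def)
  qed
  have fitsG: "src.fits (rd M) F (rd G) n"
    unfolding src.fits_def n_def[abs_def]
    using sem[OF g] \<open>fm_holds lam \<Sigma> (rd G) (ctx_env lam x g) \<phi>\<close> n_carr by (auto simp: n_def)
  have map_n: "rdm h s (n s y) = m (ix (s, y))" if "tgt.ctx_map ?x h g = m" "(s, y) \<in> ?A" for h m s y
    using that ix[OF that(2)] vix[OF that(2)] rdm_at[OF srt[OF that(2)], of h]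
    by (auto simp: n_def tgt.ctx_map_def)
  have init: "\<exists>h. tgt.hm G N h \<and> (\<forall>(s, y) \<in> ?A. rdm h s (n s y) = n' s y)"
    if N: "N \<in> E" and n': "src.fits (rd M) F (rd N) n'" for N n'
  proof -
    have k: "(N, tup n') \<in> K" using N tup_holds[OF n'] tup_prod[of n' N] n' by (auto simp: K_def src.fits_def)
    have "rdm (p (N, tup n')) s (n s y) = n' s y" if "(s, y) \<in> ?A" for s y
      using map_n[OF pg[OF k] that] tup_ix[OF that] by simp
    then show ?thesis using tgt.joint_embD(1)[OF G(3) k] by auto
  qed
  have uniq: "h = h'" if h: "tgt.hm G N h" "tgt.hm G N h'" and eq: "\<forall>(s, y) \<in> ?A. rdm h s (n s y) = rdm h' s (n s y)" for N h h'
  proof (rule tgt.generated_hom_unique[OF G(2,1) h])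
    have "src.ctx_map x (rdm h) g = src.ctx_map x (rdm h') g"
      unfolding src.ctx_map_def
    proof (rule restrict_ext)
      fix i assume i: "i \<in> ctx_idx lam x"
      obtain s y where sy: "en i = (s, y)" by (cases "en i")
      then have "(s, y) \<in> ?A" "n s y = g i" "fst (ctx_var x i) = s" using en[OF i] by (auto simp: n_def)
      then show "rdm h (fst (ctx_var x i)) (g i) = rdm h' (fst (ctx_var x i)) (g i)" using eq by fastforce
    qed
    then show "tgt.ctx_map ?x h g = tgt.ctx_map ?x h' g" unfolding ctx_map_tr[OF x] .
  qed
  have "\<exists>h. tgt.hm G M h \<and> (\<forall>(s, y) \<in> ?A. rdm h s (n s y) = y)"
  proof -
    let ?m = "tup (\<lambda>s y. y)"
    have fitsM: "src.fits (rd M) F (rd M) (\<lambda>s y. y)"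
      unfolding src.fits_def
    proof (intro conjI ballI)
      show "case sy of (s, y) \<Rightarrow> y \<in> carr (rd M) s" if "sy \<in> ?A" for sy
        using src.elts_carr(1)[OF psM F(1)] that by (cases sy) blast
      fix \<alpha> assume "\<alpha> \<in> F"
      then have \<alpha>: "\<alpha> \<in> src.facts (rd M)" using F by blast
      show "src.fact_holds (rd M) (rd M) (\<lambda>s y. y) \<alpha>"
      proof (cases \<alpha>)
        case (Fun_fact f a)
        then obtain z where f: "f \<in> funs \<Sigma>" and z: "fint (rd M) f a = Some z" using \<alpha> by (auto simp: src.facts_def)
        have "fun_tuple lam \<Sigma> f (\<lambda>s y. y) a = a"
          using src.fintD(1)[OF psM f z] by (auto simp: fun_tuple_def fun_args_def PiE_iff extensional_def intro!: ext)
        then show ?thesis using z Fun_fact by simp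
      next
        case (Rel_fact R a)
        then have R: "R \<in> rels \<Sigma>" and a: "a \<in> rint (rd M) R" using \<alpha> by (auto simp: src.facts_def)
        have "rel_tuple lam \<Sigma> R (\<lambda>s y. y) a = a"
          using src.fintD(3)[OF psM R a] by (auto simp: rel_tuple_def rel_args_def PiE_iff extensional_def intro!: ext)
        then show ?thesis using a Rel_fact by simp
      qed simp
    qed
    have m: "?m \<in> ctx_prod lam (rd M) x" by (rule tup_prod) (use fitsM in \<open>simp add: src.fits_def\<close>)
    have m': "?m \<in> ctx_prod lam M ?x" using m ctx_prod_tr[OF x] by simp
    \<comment> \<open>The only use of the judgments: each formula true at the generic tuple produces
      one judgment with the diagram as premise.\<close>
    have sat: "fm_holds lam \<Sigma>' M (ctx_env lam ?x ?m) \<psi>"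
      if \<psi>: "fm_in_ctx lam \<Sigma>' ?x \<psi>" and h: "fm_holds lam \<Sigma>' G (ctx_env lam ?x g) \<psi>" for \<psi>
    proof -
      let ?\<sigma> = "Sequent ?x (fm_tr lam \<Sigma> \<Sigma>' \<rho> x \<phi>) \<psi>"
      have "relative_judgment lam \<Sigma> \<Sigma>' \<rho> ?\<sigma>" using \<phi> \<psi> unfolding relative_judgment_def by blast
      moreover have "valid_in lam \<Sigma>' N ?\<sigma>" if N: "N \<in> E" for N
        unfolding relative_valid_iff[OF KE[OF N] \<phi>]
      proof (intro ballI impI)
        fix m assume "m \<in> ctx_prod lam (rd N) x" "fm_holds lam \<Sigma> (rd N) (ctx_env lam x m) \<phi>"
        then have k: "(N, m) \<in> K" using N by (simp add: K_def)
        have "tgt.hm G N (p (N, m))" using tgt.joint_embD(1)[OF G(3) k] by simp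
        from tgt.ctx_fm_hom[OF G(1) this \<psi> h] show "fm_holds lam \<Sigma>' N (ctx_env lam ?x m) \<psi>"
          unfolding pg[OF k] .
      qed
      ultimately have "valid_in lam \<Sigma>' M ?\<sigma>" by (rule MT')
      then show ?thesis using m tup_holds[OF fitsM] unfolding relative_valid_iff[OF M \<phi>] by blast
    qed
    obtain h where h: "tgt.hm G M h" "tgt.ctx_map ?x h g = ?m"
      by (rule tgt.generated_hom_exists[OF x' G(2,1) M m' sat])
    have "rdm h s (n s y) = y" if "(s, y) \<in> ?A" for s y using map_n[OF h(2) that] tup_ix[OF that] by simp
    then show ?thesis using h(1) by auto
  qed
  then show thesis
    by (intro that[OF GE fitsG]) (erule (1) init, erule (2) uniq)
qed

text \<open>Initiality provides the connecting maps between stages, and uniqueness on names makes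
  functoriality and compatibility with the maps to \<open>M\<close> automatic. Every fact of the
  reduct of \<open>M\<close> is realized at the stage given by its singleton, which is why naming is
  a homomorphism into the reduct of the colimit.\<close>

lemma closed_imp_contains:
  assumes E: "E \<subseteq> Obj (tgt.Mod T)" and prods: "closed_under_products \<kappa> (tgt.Mod T) E"
    and subs: "closed_under_closed_subobjects \<kappa> lam \<Sigma>' T E"
    and retr: "closed_under_retracts (tgt.Mod T) (src.Mod S) U E"
    and colims: "closed_under_filtered_colimits \<kappa> lam (tgt.Mod T) E"
    and M: "tgt.model T M" and MT': "\<And>\<sigma>. relative_judgment lam \<Sigma> \<Sigma>' \<rho> \<sigma> \<Longrightarrow> (\<And>N. N \<in> E \<Longrightarrow> valid_in lam \<Sigma>' N \<sigma>) \<Longrightarrow>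
      valid_in lam \<Sigma>' M \<sigma>"
  shows "M \<in> E"
proof -
  note psM = tgt.model_ps[OF M]
  let ?B = "rd M"
  note psB = rd_ps[OF psM]
  let ?A = "\<lambda>F. \<Union>(src.elts ?B ` F)"
  \<comment> \<open>Regularity of \<open>lam\<close> closes this family under unions of fewer than
    \<open>lam\<close> members, which gives the \<open>lam\<close>-directed index.\<close>
  define \<F> where "\<F> = {F. F \<subseteq> src.facts ?B \<and> |F| <o lam}"
  define stage where "stage F G n \<longleftrightarrow> G \<in> E \<and> src.fits ?B F (rd G) n \<and>
      (\<forall>N n'. N \<in> E \<longrightarrow> src.fits ?B F (rd N) n' \<longrightarrow> (\<exists>h. tgt.hm G N h \<and> (\<forall>(s, y) \<in> ?A F. rdm h s (n s y) = n' s y))) \<and>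
      (\<forall>N h h'. tgt.hm G N h \<longrightarrow> tgt.hm G N h' \<longrightarrow> (\<forall>(s, y) \<in> ?A F. rdm h s (n s y) = rdm h' s (n s y)) \<longrightarrow> h = h') \<and>
      (\<exists>h. tgt.hm G M h \<and> (\<forall>(s, y) \<in> ?A F. rdm h s (n s y) = y))" for F G n
  have "\<exists>p. stage F (fst p) (snd p)" if F: "F \<in> \<F>" for F
  proof -
    have F': "F \<subseteq> src.facts ?B" "|F| <o lam" using F by (auto simp: \<F>_def)
    show ?thesis
    proof (rule stage_exists[OF E prods subs psM _ F'])
      fix G n
      assume "G \<in> E" "src.fits ?B F (rd G) n"
        "\<And>N n'. N \<in> E \<Longrightarrow> src.fits ?B F (rd N) n' \<Longrightarrow> \<exists>h. tgt.hm G N h \<and> (\<forall>(s, y) \<in> ?A F. rdm h s (n s y) = n' s y)"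
        "\<And>N h h'. tgt.hm G N h \<Longrightarrow> tgt.hm G N h' \<Longrightarrow> \<forall>(s, y) \<in> ?A F. rdm h s (n s y) = rdm h' s (n s y) \<Longrightarrow> h = h'"
        "\<exists>h. tgt.hm G M h \<and> (\<forall>(s, y) \<in> ?A F. rdm h s (n s y) = y)"
      then have "stage F (fst (G, n)) (snd (G, n))" unfolding stage_def fst_conv snd_conv by blast
      then show ?thesis by (rule exI)
    qed (rule MT')
  qed
  then have "\<forall>F \<in> \<F>. \<exists>p. stage F (fst p) (snd p)" by blast
  from bchoice[OF this] obtain st where st: "\<forall>F \<in> \<F>. stage F (fst (st F)) (snd (st F))" ..
  define G where "G F = fst (st F)" for F
  define n where "n F = snd (st F)" for F
  have stage: "stage F (G F) (n F)" if "F \<in> \<F>" for F using st that by (simp add: G_def n_def)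
  have GE: "G F \<in> E" and fits: "src.fits ?B F (rd (G F)) (n F)"
    and init: "\<And>N n'. N \<in> E \<Longrightarrow> src.fits ?B F (rd N) n' \<Longrightarrow>
      \<exists>h. tgt.hm (G F) N h \<and> (\<forall>(s, y) \<in> ?A F. rdm h s (n F s y) = n' s y)"
    and uniq: "\<And>N h h'. tgt.hm (G F) N h \<Longrightarrow> tgt.hm (G F) N h' \<Longrightarrow>
      \<forall>(s, y) \<in> ?A F. rdm h s (n F s y) = rdm h' s (n F s y) \<Longrightarrow> h = h'"
    and toM: "\<exists>h. tgt.hm (G F) M h \<and> (\<forall>(s, y) \<in> ?A F. rdm h s (n F s y) = y)" if "F \<in> \<F>" for F
    using stage[OF that] unfolding stage_def by blast+
  have mG: "tgt.model T (G F)" and psG: "tgt.ps (G F)" if "F \<in> \<F>" for F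
    using GE[OF that] E tgt.model_ps by (auto simp: tgt.Mod_simps)
  have n_carr: "n F s y \<in> carr (rd (G F)) s" if "F \<in> \<F>" "(s, y) \<in> ?A F" for F s y
    using fits[OF that(1)] that(2) unfolding src.fits_def by blast
  have "\<forall>F \<in> \<F>. \<exists>h. tgt.hm (G F) M h \<and> (\<forall>(s, y) \<in> ?A F. rdm h s (n F s y) = y)" using toM by blast
  from bchoice[OF this] obtain q where q: "\<forall>F \<in> \<F>. tgt.hm (G F) M (q F) \<and> (\<forall>(s, y) \<in> ?A F. rdm (q F) s (n F s y) = y)" ..
  have qh: "tgt.hm (G F) M (q F)" and qn: "\<And>s y. (s, y) \<in> ?A F \<Longrightarrow> rdm (q F) s (n F s y) = y" if "F \<in> \<F>" for F
    using q that by blast+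
  \<comment> \<open>The names at a larger stage \<open>F'\<close> also realize the facts in
    \<open>F\<close>, so initiality of \<open>G F\<close> gives the connecting map.\<close>
  define tr where "tr F F' = (SOME h. tgt.hm (G F) (G F') h \<and> (\<forall>(s, y) \<in> ?A F. rdm h s (n F s y) = n F' s y))" for F F'
  have tr: "tgt.hm (G F) (G F') (tr F F') \<and> (\<forall>(s, y) \<in> ?A F. rdm (tr F F') s (n F s y) = n F' s y)"
    if "F \<in> \<F>" "F' \<in> \<F>" "F \<subseteq> F'" for F F'
    unfolding tr_def
    by (rule someI_ex[OF init[OF that(1) GE[OF that(2)] src.fits_mono[OF fits[OF that(2)] that(3)]]])
  have trh: "tgt.hm (G F) (G F') (tr F F')" and trn: "\<And>s y. (s, y) \<in> ?A F \<Longrightarrow> rdm (tr F F') s (n F s y) = n F' s y"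
    if "F \<in> \<F>" "F' \<in> \<F>" "F \<subseteq> F'" for F F' using tr[OF that] by blast+
  have A_mono: "?A F \<subseteq> ?A F'" if "F \<subseteq> F'" for F F' using that by blast
  have hcomp_n: "rdm (tgt.hcomp (G F) h' h) s (n F s y) = rdm h' s (rdm h s (n F s y))"
    if "F \<in> \<F>" "(s, y) \<in> ?A F" for F h h' s y
    using n_carr[OF that] by (simp add: rdm_hcomp src.hcomp_def)
  \<comment> \<open>Identities, composites and the maps to \<open>M\<close> are compared on names
    only; \<open>uniq\<close> extends the agreement to all elements.\<close>
  have tr_id: "tr F F = tgt.hid (G F)" if F: "F \<in> \<F>" for F
  proof (rule uniq[OF F trh[OF F F order_refl] tgt.hid_hm[OF psG[OF F]]])
    show "\<forall>(s, y) \<in> ?A F. rdm (tr F F) s (n F s y) = rdm (tgt.hid (G F)) s (n F s y)"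
    proof (clarify)
      fix s y \<alpha> assume "\<alpha> \<in> F" "(s, y) \<in> src.elts ?B \<alpha>"
      then have sy: "(s, y) \<in> ?A F" by blast
      show "rdm (tr F F) s (n F s y) = rdm (tgt.hid (G F)) s (n F s y)"
        using trn[OF F F order_refl sy] n_carr[OF F sy] by (simp add: rdm_hid src.hid_def)
    qed
  qed
  have tr_comp: "tgt.hcomp (G F) (tr F' F'') (tr F F') = tr F F''"
    if F: "F \<in> \<F>" "F' \<in> \<F>" "F'' \<in> \<F>" and sub: "F \<subseteq> F'" "F' \<subseteq> F''" for F F' F''
  proof (rule uniq[OF F(1) tgt.hm_comp[OF psG[OF F(1)] psG[OF F(2)] trh[OF F(1,2) sub(1)] trh[OF F(2,3) sub(2)]]
        trh[OF F(1,3) order_trans[OF sub]]])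
    show "\<forall>(s, y) \<in> ?A F. rdm (tgt.hcomp (G F) (tr F' F'') (tr F F')) s (n F s y) = rdm (tr F F'') s (n F s y)"
    proof (clarify)
      fix s y \<alpha> assume "\<alpha> \<in> F" "(s, y) \<in> src.elts ?B \<alpha>"
      then have sy: "(s, y) \<in> ?A F" "(s, y) \<in> ?A F'" using sub(1) by blast+
      show "rdm (tgt.hcomp (G F) (tr F' F'') (tr F F')) s (n F s y) = rdm (tr F F'') s (n F s y)"
        using hcomp_n[OF F(1) sy(1)] trn[OF F(1,2) sub(1) sy(1)] trn[OF F(2,3) sub(2) sy(2)]
          trn[OF F(1,3) order_trans[OF sub] sy(1)] by simp
    qed
  qed
  have tr_q: "tgt.hcomp (G F) (q F') (tr F F') = q F" if F: "F \<in> \<F>" "F' \<in> \<F>" and sub: "F \<subseteq> F'" for F F'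
  proof (rule uniq[OF F(1) tgt.hm_comp[OF psG[OF F(1)] psG[OF F(2)] trh[OF F sub] qh[OF F(2)]] qh[OF F(1)]])
    show "\<forall>(s, y) \<in> ?A F. rdm (tgt.hcomp (G F) (q F') (tr F F')) s (n F s y) = rdm (q F) s (n F s y)"
    proof (clarify)
      fix s y \<alpha> assume "\<alpha> \<in> F" "(s, y) \<in> src.elts ?B \<alpha>"
      then have sy: "(s, y) \<in> ?A F" "(s, y) \<in> ?A F'" using sub by blast+
      show "rdm (tgt.hcomp (G F) (q F') (tr F F')) s (n F s y) = rdm (q F) s (n F s y)"
        using hcomp_n[OF F(1) sy(1)] trn[OF F sub sy(1)] qn[OF F(1) sy(1)] qn[OF F(2) sy(2)] by simp
    qed
  qed
  have small: "|\<F>| <o \<kappa>"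
    by (rule src.small_subset[OF _ src.small_Pow[OF src.small_facts[OF psB]]]) (auto simp: \<F>_def)
  have union: "\<Union>X \<in> \<F>" if X: "X \<subseteq> \<F>" "|X| <o lam" for X
  proof -
    have "|\<Union>F \<in> X. F| <o lam" by (rule src.lam_UN[OF X(2)]) (use X(1) in \<open>auto simp: \<F>_def\<close>)
    then show ?thesis using X(1) by (auto simp: \<F>_def)
  qed
  obtain J :: "('u, 'u) category" and fo where J: "filtered_category lam J" "small_category \<kappa> J"
    and fo: "\<And>j. j \<in> Obj J \<Longrightarrow> fo j \<in> \<F>" "\<And>F. F \<in> \<F> \<Longrightarrow> \<exists>j \<in> Obj J. fo j = F"
      "\<And>a. a \<in> Arr J \<Longrightarrow> fo (Dom J a) \<subseteq> fo (Cod J a)"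
    using src.directed_union_category[OF small union] by metis
  have cat: "is_category J" using J(1) by (simp add: filtered_category_def)
  define D where "D = \<lparr> fobj = (\<lambda>j. G (fo j)),
    farr = (\<lambda>a. Arrow (G (fo (Dom J a))) (tr (fo (Dom J a)) (fo (Cod J a))) (G (fo (Cod J a)))) \<rparr>"
  have Ds: "fobj D j = G (fo j)"
    "farr D a = Arrow (G (fo (Dom J a))) (tr (fo (Dom J a)) (fo (Cod J a))) (G (fo (Cod J a)))" for j a
    by (simp_all add: D_def)
  have objs: "Dom J a \<in> Obj J" "Cod J a \<in> Obj J" if "a \<in> Arr J" for a
    using cat that unfolding is_category_def by blast+
  have D: "is_functor J (tgt.Mod T) D"
    unfolding is_functor_def
  proof (intro conjI ballI impI)
    show "fobj D j \<in> Obj (tgt.Mod T)" if "j \<in> Obj J" for j using mG[OF fo(1)[OF that]] by (simp add: Ds tgt.Mod_simps)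
    show "farr D a \<in> Defs.hom (tgt.Mod T) (fobj D (Dom J a)) (fobj D (Cod J a))" if a: "a \<in> Arr J" for a
      using mG[OF fo(1)[OF objs(1)[OF a]]] mG[OF fo(1)[OF objs(2)[OF a]]]
        trh[OF fo(1)[OF objs(1)[OF a]] fo(1)[OF objs(2)[OF a]] fo(3)[OF a]] by (simp add: Ds tgt.Mod_hom)
    show "farr D (Id J j) = Id (tgt.Mod T) (fobj D j)" if j: "j \<in> Obj J" for j
    proof -
      have "Dom J (Id J j) = j" "Cod J (Id J j) = j" using cat j unfolding is_category_def Defs.hom_def by blast+
      then show ?thesis using tr_id[OF fo(1)[OF j]] by (simp add: Ds tgt.Mod_simps)
    qed
    show "farr D (Comp J b a) = Comp (tgt.Mod T) (farr D b) (farr D a)"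
      if a: "a \<in> Arr J" and b: "b \<in> Arr J" and ab: "Dom J b = Cod J a" for a b
    proof -
      have c: "Dom J (Comp J b a) = Dom J a" "Cod J (Comp J b a) = Cod J b"
        using cat a b ab unfolding is_category_def Defs.hom_def by blast+
      show ?thesis
        using tr_comp[OF fo(1)[OF objs(1)[OF a]] fo(1)[OF objs(2)[OF a]] fo(1)[OF objs(2)[OF b]] fo(3)[OF a]]
          fo(3)[OF b] ab c by (simp add: Ds tgt.Mod_simps)
    qed
  qed
  interpret filtered_diagram \<kappa> lam \<Sigma>' T J D
    by unfold_locales (rule hornT, rule J, rule J, rule D)
  obtain C k where C: "tgt.ps C" "good_cocone C k" by (rule good_cocone_exists)
  note k = good_coconeD(1)[OF C(2)]
  have mC: "tgt.model T C" by (rule good_cocone_model[OF C])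
  have "filtered_colimit \<kappa> lam (tgt.Mod T) J D C (\<lambda>j. Arrow (dob j) (k j) C)"
    unfolding filtered_colimit_def using J D good_cocone_is_colimit[OF C] by simp
  from colims[unfolded closed_under_filtered_colimits_def, rule_format, OF this]
  have CE: "C \<in> E" using GE[OF fo(1)] by (simp add: Ds)
  have "compatible M (\<lambda>j. q (fo j))"
    unfolding compatible_def Ds arrow.sel
  proof (intro conjI ballI allI)
    show "tgt.hm (G (fo j)) M (q (fo j))" if "j \<in> Obj J" for j by (rule qh[OF fo(1)[OF that]])
    fix a s y assume a: "a \<in> Arr J" and y: "y \<in> carr (G (fo (Dom J a))) s"
    show "q (fo (Cod J a)) s (tr (fo (Dom J a)) (fo (Cod J a)) s y) = q (fo (Dom J a)) s y"
      by (rule tgt.hcomp_eqD[OF tr_q[OF fo(1)[OF objs(1)[OF a]] fo(1)[OF objs(2)[OF a]] fo(3)[OF a]] y])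
  qed
  then obtain p where p: "tgt.hm C M p" "\<And>j s y. j \<in> Obj J \<Longrightarrow> y \<in> carr (dob j) s \<Longrightarrow> p s (k j s y) = q (fo j) s y"
    using good_cocone_factor[OF C psM] by blast
  have rdk: "src.hm (rd (G (fo j))) (rd C) (rdm (k j))" if "j \<in> Obj J" for j
    using rdm_hm[OF dob_model(2)[OF that] compatibleD(1)[OF k that]] by (simp add: Ds)
  have srt: "s \<in> sorts \<Sigma>" if "y \<in> carr ?B s" for s y using src.carr_sort[OF psB that] .
  have kn_push: "rdm (k (Dom J a)) s (n (fo (Dom J a)) s y) = rdm (k (Cod J a)) s (n (fo (Cod J a)) s y)"
    if a: "a \<in> Arr J" and sy: "(s, y) \<in> ?A (fo (Dom J a))" for a s y
  proof -
    note F = fo(1)[OF objs(1)[OF a]] and F' = fo(1)[OF objs(2)[OF a]]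
    have nc: "n (fo (Dom J a)) s y \<in> carr (rd (G (fo (Dom J a)))) s" by (rule n_carr[OF F sy])
    have s: "s \<in> sorts \<Sigma>" using src.carr_sort[OF rd_ps[OF psG[OF F]] nc] .
    have "k (Cod J a) (smap \<rho> s) (tr (fo (Dom J a)) (fo (Cod J a)) (smap \<rho> s) (n (fo (Dom J a)) s y)) =
        k (Dom J a) (smap \<rho> s) (n (fo (Dom J a)) s y)"
      using compatibleD(2)[OF k a, of "n (fo (Dom J a)) s y" "smap \<rho> s"] nc by (simp add: Ds rd_carr[OF s])
    moreover have "tr (fo (Dom J a)) (fo (Cod J a)) (smap \<rho> s) (n (fo (Dom J a)) s y) = n (fo (Cod J a)) s y"
      using trn[OF F F' fo(3)[OF a] sy] by (simp add: rdm_at[OF s])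
    ultimately show ?thesis by (simp add: rdm_at[OF s])
  qed
  \<comment> \<open>Connecting maps send names to names, so all names of one element coincide in the
    colimit.\<close>
  have kn: "rdm (k j) s (n (fo j) s y) = rdm (k j') s (n (fo j') s y)"
    if j: "j \<in> Obj J" "j' \<in> Obj J" and sy: "(s, y) \<in> ?A (fo j)" "(s, y) \<in> ?A (fo j')" for j j' s y
  proof -
    obtain a a' where a: "a \<in> Arr J" "a' \<in> Arr J" "Dom J a = j" "Dom J a' = j'" "Cod J a = Cod J a'"
      by (rule merge_objects[OF j])
    show ?thesis using kn_push[OF a(1), of s y] kn_push[OF a(2), of s y] a sy by simp
  qed
  have at_fact: "\<exists>j \<in> Obj J. fo j = {\<alpha>}" if "\<alpha> \<in> src.facts ?B" for \<alpha>
    by (rule fo(2)) (use that src.lam_finite[of "{\<alpha>}"] in \<open>simp add: \<F>_def\<close>)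
  have "\<forall>sy \<in> {(s, y). y \<in> carr ?B s}. \<exists>j. j \<in> Obj J \<and> fo j = {Elt (fst sy) (snd sy)}"
  proof
    fix sy assume "sy \<in> {(s, y). y \<in> carr ?B s}"
    then have "Elt (fst sy) (snd sy) \<in> src.facts ?B" by (auto simp: src.facts_def)
    from at_fact[OF this] show "\<exists>j. j \<in> Obj J \<and> fo j = {Elt (fst sy) (snd sy)}" by blast
  qed
  from bchoice[OF this] obtain j0 where j0: "\<forall>sy \<in> {(s, y). y \<in> carr ?B s}. j0 sy \<in> Obj J \<and> fo (j0 sy) = {Elt (fst sy) (snd sy)}" ..
  \<comment> \<open>The singleton fact \<open>Elt s y\<close> supplies a stage that names
    \<open>y\<close>; by \<open>kn\<close> any other stage mentioning \<open>y\<close> gives the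
    same element.\<close>
  define w where "w s = (\<lambda>y \<in> carr ?B s. rdm (k (j0 (s, y))) s (n (fo (j0 (s, y))) s y))" for s
  have w: "w s y = rdm (k j) s (n (fo j) s y)" if y: "y \<in> carr ?B s" and j: "j \<in> Obj J" and sy: "(s, y) \<in> ?A (fo j)" for s y j
  proof -
    have "j0 (s, y) \<in> Obj J" "fo (j0 (s, y)) = {Elt s y}" using j0 y by auto
    then show ?thesis using kn[of "j0 (s, y)" j s y] y j sy by (simp add: w_def)
  qed
  have wj: "\<exists>j \<in> Obj J. (s, y) \<in> ?A (fo j)" if "y \<in> carr ?B s" for s y
  proof -
    have "j0 (s, y) \<in> Obj J" "fo (j0 (s, y)) = {Elt s y}" using j0 that by auto
    then show ?thesis by (intro bexI[of _ "j0 (s, y)"]) simp_all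
  qed
  have wh: "src.hm ?B (rd C) w"
    unfolding is_homomorphism_def
  proof (intro conjI allI ballI impI)
    fix s
    have "w s y \<in> carr (rd C) s" if y: "y \<in> carr ?B s" for y
    proof -
      obtain j where j: "j \<in> Obj J" "(s, y) \<in> ?A (fo j)" using wj[OF y] by blast
      show ?thesis using w[OF y j] src.hmD(1)[OF rdk[OF j(1)] n_carr[OF fo(1)[OF j(1)] j(2)]] by simp
    qed
    then show "w s \<in> carr ?B s \<rightarrow>\<^sub>E carr (rd C) s" by (auto simp: w_def)
  next
    fix f a y assume f: "f \<in> funs \<Sigma>" and a: "a \<in> fun_args lam \<Sigma> ?B f" and y: "fint ?B f a = Some y"
    \<comment> \<open>The stage of this single fact names all arguments and the value at once and
      satisfies the equation between them; the cocone map transports it to the colimit.\<close>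
    have "Fun_fact f a \<in> src.facts ?B" using f y by (simp add: src.facts_def)
    then obtain j where j: "j \<in> Obj J" "fo j = {Fun_fact f a}" using at_fact by blast
    note F = fo(1)[OF j(1)]
    have "fint (rd (G (fo j))) f (fun_tuple lam \<Sigma> f (n (fo j)) a) = Some (n (fo j) (fun_cod \<Sigma> f) y)"
      using fits[OF F] j(2) y by (simp add: src.fits_def)
    from src.hmD(2)[OF rdk[OF j(1)] rd_ps[OF psG[OF F]] f this]
    have "fint (rd C) f (fun_tuple lam \<Sigma> f (rdm (k j)) (fun_tuple lam \<Sigma> f (n (fo j)) a)) =
        Some (rdm (k j) (fun_cod \<Sigma> f) (n (fo j) (fun_cod \<Sigma> f) y))" .
    moreover have "fun_tuple lam \<Sigma> f (rdm (k j)) (fun_tuple lam \<Sigma> f (n (fo j)) a) = fun_tuple lam \<Sigma> f w a"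
      unfolding fun_tuple_def
    proof (rule restrict_ext)
      fix i assume i: "i \<in> fun_idx lam \<Sigma> f"
      have "a i \<in> carr ?B (fun_dom \<Sigma> f i)" using a i by (auto simp: fun_args_def)
      moreover have "(fun_dom \<Sigma> f i, a i) \<in> ?A (fo j)" using i by (simp add: j(2))
      ultimately show "rdm (k j) (fun_dom \<Sigma> f i) ((\<lambda>i \<in> fun_idx lam \<Sigma> f. n (fo j) (fun_dom \<Sigma> f i) (a i)) i) = w (fun_dom \<Sigma> f i) (a i)"
        using w[OF _ j(1)] i by simp
    qed
    moreover have "rdm (k j) (fun_cod \<Sigma> f) (n (fo j) (fun_cod \<Sigma> f) y) = w (fun_cod \<Sigma> f) y"
      using w[OF src.fintD(2)[OF psB f y] j(1)] y by (simp add: j(2))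
    ultimately show "fint (rd C) f (fun_tuple lam \<Sigma> f w a) = Some (w (fun_cod \<Sigma> f) y)" by simp
  next
    fix R a assume R: "R \<in> rels \<Sigma>" and a: "a \<in> rel_args lam \<Sigma> ?B R" and y: "a \<in> rint ?B R"
    have "Rel_fact R a \<in> src.facts ?B" using R y by (simp add: src.facts_def)
    then obtain j where j: "j \<in> Obj J" "fo j = {Rel_fact R a}" using at_fact by blast
    note F = fo(1)[OF j(1)]
    have "rel_tuple lam \<Sigma> R (n (fo j)) a \<in> rint (rd (G (fo j))) R"
      using fits[OF F] j(2) by (simp add: src.fits_def)
    from src.hmD(3)[OF rdk[OF j(1)] rd_ps[OF psG[OF F]] R this]
    have "rel_tuple lam \<Sigma> R (rdm (k j)) (rel_tuple lam \<Sigma> R (n (fo j)) a) \<in> rint (rd C) R" .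
    moreover have "rel_tuple lam \<Sigma> R (rdm (k j)) (rel_tuple lam \<Sigma> R (n (fo j)) a) = rel_tuple lam \<Sigma> R w a"
      unfolding rel_tuple_def
    proof (rule restrict_ext)
      fix i assume i: "i \<in> rel_idx lam \<Sigma> R"
      have "a i \<in> carr ?B (rel_dom \<Sigma> R i)" using a i by (auto simp: rel_args_def)
      moreover have "(rel_dom \<Sigma> R i, a i) \<in> ?A (fo j)" using i by (simp add: j(2))
      ultimately show "rdm (k j) (rel_dom \<Sigma> R i) ((\<lambda>i \<in> rel_idx lam \<Sigma> R. n (fo j) (rel_dom \<Sigma> R i) (a i)) i) = w (rel_dom \<Sigma> R i) (a i)"
        using w[OF _ j(1)] i by simp
    qed
    ultimately show "rel_tuple lam \<Sigma> R w a \<in> rint (rd C) R" by simp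
  qed
  \<comment> \<open>The maps from the stages to \<open>M\<close> send each name back to the element
    it names, so naming is a section.\<close>
  have "src.hcomp ?B (rdm p) w = src.hid ?B"
    unfolding src.hid_eq_iff
  proof (intro allI ballI)
    fix s y assume y: "y \<in> carr ?B s"
    obtain j where j: "j \<in> Obj J" "(s, y) \<in> ?A (fo j)" using wj[OF y] by blast
    have s: "s \<in> sorts \<Sigma>" by (rule srt[OF y])
    have "p (smap \<rho> s) (k j (smap \<rho> s) (n (fo j) s y)) = q (fo j) (smap \<rho> s) (n (fo j) s y)"
      by (rule p(2)[OF j(1)]) (use n_carr[OF fo(1)[OF j(1)] j(2)] in \<open>simp add: Ds rd_carr[OF s]\<close>)
    then show "rdm p s (w s y) = y"
      using w[OF y j] qn[OF fo(1)[OF j(1)] j(2)] by (simp add: rdm_at[OF s])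
  qed
  then have "Comp (src.Mod S) (Arrow (rd C) (rdm p) ?B) (Arrow ?B w (rd C)) = Id (src.Mod S) ?B"
    by (simp add: src.Mod_simps)
  moreover have "Arrow ?B w (rd C) \<in> Defs.hom (src.Mod S) ?B (rd C)"
    using wh rd_model[OF M] rd_model[OF mC] by (simp add: src.Mod_hom)
  moreover have "Arrow (rd C) (rdm p) ?B \<in> Arr (src.Mod S)"
    using rdm_hm[OF C(1) p(1)] rd_model[OF M] rd_model[OF mC] by (simp add: src.Mod_simps)
  ultimately have "has_section (src.Mod S) (farr U (Arrow C p M))"
    unfolding has_section_def U_simps src.Mod_simps(3,4) arrow.sel by blast
  moreover have "Arrow C p M \<in> Arr (tgt.Mod T)" using mC M p(1) by (simp add: tgt.Mod_simps)
  ultimately show "M \<in> E"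
    using retr[unfolded closed_under_retracts_def, THEN bspec, of "Arrow C p M"] CE
    by (simp add: tgt.Mod_simps(3,4))
qed

text \<open>Every closure property reduces to the transport of a single relative judgment; products
  and closed subobjects are both treated as joint embeddings.\<close>

lemma definable_closed:
  assumes "definable_by_relative_judgments \<kappa> lam \<Sigma> \<Sigma>' T \<rho> E"
  shows "closed_under_products \<kappa> (tgt.Mod T) E" and "closed_under_closed_subobjects \<kappa> lam \<Sigma>' T E"
    and "closed_under_pure_quotients \<kappa> lam (tgt.Mod T) (src.Mod S) U E"
    and "closed_under_filtered_colimits \<kappa> lam (tgt.Mod T) E"
proof -
  obtain T' where T': "\<forall>\<sigma> \<in> T'. relative_judgment lam \<Sigma> \<Sigma>' \<rho> \<sigma>" and E: "E = Obj (tgt.Mod (T \<union> T'))"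
    using assms unfolding definable_by_relative_judgments_def by blast
  have E_iff: "N \<in> E \<longleftrightarrow> tgt.model T N \<and> (\<forall>\<sigma> \<in> T'. valid_in lam \<Sigma>' N \<sigma>)" for N
    unfolding E by (auto simp: tgt.Mod_simps is_model_def)
  have joint: "K \<in> E" if K: "tgt.model T K" and je: "tgt.joint_emb K I A p" and A: "\<And>i. i \<in> I \<Longrightarrow> A i \<in> E" for K I A p
  proof -
    have "valid_in lam \<Sigma>' K \<sigma>" if "\<sigma> \<in> T'" for \<sigma>
      by (rule relative_joint_emb[OF _ tgt.model_ps[OF K] je]) (use T' A E_iff that tgt.model_ps in blast)+
    then show ?thesis using K E_iff by blast
  qed
  show "closed_under_products \<kappa> (tgt.Mod T) E"
    unfolding closed_under_products_def
  proof (intro allI impI)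
    fix I :: "'u set" and A P \<pi>
    assume I: "|I| <o \<kappa>" and A: "\<forall>i \<in> I. A i \<in> E" and prod: "is_product (tgt.Mod T) I A P \<pi>"
    have "tgt.model T P" using tgt.is_productD(1)[OF prod] by (simp add: tgt.Mod_simps)
    then show "P \<in> E" by (rule joint[OF _ tgt.is_product_joint_emb[OF hornT I prod]]) (use A in blast)
  qed
  show "closed_under_closed_subobjects \<kappa> lam \<Sigma>' T E"
    unfolding closed_under_closed_subobjects_def
  proof (intro allI impI)
    fix h assume h: "closed_mono \<kappa> lam \<Sigma>' T h" and t: "target h \<in> E"
    obtain M g N where hg: "h = Arrow M g N" by (cases h)
    have "tgt.model T M" using h unfolding hg closed_mono_def mono_arr_def by (simp add: tgt.Mod_simps)
    then show "source h \<in> E"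
      using joint[OF _ tgt.closed_mono_joint_emb[OF hornT h[unfolded hg]]] t by (simp add: hg)
  qed
  show "closed_under_pure_quotients \<kappa> lam (tgt.Mod T) (src.Mod S) U E"
    unfolding closed_under_pure_quotients_def
  proof (intro ballI impI)
    fix p assume p: "p \<in> Arr (tgt.Mod T)" and d: "Dom (tgt.Mod T) p \<in> E"
      and pure: "pure_epi \<kappa> lam (src.Mod S) (farr U p)"
    have "tgt.model T (target p)" using p by (cases p) (simp add: tgt.Mod_simps)
    moreover have "valid_in lam \<Sigma>' (target p) \<sigma>" if "\<sigma> \<in> T'" for \<sigma>
      by (rule relative_pure_quotient[OF _ p pure]) (use T' that d E_iff in \<open>auto simp: tgt.Mod_simps\<close>)
    ultimately show "Cod (tgt.Mod T) p \<in> E" by (simp add: E_iff tgt.Mod_simps)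
  qed
  show "closed_under_filtered_colimits \<kappa> lam (tgt.Mod T) E"
    unfolding closed_under_filtered_colimits_def
  proof (intro allI impI)
    fix J :: "('u, 'u) category" and D X \<xi>
    assume fc: "filtered_colimit \<kappa> lam (tgt.Mod T) J D X \<xi>" and DE: "\<forall>j \<in> Obj J. fobj D j \<in> E"
    interpret morphism_diagram \<kappa> lam \<Sigma> \<Sigma>' S T \<rho> J D by (rule filtered_colimit_diagram[OF fc])
    have col: "is_colimit J (tgt.Mod T) D X \<xi>" using fc by (simp add: filtered_colimit_def)
    have X: "tgt.model T X" using td.is_colimitD(1)[OF col] by (simp add: td.is_cocone_iff)
    have "valid_in lam \<Sigma>' X \<sigma>" if "\<sigma> \<in> T'" for \<sigma>
      by (rule relative_good_cocone[OF _ tgt.model_ps[OF X] td.is_colimit_good[OF col]])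
        (use T' that DE E_iff in blast)+
    then show "X \<in> E" using X E_iff by blast
  qed
qed

lemma pure_quotients_imp_retracts:
  assumes "closed_under_pure_quotients \<kappa> lam (tgt.Mod T) (src.Mod S) U E"
  shows "closed_under_retracts (tgt.Mod T) (src.Mod S) U E"
  using assms src.has_section_pure_epi
  unfolding closed_under_pure_quotients_def closed_under_retracts_def by blast

text \<open>The defining set is the largest candidate, all relative judgments valid throughout
  \<open>E\<close>; that its models already lie in \<open>E\<close> is
  \<open>closed_imp_contains\<close>.\<close>

lemma closed_imp_definable:
  assumes E: "E \<subseteq> Obj (tgt.Mod T)" and "closed_under_products \<kappa> (tgt.Mod T) E"
    "closed_under_closed_subobjects \<kappa> lam \<Sigma>' T E" "closed_under_retracts (tgt.Mod T) (src.Mod S) U E"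
    "closed_under_filtered_colimits \<kappa> lam (tgt.Mod T) E"
  shows "definable_by_relative_judgments \<kappa> lam \<Sigma> \<Sigma>' T \<rho> E"
proof -
  define T' where "T' = {\<sigma>. relative_judgment lam \<Sigma> \<Sigma>' \<rho> \<sigma> \<and> (\<forall>N \<in> E. valid_in lam \<Sigma>' N \<sigma>)}"
  have "E = Obj (tgt.Mod (T \<union> T'))"
  proof (intro equalityI subsetI)
    fix N assume "N \<in> E"
    then show "N \<in> Obj (tgt.Mod (T \<union> T'))" using E by (auto simp: tgt.Mod_simps is_model_def T'_def)
  next
    fix M assume "M \<in> Obj (tgt.Mod (T \<union> T'))"
    then have "tgt.model T M" "\<forall>\<sigma> \<in> T'. valid_in lam \<Sigma>' M \<sigma>" by (auto simp: tgt.Mod_simps is_model_def)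
    then show "M \<in> E" by (intro closed_imp_contains[OF assms]) (auto simp: T'_def)
  qed
  moreover have "\<forall>\<sigma> \<in> T'. relative_judgment lam \<Sigma> \<Sigma>' \<rho> \<sigma>" by (simp add: T'_def)
  ultimately show ?thesis unfolding definable_by_relative_judgments_def by blast
qed

end

theorem theorem5p10:
  fixes \<kappa> :: "'u rel" and lam :: "'l rel"
    and \<Sigma> :: "('s, 'f, 'r, 'l) signature" and S :: "('s, 'f, 'r, 'l) sequent set"
    and \<Sigma>' :: "('t, 'g, 'q, 'l) signature" and T :: "('t, 'g, 'q, 'l) sequent set"
    and \<rho> :: "('s, 'f, 'r, 't, 'g, 'q, 'l) morphism"
    and E :: "('t, 'g, 'q, 'l, 'u) pstruct set"
  assumes "inaccessible \<kappa>"
    and "Cinfinite lam" and "regularCard lam" and "lam <o \<kappa>"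
    and "is_signature \<kappa> lam \<Sigma>" and "is_horn_theory lam \<Sigma> S"
    and "is_signature \<kappa> lam \<Sigma>'" and "is_horn_theory lam \<Sigma>' T"
    and "is_theory_morphism \<kappa> lam \<Sigma> S \<Sigma>' T \<rho>"
    and "ascending_chain_condition
      (PMod \<kappa> lam \<Sigma> S :: (('s, 'f, 'r, 'l, 'u) pstruct, ('s, 'f, 'r, 'l, 'u) arrow) category)"
    and "replete_full_subcategory (PMod \<kappa> lam \<Sigma>' T) E"
  shows
    "(definable_by_relative_judgments \<kappa> lam \<Sigma> \<Sigma>' T \<rho> E \<longleftrightarrow>
        closed_under_products \<kappa> (PMod \<kappa> lam \<Sigma>' T) E \<and>
        closed_under_closed_subobjects \<kappa> lam \<Sigma>' T E \<and>
        closed_under_pure_quotients \<kappa> lam (PMod \<kappa> lam \<Sigma>' T) (PMod \<kappa> lam \<Sigma> S)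
          (translation_functor lam \<Sigma> \<Sigma>' \<rho>) E) \<and>
     (definable_by_relative_judgments \<kappa> lam \<Sigma> \<Sigma>' T \<rho> E \<longleftrightarrow>
        closed_under_products \<kappa> (PMod \<kappa> lam \<Sigma>' T) E \<and>
        closed_under_closed_subobjects \<kappa> lam \<Sigma>' T E \<and>
        closed_under_retracts (PMod \<kappa> lam \<Sigma>' T) (PMod \<kappa> lam \<Sigma> S)
          (translation_functor lam \<Sigma> \<Sigma>' \<rho>) E \<and>
        closed_under_filtered_colimits \<kappa> lam (PMod \<kappa> lam \<Sigma>' T) E)"
proof -
  interpret theory_morphism \<kappa> lam \<Sigma> \<Sigma>' S T \<rho>
    by unfold_locales (fact assms)+
  have E: "E \<subseteq> Obj (PMod \<kappa> lam \<Sigma>' T)"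
    using assms(11) by (simp add: replete_full_subcategory_def)
  show ?thesis
    \<comment> \<open>Condition (ii) yields (iii) since split epimorphisms are pure and the chain
      condition handles filtered colimits; (iii) yields (i), and (i) yields (ii).\<close>
    using definable_closed[of E] closed_imp_definable[OF E] pure_quotients_imp_retracts[of E]
      pure_quotients_imp_filtered_colimits[OF assms(10) E] by blast
qed


end
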